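(* Let $P=\prod_{i=1}^k \operatorname{Aff}\mathcal{T}_i$ be a finite direct product of affine automorphism groups of homogeneous trees. Let $\mu$ be an aperiodic, spread-out probability measure on $P$ with finite first moment with respect to $|\cdot|_P$, and suppose that the closed semigroup $\Gamma=\operatorname{sgr}\mu$ generated by the support of $\mu$ is a closed subgroup of $P$ which is not fully exceptional. Then the Poisson boundary of $(P,\mu)$ is trivial if and only if $m_1(\mu_j)\le 0$ for all natural numbers $j\le k$.
   Context: Trees. Each $\mathcal{T}_i$ ($1\le i\le k$) is a homogeneous tree in which every vertex has $d_i\ge 3$ neighbours, with a distinguished vertex $o_i$ and a distinguished end $\omega_i$ (an end is an equivalence class of geodesic rays, two rays being equivalent if their intersection is infinite). $d$ denotes graph distance. $\operatorname{Aff}\mathcal{T}_i$ is the group of automorphisms of $\mathcal{T}_i$ fixing $\omega_i$, with the topology of pointwise convergence on vertices. The Busemann function is $h_i(v)=d(v,c)-d(o_i,c)$, with $c$ the first common vertex of the rays from $v$ and from $o_i$ to $\omega_i$. The horocyclic homomorphism is $\phi_i:\operatorname{Aff}\mathcal{T}_i\to\mathbb{Z}$, $\phi_i(\gamma)=h_i(\gamma o_i)$, and $\operatorname{Hor}\mathcal{T}_i=\ker\phi_i$. The product. $P$ has the product topology, $\pi_j:P\to\operatorname{Aff}\mathcal{T}_j$ is the projection, $|\gamma|_P=\sum_{i=1}^k d(o_i,\pi_i(\gamma)o_i)$, and finite first moment means $\int_P|\gamma|_P\,d\mu(\gamma)<\infty$. A subgroup of $\operatorname{Aff}\mathcal{T}_j$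 is exceptional if it is contained in $\operatorname{Hor}\mathcal{T}_j$ or if all of its elements fix a common end other than $\omega_j$. A closed subgroup $\Gamma\le P$ is fully exceptional if $\pi_j(\Gamma)$ is exceptional for every $1\le j\le k$. Measures. $\mu$ is spread-out if some convolution power $\mu^{*n}$ is not singular with respect to Haar measure on $P$. $\mu$ is aperiodic if, regarded as a measure on $\Gamma$, its support is not contained in a proper closed subgroup of $\Gamma$. Let $\mu_j=(\phi_j\circ\pi_j)_*\mu$ and let $m_1(\mu_j)=\int_{\mathbb{Z}}z\,d\mu_j(z)$ be its mean (finite under the first moment assumption). Poisson boundary. The Poisson boundary is understood for the walk with $\mu$ regarded as a measure on $\Gamma$: for i.i.d. $\mu$-distributed $X_1,X_2,\dots$ let $R_n=X_1X_2\cdots X_n$. A $\Gamma$-space $B$ with a $\mu$-stationary probability measure $\nu$ ($\mu*\nu=\nu$) is a $\mu$-boundary if for almost every path $R_n\cdot\nu$ converges weak* to a point mass. It is the Poisson boundary if moreover the Poisson transform $P_\nu\varphi(g)=\int_B\varphi(gb)\,d\nu(b)$ is an isometric isomorphism from $L^\infty(B,\nu)$ onto the space of bounded $\mu$-harmonic functions $f$ on $\Gamma$ ($f(g)=\int f(gx)\,d\mu(x)$). It is trivial if $\nu$ is a point mass, equivalently if every bounded $\mu$-harmonic function on $\Gamma$ is constant. *)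

theory Defs
  imports "HOL-Algebra.Product_Groups" "HOL-Algebra.Group_Action" "HOL-Probability.Probability"
begin

text \<open>
  A tree with a reference vertex and a distinguished end. The carrier \<open>verts\<close> need not be the whole
  type, so a family of different trees can share one vertex type. An end is a set of rays.
\<close>

record 'v pointed_tree =
  verts :: "'v set"
  adj :: "'v \<Rightarrow> 'v \<Rightarrow> bool"
  origin :: 'v
  top_end :: "(nat \<Rightarrow> 'v) set"

definition is_tree :: "('v, 'm) pointed_tree_scheme \<Rightarrow> bool" where
  "is_tree T \<longleftrightarrow>
     (\<forall>u v. adj T u v \<longrightarrow> u \<in> verts T \<and> v \<in> verts T \<and> u \<noteq> v \<and> adj T v u) \<and>
     (\<forall>u\<in>verts T. \<forall>v\<in>verts T. (adj T)\<^sup>*\<^sup>* u v) \<and>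
     (\<nexists>c. 3 \<le> length c \<and> distinct c \<and>
          (\<forall>i<length c. adj T (c ! i) (c ! (Suc i mod length c))))"

definition tree_dist :: "('v, 'm) pointed_tree_scheme \<Rightarrow> 'v \<Rightarrow> 'v \<Rightarrow> nat" where
  "tree_dist T u v = (LEAST n. (adj T ^^ n) u v)"

definition rays :: "('v, 'm) pointed_tree_scheme \<Rightarrow> (nat \<Rightarrow> 'v) set" where
  "rays T = {r. range r \<subseteq> verts T \<and> (\<forall>m n. m \<le> n \<longrightarrow> tree_dist T (r m) (r n) = n - m)}"

definition ray_equiv :: "('v, 'm) pointed_tree_scheme \<Rightarrow> ((nat \<Rightarrow> 'v) \<times> (nat \<Rightarrow> 'v)) set" where
  "ray_equiv T = {(r, s). r \<in> rays T \<and> s \<in> rays T \<and> infinite (range r \<inter> range s)}"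

definition ends :: "('v, 'm) pointed_tree_scheme \<Rightarrow> (nat \<Rightarrow> 'v) set set" where
  "ends T = rays T // ray_equiv T"

definition homogeneous_tree :: "nat \<Rightarrow> ('v, 'm) pointed_tree_scheme \<Rightarrow> bool" where
  "homogeneous_tree d T \<longleftrightarrow>
     is_tree T \<and> (\<forall>v\<in>verts T. finite {w. adj T v w} \<and> card {w. adj T v w} = d) \<and>
     origin T \<in> verts T \<and> top_end T \<in> ends T"

definition ray_to_top :: "('v, 'm) pointed_tree_scheme \<Rightarrow> 'v \<Rightarrow> nat \<Rightarrow> 'v" where
  "ray_to_top T v = (THE r. r \<in> top_end T \<and> r 0 = v)"

definition confluent :: "('v, 'm) pointed_tree_scheme \<Rightarrow> 'v \<Rightarrow> 'v" where
  "confluent T v =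
     ray_to_top T v (LEAST n. ray_to_top T v n \<in> range (ray_to_top T (origin T)))"

definition busemann :: "('v, 'm) pointed_tree_scheme \<Rightarrow> 'v \<Rightarrow> int" where
  "busemann T v =
     int (tree_dist T v (confluent T v)) - int (tree_dist T (origin T) (confluent T v))"

text \<open>
  Automorphisms live in \<^const>\<open>Bij\<close>, so they are \<^const>\<open>undefined\<close> off \<^const>\<open>verts\<close>
  and two of them are equal as soon as they agree on the vertices.
\<close>

definition automorphisms :: "('v, 'm) pointed_tree_scheme \<Rightarrow> ('v \<Rightarrow> 'v) set" where
  "automorphisms T =
     {g \<in> Bij (verts T). \<forall>u\<in>verts T. \<forall>v\<in>verts T. adj T (g u) (g v) \<longleftrightarrow> adj T u v}"

definition fixes_end :: "('v \<Rightarrow> 'v) \<Rightarrow> (nat \<Rightarrow> 'v) set \<Rightarrow> bool" where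
  "fixes_end g \<xi> \<longleftrightarrow> (\<lambda>r. g \<circ> r) ` \<xi> = \<xi>"

definition Aff :: "('v, 'm) pointed_tree_scheme \<Rightarrow> ('v \<Rightarrow> 'v) set" where
  "Aff T = {g \<in> automorphisms T. fixes_end g (top_end T)}"

definition Aff_group :: "('v, 'm) pointed_tree_scheme \<Rightarrow> ('v \<Rightarrow> 'v) monoid" where
  "Aff_group T = (BijGroup (verts T))\<lparr>carrier := Aff T\<rparr>"

definition Aff_topology :: "('v, 'm) pointed_tree_scheme \<Rightarrow> ('v \<Rightarrow> 'v) topology" where
  "Aff_topology T =
     subtopology (product_topology (\<lambda>_. discrete_topology (verts T)) (verts T)) (Aff T)"

definition horocyclic :: "('v, 'm) pointed_tree_scheme \<Rightarrow> ('v \<Rightarrow> 'v) \<Rightarrow> int" where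
  "horocyclic T g = busemann T (g (origin T))"

definition Hor :: "('v, 'm) pointed_tree_scheme \<Rightarrow> ('v \<Rightarrow> 'v) set" where
  "Hor T = {g \<in> Aff T. horocyclic T g = 0}"

definition exceptional :: "('v, 'm) pointed_tree_scheme \<Rightarrow> ('v \<Rightarrow> 'v) set \<Rightarrow> bool" where
  "exceptional T H \<longleftrightarrow>
     H \<subseteq> Hor T \<or> (\<exists>\<xi>\<in>ends T - {top_end T}. \<forall>g\<in>H. fixes_end g \<xi>)"

definition prod_group :: "nat \<Rightarrow> (nat \<Rightarrow> ('v, 'm) pointed_tree_scheme) \<Rightarrow> (nat \<Rightarrow> 'v \<Rightarrow> 'v) monoid"
  where "prod_group k T = product_group {1..k} (\<lambda>i. Aff_group (T i))"

definition prod_top :: "nat \<Rightarrow> (nat \<Rightarrow> ('v, 'm) pointed_tree_scheme) \<Rightarrow> (nat \<Rightarrow> 'v \<Rightarrow> 'v) topology"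
  where "prod_top k T = product_topology (\<lambda>i. Aff_topology (T i)) {1..k}"

definition prod_length :: "nat \<Rightarrow> (nat \<Rightarrow> ('v, 'm) pointed_tree_scheme) \<Rightarrow> (nat \<Rightarrow> 'v \<Rightarrow> 'v) \<Rightarrow> nat"
  where "prod_length k T \<gamma> = (\<Sum>i\<in>{1..k}. tree_dist (T i) (origin (T i)) (\<gamma> i (origin (T i))))"

definition fully_exceptional ::
    "nat \<Rightarrow> (nat \<Rightarrow> ('v, 'm) pointed_tree_scheme) \<Rightarrow> (nat \<Rightarrow> 'v \<Rightarrow> 'v) set \<Rightarrow> bool" where
  "fully_exceptional k T \<Gamma> \<longleftrightarrow> (\<forall>j\<in>{1..k}. exceptional (T j) ((\<lambda>\<gamma>. \<gamma> j) ` \<Gamma>))"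

definition vertical_image ::
    "(nat \<Rightarrow> ('v, 'm) pointed_tree_scheme) \<Rightarrow> nat \<Rightarrow> (nat \<Rightarrow> 'v \<Rightarrow> 'v) measure \<Rightarrow> int measure" where
  "vertical_image T j \<mu> = distr \<mu> (count_space UNIV) (\<lambda>\<gamma>. horocyclic (T j) (\<gamma> j))"

definition m1 :: "int measure \<Rightarrow> real" where
  "m1 \<kappa> = (\<integral>z. real_of_int z \<partial>\<kappa>)"

text \<open>
  Throughout, a topological group is a pair of an algebraic structure \<open>G\<close> and a topology \<open>X\<close> with
  \<open>topspace X = carrier G\<close>.
\<close>

definition borel_of :: "'a topology \<Rightarrow> 'a measure" where
  "borel_of X = sigma (topspace X) {U. openin X U}"

definition support :: "'a topology \<Rightarrow> 'a measure \<Rightarrow> 'a set" where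
  "support X \<mu> = {x \<in> topspace X. \<forall>U. openin X U \<and> x \<in> U \<longrightarrow> 0 < emeasure \<mu> U}"

definition closed_semigroup ::
    "('a, 'm) monoid_scheme \<Rightarrow> 'a topology \<Rightarrow> 'a measure \<Rightarrow> 'a set" where
  "closed_semigroup G X \<mu> =
     \<Inter>{S. closedin X S \<and> support X \<mu> \<subseteq> S \<and> (\<forall>x\<in>S. \<forall>y\<in>S. x \<otimes>\<^bsub>G\<^esub> y \<in> S)}"

definition aperiodic :: "('a, 'm) monoid_scheme \<Rightarrow> 'a topology \<Rightarrow> 'a measure \<Rightarrow> bool" where
  "aperiodic G X \<mu> \<longleftrightarrow>
     (\<nexists>H. subgroup H G \<and> closedin X H \<and> H \<noteq> carrier G \<and> support X \<mu> \<subseteq> H)"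

text \<open>
  The convolution of a measure on a group with a measure on a space it acts on, where \<open>a\<close> is
  the action. With the group multiplication for \<open>a\<close> this is the convolution of measures on the group.
\<close>

definition convolve ::
    "'b topology \<Rightarrow> ('a \<Rightarrow> 'b \<Rightarrow> 'b) \<Rightarrow> 'a measure \<Rightarrow> 'b measure \<Rightarrow> 'b measure" where
  "convolve B a \<mu> \<nu> = distr (\<mu> \<Otimes>\<^sub>M \<nu>) (borel_of B) (\<lambda>(g, b). a g b)"

primrec conv_power ::
    "('a, 'm) monoid_scheme \<Rightarrow> 'a topology \<Rightarrow> 'a measure \<Rightarrow> nat \<Rightarrow> 'a measure" where
  "conv_power G X \<mu> 0 = return (borel_of X) \<one>\<^bsub>G\<^esub>"
| "conv_power G X \<mu> (Suc n) = convolve X (\<otimes>\<^bsub>G\<^esub>) \<mu> (conv_power G X \<mu> n)"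

definition haar_measure :: "('a, 'm) monoid_scheme \<Rightarrow> 'a topology \<Rightarrow> 'a measure \<Rightarrow> bool" where
  "haar_measure G X \<eta> \<longleftrightarrow>
     sets \<eta> = sets (borel_of X) \<and>
     emeasure \<eta> (topspace X) \<noteq> 0 \<and>
     (\<forall>g\<in>carrier G. \<forall>A\<in>sets \<eta>. emeasure \<eta> (g <#\<^bsub>G\<^esub> A) = emeasure \<eta> A) \<and>
     (\<forall>K. compactin X K \<and> K \<in> sets \<eta> \<longrightarrow> emeasure \<eta> K < \<infinity>) \<and>
     (\<forall>A\<in>sets \<eta>. emeasure \<eta> A = (INF U\<in>{U. openin X U \<and> A \<subseteq> U}. emeasure \<eta> U)) \<and>
     (\<forall>U. openin X U \<longrightarrow>
        emeasure \<eta> U = (SUP K\<in>{K. compactin X K \<and> K \<in> sets \<eta> \<and> K \<subseteq> U}. emeasure \<eta> K))"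

definition mutually_singular :: "'a measure \<Rightarrow> 'a measure \<Rightarrow> bool" where
  "mutually_singular \<mu> \<eta> \<longleftrightarrow>
     (\<exists>A\<in>sets \<mu> \<inter> sets \<eta>. emeasure \<mu> A = 0 \<and> emeasure \<eta> (space \<eta> - A) = 0)"

text \<open>
  All left and right Haar measures have the same null sets, so it does not matter which one is used.
\<close>

definition spread_out :: "('a, 'm) monoid_scheme \<Rightarrow> 'a topology \<Rightarrow> 'a measure \<Rightarrow> bool" where
  "spread_out G X \<mu> \<longleftrightarrow>
     (\<exists>\<eta>. haar_measure G X \<eta> \<and> (\<exists>n\<ge>1. \<not> mutually_singular (conv_power G X \<mu> n) \<eta>))"

definition bounded_harmonic ::
    "('a, 'm) monoid_scheme \<Rightarrow> 'a topology \<Rightarrow> 'a measure \<Rightarrow> ('a \<Rightarrow> real) set" where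
  "bounded_harmonic G X \<mu> =
     {f \<in> borel_measurable (borel_of X). bounded (f ` carrier G) \<and>
        (\<forall>g\<in>carrier G. f g = (\<integral>x. f (g \<otimes>\<^bsub>G\<^esub> x) \<partial>\<mu>))}"

text \<open>The right random walk; the increment \<open>X\<^sub>i\<close> with \<open>i \<ge> 1\<close> is \<open>x (i - 1)\<close>.\<close>

primrec random_walk :: "('a, 'm) monoid_scheme \<Rightarrow> (nat \<Rightarrow> 'a) \<Rightarrow> nat \<Rightarrow> 'a" where
  "random_walk G x 0 = \<one>\<^bsub>G\<^esub>"
| "random_walk G x (Suc n) = random_walk G x n \<otimes>\<^bsub>G\<^esub> x n"

text \<open>
  Spaces carrying boundaries are locally compact, second countable and Hausdorff. On them, weak*
  convergence of probability measures to a probability measure can be tested equivalently on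
  functions vanishing at infinity and on bounded continuous functions.
\<close>

definition stationary_space ::
    "('a, 'm) monoid_scheme \<Rightarrow> 'a topology \<Rightarrow> 'a measure \<Rightarrow>
     'b topology \<Rightarrow> ('a \<Rightarrow> 'b \<Rightarrow> 'b) \<Rightarrow> 'b measure \<Rightarrow> bool" where
  "stationary_space G X \<mu> B act \<nu> \<longleftrightarrow>
     locally_compact_space B \<and> second_countable B \<and> Hausdorff_space B \<and>
     group_action G (topspace B) act \<and>
     continuous_map (prod_topology X B) B (\<lambda>(g, b). act g b) \<and>
     prob_space \<nu> \<and> sets \<nu> = sets (borel_of B) \<and>
     convolve B act \<mu> \<nu> = \<nu>"

definition weak_star_converges :: "'b topology \<Rightarrow> (nat \<Rightarrow> 'b measure) \<Rightarrow> 'b measure \<Rightarrow> bool" where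
  "weak_star_converges B N \<nu> \<longleftrightarrow>
     (\<forall>f::'b \<Rightarrow> real. continuous_map B euclidean f \<and> bounded (f ` topspace B) \<longrightarrow>
        (\<lambda>n. \<integral>b. f b \<partial>(N n)) \<longlonglongrightarrow> (\<integral>b. f b \<partial>\<nu>))"

definition mu_boundary ::
    "('a, 'm) monoid_scheme \<Rightarrow> 'a topology \<Rightarrow> 'a measure \<Rightarrow>
     'b topology \<Rightarrow> ('a \<Rightarrow> 'b \<Rightarrow> 'b) \<Rightarrow> 'b measure \<Rightarrow> bool" where
  "mu_boundary G X \<mu> B act \<nu> \<longleftrightarrow>
     stationary_space G X \<mu> B act \<nu> \<and>
     (AE x in (\<Pi>\<^sub>M n\<in>(UNIV :: nat set). \<mu>). \<exists>b\<in>topspace B.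
        weak_star_converges B
          (\<lambda>n. distr \<nu> (borel_of B) (act (random_walk G x n))) (return (borel_of B) b))"

definition poisson_transform ::
    "('a \<Rightarrow> 'b \<Rightarrow> 'b) \<Rightarrow> 'b measure \<Rightarrow> ('b \<Rightarrow> real) \<Rightarrow> 'a \<Rightarrow> real" where
  "poisson_transform act \<nu> \<phi> g = (\<integral>b. \<phi> (act g b) \<partial>\<nu>)"

definition ess_norm :: "'b measure \<Rightarrow> ('b \<Rightarrow> real) \<Rightarrow> ereal" where
  "ess_norm \<nu> \<phi> = esssup \<nu> (\<lambda>b. ereal \<bar>\<phi> b\<bar>)"

definition ess_bounded :: "'b measure \<Rightarrow> ('b \<Rightarrow> real) set" where
  "ess_bounded \<nu> = {\<phi> \<in> borel_measurable \<nu>. ess_norm \<nu> \<phi> < \<infinity>}"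

text \<open>
  Elements of \<open>L\<^sup>\<infinity>\<close> are represented by functions. The isometry condition, applied to functions
  that vanish almost everywhere, shows that the transform does not depend on the representative and
  that almost everywhere equality is the only identification; linearity is that of the integral.
\<close>

definition poisson_boundary ::
    "('a, 'm) monoid_scheme \<Rightarrow> 'a topology \<Rightarrow> 'a measure \<Rightarrow>
     'b topology \<Rightarrow> ('a \<Rightarrow> 'b \<Rightarrow> 'b) \<Rightarrow> 'b measure \<Rightarrow> bool" where
  "poisson_boundary G X \<mu> B act \<nu> \<longleftrightarrow>
     mu_boundary G X \<mu> B act \<nu> \<and>
     (\<forall>\<phi>\<in>ess_bounded \<nu>.
        poisson_transform act \<nu> \<phi> \<in> bounded_harmonic G X \<mu> \<and>
        (SUP g\<in>carrier G. ereal \<bar>poisson_transform act \<nu> \<phi> g\<bar>) = ess_norm \<nu> \<phi>) \<and>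
     (\<forall>f\<in>bounded_harmonic G X \<mu>. \<exists>\<phi>\<in>ess_bounded \<nu>.
        \<forall>g\<in>carrier G. f g = poisson_transform act \<nu> \<phi> g)"

definition point_mass :: "'b topology \<Rightarrow> 'b measure \<Rightarrow> bool" where
  "point_mass B \<nu> \<longleftrightarrow> (\<exists>b\<in>topspace B. \<nu> = return (borel_of B) b)"

end

theory Submission
  imports Defs "HOL-Complex_Analysis.Great_Picard"
begin

text \<open>
  A Poisson boundary is a point mass exactly when all bounded harmonic functions on
  \<open>\<Gamma>\<close> are constant: the isometry of the Poisson transform, applied to shifted
  functions, gives both directions (\<open>constant_if_point_mass\<close>,
  \<open>point_mass_if_constant\<close>), and a one-point space is a Poisson boundary as soon as
  the constants are the only bounded harmonic functions (\<open>trivial_poisson_boundary\<close>).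
  The theorem therefore says that all bounded harmonic functions are constant if and only if none
  of the walks on the single trees drifts away from the distinguished end. This is
  \<open>constant_harmonic_iff\<close>; no identification of the boundary is involved.

  The group acts on the disjoint union of the trees, a countable set, and its topology is that of
  pointwise agreement on finite sets of vertices. A spread-out measure makes every bounded
  harmonic function \<open>f\<close> uniformly continuous
  (\<open>harmonic_uniformly_continuous\<close>): there is a finite set \<open>F\<close> of
  vertices such that \<open>f (g u)\<close> is close to \<open>f g\<close> whenever
  \<open>u\<close> fixes \<open>F\<close> pointwise. The reason is that a part of some convolution
  power is a multiple of Haar measure on a set, and translation acts continuously on such a part;
  each use of the convolution power thus shrinks the oscillation by a fixed factor. Up to a small
  error \<open>f g\<close> only depends on the position \<open>g F\<close>, which takes countably
  many values, so Shannon entropy becomes available although the group is not discrete. The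
  indicator function of \<open>\<Gamma>\<close> is harmonic as well, since almost every step lies
  in \<open>\<Gamma>\<close>; being uniformly continuous, it forces \<open>\<Gamma>\<close> to
  contain the pointwise fixer of a finite set (\<open>fixer_in_subgroup\<close>).

  Suppose that no drift is positive. A vertex is determined by how far one climbs from the origin
  towards the end and by the path descended from there, so it can be encoded at a small cost per
  step climbed and a cost above \<open>ln q\<close> per step descended, where \<open>q\<close> is
  the number of children. After \<open>n\<close> steps the mean climb is at most linear in
  \<open>n\<close>, and the mean descent is sublinear (\<open>down_sublinear\<close>); for the
  latter, the descent obeys the recursion of a random walk reflected at zero, and a Lyapunov
  function that is quadratic near zero controls it with a first moment only. Hence the entropy of
  the position of \<open>F\<close> after \<open>n\<close> steps is sublinear
  (\<open>tree_cost\<close>, \<open>entropy_sublinear\<close>). An inequality of Pinsker type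
  (\<open>entropy_step\<close>) turns dependence of the position on the first step into growth of
  entropy, so for suitable \<open>n\<close> the position is almost independent of the first step.
  Consequently the first step does not change the value of a harmonic function
  (\<open>harmonic_step_constant\<close>), and neither does any element of \<open>\<Gamma>\<close>
  (\<open>harmonic_constant_on_semigroup\<close>).

  Suppose conversely that the drift in one tree is positive. Then the walk on that tree spends a
  positive proportion \<open>\<delta>\<close> of its time below a fixed ancestor of the origin
  (\<open>occupation_lower_bound\<close>). A limit of the averaged probabilities of being below
  \<open>w\<close> is a function \<open>A w\<close> for which \<open>A (inverse g w)\<close> is
  harmonic in \<open>g\<close>. If all bounded harmonic functions were constant on
  \<open>\<Gamma>\<close>, then \<open>A\<close> would be \<open>\<Gamma>\<close>-invariant. An
  element of \<open>\<Gamma>\<close> that lowers the origin has an axis, along which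
  \<open>A\<close> is then constant, so \<open>A \<ge> \<delta>\<close> at some vertex
  \<open>y\<close> far below all of \<open>F\<close>. Exchanging subtrees below \<open>F\<close>
  gives elements of \<open>\<Gamma>\<close> that move \<open>y\<close> to \<open>N\<close>
  different vertices of the same height. Their sets of descendants are disjoint, so \<open>N *
  \<delta> \<le> 1\<close>, for every \<open>N\<close> (\<open>nonconstant_harmonic\<close>).
\<close>

section \<open>Borel measurability for groups of permutations\<close>

lemma space_borel_of [simp]: "space (borel_of X) = topspace X"
  unfolding borel_of_def by (rule space_measure_of) (auto dest: openin_subset)

lemma sets_borel_of: "sets (borel_of X) = sigma_sets (topspace X) {U. openin X U}"
  unfolding borel_of_def by (rule sets_measure_of) (auto dest: openin_subset)

lemma borel_of_open: "openin X U \<Longrightarrow> U \<in> sets (borel_of X)"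
  by (simp add: sets_borel_of)

lemma borel_of_closed: "closedin X C \<Longrightarrow> C \<in> sets (borel_of X)"
proof -
  assume C: "closedin X C"
  then have "topspace X - (topspace X - C) \<in> sets (borel_of X)"
    using sets.compl_sets[OF borel_of_open[of X "topspace X - C"]] by (simp add: closedin_def)
  then show ?thesis
    using closedin_subset[OF C] by (simp add: double_diff)
qed

lemma measurable_borel_ofI:
  assumes "f \<in> space M \<rightarrow> topspace X"
    and "\<And>U. openin X U \<Longrightarrow> f -` U \<inter> space M \<in> sets M"
  shows "f \<in> measurable M (borel_of X)"
  unfolding borel_of_def using assms by (intro measurable_measure_of) (auto dest: openin_subset)

lemma continuous_map_borel_of:
  assumes "continuous_map X Y f"
  shows "f \<in> measurable (borel_of X) (borel_of Y)"
proof (rule measurable_borel_ofI)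
  show "f \<in> space (borel_of X) \<rightarrow> topspace Y"
    using continuous_map_image_subset_topspace[OF assms] by auto
  fix U assume "openin Y U"
  then have "openin X {x \<in> topspace X. f x \<in> U}"
    by (rule openin_continuous_map_preimage[OF assms])
  moreover have "f -` U \<inter> space (borel_of X) = {x \<in> topspace X. f x \<in> U}"
    by auto
  ultimately show "f -` U \<inter> space (borel_of X) \<in> sets (borel_of X)"
    using borel_of_open by metis
qed

text \<open>
  The only feature of a product of automorphism groups of trees that matters for measurability,
  Haar measure and entropy is its action on a countable set, here \<open>\<Omega>\<close>, which
  determines the topology.
\<close>

locale permutation_group = group G for G :: "('g, 'm) monoid_scheme" (structure) +
  fixes X :: "'g topology" and \<Omega> :: "'w set" and act :: "'g \<Rightarrow> 'w \<Rightarrow> 'w"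
  assumes countable_points: "countable \<Omega>"
    and act_closed: "g \<in> carrier G \<Longrightarrow> w \<in> \<Omega> \<Longrightarrow> act g w \<in> \<Omega>"
    and act_mult: "g \<in> carrier G \<Longrightarrow> h \<in> carrier G \<Longrightarrow> w \<in> \<Omega> \<Longrightarrow> act (g \<otimes> h) w = act g (act h w)"
    and act_one: "w \<in> \<Omega> \<Longrightarrow> act \<one> w = w"
    and openin_iff: "openin X S \<longleftrightarrow> S \<subseteq> carrier G \<and>
      (\<forall>g\<in>S. \<exists>F. finite F \<and> F \<subseteq> \<Omega> \<and> (\<forall>h\<in>carrier G. (\<forall>w\<in>F. act h w = act g w) \<longrightarrow> h \<in> S))"
begin

text \<open>
  Finitely many conditions are kept in a list because lists over a countable set are countable.
\<close>

definition cylinder :: "('w \<times> 'w) list \<Rightarrow> 'g set" where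
  "cylinder l = {h \<in> carrier G. \<forall>(v, w)\<in>set l. act h v = w}"

definition fixer :: "'w set \<Rightarrow> 'g set" where
  "fixer F = {u \<in> carrier G. \<forall>w\<in>F. act u w = w}"

lemma act_inv: "g \<in> carrier G \<Longrightarrow> w \<in> \<Omega> \<Longrightarrow> act (inv g) (act g w) = w"
  using act_mult[of "inv g" g w] act_one[of w] by simp

lemma act_inv': "g \<in> carrier G \<Longrightarrow> w \<in> \<Omega> \<Longrightarrow> act g (act (inv g) w) = w"
  using act_mult[of g "inv g" w] act_one[of w] by simp

lemma act_inv_eq_iff:
  "g \<in> carrier G \<Longrightarrow> v \<in> \<Omega> \<Longrightarrow> w \<in> \<Omega> \<Longrightarrow> act (inv g) v = w \<longleftrightarrow> act g w = v"
  using act_inv act_inv' by metis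

lemma topspace_eq [simp]: "topspace X = carrier G"
proof -
  have "openin X (carrier G)"
    unfolding openin_iff by (auto intro!: exI[of _ "{}"])
  moreover have "topspace X \<subseteq> carrier G"
    using openin_iff[of "topspace X"] by simp
  ultimately show ?thesis
    using openin_subset by fastforce
qed

lemma openin_cylinder:
  assumes "l \<in> lists (\<Omega> \<times> \<Omega>)"
  shows "openin X (cylinder l)"
  unfolding openin_iff
proof (intro conjI ballI)
  show "cylinder l \<subseteq> carrier G" by (auto simp: cylinder_def)
  fix g assume g: "g \<in> cylinder l"
  have "fst ` set l \<subseteq> \<Omega>" using assms by auto
  moreover have "h \<in> cylinder l" if "h \<in> carrier G" "\<forall>w\<in>fst ` set l. act h w = act g w" for h
    using that g unfolding cylinder_def by force
  ultimately show "\<exists>F. finite F \<and> F \<subseteq> \<Omega> \<and> (\<forall>h\<in>carrier G. (\<forall>w\<in>F. act h w = act g w) \<longrightarrow> h \<in> cylinder l)"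
    by (intro exI[of _ "fst ` set l"]) auto
qed

lemma agree_eq_cylinder:
  assumes "finite F" "F \<subseteq> \<Omega>" "g \<in> carrier G"
  obtains l where "l \<in> lists (\<Omega> \<times> \<Omega>)" "{h \<in> carrier G. \<forall>w\<in>F. act h w = act g w} = cylinder l"
proof -
  obtain xs where xs: "set xs = F" using finite_list[OF assms(1)] by auto
  show ?thesis
  proof (rule that[of "map (\<lambda>w. (w, act g w)) xs"])
    show "map (\<lambda>w. (w, act g w)) xs \<in> lists (\<Omega> \<times> \<Omega>)"
      using xs assms(2) act_closed[OF assms(3)] by (fastforce simp: in_lists_conv_set)
    show "{h \<in> carrier G. \<forall>w\<in>F. act h w = act g w} = cylinder (map (\<lambda>w. (w, act g w)) xs)"
      using xs by (auto simp: cylinder_def)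
  qed
qed

lemma countable_cylinders: "countable (lists (\<Omega> \<times> \<Omega>))"
  by (intro countable_lists countable_SIGMA countable_points)

lemma open_eq_Union_cylinders:
  assumes "openin X S"
  shows "S = (\<Union>l\<in>{l\<in>lists (\<Omega> \<times> \<Omega>). cylinder l \<subseteq> S}. cylinder l)"
proof (intro equalityI subsetI)
  fix g assume g: "g \<in> S"
  then have gc: "g \<in> carrier G" using openin_subset[OF assms] by auto
  obtain F where F: "finite F" "F \<subseteq> \<Omega>" "\<And>h. h\<in>carrier G \<Longrightarrow> (\<forall>w\<in>F. act h w = act g w) \<Longrightarrow> h \<in> S"
    using assms[unfolded openin_iff, THEN conjunct2, THEN bspec, OF g] by auto
  obtain l where l: "l \<in> lists (\<Omega> \<times> \<Omega>)" "{h \<in> carrier G. \<forall>w\<in>F. act h w = act g w} = cylinder l"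
    using agree_eq_cylinder[OF F(1,2) gc] .
  have "cylinder l \<subseteq> S" unfolding l(2)[symmetric] using F(3) by auto
  moreover have "g \<in> cylinder l" unfolding l(2)[symmetric] using gc by auto
  ultimately show "g \<in> (\<Union>l\<in>{l\<in>lists (\<Omega> \<times> \<Omega>). cylinder l \<subseteq> S}. cylinder l)"
    using l(1) by (intro UN_I[of l]) simp_all
next
  fix g assume "g \<in> (\<Union>l\<in>{l\<in>lists (\<Omega> \<times> \<Omega>). cylinder l \<subseteq> S}. cylinder l)"
  then show "g \<in> S" by (elim UN_E) (simp, blast dest: subsetD)
qed

text \<open>
  Open sets are countable unions of cylinders, so measurability can be tested on the action on
  single points.
\<close>

lemma measurable_into:
  assumes f: "f \<in> space M \<rightarrow> carrier G"
    and cyl: "\<And>v w. v \<in> \<Omega> \<Longrightarrow> w \<in> \<Omega> \<Longrightarrow> {x \<in> space M. act (f x) v = w} \<in> sets M"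
  shows "f \<in> measurable M (borel_of X)"
proof (rule measurable_borel_ofI)
  show "f \<in> space M \<rightarrow> topspace X" using f by simp
  have *: "f -` cylinder l \<inter> space M \<in> sets M" if "l \<in> lists (\<Omega> \<times> \<Omega>)" for l
  proof -
    have "f -` cylinder l \<inter> space M = {x\<in>space M. \<forall>p\<in>set l. act (f x) (fst p) = snd p}"
      using f by (auto simp: cylinder_def)
    also have "\<dots> \<in> sets M"
    proof (intro sets.sets_Collect_finite_All cyl)
      fix p assume "p \<in> set l"
      then have "p \<in> \<Omega> \<times> \<Omega>" using that by (simp add: in_lists_conv_set)
      then show "fst p \<in> \<Omega>" "snd p \<in> \<Omega>" by (simp_all add: mem_Times_iff)
    qed simp
    finally show ?thesis .
  qed
  fix U assume "openin X U"
  have "f -` U \<inter> space M = f -` (\<Union>l\<in>{l\<in>lists (\<Omega> \<times> \<Omega>). cylinder l \<subseteq> U}. cylinder l) \<inter> space M"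
    using open_eq_Union_cylinders[OF \<open>openin X U\<close>] by metis
  also have "\<dots> = (\<Union>l\<in>{l\<in>lists (\<Omega> \<times> \<Omega>). cylinder l \<subseteq> U}. f -` cylinder l \<inter> space M)"
    by blast
  also have "\<dots> \<in> sets M"
  proof (intro sets.countable_UN' image_subsetI)
    show "countable {l\<in>lists (\<Omega> \<times> \<Omega>). cylinder l \<subseteq> U}"
      using countable_cylinders by (rule countable_subset[rotated]) simp
  qed (simp add: *)
  finally show "f -` U \<inter> space M \<in> sets M" .
qed

lemma act_measurable:
  assumes "v \<in> \<Omega>"
  shows "(\<lambda>g. act g v) \<in> measurable (borel_of X) (count_space \<Omega>)"
proof (rule measurable_count_space_eq_countable[THEN iffD2, OF countable_points], intro conjI ballI)
  show "(\<lambda>g. act g v) \<in> space (borel_of X) \<rightarrow> \<Omega>" using assms act_closed by auto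
  fix w assume "w \<in> \<Omega>"
  then have "cylinder [(v, w)] \<in> sets (borel_of X)"
    using assms by (intro borel_of_open openin_cylinder) auto
  moreover have "cylinder [(v, w)] = (\<lambda>g. act g v) -` {w} \<inter> space (borel_of X)"
    by (auto simp: cylinder_def)
  ultimately show "(\<lambda>g. act g v) -` {w} \<inter> space (borel_of X) \<in> sets (borel_of X)"
    by metis
qed

lemma act_eq_measurable:
  assumes "v \<in> \<Omega>"
  shows "{g \<in> carrier G. act g v = w} \<in> sets (borel_of X)"
proof (cases "w \<in> \<Omega>")
  case True
  then show ?thesis
    using measurable_sets[OF act_measurable[OF assms], of "{w}"]
    by (simp add: vimage_def Int_def conj_commute)
next
  case False
  then have "{g \<in> carrier G. act g v = w} = {}" using act_closed assms by auto
  then show ?thesis by (metis sets.empty_sets)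
qed

lemma mult_measurable:
  "(\<lambda>(g, h). g \<otimes> h) \<in> measurable (borel_of X \<Otimes>\<^sub>M borel_of X) (borel_of X)"
proof (rule measurable_into)
  show "(\<lambda>(g, h). g \<otimes> h) \<in> space (borel_of X \<Otimes>\<^sub>M borel_of X) \<rightarrow> carrier G"
    by (auto simp: space_pair_measure)
  fix v w assume v: "v \<in> \<Omega>" and w: "w \<in> \<Omega>"
  have "{x \<in> space (borel_of X \<Otimes>\<^sub>M borel_of X). act (case x of (g, h) \<Rightarrow> g \<otimes> h) v = w}
      = (\<Union>y\<in>\<Omega>. {g \<in> carrier G. act g y = w} \<times> {h \<in> carrier G. act h v = y})"
    using v act_mult act_closed by (auto simp: space_pair_measure)
  also have "\<dots> \<in> sets (borel_of X \<Otimes>\<^sub>M borel_of X)"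
    by (intro sets.countable_UN'[OF countable_points] image_subsetI pair_measureI act_eq_measurable v)
  finally show "{x \<in> space (borel_of X \<Otimes>\<^sub>M borel_of X). act (case x of (g, h) \<Rightarrow> g \<otimes> h) v = w}
      \<in> sets (borel_of X \<Otimes>\<^sub>M borel_of X)" .
qed

lemma mult_measurable' [measurable (raw)]:
  assumes "f \<in> measurable M (borel_of X)" "g \<in> measurable M (borel_of X)"
  shows "(\<lambda>x. f x \<otimes> g x) \<in> measurable M (borel_of X)"
  using measurable_compose[OF measurable_Pair[OF assms] mult_measurable] by simp

lemma inv_measurable: "(\<lambda>g. inv g) \<in> measurable (borel_of X) (borel_of X)"
proof (rule measurable_into)
  fix v w assume v: "v \<in> \<Omega>" and w: "w \<in> \<Omega>"
  then have "{x \<in> space (borel_of X). act (inv x) v = w} = {x \<in> carrier G. act x w = v}"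
    using act_inv_eq_iff by auto
  then show "{x \<in> space (borel_of X). act (inv x) v = w} \<in> sets (borel_of X)"
    using act_eq_measurable[OF w] by simp
qed auto

lemma const_mult_measurable:
  "g \<in> carrier G \<Longrightarrow> (\<lambda>x. g \<otimes> x) \<in> measurable (borel_of X) (borel_of X)"
  by (intro mult_measurable') auto

lemma inv_fixer: "F \<subseteq> \<Omega> \<Longrightarrow> u \<in> fixer F \<Longrightarrow> inv u \<in> fixer F"
  using act_inv by (force simp: fixer_def)

end

section \<open>Convolution powers and bounded harmonic functions\<close>

locale group_walk = permutation_group G X \<Omega> act + prob_space \<mu>
  for G :: "('g, 'm) monoid_scheme" (structure) and X :: "'g topology" and \<Omega> :: "'w set" and act
    and \<mu> :: "'g measure" +
  assumes sets_step: "sets \<mu> = sets (borel_of X)"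
begin

text \<open>
  The recursion of the convolution powers splits off the first step \<open>x\<close> of a walk
  \<open>x \<otimes> r\<close>; all arguments below condition on this first step.
\<close>

abbreviation law :: "nat \<Rightarrow> 'g measure" where "law \<equiv> conv_power G X \<mu>"

lemma space_step [simp]: "space \<mu> = carrier G"
  using sets_eq_imp_space_eq[OF sets_step] by simp

lemma measurable_step: "measurable \<mu> N = measurable (borel_of X) N"
  by (rule measurable_cong_sets[OF sets_step refl])

lemma sets_law: "sets (law n) = sets (borel_of X)"
  by (cases n) (simp_all add: convolve_def)

lemma space_law [simp]: "space (law n) = carrier G"
  using sets_eq_imp_space_eq[OF sets_law] by simp

lemma measurable_law: "measurable (law n) N = measurable (borel_of X) N"
  by (rule measurable_cong_sets[OF sets_law refl])

lemma measurable_pair_law: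
  "measurable (\<mu> \<Otimes>\<^sub>M law n) N = measurable (borel_of X \<Otimes>\<^sub>M borel_of X) N"
  by (rule measurable_cong_sets[OF sets_pair_measure_cong[OF sets_step sets_law] refl])

lemma prob_space_law: "prob_space (law n)"
proof (induction n)
  case 0
  then show ?case by (simp add: prob_space_return)
next
  case (Suc n)
  interpret L: prob_space "law n" by fact
  interpret pair_prob_space \<mu> "law n" ..
  show ?case
    unfolding conv_power.simps convolve_def
    by (rule prob_space_distr) (simp add: measurable_pair_law mult_measurable)
qed

lemma nn_integral_law_Suc:
  assumes f: "f \<in> borel_measurable (borel_of X)"
  shows "(\<integral>\<^sup>+ r. f r \<partial>law (Suc n)) = (\<integral>\<^sup>+ x. \<integral>\<^sup>+ r. f (x \<otimes> r) \<partial>law n \<partial>\<mu>)"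
proof -
  interpret L: prob_space "law n" by (rule prob_space_law)
  have "(\<integral>\<^sup>+ r. f r \<partial>law (Suc n)) = (\<integral>\<^sup>+ p. f (case p of (g, h) \<Rightarrow> g \<otimes> h) \<partial>(\<mu> \<Otimes>\<^sub>M law n))"
    unfolding conv_power.simps convolve_def
    by (subst nn_integral_distr) (simp_all add: measurable_pair_law mult_measurable f)
  also have "\<dots> = (\<integral>\<^sup>+ x. \<integral>\<^sup>+ r. f (case (x, r) of (g, h) \<Rightarrow> g \<otimes> h) \<partial>law n \<partial>\<mu>)"
    by (subst L.nn_integral_fst[symmetric])
       (simp_all add: measurable_pair_law measurable_compose[OF mult_measurable f])
  finally show ?thesis by simp
qed

lemma integral_law_Suc:
  fixes f :: "'g \<Rightarrow> real"
  assumes f: "f \<in> borel_measurable (borel_of X)" and b: "\<And>g. g \<in> carrier G \<Longrightarrow> \<bar>f g\<bar> \<le> C"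
  shows "(\<integral> r. f r \<partial>law (Suc n)) = (\<integral> x. (\<integral> r. f (x \<otimes> r) \<partial>law n) \<partial>\<mu>)"
proof -
  interpret L: prob_space "law n" by (rule prob_space_law)
  interpret pair_prob_space \<mu> "law n" ..
  have m: "(\<lambda>p. f (case p of (g, h) \<Rightarrow> g \<otimes> h)) \<in> borel_measurable (\<mu> \<Otimes>\<^sub>M law n)"
    by (simp add: measurable_pair_law measurable_compose[OF mult_measurable f])
  have "(\<integral> r. f r \<partial>law (Suc n)) = (\<integral> p. f (case p of (g, h) \<Rightarrow> g \<otimes> h) \<partial>(\<mu> \<Otimes>\<^sub>M law n))"
    unfolding conv_power.simps convolve_def
    by (subst integral_distr) (simp_all add: measurable_pair_law mult_measurable f)
  also have "\<dots> = (\<integral> x. (\<integral> r. f (case (x, r) of (g, h) \<Rightarrow> g \<otimes> h) \<partial>law n) \<partial>\<mu>)"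
  proof (rule integral_fst'[symmetric])
    show "integrable (\<mu> \<Otimes>\<^sub>M law n) (\<lambda>p. f (case p of (g, h) \<Rightarrow> g \<otimes> h))"
      by (rule P.integrable_const_bound[where B=C, OF AE_I2 m])
         (auto simp: space_pair_measure b)
  qed
  finally show ?thesis by simp
qed

lemma integrable_law_bounded:
  fixes f :: "'g \<Rightarrow> real"
  assumes f: "f \<in> borel_measurable (borel_of X)" and b: "\<And>g. g \<in> carrier G \<Longrightarrow> \<bar>f g\<bar> \<le> C"
  shows "integrable (law n) f"
proof -
  interpret L: prob_space "law n" by (rule prob_space_law)
  show ?thesis
    by (rule L.integrable_const_bound[where B=C, OF AE_I2]) (auto simp: b f measurable_law)
qed

lemma harmonic_bound:
  assumes "f \<in> bounded_harmonic G X \<mu>"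
  obtains C where "0 < C" "\<And>g. g \<in> carrier G \<Longrightarrow> \<bar>f g\<bar> \<le> C"
  using assms unfolding bounded_harmonic_def bounded_pos by auto

lemma harmonic_law:
  assumes f: "f \<in> bounded_harmonic G X \<mu>" and g: "g \<in> carrier G"
  shows "f g = (\<integral>r. f (g \<otimes> r) \<partial>law n)"
  using g
proof (induction n arbitrary: g)
  case 0
  have "f \<in> borel_measurable (borel_of X)" using f by (simp add: bounded_harmonic_def)
  with 0 show ?case
    by (simp add: integral_return measurable_compose[OF const_mult_measurable])
next
  case (Suc n)
  obtain C where C: "\<And>g. g \<in> carrier G \<Longrightarrow> \<bar>f g\<bar> \<le> C" using harmonic_bound[OF f] by metis
  have fm: "f \<in> borel_measurable (borel_of X)" using f by (simp add: bounded_harmonic_def)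
  have "f g = (\<integral>x. f (g \<otimes> x) \<partial>\<mu>)"
    using f Suc.prems by (simp add: bounded_harmonic_def)
  also have "\<dots> = (\<integral>x. (\<integral>r. f (g \<otimes> (x \<otimes> r)) \<partial>law n) \<partial>\<mu>)"
  proof (rule Bochner_Integration.integral_cong[OF refl])
    fix x assume "x \<in> space \<mu>"
    then have "f (g \<otimes> x) = (\<integral>r. f (g \<otimes> x \<otimes> r) \<partial>law n)"
      using Suc by simp
    also have "\<dots> = (\<integral>r. f (g \<otimes> (x \<otimes> r)) \<partial>law n)"
      using \<open>x \<in> space \<mu>\<close> Suc.prems by (intro Bochner_Integration.integral_cong) (auto simp: m_assoc)
    finally show "f (g \<otimes> x) = (\<integral>r. f (g \<otimes> (x \<otimes> r)) \<partial>law n)" .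
  qed
  also have "\<dots> = (\<integral>r. f (g \<otimes> r) \<partial>law (Suc n))"
    using Suc.prems C fm
    by (intro integral_law_Suc[symmetric, where C=C])
       (auto intro: measurable_compose[OF const_mult_measurable])
  finally show ?case .
qed

lemma harmonic_translate:
  assumes f: "f \<in> bounded_harmonic G X \<mu>" and k: "k \<in> carrier G"
  shows "(\<lambda>g. f (k \<otimes> g)) \<in> bounded_harmonic G X \<mu>"
proof -
  obtain C where C: "\<And>g. g \<in> carrier G \<Longrightarrow> \<bar>f g\<bar> \<le> C" using harmonic_bound[OF f] by metis
  have "f (k \<otimes> g) = (\<integral>x. f (k \<otimes> (g \<otimes> x)) \<partial>\<mu>)" if g: "g \<in> carrier G" for g
  proof -
    have "f (k \<otimes> g) = (\<integral>x. f (k \<otimes> g \<otimes> x) \<partial>\<mu>)"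
      using f g k by (simp add: bounded_harmonic_def)
    also have "\<dots> = (\<integral>x. f (k \<otimes> (g \<otimes> x)) \<partial>\<mu>)"
      using g k by (intro Bochner_Integration.integral_cong) (auto simp: m_assoc)
    finally show ?thesis .
  qed
  moreover have "bounded ((\<lambda>g. f (k \<otimes> g)) ` carrier G)"
    using C k by (auto simp: bounded_iff)
  moreover have "(\<lambda>g. f (k \<otimes> g)) \<in> borel_measurable (borel_of X)"
    using f k by (auto simp: bounded_harmonic_def intro: measurable_compose[OF const_mult_measurable])
  ultimately show ?thesis by (simp add: bounded_harmonic_def)
qed

text \<open>
  A point outside the support has a null cylinder as a neighbourhood, and there are only countably
  many cylinders.
\<close>

lemma emeasure_support:
  assumes "closedin X S" "support X \<mu> \<subseteq> S"
  shows "emeasure \<mu> S = 1"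
proof -
  have So: "openin X (carrier G - S)" using assms(1) by (simp add: closedin_def)
  define L where "L = {l\<in>lists (\<Omega> \<times> \<Omega>). cylinder l \<subseteq> carrier G - S \<and> emeasure \<mu> (cylinder l) = 0}"
  have cm: "cylinder l \<in> sets \<mu>" if "l \<in> lists (\<Omega> \<times> \<Omega>)" for l
    using borel_of_open[OF openin_cylinder[OF that]] by (simp add: sets_step)
  have "carrier G - S \<subseteq> (\<Union>l\<in>L. cylinder l)"
  proof
    fix x assume x: "x \<in> carrier G - S"
    then have xc: "x \<in> carrier G" and "x \<notin> support X \<mu>" using assms(2) by auto
    then obtain U where U: "openin X U" "x \<in> U" "emeasure \<mu> U = 0" by (auto simp: support_def zero_less_iff_neq_zero)
    then have o: "openin X (U \<inter> (carrier G - S))" using So by (intro openin_Int)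
    then obtain l where l: "l \<in> lists (\<Omega> \<times> \<Omega>)" "cylinder l \<subseteq> U \<inter> (carrier G - S)" "x \<in> cylinder l"
      using open_eq_Union_cylinders[OF o] x U(2) by blast
    have "emeasure \<mu> (cylinder l) \<le> emeasure \<mu> U"
      using l(2) borel_of_open[OF U(1)] by (intro emeasure_mono) (auto simp: sets_step)
    then have "l \<in> L" using l U(3) by (auto simp: L_def simp del: in_lists_conv_set)
    then show "x \<in> (\<Union>l\<in>L. cylinder l)" using l(3) by blast
  qed
  moreover have "(\<Union>l\<in>L. cylinder l) \<in> null_sets \<mu>"
  proof (rule null_sets_UN')
    show "countable L" unfolding L_def using countable_cylinders by (rule countable_subset[rotated]) simp
    fix l assume "l \<in> L"
    then show "cylinder l \<in> null_sets \<mu>" using cm by (simp only: L_def null_sets_def mem_Collect_eq)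
  qed
  moreover have Sm: "S \<in> sets \<mu>" using borel_of_closed[OF assms(1)] by (simp add: sets_step)
  moreover have "carrier G - S \<in> sets \<mu>" using Sm sets.compl_sets[OF Sm] by simp
  ultimately have "carrier G - S \<in> null_sets \<mu>" using null_sets_subset by blast
  then have "emeasure \<mu> (space \<mu> - S) = 0" by auto
  then have "prob (space \<mu> - S) = 0" by (simp add: measure_def)
  then have "prob S = 1" using prob_compl[OF Sm] by simp
  then show ?thesis by (simp add: emeasure_eq_measure)
qed

end

section \<open>Measures that are not mutually singular\<close>

text \<open>
  Compare \<open>\<nu>\<close> with \<open>\<eta> / (n + 1)\<close> by a Hahn decomposition on
  each piece of finite \<open>\<eta>\<close>-measure. If all the sets where \<open>\<nu>\<close>
  is larger were \<open>\<eta>\<close>-null, then off their union \<open>\<nu>\<close> would be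
  bounded by \<open>\<eta> / (n + 1)\<close> for every \<open>n\<close>, hence vanish, and the
  measures would be singular.
\<close>

lemma not_singular_imp_lower_bound:
  assumes "finite_measure \<nu>" "sigma_finite_measure \<eta>" and sets: "sets \<eta> = sets \<nu>"
    and ns: "\<not> mutually_singular \<nu> \<eta>"
  obtains A c where "A \<in> sets \<nu>" "0 < c" "0 < emeasure \<eta> A" "emeasure \<eta> A < \<infinity>"
    "\<And>B. B \<in> sets \<nu> \<Longrightarrow> B \<subseteq> A \<Longrightarrow> ennreal c * emeasure \<eta> B \<le> emeasure \<nu> B"
proof -
  interpret N: finite_measure \<nu> by fact
  interpret E: sigma_finite_measure \<eta> by fact
  obtain E :: "nat \<Rightarrow> 'a set" where E: "range E \<subseteq> sets \<eta>" "(\<Union>i. E i) = space \<eta>"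
      "\<And>i. emeasure \<eta> (E i) \<noteq> \<infinity>" "disjoint_family E"
    using E.sigma_finite_disjoint by blast
  have sp: "space \<eta> = space \<nu>" using sets by (rule sets_eq_imp_space_eq)
  define N where "N n = scale_measure (ennreal (1 / real (Suc n))) \<eta>" for n
  have "\<exists>Y. Y \<in> sets \<nu> \<and> Y \<subseteq> E i
      \<and> (\<forall>B\<in>sets \<nu>. B \<subseteq> Y \<longrightarrow> emeasure (N n) B \<le> emeasure \<nu> B)
      \<and> (\<forall>B\<in>sets \<nu>. B \<subseteq> E i \<longrightarrow> B \<inter> Y = {} \<longrightarrow> emeasure \<nu> B \<le> emeasure (N n) B)" for i n
    using unsigned_Hahn_decomposition[of "N n" \<nu> "E i"] E(1) E(3)[of i]
    by (auto simp: N_def sets ennreal_mult_eq_top_iff image_subset_iff Bex_def)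
  then obtain Y where Y: "\<And>i n. Y i n \<in> sets \<nu>" "\<And>i n. Y i n \<subseteq> E i"
      "\<And>i n B. B \<in> sets \<nu> \<Longrightarrow> B \<subseteq> Y i n \<Longrightarrow> emeasure (N n) B \<le> emeasure \<nu> B"
      "\<And>i n B. B \<in> sets \<nu> \<Longrightarrow> B \<subseteq> E i \<Longrightarrow> B \<inter> Y i n = {} \<Longrightarrow> emeasure \<nu> B \<le> emeasure (N n) B"
    by metis
  show thesis
  proof (cases "\<exists>i n. 0 < emeasure \<eta> (Y i n)")
    case True
    then obtain i n where in_pos: "0 < emeasure \<eta> (Y i n)" by auto
    show thesis
    proof (rule that[of "Y i n" "1 / real (Suc n)"])
      have "emeasure \<eta> (Y i n) \<le> emeasure \<eta> (E i)"
        using Y(2) E(1) by (intro emeasure_mono) auto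
      then show "emeasure \<eta> (Y i n) < \<infinity>" using E(3)[of i] by (metis infinity_ennreal_def neq_top_trans top.not_eq_extremum)
    qed (use Y in_pos in \<open>simp_all add: N_def\<close>)
  next
    case False
    define Z where "Z = (\<Union>i. \<Union>n. Y i n)"
    have Z: "Z \<in> sets \<nu>" unfolding Z_def using Y(1) by auto
    have "emeasure \<eta> Z = 0"
    proof -
      have "Y i n \<in> null_sets \<eta>" for i n using False Y(1) sets by (auto simp: null_sets_def)
      then have "Z \<in> null_sets \<eta>" unfolding Z_def by auto
      then show ?thesis by auto
    qed
    have "emeasure \<nu> (E i - Z) = 0" for i
    proof -
      have Ei: "E i - Z \<in> sets \<nu>" using E(1) sets Z by auto
      have le: "measure \<nu> (E i - Z) \<le> measure \<eta> (E i) / real (Suc n)" for n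
      proof -
        have "emeasure \<nu> (E i - Z) \<le> emeasure (N n) (E i - Z)"
          using Ei by (intro Y(4)[of _ i n]) (auto simp: Z_def)
        also have "\<dots> \<le> emeasure (N n) (E i)"
          using E(1) by (intro emeasure_mono) (auto simp: N_def)
        also have "\<dots> = ennreal (1 / real (Suc n)) * ennreal (measure \<eta> (E i))"
          using E(3)[of i] by (simp add: N_def emeasure_eq_ennreal_measure)
        also have "\<dots> = ennreal (measure \<eta> (E i) / real (Suc n))"
          by (simp add: ennreal_mult[symmetric])
        finally show ?thesis
          by (simp add: N.emeasure_eq_measure)
      qed
      have "(\<lambda>n. measure \<eta> (E i) / real (Suc n)) \<longlonglongrightarrow> 0"
        by (rule LIMSEQ_Suc) (rule lim_const_over_n)
      then have "measure \<nu> (E i - Z) \<le> 0"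
        by (rule LIMSEQ_le_const) (use le in auto)
      then show ?thesis by (simp add: N.emeasure_eq_measure measure_le_0_iff)
    qed
    then have "(\<Union>i. E i - Z) \<in> null_sets \<nu>"
      using E(1) sets Z by (intro null_sets_UN') (auto simp: null_sets_def)
    moreover have "(\<Union>i. E i - Z) = space \<nu> - Z" using E(2) sp by auto
    ultimately have "emeasure \<nu> (space \<nu> - Z) = 0" by auto
    moreover have "space \<eta> - (space \<nu> - Z) = Z"
      using sets.sets_into_space[OF Z] sp by auto
    ultimately have "mutually_singular \<nu> \<eta>"
      unfolding mutually_singular_def using Z sets \<open>emeasure \<eta> Z = 0\<close>
      by (intro bexI[of _ "space \<nu> - Z"]) auto
    then show thesis using ns by simp
  qed
qed

lemma integral_lower_bound:
  fixes k :: "'a \<Rightarrow> real"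
  assumes sets: "sets \<eta> = sets \<nu>" and A: "A \<in> sets \<nu>" and c: "0 \<le> c"
    and lb: "\<And>B. B \<in> sets \<nu> \<Longrightarrow> B \<subseteq> A \<Longrightarrow> ennreal c * emeasure \<eta> B \<le> emeasure \<nu> B"
    and k: "integrable \<nu> k" "integrable \<eta> (\<lambda>x. indicator A x * k x)" "\<And>x. x \<in> space \<nu> \<Longrightarrow> 0 \<le> k x"
  shows "c * (\<integral>x. indicator A x * k x \<partial>\<eta>) \<le> (\<integral>x. k x \<partial>\<nu>)"
proof -
  have sp: "space \<eta> = space \<nu>" using sets by (rule sets_eq_imp_space_eq)
  have Am: "A \<in> sets \<eta>" using A sets by simp
  define \<alpha> where "\<alpha> = density \<eta> (\<lambda>x. ennreal c * indicator A x)"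
  have s\<alpha>: "sets \<alpha> = sets \<nu>" by (simp add: \<alpha>_def sets)
  have "emeasure \<alpha> B \<le> emeasure \<nu> B" if B: "B \<in> sets \<nu>" for B
  proof -
    have "emeasure \<alpha> B = (\<integral>\<^sup>+x. ennreal c * indicator (A \<inter> B) x \<partial>\<eta>)"
      unfolding \<alpha>_def using Am sets B
      by (subst emeasure_density) (auto intro!: nn_integral_cong simp: indicator_def)
    also have "\<dots> = ennreal c * emeasure \<eta> (A \<inter> B)"
      using Am B sets by (intro nn_integral_cmult_indicator) auto
    also have "\<dots> \<le> emeasure \<nu> (A \<inter> B)" using A B by (intro lb) auto
    also have "\<dots> \<le> emeasure \<nu> B" using B by (intro emeasure_mono) auto
    finally show ?thesis .
  qed
  then have "\<alpha> \<le> \<nu>" unfolding le_measure[OF s\<alpha>] using s\<alpha> by simp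
  then have le: "(\<integral>\<^sup>+x. ennreal (k x) \<partial>\<alpha>) \<le> (\<integral>\<^sup>+x. ennreal (k x) \<partial>\<nu>)"
    using s\<alpha> by (intro nn_integral_mono_measure)
  have km: "k \<in> borel_measurable \<nu>" using k(1) by auto
  then have km': "k \<in> borel_measurable \<eta>" using measurable_cong_sets[OF sets refl] by blast
  have "(\<integral>\<^sup>+x. ennreal (k x) \<partial>\<alpha>) = (\<integral>\<^sup>+x. ennreal c * indicator A x * ennreal (k x) \<partial>\<eta>)"
    unfolding \<alpha>_def using Am km' by (subst nn_integral_density) auto
  also have "\<dots> = (\<integral>\<^sup>+x. ennreal (c * (indicator A x * k x)) \<partial>\<eta>)"
    using c k(3) sp by (intro nn_integral_cong) (auto simp: indicator_def ennreal_mult)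
  also have "\<dots> = ennreal (\<integral>x. c * (indicator A x * k x) \<partial>\<eta>)"
    using k(2,3) c sp by (intro nn_integral_eq_integral AE_I2) auto
  finally have l: "(\<integral>\<^sup>+x. ennreal (k x) \<partial>\<alpha>) = ennreal (c * (\<integral>x. indicator A x * k x \<partial>\<eta>))"
    by simp
  have r: "(\<integral>\<^sup>+x. ennreal (k x) \<partial>\<nu>) = ennreal (\<integral>x. k x \<partial>\<nu>)"
    using k(1,3) by (intro nn_integral_eq_integral AE_I2) auto
  have "0 \<le> (\<integral>x. k x \<partial>\<nu>)" using k(3) by (intro Bochner_Integration.integral_nonneg) auto
  then show ?thesis using le unfolding l r by (simp add: ennreal_le_iff)
qed

section \<open>Haar measure\<close>

context permutation_group
begin

lemma fixer_coset:
  assumes "g \<in> carrier G" "F \<subseteq> \<Omega>"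
  shows "g <#\<^bsub>G\<^esub> fixer F = {h \<in> carrier G. \<forall>w\<in>F. act h w = act g w}"
proof (intro equalityI subsetI)
  fix h assume "h \<in> g <#\<^bsub>G\<^esub> fixer F"
  then show "h \<in> {h \<in> carrier G. \<forall>w\<in>F. act h w = act g w}"
    using assms by (auto simp: l_coset_def fixer_def act_mult subset_iff)
next
  fix h assume h: "h \<in> {h \<in> carrier G. \<forall>w\<in>F. act h w = act g w}"
  have "inv g \<otimes> h \<in> fixer F"
    using h assms by (auto simp: fixer_def act_mult act_inv subset_iff)
  moreover have "h = g \<otimes> (inv g \<otimes> h)" using h assms by (simp add: m_assoc[symmetric])
  ultimately show "h \<in> g <#\<^bsub>G\<^esub> fixer F" unfolding l_coset_def by blast
qed

lemma openin_agree:
  assumes "finite F" "F \<subseteq> \<Omega>" "g \<in> carrier G"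
  shows "openin X {h \<in> carrier G. \<forall>w\<in>F. act h w = act g w}"
proof -
  obtain l where "l \<in> lists (\<Omega> \<times> \<Omega>)" "{h \<in> carrier G. \<forall>w\<in>F. act h w = act g w} = cylinder l"
    using agree_eq_cylinder[OF assms] .
  then show ?thesis using openin_cylinder by simp
qed

lemma openin_fixer:
  assumes "finite F" "F \<subseteq> \<Omega>"
  shows "openin X (fixer F)"
proof -
  have "fixer F = {h \<in> carrier G. \<forall>w\<in>F. act h w = act \<one> w}"
    using assms act_one by (auto simp: fixer_def subset_iff)
  then show ?thesis using openin_agree[OF assms one_closed] by simp
qed

lemma haar_sets: "haar_measure G X \<eta> \<Longrightarrow> sets \<eta> = sets (borel_of X)"
  by (simp add: haar_measure_def)

lemma haar_invariant:
  "haar_measure G X \<eta> \<Longrightarrow> g \<in> carrier G \<Longrightarrow> A \<in> sets \<eta> \<Longrightarrow> emeasure \<eta> (g <#\<^bsub>G\<^esub> A) = emeasure \<eta> A"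
  unfolding haar_measure_def by blast

lemma haar_outer_regular:
  "haar_measure G X \<eta> \<Longrightarrow> A \<in> sets \<eta> \<Longrightarrow> emeasure \<eta> A = (INF U\<in>{U. openin X U \<and> A \<subseteq> U}. emeasure \<eta> U)"
  unfolding haar_measure_def by blast

lemma haar_compact_positive:
  assumes "haar_measure G X \<eta>"
  obtains K where "K \<in> sets \<eta>" "K \<subseteq> carrier G" "emeasure \<eta> K \<noteq> 0" "emeasure \<eta> K < \<infinity>"
proof -
  have "openin X (carrier G)" using openin_topspace[of X] by simp
  then have "emeasure \<eta> (carrier G) = (SUP K\<in>{K. compactin X K \<and> K \<in> sets \<eta> \<and> K \<subseteq> carrier G}. emeasure \<eta> K)"
    using assms unfolding haar_measure_def by blast
  moreover have "emeasure \<eta> (carrier G) \<noteq> 0" using assms unfolding haar_measure_def topspace_eq by blast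
  ultimately obtain K where "compactin X K" "K \<in> sets \<eta>" "K \<subseteq> carrier G" "emeasure \<eta> K \<noteq> 0"
    by (metis (mono_tags, lifting) SUP_bot_conv(1) bot_ennreal mem_Collect_eq)
  moreover have "emeasure \<eta> K < \<infinity>" if "compactin X K" "K \<in> sets \<eta>" for K
    using assms that unfolding haar_measure_def by blast
  ultimately show thesis using that by blast
qed

text \<open>
  A compact set of positive measure has, by outer regularity, an open neighbourhood of finite
  measure, and this contains a coset of the pointwise fixer of a finite set.
\<close>

lemma haar_finite_fixer:
  assumes \<eta>: "haar_measure G X \<eta>"
  obtains F where "finite F" "F \<subseteq> \<Omega>" "emeasure \<eta> (fixer F) < \<infinity>"
proof -
  have sets: "sets \<eta> = sets (borel_of X)" using haar_sets[OF \<eta>] .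
  obtain K where K: "K \<in> sets \<eta>" "K \<subseteq> carrier G" "emeasure \<eta> K \<noteq> 0" "emeasure \<eta> K < \<infinity>"
    using haar_compact_positive[OF \<eta>] .
  note K(4)
  moreover have "emeasure \<eta> K = (INF U\<in>{U. openin X U \<and> K \<subseteq> U}. emeasure \<eta> U)"
    using haar_outer_regular[OF \<eta> K(1)] .
  ultimately obtain U where U: "openin X U" "K \<subseteq> U" "emeasure \<eta> U < \<infinity>"
    by (auto simp: INF_less_iff)
  obtain g where g: "g \<in> K" using K(3) by fastforce
  then have gc: "g \<in> carrier G" using K(2) by auto
  obtain F where F: "finite F" "F \<subseteq> \<Omega>"
      "\<And>h. h\<in>carrier G \<Longrightarrow> (\<forall>w\<in>F. act h w = act g w) \<Longrightarrow> h \<in> U"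
    using U(1)[unfolded openin_iff, THEN conjunct2, THEN bspec, OF subsetD[OF U(2) g]] by auto
  have fm: "fixer F \<in> sets \<eta>" using openin_fixer[OF F(1,2)] borel_of_open sets by simp
  have "emeasure \<eta> (fixer F) = emeasure \<eta> (g <#\<^bsub>G\<^esub> fixer F)"
    using haar_invariant[OF \<eta> gc fm] by simp
  also have "\<dots> \<le> emeasure \<eta> U"
    using F(3) U(1) borel_of_open sets by (intro emeasure_mono) (auto simp: fixer_coset[OF gc F(2)])
  finally show thesis using that[OF F(1,2)] U(3) by simp
qed

text \<open>
  There are only countably many cosets of a fixer of finite measure, because each of them is a
  cylinder.
\<close>

lemma haar_sigma_finite:
  assumes \<eta>: "haar_measure G X \<eta>"
  shows "sigma_finite_measure \<eta>"
proof
  have sets: "sets \<eta> = sets (borel_of X)" using haar_sets[OF \<eta>] .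
  have sp: "space \<eta> = carrier G" using sets_eq_imp_space_eq[OF sets] by simp
  obtain F where F: "finite F" "F \<subseteq> \<Omega>" "emeasure \<eta> (fixer F) < \<infinity>"
    using haar_finite_fixer[OF \<eta>] .
  have fm: "fixer F \<in> sets \<eta>" using openin_fixer[OF F(1,2)] borel_of_open sets by simp
  define \<A> where "\<A> = {cylinder l |l. l \<in> lists (\<Omega> \<times> \<Omega>) \<and> emeasure \<eta> (cylinder l) \<noteq> \<infinity>}"
  have "countable \<A>"
  proof -
    have "\<A> \<subseteq> cylinder ` lists (\<Omega> \<times> \<Omega>)" by (auto simp only: \<A>_def)
    then show ?thesis using countable_cylinders countable_image countable_subset by blast
  qed
  moreover have "\<A> \<subseteq> sets \<eta>" unfolding \<A>_def sets using openin_cylinder borel_of_open by blast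
  moreover have "\<Union>\<A> = space \<eta>"
  proof (intro equalityI subsetI)
    fix g assume "g \<in> space \<eta>"
    then have gc: "g \<in> carrier G" using sp by simp
    obtain l where l: "l \<in> lists (\<Omega> \<times> \<Omega>)" "{h \<in> carrier G. \<forall>w\<in>F. act h w = act g w} = cylinder l"
      using agree_eq_cylinder[OF F(1,2) gc] .
    have "emeasure \<eta> (cylinder l) = emeasure \<eta> (fixer F)"
      unfolding l(2)[symmetric] fixer_coset[OF gc F(2), symmetric] by (rule haar_invariant[OF \<eta> gc fm])
    then have "cylinder l \<in> \<A>" using l(1) F(3) unfolding \<A>_def by force
    moreover have "g \<in> cylinder l" unfolding l(2)[symmetric] using gc by simp
    ultimately show "g \<in> \<Union>\<A>" by blast
  next
    fix g assume "g \<in> \<Union>\<A>"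
    then obtain l where "g \<in> cylinder l" unfolding \<A>_def by blast
    then show "g \<in> space \<eta>" using sp by (simp add: cylinder_def)
  qed
  moreover have "\<forall>a\<in>\<A>. emeasure \<eta> a \<noteq> \<infinity>" by (auto simp only: \<A>_def)
  ultimately show "\<exists>A. countable A \<and> A \<subseteq> sets \<eta> \<and> \<Union> A = space \<eta> \<and> (\<forall>a\<in>A. emeasure \<eta> a \<noteq> \<infinity>)"
    by blast
qed

lemma haar_distr:
  assumes \<eta>: "haar_measure G X \<eta>" and u: "u \<in> carrier G"
  shows "distr \<eta> (borel_of X) (\<lambda>x. u \<otimes> x) = \<eta>"
proof -
  have sets: "sets \<eta> = sets (borel_of X)" using haar_sets[OF \<eta>] .
  have sp: "space \<eta> = carrier G" using sets_eq_imp_space_eq[OF sets] by simp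
  have m: "(\<lambda>x. u \<otimes> x) \<in> measurable \<eta> (borel_of X)"
    using const_mult_measurable[OF u] measurable_cong_sets[OF sets refl] by blast
  show ?thesis
  proof (rule measure_eqI)
    fix B assume "B \<in> sets (distr \<eta> (borel_of X) (\<lambda>x. u \<otimes> x))"
    then have B: "B \<in> sets (borel_of X)" by simp
    then have Bc: "B \<subseteq> carrier G" using sets.sets_into_space by fastforce
    have "(\<lambda>x. u \<otimes> x) -` B \<inter> space \<eta> = inv u <#\<^bsub>G\<^esub> B"
    proof (intro equalityI subsetI)
      fix x assume "x \<in> (\<lambda>x. u \<otimes> x) -` B \<inter> space \<eta>"
      then have "u \<otimes> x \<in> B" "x = inv u \<otimes> (u \<otimes> x)" using sp u by (auto simp: m_assoc[symmetric])
      then show "x \<in> inv u <#\<^bsub>G\<^esub> B" unfolding l_coset_def by blast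
    next
      fix x assume "x \<in> inv u <#\<^bsub>G\<^esub> B"
      then obtain b where b: "b \<in> B" "x = inv u \<otimes> b" unfolding l_coset_def by blast
      then show "x \<in> (\<lambda>x. u \<otimes> x) -` B \<inter> space \<eta>" using Bc u sp by (auto simp: m_assoc[symmetric])
    qed
    then have "emeasure (distr \<eta> (borel_of X) (\<lambda>x. u \<otimes> x)) B = emeasure \<eta> (inv u <#\<^bsub>G\<^esub> B)"
      using m B by (simp add: emeasure_distr)
    also have "\<dots> = emeasure \<eta> B" using B sets u by (intro haar_invariant[OF \<eta>]) auto
    finally show "emeasure (distr \<eta> (borel_of X) (\<lambda>x. u \<otimes> x)) B = emeasure \<eta> B" .
  qed (simp add: sets)
qed

text \<open>
  An open set that approximates \<open>A\<close> from outside is an increasing union of finite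
  unions of cylinders. Membership of \<open>x\<close> in such a finite union \<open>W\<close> only
  depends on whether \<open>x\<close> sends certain points to certain targets, and this is
  unaffected by multiplying \<open>x\<close> on the left by a permutation that fixes the targets.
\<close>

lemma haar_approx_invariant:
  assumes \<eta>: "haar_measure G X \<eta>" and A: "A \<in> sets \<eta>" "emeasure \<eta> A < \<infinity>" and \<delta>: "0 < \<delta>"
  obtains F W where "finite F" "F \<subseteq> \<Omega>" "W \<in> sets \<eta>" "emeasure \<eta> W < \<infinity>"
    "measure \<eta> (A - W) + measure \<eta> (W - A) \<le> \<delta>"
    "\<And>u x. u \<in> fixer F \<Longrightarrow> x \<in> carrier G \<Longrightarrow> u \<otimes> x \<in> W \<longleftrightarrow> x \<in> W"
proof -
  have sets: "sets \<eta> = sets (borel_of X)" using haar_sets[OF \<eta>] .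
  have "emeasure \<eta> A = (INF U\<in>{U. openin X U \<and> A \<subseteq> U}. emeasure \<eta> U)"
    using haar_outer_regular[OF \<eta> A(1)] .
  moreover have "emeasure \<eta> A < emeasure \<eta> A + ennreal (\<delta>/2)"
    using A(2) \<delta> by (simp add: ennreal_add_left_cancel_less less_top add_pos_pos) 
  ultimately obtain V where V: "openin X V" "A \<subseteq> V" "emeasure \<eta> V < emeasure \<eta> A + ennreal (\<delta>/2)"
    by (metis (mono_tags, lifting) INF_less_iff mem_Collect_eq)
  have Vm: "V \<in> sets \<eta>" using V(1) borel_of_open sets by simp
  have "emeasure \<eta> A + ennreal (\<delta>/2) < \<infinity>" using A(2) by simp
  then have Vfin: "emeasure \<eta> V < \<infinity>" using V(3) by (rule order.strict_trans[rotated])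
  define L where "L = {l\<in>lists (\<Omega> \<times> \<Omega>). cylinder l \<subseteq> V}"
  have Lc: "countable L" unfolding L_def using countable_cylinders by (rule countable_subset[rotated]) simp
  define C where "C n = {l\<in>L. to_nat_on L l < n}" for n
  have Cfin: "finite (C n)" for n
  proof (rule finite_imageD[of "to_nat_on L"])
    show "finite (to_nat_on L ` C n)" by (rule finite_subset[of _ "{..<n}"]) (auto simp: C_def)
    show "inj_on (to_nat_on L) (C n)"
      using inj_on_to_nat_on[OF Lc] by (rule inj_on_subset) (auto simp: C_def)
  qed
  define W where "W n = (\<Union>l\<in>C n. cylinder l)" for n
  have Wm: "W n \<in> sets \<eta>" for n
    unfolding W_def sets using Cfin
    by (intro sets.finite_UN borel_of_open openin_cylinder) (auto simp only: C_def L_def)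
  have WV: "W n \<subseteq> V" for n by (auto simp only: W_def C_def L_def)
  have "incseq W" unfolding W_def C_def by (intro incseq_SucI) force
  moreover have Vun: "(\<Union>n. W n) = V"
  proof (intro equalityI subsetI)
    fix x assume "x \<in> V"
    then obtain l where "l \<in> L" "x \<in> cylinder l"
      using open_eq_Union_cylinders[OF V(1)] unfolding L_def by blast
    then have "x \<in> W (Suc (to_nat_on L l))" unfolding W_def C_def by blast
    then show "x \<in> (\<Union>n. W n)" by blast
  qed (use WV in blast)
  ultimately have "(\<lambda>n. measure \<eta> (W n)) \<longlonglongrightarrow> measure \<eta> V"
    using Lim_measure_incseq[of W \<eta>] Wm Vfin by (simp add: Vun image_subset_iff less_top)
  then have "eventually (\<lambda>n. measure \<eta> V - \<delta>/2 < measure \<eta> (W n)) sequentially"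
    using \<delta> by (intro order_tendstoD(1)) auto
  then obtain n where "measure \<eta> V - \<delta>/2 < measure \<eta> (W n)" by (auto simp: eventually_sequentially)
  then have n': "measure \<eta> V \<le> measure \<eta> (W n) + \<delta>/2" by simp
  have Wfin: "emeasure \<eta> (W n) < \<infinity>"
    using emeasure_mono[OF WV Vm] Vfin by (meson le_less_trans)
  have eq: "emeasure \<eta> B = ennreal (measure \<eta> B)" if "emeasure \<eta> B < \<infinity>" for B
    using that by (simp add: emeasure_eq_ennreal_measure less_top)
  have V': "measure \<eta> V \<le> measure \<eta> A + \<delta>/2"
    using less_imp_le[OF V(3)] \<delta> unfolding eq[OF Vfin] eq[OF A(2)] by (simp add: ennreal_plus[symmetric] del: ennreal_plus)
  have fm: "V \<in> fmeasurable \<eta>" using Vm Vfin by (simp add: fmeasurable_def)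
  have "measure \<eta> (A - W n) \<le> measure \<eta> (V - W n)"
    using V(2) Wm A(1) fmeasurable_Diff[OF fm Wm] by (intro measure_mono_fmeasurable) auto
  also have "\<dots> = measure \<eta> V - measure \<eta> (W n)"
    using fm Wm WV by (intro measure_Diff) (auto simp: fmeasurable_def)
  finally have 1: "measure \<eta> (A - W n) \<le> \<delta>/2" using n' by simp
  have "measure \<eta> (W n - A) \<le> measure \<eta> (V - A)"
    using WV Wm A(1) fmeasurable_Diff[OF fm A(1)] by (intro measure_mono_fmeasurable) (blast | simp)+
  also have "\<dots> = measure \<eta> V - measure \<eta> A"
    using fm A V(2) by (intro measure_Diff) (auto simp: fmeasurable_def)
  finally have 2: "measure \<eta> (W n - A) \<le> \<delta>/2" using V' by simp
  (* the targets of all the conditions that define W n *)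
  define F where "F = (\<Union>l\<in>C n. snd ` set l)"
  have F: "finite F" "F \<subseteq> \<Omega>"
  proof -
    show "finite F" unfolding F_def using Cfin by auto
    show "F \<subseteq> \<Omega>"
    proof
      fix w assume "w \<in> F"
      then obtain l p where "l \<in> C n" "p \<in> set l" "w = snd p" unfolding F_def by blast
      then have "p \<in> \<Omega> \<times> \<Omega>" by (simp add: C_def L_def in_lists_conv_set)
      then show "w \<in> \<Omega>" using \<open>w = snd p\<close> by (simp add: mem_Times_iff)
    qed
  qed
  have fwd: "u \<otimes> x \<in> W n" if u: "u \<in> fixer F" and x: "x \<in> carrier G" "x \<in> W n" for u x
  proof -
    obtain l where l: "l \<in> C n" "x \<in> cylinder l" using x(2) unfolding W_def by blast
    have uc: "u \<in> carrier G" using u by (simp add: fixer_def)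
    have "act (u \<otimes> x) (fst p) = snd p" if p: "p \<in> set l" for p
    proof -
      have "p \<in> \<Omega> \<times> \<Omega>" using l(1) p by (simp add: C_def L_def in_lists_conv_set)
      then have "act (u \<otimes> x) (fst p) = act u (act x (fst p))"
        using uc x(1) by (intro act_mult) (simp_all add: mem_Times_iff)
      also have "act x (fst p) = snd p" using l(2) p by (auto simp: cylinder_def)
      also have "act u (snd p) = snd p" using u p l(1) by (auto simp: fixer_def F_def)
      finally show ?thesis .
    qed
    then have "u \<otimes> x \<in> cylinder l" using uc x(1) by (auto simp: cylinder_def)
    then show ?thesis using l(1) unfolding W_def by blast
  qed
  have "u \<otimes> x \<in> W n \<longleftrightarrow> x \<in> W n" if u: "u \<in> fixer F" and x: "x \<in> carrier G" for u x
  proof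
    assume a: "u \<otimes> x \<in> W n"
    have uc: "u \<in> carrier G" using u by (simp add: fixer_def)
    have "inv u \<otimes> (u \<otimes> x) = x" using uc x by (simp add: m_assoc[symmetric])
    moreover have "inv u \<otimes> (u \<otimes> x) \<in> W n" by (rule fwd[OF inv_fixer[OF F(2) u] _ a]) (use uc x in simp)
    ultimately show "x \<in> W n" by (rule subst)
  qed (use fwd u x in blast)
  then show thesis
    using that[OF F Wm Wfin] 1 2 by force
qed

end

section \<open>Continuity of harmonic functions of spread-out walks\<close>

context permutation_group
begin

text \<open>
  For \<open>W\<close> in place of \<open>A\<close>, where \<open>W\<close> is invariant under the
  fixer of \<open>F\<close>, the two integrals agree by invariance of Haar measure. Replacing
  \<open>A\<close> by \<open>W\<close> costs at most \<open>C * \<delta>\<close> in each integral.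
\<close>

lemma haar_translation_continuous:
  fixes \<delta> :: real
  assumes \<eta>: "haar_measure G X \<eta>" and A: "A \<in> sets \<eta>" "emeasure \<eta> A < \<infinity>" and \<delta>: "0 < \<delta>"
  obtains F where "finite F" "F \<subseteq> \<Omega>"
    "\<forall>u\<in>fixer F. \<forall>\<phi>\<in>borel_measurable (borel_of X). \<forall>C::real. (\<forall>x\<in>carrier G. \<bar>\<phi> x\<bar> \<le> C) \<longrightarrow>
      \<bar>(\<integral>x. indicator A x * \<phi> (u \<otimes> x) \<partial>\<eta>) - (\<integral>x. indicator A x * \<phi> x \<partial>\<eta>)\<bar> \<le> 2 * C * \<delta>"
proof -
  have sets: "sets \<eta> = sets (borel_of X)" using haar_sets[OF \<eta>] .
  have sp: "space \<eta> = carrier G" using sets_eq_imp_space_eq[OF sets] by simp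
  note mc = measurable_cong_sets[OF sets refl]
  obtain F W where F: "finite F" "F \<subseteq> \<Omega>" and W: "W \<in> sets \<eta>" "emeasure \<eta> W < \<infinity>"
    and d: "measure \<eta> (A - W) + measure \<eta> (W - A) \<le> \<delta>"
    and inv: "\<And>u x. u \<in> fixer F \<Longrightarrow> x \<in> carrier G \<Longrightarrow> u \<otimes> x \<in> W \<longleftrightarrow> x \<in> W"
    using haar_approx_invariant[OF \<eta> A \<delta>] by metis
  show thesis
  proof (rule that[OF F], intro ballI allI impI)
    fix u \<phi> and C :: real
    assume u: "u \<in> fixer F" and \<phi>: "\<phi> \<in> borel_measurable (borel_of X)"
      and C': "\<forall>x\<in>carrier G. \<bar>\<phi> x\<bar> \<le> C"
    have C: "\<bar>\<phi> x\<bar> \<le> C" if "x \<in> carrier G" for x using C' that by blast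
    have uc: "u \<in> carrier G" using u by (simp add: fixer_def)
    have C0: "0 \<le> C" using C[OF one_closed] by linarith
    have int: "integrable \<eta> (\<lambda>x. indicator B x * \<psi> x)"
      if "B \<in> sets \<eta>" "emeasure \<eta> B < \<infinity>" "\<psi> \<in> borel_measurable (borel_of X)"
        "\<And>x. x \<in> carrier G \<Longrightarrow> \<bar>\<psi> x\<bar> \<le> C" for B and \<psi> :: "_ \<Rightarrow> real"
    proof (rule Bochner_Integration.integrable_bound)
      show "integrable \<eta> (\<lambda>x. C * indicator B x)" using that(1,2) by auto
      show "(\<lambda>x. indicator B x * \<psi> x) \<in> borel_measurable \<eta>"
        using that(1,3) by (intro borel_measurable_times borel_measurable_indicator) (simp_all add: mc)
      show "AE x in \<eta>. norm (indicator B x * \<psi> x) \<le> norm (C * indicator B x)"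
        using that(4) C0 sp by (intro AE_I2) (auto simp: indicator_def)
    qed
    have close: "\<bar>(\<integral>x. indicator A x * \<psi> x \<partial>\<eta>) - (\<integral>x. indicator W x * \<psi> x \<partial>\<eta>)\<bar> \<le> C * \<delta>"
      if \<psi>: "\<psi> \<in> borel_measurable (borel_of X)" "\<And>x. x \<in> carrier G \<Longrightarrow> \<bar>\<psi> x\<bar> \<le> C" for \<psi>
    proof -
      have AW: "emeasure \<eta> (A - W) < \<infinity>" "emeasure \<eta> (W - A) < \<infinity>"
        using A W emeasure_mono[of "A - W" A \<eta>] emeasure_mono[of "W - A" W \<eta>]
        by (auto simp: order.strict_trans1)
      have iC: "integrable \<eta> (\<lambda>x. C * indicator (A - W) x + C * indicator (W - A) x)"
        using A(1) W(1) AW by (intro Bochner_Integration.integrable_add integrable_mult_right integrable_real_indicator) auto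
      have "(\<integral>x. indicator A x * \<psi> x \<partial>\<eta>) - (\<integral>x. indicator W x * \<psi> x \<partial>\<eta>)
          = (\<integral>x. indicator A x * \<psi> x - indicator W x * \<psi> x \<partial>\<eta>)"
        using int[OF A \<psi>] int[OF W \<psi>] by simp
      also have "\<bar>\<dots>\<bar> \<le> (\<integral>x. C * indicator (A - W) x + C * indicator (W - A) x \<partial>\<eta>)"
      proof (rule integral_abs_bound[THEN order_trans], rule integral_mono)
        show "integrable \<eta> (\<lambda>x. \<bar>indicator A x * \<psi> x - indicator W x * \<psi> x\<bar>)"
          using int[OF A \<psi>] int[OF W \<psi>] by simp
        show "\<bar>indicator A x * \<psi> x - indicator W x * \<psi> x\<bar>
            \<le> C * indicator (A - W) x + C * indicator (W - A) x" if "x \<in> space \<eta>" for x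
          using \<psi>(2)[of x] that sp C0 by (auto simp: indicator_def)
      qed (rule iC)
      also have "\<dots> = C * (measure \<eta> (A - W) + measure \<eta> (W - A))"
        using A(1) W(1) AW by (subst Bochner_Integration.integral_add) (auto simp: distrib_left)
      also have "\<dots> \<le> C * \<delta>" using d C0 by (intro mult_left_mono)
      finally show ?thesis .
    qed
    have \<phi>u: "(\<lambda>x. \<phi> (u \<otimes> x)) \<in> borel_measurable (borel_of X)"
      by (rule measurable_compose[OF const_mult_measurable[OF uc] \<phi>])
    have "(\<integral>x. indicator W x * \<phi> (u \<otimes> x) \<partial>\<eta>) = (\<integral>x. indicator W (u \<otimes> x) * \<phi> (u \<otimes> x) \<partial>\<eta>)"
      using inv[OF u] sp by (intro Bochner_Integration.integral_cong) (auto simp: indicator_def)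
    also have "\<dots> = (\<integral>x. indicator W x * \<phi> x \<partial>distr \<eta> (borel_of X) (\<lambda>x. u \<otimes> x))"
      using const_mult_measurable[OF uc] \<phi> W(1) sets
      by (intro integral_distr[symmetric] borel_measurable_times borel_measurable_indicator) (simp_all add: mc)
    also have "\<dots> = (\<integral>x. indicator W x * \<phi> x \<partial>\<eta>)" by (simp only: haar_distr[OF \<eta> uc])
    finally have Weq: "(\<integral>x. indicator W x * \<phi> (u \<otimes> x) \<partial>\<eta>) = (\<integral>x. indicator W x * \<phi> x \<partial>\<eta>)" .
    show "\<bar>(\<integral>x. indicator A x * \<phi> (u \<otimes> x) \<partial>\<eta>) - (\<integral>x. indicator A x * \<phi> x \<partial>\<eta>)\<bar> \<le> 2 * C * \<delta>"
    proof -
      have "\<bar>\<phi> (u \<otimes> x)\<bar> \<le> C" if "x \<in> carrier G" for x using C uc that by simp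
      note close[OF \<phi>u this]
      moreover have "\<bar>(\<integral>x. indicator A x * \<phi> x \<partial>\<eta>) - (\<integral>x. indicator W x * \<phi> x \<partial>\<eta>)\<bar> \<le> C * \<delta>"
        by (rule close[OF \<phi> C])
      ultimately show ?thesis using Weq by (simp add: abs_le_iff)
    qed
  qed
qed

lemma finite_image_concentrated:
  assumes "prob_space \<nu>" and sets: "sets \<nu> = sets (borel_of X)"
    and F: "finite F" "F \<subseteq> \<Omega>" and \<delta>: "0 < \<delta>"
  obtains F' where "finite F'" "F' \<subseteq> \<Omega>" "measure \<nu> {x \<in> carrier G. \<not> act x ` F \<subseteq> F'} \<le> \<delta>"
    "{x \<in> carrier G. \<not> act x ` F \<subseteq> F'} \<in> sets \<nu>"
proof -
  interpret N: prob_space \<nu> by fact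
  have sp: "space \<nu> = carrier G" using sets_eq_imp_space_eq[OF sets] by simp
  define B where "B n = {w\<in>\<Omega>. to_nat_on \<Omega> w < n}" for n
  define A where "A n = {x\<in>carrier G. act x ` F \<subseteq> B n}" for n
  have Bfin: "finite (B n)" for n
  proof (rule finite_imageD[of "to_nat_on \<Omega>"])
    show "finite (to_nat_on \<Omega> ` B n)" by (rule finite_subset[of _ "{..<n}"]) (auto simp: B_def)
    show "inj_on (to_nat_on \<Omega>) (B n)"
      using inj_on_to_nat_on[OF countable_points] by (rule inj_on_subset) (auto simp: B_def)
  qed
  have Am: "A n \<in> sets \<nu>" for n
  proof -
    have "{x \<in> space \<nu>. \<forall>w\<in>F. act x w \<in> B n} \<in> sets \<nu>"
    proof (rule sets.sets_Collect_finite_All[OF _ F(1)])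
      fix w assume "w \<in> F"
      then have "w \<in> \<Omega>" using F(2) by blast
      then have "(\<lambda>g. act g w) -` B n \<inter> space (borel_of X) \<in> sets (borel_of X)"
        by (rule measurable_sets[OF act_measurable]) (simp add: B_def)
      moreover have "{x \<in> space \<nu>. act x w \<in> B n} = (\<lambda>g. act g w) -` B n \<inter> space (borel_of X)"
        using sp by auto
      ultimately show "{x \<in> space \<nu>. act x w \<in> B n} \<in> sets \<nu>" using sets by simp
    qed
    then show ?thesis using sp by (simp add: A_def image_subset_iff)
  qed
  have BS: "B n \<subseteq> B (Suc n)" for n by (auto simp: B_def)
  have "incseq A"
  proof (rule incseq_SucI)
    show "A n \<subseteq> A (Suc n)" for n unfolding A_def using BS[of n] by (blast dest: subset_trans)
  qed
  moreover have "(\<Union>n. A n) = space \<nu>"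
  proof (intro equalityI subsetI)
    fix x assume "x \<in> space \<nu>"
    then have xc: "x \<in> carrier G" using sp by simp
    have "finite (to_nat_on \<Omega> ` act x ` F)" using F by auto
    then obtain n where n: "\<And>m. m \<in> to_nat_on \<Omega> ` act x ` F \<Longrightarrow> m < n"
      unfolding finite_nat_set_iff_bounded by blast
    have "act x w \<in> B n" if "w \<in> F" for w
      using n[of "to_nat_on \<Omega> (act x w)"] that act_closed[OF xc, of w] F(2) by (simp add: B_def subsetD)
    then have "x \<in> A n" using xc by (simp add: A_def image_subset_iff)
    then show "x \<in> (\<Union>n. A n)" by blast
  next
    fix x assume "x \<in> (\<Union>n. A n)"
    then show "x \<in> space \<nu>" unfolding A_def sp by blast
  qed
  ultimately have "(\<lambda>n. measure \<nu> (A n)) \<longlonglongrightarrow> 1"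
    using N.finite_Lim_measure_incseq[of A] Am by (simp add: image_subset_iff N.prob_space)
  then have "eventually (\<lambda>n. 1 - \<delta> < measure \<nu> (A n)) sequentially"
    using \<delta> by (intro order_tendstoD(1)) auto
  then obtain n where n: "1 - \<delta> < measure \<nu> (A n)" by (auto simp: eventually_sequentially)
  have eq: "{x \<in> carrier G. \<not> act x ` F \<subseteq> B n} = space \<nu> - A n" unfolding A_def sp by blast
  show thesis
  proof (rule that[OF Bfin])
    show "B n \<subseteq> \<Omega>" by (auto simp: B_def)
    show "measure \<nu> {x \<in> carrier G. \<not> act x ` F \<subseteq> B n} \<le> \<delta>"
      unfolding eq using n by (simp add: N.prob_compl[OF Am])
    show "{x \<in> carrier G. \<not> act x ` F \<subseteq> B n} \<in> sets \<nu>" unfolding eq using Am by simp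
  qed
qed

end

context group_walk
begin

text \<open>
  By harmonicity, \<open>f (g u) - f g\<close> is the integral of \<open>D x = f (g u x) - f (g
  x)\<close> over the law of the walk after \<open>n\<close> steps. For most \<open>x\<close> the
  element \<open>inv x \<otimes> u \<otimes> x\<close> fixes \<open>F\<close>, so that
  \<open>\<bar>D x\<bar> \<le> \<omega>\<close>. The law dominates a multiple \<open>c\<close> of
  Haar measure on a set \<open>A\<close>, and over this part the integral of \<open>D\<close>
  almost vanishes because translation is continuous there. The gain \<open>a\<close> is the mass
  of that part; it depends neither on \<open>F\<close> nor on \<open>\<omega>\<close>, so the
  estimate can be iterated.
\<close>

lemma oscillation_contracts:
  assumes \<eta>: "haar_measure G X \<eta>" and ns: "\<not> mutually_singular (law n) \<eta>"
    and f: "f \<in> bounded_harmonic G X \<mu>"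
  obtains a where "0 < a" "a \<le> 1"
    "\<forall>F \<omega> \<delta>. finite F \<and> F \<subseteq> \<Omega> \<and> 0 < \<delta> \<and> (\<forall>g\<in>carrier G. \<forall>u\<in>fixer F. \<bar>f (g \<otimes> u) - f g\<bar> \<le> \<omega>)
      \<longrightarrow> (\<exists>F'. finite F' \<and> F' \<subseteq> \<Omega> \<and>
            (\<forall>g\<in>carrier G. \<forall>u\<in>fixer F'. \<bar>f (g \<otimes> u) - f g\<bar> \<le> (1 - a) * \<omega> + \<delta>))"
proof -
  define \<nu> where "\<nu> = law n"
  interpret N: prob_space \<nu> unfolding \<nu>_def by (rule prob_space_law)
  have s\<nu>: "sets \<nu> = sets (borel_of X)" by (simp add: \<nu>_def sets_law)
  have sp: "space \<nu> = carrier G" by (simp add: \<nu>_def)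
  have s\<eta>: "sets \<eta> = sets \<nu>" using haar_sets[OF \<eta>] s\<nu> by simp
  have sp\<eta>: "space \<eta> = carrier G" using sets_eq_imp_space_eq[OF s\<eta>] sp by simp
  obtain A c where A: "A \<in> sets \<nu>" and c: "0 < c" and A\<eta>: "0 < emeasure \<eta> A" "emeasure \<eta> A < \<infinity>"
    and lb: "\<And>B. B \<in> sets \<nu> \<Longrightarrow> B \<subseteq> A \<Longrightarrow> ennreal c * emeasure \<eta> B \<le> emeasure \<nu> B"
    using not_singular_imp_lower_bound[OF N.finite_measure_axioms haar_sigma_finite[OF \<eta>] s\<eta>] ns
    unfolding \<nu>_def by metis
  have A': "A \<in> sets \<eta>" using A s\<eta> by simp
  define a where "a = c * measure \<eta> A"
  have eA: "emeasure \<eta> A = ennreal (measure \<eta> A)"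
    using A\<eta>(2) by (simp add: emeasure_eq_ennreal_measure less_top)
  have a0: "0 < a" using A\<eta>(1) c by (simp add: a_def eA)
  have "ennreal a \<le> emeasure \<nu> A" using lb[OF A] c by (simp add: a_def eA ennreal_mult)
  then have a1: "a \<le> 1" using N.emeasure_le_1[of A] by (metis ennreal_le_1 order_trans)
  obtain C where C: "0 < C" "\<And>g. g \<in> carrier G \<Longrightarrow> \<bar>f g\<bar> \<le> C" using harmonic_bound[OF f] by metis
  have fm: "f \<in> borel_measurable (borel_of X)" using f by (simp add: bounded_harmonic_def)
  show thesis
  proof (rule that[OF a0 a1], intro allI impI, elim conjE)
    fix F and \<omega> \<delta> :: real
    assume F: "finite F" "F \<subseteq> \<Omega>" and \<delta>: "0 < \<delta>"
      and osc: "\<forall>g\<in>carrier G. \<forall>u\<in>fixer F. \<bar>f (g \<otimes> u) - f g\<bar> \<le> \<omega>"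
    have "0 \<le> \<omega>"
    proof -
      have "\<one> \<in> fixer F" using F act_one by (auto simp: fixer_def)
      then show ?thesis using osc one_closed by (metis abs_ge_zero order_trans)
    qed
    (* the errors 2 * C * \<delta>1 from the bad set and 2 * C * \<delta>1 * c from translation
       add up to \<delta> / 2 *)
    define \<delta>1 where "\<delta>1 = \<delta> / (2 * (2 * C * (1 + c)))"
    have \<delta>1: "0 < \<delta>1" using \<delta> C c by (simp add: \<delta>1_def)
    obtain F1 where F1: "finite F1" "F1 \<subseteq> \<Omega>"
      "\<forall>u\<in>fixer F1. \<forall>\<phi>\<in>borel_measurable (borel_of X). \<forall>C::real. (\<forall>x\<in>carrier G. \<bar>\<phi> x\<bar> \<le> C) \<longrightarrow>
      \<bar>(\<integral>x. indicator A x * \<phi> (u \<otimes> x) \<partial>\<eta>) - (\<integral>x. indicator A x * \<phi> x \<partial>\<eta>)\<bar> \<le> 2 * C * \<delta>1"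
      by (rule haar_translation_continuous[OF \<eta> A' A\<eta>(2) \<delta>1])
    obtain F2 where F2: "finite F2" "F2 \<subseteq> \<Omega>" "measure \<nu> {x \<in> carrier G. \<not> act x ` F \<subseteq> F2} \<le> \<delta>1"
      "{x \<in> carrier G. \<not> act x ` F \<subseteq> F2} \<in> sets \<nu>"
      by (rule finite_image_concentrated[OF N.prob_space_axioms s\<nu> F \<delta>1])
    (* for x outside this set, inv x \<otimes> u \<otimes> x fixes F as soon as u fixes F2 *)
    define bad where "bad = {x \<in> carrier G. \<not> act x ` F \<subseteq> F2}"
    have bound: "\<bar>f (g \<otimes> u) - f g\<bar> \<le> (1 - a) * \<omega> + \<delta>" if g: "g \<in> carrier G" and u: "u \<in> fixer (F1 \<union> F2)" for g u
    proof -
      have uc: "u \<in> carrier G" and u1: "u \<in> fixer F1" and u2: "u \<in> fixer F2"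
        using u by (auto simp: fixer_def)
      define \<phi> where "\<phi> x = f (g \<otimes> x)" for x
      define D where "D x = \<phi> (u \<otimes> x) - \<phi> x" for x
      have \<phi>m: "\<phi> \<in> borel_measurable (borel_of X)"
        unfolding \<phi>_def by (rule measurable_compose[OF const_mult_measurable[OF g] fm])
      have \<phi>um: "(\<lambda>x. \<phi> (u \<otimes> x)) \<in> borel_measurable (borel_of X)"
        by (rule measurable_compose[OF const_mult_measurable[OF uc] \<phi>m])
      have \<phi>C: "\<bar>\<phi> x\<bar> \<le> C" if "x \<in> carrier G" for x using C(2) g that by (simp add: \<phi>_def)
      have \<phi>uC: "\<bar>\<phi> (u \<otimes> x)\<bar> \<le> C" if "x \<in> carrier G" for x using \<phi>C uc that by simp
      have Dm: "D \<in> borel_measurable (borel_of X)" unfolding D_def using \<phi>m \<phi>um by simp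
      have D2C: "\<bar>D x\<bar> \<le> 2 * C" if "x \<in> carrier G" for x
        using \<phi>C[OF that] \<phi>C[of "u \<otimes> x"] uc that by (simp add: D_def)
      have Dgood: "\<bar>D x\<bar> \<le> \<omega>" if x: "x \<in> carrier G" "x \<notin> bad" for x
      proof -
        have "inv x \<otimes> (u \<otimes> x) \<in> fixer F"
        proof -
          have "act (inv x \<otimes> (u \<otimes> x)) w = w" if w: "w \<in> F" for w
          proof -
            have w\<Omega>: "w \<in> \<Omega>" using w F by auto
            have "act x w \<in> F2" using x w by (auto simp: bad_def)
            then have "act u (act x w) = act x w" using u2 by (simp add: fixer_def)
            then show ?thesis using x(1) uc w\<Omega> by (simp add: act_mult act_inv)
          qed
          then show ?thesis using x(1) uc by (simp add: fixer_def)
        qed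
        then have "\<bar>f (g \<otimes> x \<otimes> (inv x \<otimes> (u \<otimes> x))) - f (g \<otimes> x)\<bar> \<le> \<omega>"
          using osc g x(1) by blast
        moreover have "x \<otimes> (inv x \<otimes> (u \<otimes> x)) = u \<otimes> x"
          using x(1) uc by (simp add: m_assoc[symmetric])
        ultimately show ?thesis using g x(1) uc by (simp add: D_def \<phi>_def m_assoc)
      qed
      have badm: "bad \<in> sets (borel_of X)" using F2(4) s\<nu> by (simp add: bad_def)
      have lawint: "integrable \<nu> \<psi>" if "\<psi> \<in> borel_measurable (borel_of X)" "\<And>x. x \<in> carrier G \<Longrightarrow> \<bar>\<psi> x\<bar> \<le> B"
        for \<psi> :: "_ \<Rightarrow> real" and B unfolding \<nu>_def by (rule integrable_law_bounded[OF that])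
      (* the sign s = 1 or s = -1 gives the upper and the lower bound at once *)
      have key: "s * (\<integral>x. D x \<partial>\<nu>) \<le> (1 - a) * \<omega> + \<delta>" if s: "\<bar>s\<bar> = 1" for s :: real
      proof -
        (* k is nonnegative, also on the bad set, so its integral over \<nu> is at least that over
           the Haar part *)
        define k where "k x = \<omega> + 2 * C * indicator bad x - s * D x" for x
        have sD: "\<bar>s * D x\<bar> = \<bar>D x\<bar>" for x using s by (simp add: abs_mult)
        have k0: "0 \<le> k x" if "x \<in> carrier G" for x
          using Dgood[OF that] D2C[OF that] sD[of x] \<open>0 \<le> \<omega>\<close> C(1) by (auto simp: k_def indicator_def)
        have kB: "\<bar>k x\<bar> \<le> \<omega> + 4 * C" if "x \<in> carrier G" for x
          using D2C[OF that] sD[of x] \<open>0 \<le> \<omega>\<close> C(1) by (auto simp: k_def indicator_def)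
        have km: "k \<in> borel_measurable (borel_of X)" unfolding k_def using Dm badm by auto
        have Aint: "integrable \<eta> (\<lambda>x. indicator A x * \<psi> x)"
          if "\<psi> \<in> borel_measurable (borel_of X)" "\<And>x. x \<in> carrier G \<Longrightarrow> \<bar>\<psi> x\<bar> \<le> B"
          for \<psi> :: "_ \<Rightarrow> real" and B
        proof (rule Bochner_Integration.integrable_bound)
          show "integrable \<eta> (\<lambda>x. \<bar>B\<bar> * indicator A x)" using A' A\<eta>(2) by auto
          have "\<psi> \<in> borel_measurable \<eta>"
            using that(1) measurable_cong_sets[OF haar_sets[OF \<eta>] refl] by blast
          then show "(\<lambda>x. indicator A x * \<psi> x) \<in> borel_measurable \<eta>" using A' by auto
          show "AE x in \<eta>. norm (indicator A x * \<psi> x) \<le> norm (\<bar>B\<bar> * indicator A x)"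
            using that(2) sp\<eta> by (intro AE_I2) (auto simp: indicator_def intro: order_trans[OF _ abs_ge_self])
        qed
        have "c * (\<integral>x. indicator A x * k x \<partial>\<eta>) \<le> (\<integral>x. k x \<partial>\<nu>)"
          by (rule integral_lower_bound[OF s\<eta> A less_imp_le[OF c] lb lawint[OF km kB] Aint[OF km kB]])
             (use k0 sp in auto)
        moreover have "(\<integral>x. k x \<partial>\<nu>) = \<omega> + 2 * C * measure \<nu> bad - s * (\<integral>x. D x \<partial>\<nu>)"
        proof -
          have "bad \<in> sets \<nu>" using badm s\<nu> by simp
          then have i: "integrable \<nu> (\<lambda>x. 2 * C * indicator bad x)"
            and "(\<integral>x. 2 * C * indicator bad x \<partial>\<nu>) = 2 * C * measure \<nu> bad"
            by (auto simp: N.emeasure_eq_measure)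
          then show ?thesis unfolding k_def using lawint[OF Dm D2C] by (simp add: N.prob_space)
        qed
        moreover have "(\<integral>x. indicator A x * k x \<partial>\<eta>) \<ge> \<omega> * measure \<eta> A - 2 * C * \<delta>1"
        proof -
          have "(\<integral>x. indicator A x * D x \<partial>\<eta>) =
              (\<integral>x. indicator A x * \<phi> (u \<otimes> x) \<partial>\<eta>) - (\<integral>x. indicator A x * \<phi> x \<partial>\<eta>)"
            unfolding D_def right_diff_distrib
            using Aint[OF \<phi>um \<phi>uC] Aint[OF \<phi>m \<phi>C] by (rule Bochner_Integration.integral_diff)
          then have "\<bar>\<integral>x. indicator A x * D x \<partial>\<eta>\<bar> \<le> 2 * C * \<delta>1"
            using F1(3)[rule_format, OF u1 \<phi>m \<phi>C] by simp
          then have "\<bar>s * (\<integral>x. indicator A x * D x \<partial>\<eta>)\<bar> \<le> 2 * C * \<delta>1" using s by (simp add: abs_mult)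
          moreover have "\<omega> * measure \<eta> A - s * (\<integral>x. indicator A x * D x \<partial>\<eta>)
              = (\<integral>x. \<omega> * indicator A x - s * (indicator A x * D x) \<partial>\<eta>)"
            using A' A\<eta>(2) Aint[OF Dm D2C] by simp
          moreover have "\<dots> \<le> (\<integral>x. indicator A x * k x \<partial>\<eta>)"
          proof (rule integral_mono)
            show "integrable \<eta> (\<lambda>x. \<omega> * indicator A x - s * (indicator A x * D x))"
              using A' A\<eta>(2) Aint[OF Dm D2C] by simp
            show "integrable \<eta> (\<lambda>x. indicator A x * k x)" by (rule Aint[OF km kB])
          qed (use C(1) in \<open>auto simp: k_def indicator_def\<close>)
          ultimately show ?thesis by linarith
        qed
        then have "c * (\<integral>x. indicator A x * k x \<partial>\<eta>) \<ge> a * \<omega> - 2 * C * \<delta>1 * c"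
          using c mult_left_mono[of "\<omega> * measure \<eta> A - 2 * C * \<delta>1" "\<integral>x. indicator A x * k x \<partial>\<eta>" c]
          by (simp add: a_def algebra_simps)
        moreover have "2 * C * measure \<nu> bad \<le> 2 * C * \<delta>1"
          using F2(3) C(1) by (simp add: bad_def)
        ultimately have "s * (\<integral>x. D x \<partial>\<nu>) \<le> (1 - a) * \<omega> + (2 * C * \<delta>1 + 2 * C * \<delta>1 * c)"
          by (simp add: algebra_simps)
        also have "2 * C * \<delta>1 + 2 * C * \<delta>1 * c = \<delta> / 2"
        proof -
          have "2 * C * \<delta>1 + 2 * C * \<delta>1 * c = 2 * C * (1 + c) * \<delta>1" by (simp add: algebra_simps)
          also have "\<dots> = \<delta> / 2"
          proof -
            have "0 < 2 * C * (1 + c)" using C(1) c by simp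
            then show ?thesis unfolding \<delta>1_def by (simp add: field_simps)
          qed
          finally show ?thesis .
        qed
        finally show ?thesis using \<delta> by simp
      qed
      have "f (g \<otimes> u) - f g = (\<integral>x. D x \<partial>\<nu>)"
      proof -
        have "f (g \<otimes> u) = (\<integral>x. f (g \<otimes> u \<otimes> x) \<partial>\<nu>)"
          unfolding \<nu>_def using f g uc by (intro harmonic_law) auto
        also have "\<dots> = (\<integral>x. \<phi> (u \<otimes> x) \<partial>\<nu>)"
          unfolding \<phi>_def using g uc sp by (intro Bochner_Integration.integral_cong) (auto simp: m_assoc)
        finally have "f (g \<otimes> u) = (\<integral>x. \<phi> (u \<otimes> x) \<partial>\<nu>)" .
        moreover have "f g = (\<integral>x. \<phi> x \<partial>\<nu>)" unfolding \<nu>_def \<phi>_def using f g by (rule harmonic_law)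
        moreover have "integrable \<nu> (\<lambda>x. \<phi> (u \<otimes> x))" using \<phi>C uc by (intro lawint[OF \<phi>um]) auto
        ultimately show ?thesis using lawint[OF \<phi>m \<phi>C] by (simp add: D_def)
      qed
      then show ?thesis using key[of 1] key[of "-1"] by (simp add: abs_le_iff)
    qed
    show "\<exists>F'. finite F' \<and> F' \<subseteq> \<Omega> \<and>
            (\<forall>g\<in>carrier G. \<forall>u\<in>fixer F'. \<bar>f (g \<otimes> u) - f g\<bar> \<le> (1 - a) * \<omega> + \<delta>)"
      using F1(1,2) F2(1,2) bound by (intro exI[of _ "F1 \<union> F2"]) auto
  qed
qed

text \<open>
  The infimum \<open>m\<close> of all bounds for the oscillation under the fixer of some finite
  set satisfies \<open>m \<le> (1 - a) * m\<close> by \<open>oscillation_contracts\<close>, so it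
  is zero.
\<close>

lemma harmonic_uniformly_continuous:
  assumes "spread_out G X \<mu>" and f: "f \<in> bounded_harmonic G X \<mu>" and \<epsilon>: "0 < \<epsilon>"
  obtains F where "finite F" "F \<subseteq> \<Omega>" "\<And>g u. g \<in> carrier G \<Longrightarrow> u \<in> fixer F \<Longrightarrow> \<bar>f (g \<otimes> u) - f g\<bar> \<le> \<epsilon>"
proof -
  obtain \<eta> n where \<eta>: "haar_measure G X \<eta>" "\<not> mutually_singular (law n) \<eta>"
    using assms(1) unfolding spread_out_def by auto
  define ok where "ok F \<omega> \<longleftrightarrow> finite F \<and> F \<subseteq> \<Omega> \<and> (\<forall>g\<in>carrier G. \<forall>u\<in>fixer F. \<bar>f (g \<otimes> u) - f g\<bar> \<le> \<omega>)" for F \<omega>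
  obtain a where a: "0 < a" "a \<le> 1"
    and step': "\<forall>F \<omega> \<delta>. finite F \<and> F \<subseteq> \<Omega> \<and> 0 < \<delta> \<and> (\<forall>g\<in>carrier G. \<forall>u\<in>fixer F. \<bar>f (g \<otimes> u) - f g\<bar> \<le> \<omega>)
      \<longrightarrow> (\<exists>F'. finite F' \<and> F' \<subseteq> \<Omega> \<and>
            (\<forall>g\<in>carrier G. \<forall>u\<in>fixer F'. \<bar>f (g \<otimes> u) - f g\<bar> \<le> (1 - a) * \<omega> + \<delta>))"
    by (rule oscillation_contracts[OF \<eta> f])
  have step: "\<exists>F'. ok F' ((1 - a) * \<omega> + \<delta>)" if "ok F \<omega>" "0 < \<delta>" for F \<omega> \<delta>
    using step'[rule_format, of F \<delta> \<omega>] that unfolding ok_def by blast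
  define S where "S = {\<omega>. \<exists>F. ok F \<omega>}"
  have nn: "0 \<le> \<omega>" if w: "\<omega> \<in> S" for \<omega>
  proof -
    obtain F where F: "ok F \<omega>" using w by (auto simp: S_def)
    then have "\<one> \<in> fixer F" using act_one by (auto simp: fixer_def ok_def)
    then show ?thesis using F one_closed unfolding ok_def by (metis abs_ge_zero order_trans)
  qed
  then have bdd: "bdd_below S" by (auto simp: bdd_below_def)
  obtain C where C: "0 < C" "\<And>g. g \<in> carrier G \<Longrightarrow> \<bar>f g\<bar> \<le> C" using harmonic_bound[OF f] by metis
  have "\<bar>f (g \<otimes> u) - f g\<bar> \<le> 2 * C" if "g \<in> carrier G" "u \<in> fixer {}" for g u
    using C(2)[of g] C(2)[of "g \<otimes> u"] that by (simp add: fixer_def)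
  then have "ok {} (2 * C)" by (simp add: ok_def)
  then have ne: "S \<noteq> {}" by (auto simp: S_def)
  have "a * Inf S \<le> 2 * \<delta>" if \<delta>: "0 < \<delta>" for \<delta>
  proof -
    have "Inf S < Inf S + \<delta>" using \<delta> by simp
    then obtain \<omega> where \<omega>: "\<omega> \<in> S" "\<omega> < Inf S + \<delta>"
      using cInf_less_iff[OF ne bdd] by blast
    then have "(1 - a) * \<omega> + \<delta> \<in> S" using step[OF _ \<delta>] by (auto simp: S_def)
    then have "Inf S \<le> (1 - a) * \<omega> + \<delta>" by (rule cInf_lower[OF _ bdd])
    also have "\<dots> \<le> (1 - a) * (Inf S + \<delta>) + \<delta>"
      using \<omega>(2) a by (intro add_right_mono mult_left_mono) auto
    also have "\<dots> \<le> Inf S - a * Inf S + 2 * \<delta>" using a \<delta> by (simp add: algebra_simps)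
    finally show ?thesis by simp
  qed
  from this[of "a * \<epsilon> / 4"] have "Inf S < \<epsilon>" using a \<epsilon> by (simp add: field_simps)
  then obtain \<omega> where "\<omega> \<in> S" "\<omega> < \<epsilon>" using cInf_less_iff[OF ne bdd] by blast
  then obtain F where "ok F \<omega>" by (auto simp: S_def)
  then show thesis using that[of F] \<open>\<omega> < \<epsilon>\<close> unfolding ok_def by fastforce
qed

end

section \<open>Entropy of the position of finitely many points\<close>

definition neg_xlogx :: "real \<Rightarrow> real" where
  "neg_xlogx t = - (t * ln t)"

lemma neg_xlogx_nonneg: "0 \<le> t \<Longrightarrow> t \<le> 1 \<Longrightarrow> 0 \<le> neg_xlogx t"
  by (cases "t = 0") (auto simp: neg_xlogx_def mult_nonneg_nonpos)

lemma neg_xlogx_measurable [measurable]: "neg_xlogx \<in> borel_measurable borel"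
  unfolding neg_xlogx_def by measurable

text \<open>
  Summed over all outcomes and optimised over \<open>\<delta>\<close>, this is Pinsker's
  inequality, up to a constant: relative entropy bounds the total variation distance. With
  \<open>s = sqrt (p / q)\<close>, the inequality \<open>s - 1 \<le> s * ln s\<close> shows that
  \<open>p * ln (p / q) - p + q\<close> is at least \<open>q * (s - 1)\<^sup>2\<close>; the
  distance \<open>q * \<bar>s - 1\<bar> * (s + 1)\<close> is split by the inequality of arithmetic
  and geometric means, weighted by \<open>\<delta>\<close>. Keeping \<open>p\<close> on the left
  and \<open>q\<close> on the right makes every term nonnegative for probabilities, so that the
  inequality can be integrated in the extended nonnegative reals.
\<close>

lemma pinsker_pointwise:
  fixes p q \<delta> :: real
  assumes p: "0 \<le> p" and q: "0 < q" and \<delta>: "0 < \<delta>"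
  shows "2 * \<delta> * \<bar>p - q\<bar> + neg_xlogx p + p \<le> p * - ln q + q + 2 * \<delta>\<^sup>2 * (p + q)"
proof -
  define t where "t = p / q"
  have t: "0 \<le> t" and pt: "p = t * q" using p q by (auto simp: t_def)
  define s where "s = sqrt t"
  have s: "0 \<le> s" and ts: "t = s * s" using t by (auto simp: s_def)
  have sln: "s - 1 \<le> s * ln s"
  proof (cases "s = 0")
    case False
    then have "0 < s" using s by simp
    have "ln (1 / s) \<le> 1 / s - 1" using \<open>0 < s\<close> by (intro ln_le_minus_one) simp
    then have "1 - 1 / s \<le> ln s" using \<open>0 < s\<close> by (simp add: ln_div)
    then have "s * (1 - 1 / s) \<le> s * ln s" using s by (rule mult_left_mono)
    then show ?thesis using \<open>0 < s\<close> by (simp add: algebra_simps)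
  qed simp
  have tln: "t * ln t = 2 * s * (s * ln s)"
    by (cases "s = 0") (use s in \<open>auto simp: ts ln_mult\<close>)
  have "2 * s * (s - 1) \<le> t * ln t"
    unfolding tln using sln s by (intro mult_left_mono) auto
  then have "(s - 1)\<^sup>2 \<le> t * ln t - t + 1"
    by (simp add: ts[symmetric] power2_eq_square algebra_simps) (simp add: ts)
  moreover have "2 * \<delta> * \<bar>t - 1\<bar> \<le> (s - 1)\<^sup>2 + 2 * \<delta>\<^sup>2 * (t + 1)"
  proof -
    have "t - 1 = (s - 1) * (s + 1)" by (simp add: ts algebra_simps)
    then have "\<bar>t - 1\<bar> = \<bar>s - 1\<bar> * (s + 1)" using s by (simp add: abs_mult)
    then have "2 * \<delta> * \<bar>t - 1\<bar> = 2 * \<bar>s - 1\<bar> * (\<delta> * (s + 1))" by simp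
    also have "\<dots> \<le> \<bar>s - 1\<bar>\<^sup>2 + (\<delta> * (s + 1))\<^sup>2" by (rule sum_squares_bound)
    also have "(\<delta> * (s + 1))\<^sup>2 \<le> \<delta>\<^sup>2 * (2 * (t + 1))"
    proof -
      have "(s + 1)\<^sup>2 \<le> 2 * (t + 1)"
        using zero_le_power2[of "s - 1"] by (simp add: ts power2_eq_square algebra_simps)
      then show ?thesis by (simp add: power_mult_distrib mult_left_mono)
    qed
    finally show ?thesis by (simp add: algebra_simps)
  qed
  ultimately have "2 * \<delta> * \<bar>t - 1\<bar> \<le> t * ln t - t + 1 + 2 * \<delta>\<^sup>2 * (t + 1)" by linarith
  then have "q * (2 * \<delta> * \<bar>t - 1\<bar>) \<le> q * (t * ln t - t + 1 + 2 * \<delta>\<^sup>2 * (t + 1))"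
    using q by (intro mult_left_mono) auto
  moreover have "q * (2 * \<delta> * \<bar>t - 1\<bar>) = 2 * \<delta> * \<bar>p - q\<bar>"
  proof -
    have "p - q = q * (t - 1)" by (simp add: pt algebra_simps)
    then have "\<bar>p - q\<bar> = q * \<bar>t - 1\<bar>" using q by (simp add: abs_mult)
    then show ?thesis by simp
  qed
  moreover have "q * (t * ln t) = p * ln p - p * ln q"
    by (cases "t = 0") (use t q in \<open>auto simp: pt ln_mult algebra_simps\<close>)
  moreover have "q * (t * ln t - t + 1 + 2 * \<delta>\<^sup>2 * (t + 1)) = q * (t * ln t) - p + q + 2 * \<delta>\<^sup>2 * (p + q)"
    by (simp add: pt algebra_simps)
  ultimately show ?thesis by (simp add: neg_xlogx_def)
qed

text \<open>
  Summed over all outcomes, this bounds the entropy by the mean code length plus the sum of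
  \<open>exp (- L)\<close>, for arbitrary code lengths \<open>L\<close>.
\<close>

lemma gibbs_pointwise:
  assumes "0 \<le> p"
  shows "neg_xlogx p \<le> p * L + exp (- L)"
proof (cases "p = 0")
  case False
  then have p: "0 < p" using assms by simp
  have "ln (exp (- L) / p) \<le> exp (- L) / p - 1" using p by (intro ln_le_minus_one) simp
  then have "- L - ln p \<le> exp (- L) / p - 1" using p by (simp add: ln_div)
  then have "p * (- L - ln p) \<le> p * (exp (- L) / p - 1)" using p by (intro mult_left_mono) auto
  then show ?thesis using p by (simp add: neg_xlogx_def algebra_simps)
qed (simp add: neg_xlogx_def)

lemma borel_measurable_nn_integral_count_space:
  assumes "countable I" and f: "\<And>i. i \<in> I \<Longrightarrow> f i \<in> borel_measurable M"
  shows "(\<lambda>x. \<integral>\<^sup>+i. f i x \<partial>count_space I) \<in> borel_measurable M"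
proof -
  interpret sigma_finite_measure "count_space I"
    using assms(1) by (rule sigma_finite_measure_count_space_countable)
  have "(\<lambda>p. f (fst p) (snd p)) \<in> borel_measurable (count_space I \<Otimes>\<^sub>M M)"
    using assms(1) by (rule measurable_pair_measure_countable1) (simp add: f)
  from measurable_pair_swap[OF this] have "(\<lambda>(x, i). f i x) \<in> borel_measurable (M \<Otimes>\<^sub>M count_space I)"
    by (simp add: case_prod_unfold)
  then show ?thesis by (rule borel_measurable_nn_integral)
qed

context group_walk
begin

lemma emeasure_carrier: "emeasure \<mu> (carrier G) = 1"
  using emeasure_space_1 by simp

lemma emeasure_law_carrier: "emeasure (law n) (carrier G) = 1"
proof -
  interpret L: prob_space "law n" by (rule prob_space_law)
  show ?thesis using L.emeasure_space_1 by (simp only: space_law)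
qed

text \<open>
  The position of the points of \<open>F\<close> takes countably many values and determines the
  coset of \<open>g\<close> modulo the fixer of \<open>F\<close>.
\<close>

definition place :: "'w set \<Rightarrow> 'g \<Rightarrow> 'w \<Rightarrow> 'w" where
  "place F g = restrict (act g) F"

definition place_prob :: "'w set \<Rightarrow> nat \<Rightarrow> 'g \<Rightarrow> ('w \<Rightarrow> 'w) \<Rightarrow> real" where
  "place_prob F n x y = measure (law n) {h \<in> carrier G. place F (x \<otimes> h) = y}"

text \<open>
  Shannon entropy of the position of \<open>F\<close> after \<open>n\<close> steps from
  \<open>x\<close>.
\<close>

definition entropy_at :: "'w set \<Rightarrow> nat \<Rightarrow> 'g \<Rightarrow> ennreal" where
  "entropy_at F n x = (\<integral>\<^sup>+y. ennreal (neg_xlogx (place_prob F n x y)) \<partial>count_space (F \<rightarrow>\<^sub>E \<Omega>))"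

text \<open>
  The sum of the absolute differences between the law of the position after \<open>n + 1\<close>
  steps and the conditional law given the first step \<open>x\<close>, averaged over
  \<open>x\<close>.
\<close>

definition step_dependence :: "'w set \<Rightarrow> nat \<Rightarrow> ennreal" where
  "step_dependence F n =
    (\<integral>\<^sup>+x. \<integral>\<^sup>+y. ennreal \<bar>place_prob F n x y - place_prob F (Suc n) \<one> y\<bar> \<partial>count_space (F \<rightarrow>\<^sub>E \<Omega>) \<partial>\<mu>)"

context
  fixes F assumes F: "finite F" "F \<subseteq> \<Omega>"
begin

lemma countable_places: "countable (F \<rightarrow>\<^sub>E \<Omega>)"
  using F countable_points by (intro countable_PiE) auto

lemma place_closed: "g \<in> carrier G \<Longrightarrow> place F g \<in> F \<rightarrow>\<^sub>E \<Omega>"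
  using F act_closed by (auto simp: place_def)

lemma place_measurable: "place F \<in> measurable (borel_of X) (count_space (F \<rightarrow>\<^sub>E \<Omega>))"
proof (rule measurable_count_space_eq_countable[THEN iffD2, OF countable_places], intro conjI ballI)
  show "place F \<in> space (borel_of X) \<rightarrow> F \<rightarrow>\<^sub>E \<Omega>" using place_closed by auto
  fix y assume y: "y \<in> F \<rightarrow>\<^sub>E \<Omega>"
  have "place F -` {y} \<inter> space (borel_of X) = {g \<in> space (borel_of X). \<forall>w\<in>F. act g w = y w}"
    using y by (auto simp: place_def fun_eq_iff restrict_def PiE_def extensional_def) 
  also have "\<dots> \<in> sets (borel_of X)"
    using F by (intro sets.sets_Collect_finite_All) (auto simp: act_eq_measurable subset_iff)
  finally show "place F -` {y} \<inter> space (borel_of X) \<in> sets (borel_of X)" .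
qed

lemma place_event_measurable: "{h \<in> carrier G. place F h = y} \<in> sets (borel_of X)"
proof -
  have "place F -` ({y} \<inter> (F \<rightarrow>\<^sub>E \<Omega>)) \<inter> space (borel_of X) \<in> sets (borel_of X)"
    by (rule measurable_sets[OF place_measurable]) simp
  moreover have "place F -` ({y} \<inter> (F \<rightarrow>\<^sub>E \<Omega>)) \<inter> space (borel_of X) = {h \<in> carrier G. place F h = y}"
    using place_closed by auto
  ultimately show ?thesis by simp
qed

lemma place_event_measurable':
  assumes "x \<in> carrier G"
  shows "{h \<in> carrier G. place F (x \<otimes> h) = y} \<in> sets (borel_of X)"
proof -
  have "(\<lambda>h. x \<otimes> h) -` {h \<in> carrier G. place F h = y} \<inter> space (borel_of X) \<in> sets (borel_of X)"
    by (rule measurable_sets[OF const_mult_measurable[OF assms] place_event_measurable])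
  moreover have "(\<lambda>h. x \<otimes> h) -` {h \<in> carrier G. place F h = y} \<inter> space (borel_of X)
      = {h \<in> carrier G. place F (x \<otimes> h) = y}" using assms by auto
  ultimately show ?thesis by simp
qed

lemma place_prob_bounds: "0 \<le> place_prob F n x y" "place_prob F n x y \<le> 1"
proof -
  interpret L: prob_space "law n" by (rule prob_space_law)
  show "0 \<le> place_prob F n x y" "place_prob F n x y \<le> 1" by (simp_all add: place_prob_def)
qed

lemma ennreal_place_prob:
  assumes x: "x \<in> carrier G"
  shows "ennreal (place_prob F n x y) = (\<integral>\<^sup>+h. indicator {k \<in> carrier G. place F k = y} (x \<otimes> h) \<partial>law n)"
proof -
  interpret L: prob_space "law n" by (rule prob_space_law)
  have "(\<integral>\<^sup>+h. indicator {k \<in> carrier G. place F k = y} (x \<otimes> h) \<partial>law n)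
      = (\<integral>\<^sup>+h. indicator {h \<in> carrier G. place F (x \<otimes> h) = y} h \<partial>law n)"
    using x by (intro nn_integral_cong) (auto simp: indicator_def)
  also have "\<dots> = emeasure (law n) {h \<in> carrier G. place F (x \<otimes> h) = y}"
    using place_event_measurable'[OF x] by (intro nn_integral_indicator) (simp add: sets_law)
  finally show ?thesis by (simp add: place_prob_def L.emeasure_eq_measure)
qed

lemma place_prob_measurable: "(\<lambda>x. place_prob F n x y) \<in> borel_measurable (borel_of X)"
proof -
  interpret L: prob_space "law n" by (rule prob_space_law)
  have "(\<lambda>p. indicator {k \<in> carrier G. place F k = y} (case p of (g, h) \<Rightarrow> g \<otimes> h) :: ennreal)
      \<in> borel_measurable (borel_of X \<Otimes>\<^sub>M law n)"
  proof (rule measurable_compose[where N="borel_of X"])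
    show "(\<lambda>p. case p of (g, h) \<Rightarrow> g \<otimes> h) \<in> measurable (borel_of X \<Otimes>\<^sub>M law n) (borel_of X)"
      using mult_measurable measurable_cong_sets[OF sets_pair_measure_cong[OF refl sets_law] refl] by blast
    show "indicator {k \<in> carrier G. place F k = y} \<in> borel_measurable (borel_of X)"
      using place_event_measurable by simp
  qed
  then have "(\<lambda>x. \<integral>\<^sup>+h. indicator {k \<in> carrier G. place F k = y} (x \<otimes> h) \<partial>law n) \<in> borel_measurable (borel_of X)"
    by (intro L.borel_measurable_nn_integral) (simp add: case_prod_unfold)
  then have "(\<lambda>x. enn2real (\<integral>\<^sup>+h. indicator {k \<in> carrier G. place F k = y} (x \<otimes> h) \<partial>law n)) \<in> borel_measurable (borel_of X)"
    by simp
  then show ?thesis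
    by (rule measurable_cong[THEN iffD1, rotated]) (simp add: ennreal_place_prob[symmetric] place_prob_bounds)
qed

lemma place_prob_Suc:
  "(\<integral>\<^sup>+x. ennreal (place_prob F n x y) \<partial>\<mu>) = ennreal (place_prob F (Suc n) \<one> y)"
proof -
  have "ennreal (place_prob F (Suc n) \<one> y) = (\<integral>\<^sup>+h. indicator {k \<in> carrier G. place F k = y} (\<one> \<otimes> h) \<partial>law (Suc n))"
    by (rule ennreal_place_prob) simp
  also have "\<dots> = (\<integral>\<^sup>+h. indicator {k \<in> carrier G. place F k = y} h \<partial>law (Suc n))"
  proof (intro nn_integral_cong)
    fix h assume "h \<in> space (law (Suc n))"
    then have "h \<in> carrier G" unfolding space_law .
    then show "indicator {k \<in> carrier G. place F k = y} (\<one> \<otimes> h) = (indicator {k \<in> carrier G. place F k = y} h :: ennreal)"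
      by simp
  qed
  also have "\<dots> = (\<integral>\<^sup>+x. \<integral>\<^sup>+h. indicator {k \<in> carrier G. place F k = y} (x \<otimes> h) \<partial>law n \<partial>\<mu>)"
    using place_event_measurable by (intro nn_integral_law_Suc) simp
  also have "\<dots> = (\<integral>\<^sup>+x. ennreal (place_prob F n x y) \<partial>\<mu>)"
    by (intro nn_integral_cong) (simp add: ennreal_place_prob)
  finally show ?thesis by simp
qed

lemma place_indicator_measurable:
  assumes "x \<in> carrier G"
  shows "(\<lambda>h. indicator {k \<in> carrier G. place F k = y} (x \<otimes> h) :: ennreal) \<in> borel_measurable (law n)"
  unfolding measurable_law
  by (rule measurable_compose[OF const_mult_measurable[OF assms] borel_measurable_indicator[OF place_event_measurable]])

lemma nn_integral_place:
  assumes x: "x \<in> carrier G"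
  shows "(\<integral>\<^sup>+h. \<phi> (place F (x \<otimes> h)) \<partial>law n) = (\<integral>\<^sup>+y. \<phi> y * ennreal (place_prob F n x y) \<partial>count_space (F \<rightarrow>\<^sub>E \<Omega>))"
proof -
  have "(\<integral>\<^sup>+h. \<phi> (place F (x \<otimes> h)) \<partial>law n)
      = (\<integral>\<^sup>+h. \<integral>\<^sup>+y. \<phi> y * indicator {k \<in> carrier G. place F k = y} (x \<otimes> h) \<partial>count_space (F \<rightarrow>\<^sub>E \<Omega>) \<partial>law n)"
  proof (intro nn_integral_cong)
    fix h assume "h \<in> space (law n)"
    then have xh: "x \<otimes> h \<in> carrier G" using x by simp
    have "(\<integral>\<^sup>+y. \<phi> y * indicator {k \<in> carrier G. place F k = y} (x \<otimes> h) \<partial>count_space (F \<rightarrow>\<^sub>E \<Omega>))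
        = (\<integral>\<^sup>+y. \<phi> (place F (x \<otimes> h)) * indicator {place F (x \<otimes> h)} y \<partial>count_space (F \<rightarrow>\<^sub>E \<Omega>))"
      using xh by (intro nn_integral_cong) (auto simp: indicator_def)
    also have "\<dots> = \<phi> (place F (x \<otimes> h))"
      using place_closed[OF xh] by (subst nn_integral_cmult_indicator) (auto simp: emeasure_count_space)
    finally show "\<phi> (place F (x \<otimes> h)) = (\<integral>\<^sup>+y. \<phi> y * indicator {k \<in> carrier G. place F k = y} (x \<otimes> h) \<partial>count_space (F \<rightarrow>\<^sub>E \<Omega>))"
      by simp
  qed
  also have "\<dots> = (\<integral>\<^sup>+y. \<integral>\<^sup>+h. \<phi> y * indicator {k \<in> carrier G. place F k = y} (x \<otimes> h) \<partial>law n \<partial>count_space (F \<rightarrow>\<^sub>E \<Omega>))"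
  proof (rule nn_integral_count_space_nn_integral[OF countable_places])
    fix y
    show "(\<lambda>h. \<phi> y * indicator {k \<in> carrier G. place F k = y} (x \<otimes> h)) \<in> borel_measurable (law n)"
      by (rule borel_measurable_times_ennreal[OF borel_measurable_const place_indicator_measurable[OF x]])
  qed
  also have "\<dots> = (\<integral>\<^sup>+y. \<phi> y * ennreal (place_prob F n x y) \<partial>count_space (F \<rightarrow>\<^sub>E \<Omega>))"
  proof (intro nn_integral_cong)
    fix y
    show "(\<integral>\<^sup>+h. \<phi> y * indicator {k \<in> carrier G. place F k = y} (x \<otimes> h) \<partial>law n) = \<phi> y * ennreal (place_prob F n x y)"
      unfolding ennreal_place_prob[OF x]
      by (rule nn_integral_cmult[OF place_indicator_measurable[OF x]])
  qed
  finally show ?thesis .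
qed

lemma place_prob_total:
  assumes x: "x \<in> carrier G"
  shows "(\<integral>\<^sup>+y. ennreal (place_prob F n x y) \<partial>count_space (F \<rightarrow>\<^sub>E \<Omega>)) = 1"
proof -
  interpret L: prob_space "law n" by (rule prob_space_law)
  have "(\<integral>\<^sup>+h. 1 \<partial>law n) = (\<integral>\<^sup>+y. 1 * ennreal (place_prob F n x y) \<partial>count_space (F \<rightarrow>\<^sub>E \<Omega>))"
    by (rule nn_integral_place[OF x])
  then show ?thesis using L.emeasure_space_1 by simp
qed

text \<open>Left multiplication permutes the possible positions.\<close>

lemma entropy_translate:
  assumes x: "x \<in> carrier G"
  shows "entropy_at F n x = entropy_at F n \<one>"
proof -
  define b where "b y = restrict (\<lambda>w. act x (y w)) F" for y
  have bij: "bij_betw b (F \<rightarrow>\<^sub>E \<Omega>) (F \<rightarrow>\<^sub>E \<Omega>)"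
  proof (rule bij_betwI)
    show "b \<in> (F \<rightarrow>\<^sub>E \<Omega>) \<rightarrow> F \<rightarrow>\<^sub>E \<Omega>" using act_closed[OF x] by (auto simp: b_def PiE_iff)
    show "(\<lambda>y. restrict (\<lambda>w. act (inv x) (y w)) F) \<in> (F \<rightarrow>\<^sub>E \<Omega>) \<rightarrow> F \<rightarrow>\<^sub>E \<Omega>"
      using act_closed[of "inv x"] x by (auto simp: PiE_iff)
    show "restrict (\<lambda>w. act (inv x) (b y w)) F = y" if y: "y \<in> F \<rightarrow>\<^sub>E \<Omega>" for y
      using y act_inv[OF x] by (auto simp: b_def fun_eq_iff restrict_def PiE_def extensional_def Pi_def)
    show "b (restrict (\<lambda>w. act (inv x) (y w)) F) = y" if y: "y \<in> F \<rightarrow>\<^sub>E \<Omega>" for y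
      using y act_inv'[OF x] by (auto simp: b_def fun_eq_iff restrict_def PiE_def extensional_def Pi_def)
  qed
  have eq: "place_prob F n x (b y) = place_prob F n \<one> y" if y: "y \<in> F \<rightarrow>\<^sub>E \<Omega>" for y
  proof -
    have "place F (x \<otimes> h) = b y \<longleftrightarrow> place F h = y" if h: "h \<in> carrier G" for h
    proof -
      have "place F (x \<otimes> h) = b (place F h)"
        using F h x by (auto simp: place_def b_def act_mult subset_iff fun_eq_iff)
      then show ?thesis
        using bij_betw_imp_inj_on[OF bij] y place_closed[OF h] by (auto dest: inj_onD)
    qed
    then have "{h \<in> carrier G. place F (x \<otimes> h) = b y} = {h \<in> carrier G. place F (\<one> \<otimes> h) = y}" by auto
    then show ?thesis by (simp add: place_prob_def)
  qed
  have "entropy_at F n x = (\<integral>\<^sup>+y. ennreal (neg_xlogx (place_prob F n x (b y))) \<partial>count_space (F \<rightarrow>\<^sub>E \<Omega>))"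
    unfolding entropy_at_def by (rule nn_integral_bij_count_space[OF bij, symmetric])
  also have "\<dots> = entropy_at F n \<one>"
    unfolding entropy_at_def by (intro nn_integral_cong) (simp add: eq)
  finally show ?thesis .
qed

text \<open>
  Apply \<open>pinsker_pointwise\<close> to the conditional probability \<open>p\<close> of a
  position given the first step and to its mean \<open>q\<close> over the first step. Averaging
  turns \<open>p * - ln q\<close> into the entropy after \<open>n + 1\<close> steps, while the
  conditional entropy given the first step is the entropy after \<open>n\<close> steps by
  \<open>entropy_translate\<close>. The summand \<open>1\<close> on both sides is the total mass
  of \<open>p\<close> and of \<open>q\<close>.
\<close>

lemma entropy_step:
  assumes \<delta>: "0 < \<delta>"
  shows "ennreal (2 * \<delta>) * step_dependence F n + entropy_at F n \<one> + 1
    \<le> entropy_at F (Suc n) \<one> + 1 + ennreal (4 * \<delta>\<^sup>2)"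
proof -
  define Y where "Y = (F \<rightarrow>\<^sub>E \<Omega>)"
  define p where "p x y = place_prob F n x y" for x y
  define q where "q y = place_prob F (Suc n) \<one> y" for y
  have pm: "(\<lambda>x. p x y) \<in> borel_measurable \<mu>" for y
    unfolding p_def measurable_step by (rule place_prob_measurable)
  have p01: "0 \<le> p x y" "p x y \<le> 1" for x y unfolding p_def by (rule place_prob_bounds)+
  have q01: "0 \<le> q y" "q y \<le> 1" for y unfolding q_def by (rule place_prob_bounds)+
  have pq: "(\<integral>\<^sup>+x. ennreal (p x y) \<partial>\<mu>) = ennreal (q y)" for y
    unfolding p_def q_def by (rule place_prob_Suc)
  define l where "l x y = ennreal (2 * \<delta>) * ennreal \<bar>p x y - q y\<bar> + ennreal (neg_xlogx (p x y)) + ennreal (p x y)" for x y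
  have lm: "(\<lambda>x. l x y) \<in> borel_measurable \<mu>" for y
    unfolding l_def using pm by measurable
  have per_y: "(\<integral>\<^sup>+x. l x y \<partial>\<mu>) \<le> ennreal (neg_xlogx (q y)) + ennreal (q y) + ennreal (4 * \<delta>\<^sup>2) * ennreal (q y)" for y
  proof (cases "q y = 0")
    case True
    then have "(\<integral>\<^sup>+x. ennreal (p x y) \<partial>\<mu>) = 0" using pq by simp
    then have "AE x in \<mu>. ennreal (p x y) = 0" using pm by (subst (asm) nn_integral_0_iff_AE) auto
    then have "AE x in \<mu>. p x y = 0"
      by (rule AE_mp, intro AE_I2 impI) (use p01 in \<open>auto simp: ennreal_eq_0_iff intro: antisym\<close>)
    then have "AE x in \<mu>. l x y = 0"
      by (rule AE_mp, intro AE_I2 impI) (simp add: l_def neg_xlogx_def True)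
    then have "(\<integral>\<^sup>+x. l x y \<partial>\<mu>) = 0" using lm by (subst nn_integral_0_iff_AE) auto
    then show ?thesis by simp
  next
    case False
    then have qpos: "0 < q y" using q01[of y] by simp
    have "ln (q y) \<le> 0" using q01[of y] qpos by simp
    then have K0: "0 \<le> - ln (q y) + 2 * \<delta>\<^sup>2" using zero_le_power2[of \<delta>] by linarith
    have c0: "0 \<le> q y + 2 * \<delta>\<^sup>2 * q y" using q01[of y] by simp
    have "l x y \<le> ennreal (- ln (q y) + 2 * \<delta>\<^sup>2) * ennreal (p x y) + ennreal (q y + 2 * \<delta>\<^sup>2 * q y)" for x
    proof -
      have "l x y = ennreal (2 * \<delta> * \<bar>p x y - q y\<bar> + neg_xlogx (p x y) + p x y)"
        using p01[of x y] \<delta> neg_xlogx_nonneg[OF p01[of x y]] by (simp add: l_def ennreal_mult ennreal_plus)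
      also have "\<dots> \<le> ennreal (p x y * - ln (q y) + q y + 2 * \<delta>\<^sup>2 * (p x y + q y))"
        by (intro ennreal_leI pinsker_pointwise p01 qpos \<delta>)
      also have "\<dots> = ennreal ((- ln (q y) + 2 * \<delta>\<^sup>2) * p x y + (q y + 2 * \<delta>\<^sup>2 * q y))"
        by (simp add: algebra_simps)
      also have "\<dots> = ennreal (- ln (q y) + 2 * \<delta>\<^sup>2) * ennreal (p x y) + ennreal (q y + 2 * \<delta>\<^sup>2 * q y)"
        by (simp only: ennreal_plus[OF mult_nonneg_nonneg[OF K0 p01(1)[of x y]] c0] ennreal_mult[OF K0 p01(1)[of x y]])
      finally show ?thesis .
    qed
    then have "(\<integral>\<^sup>+x. l x y \<partial>\<mu>) \<le> (\<integral>\<^sup>+x. ennreal (- ln (q y) + 2 * \<delta>\<^sup>2) * ennreal (p x y) + ennreal (q y + 2 * \<delta>\<^sup>2 * q y) \<partial>\<mu>)"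
      by (intro nn_integral_mono)
    also have "\<dots> = ennreal (- ln (q y) + 2 * \<delta>\<^sup>2) * ennreal (q y) + ennreal (q y + 2 * \<delta>\<^sup>2 * q y)"
      using pm[of y] by (simp add: nn_integral_add nn_integral_cmult pq emeasure_carrier)
    also have "\<dots> = ennreal ((- ln (q y) + 2 * \<delta>\<^sup>2) * q y + (q y + 2 * \<delta>\<^sup>2 * q y))"
      by (simp only: ennreal_plus[OF mult_nonneg_nonneg[OF K0 q01(1)[of y]] c0] ennreal_mult[OF K0 q01(1)[of y]])
    also have "(- ln (q y) + 2 * \<delta>\<^sup>2) * q y + (q y + 2 * \<delta>\<^sup>2 * q y) = neg_xlogx (q y) + q y + 4 * \<delta>\<^sup>2 * q y"
      by (simp add: neg_xlogx_def algebra_simps)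
    also have "ennreal \<dots> = ennreal (neg_xlogx (q y)) + ennreal (q y) + ennreal (4 * \<delta>\<^sup>2) * ennreal (q y)"
      using q01[of y] neg_xlogx_nonneg[OF q01[of y]] by (simp add: ennreal_plus ennreal_mult)
    finally show ?thesis .
  qed
  have "ennreal (2 * \<delta>) * step_dependence F n + entropy_at F n \<one> + 1 = (\<integral>\<^sup>+x. \<integral>\<^sup>+y. l x y \<partial>count_space Y \<partial>\<mu>)"
  proof -
    have "(\<integral>\<^sup>+y. l x y \<partial>count_space Y) =
        ennreal (2 * \<delta>) * (\<integral>\<^sup>+y. ennreal \<bar>p x y - q y\<bar> \<partial>count_space Y) + entropy_at F n \<one> + 1"
      if x: "x \<in> carrier G" for x
      unfolding l_def using place_prob_total[OF x, of n] entropy_translate[OF x, of n]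
      by (simp add: nn_integral_add nn_integral_cmult Y_def p_def entropy_at_def)
    then have "(\<integral>\<^sup>+x. \<integral>\<^sup>+y. l x y \<partial>count_space Y \<partial>\<mu>) =
        (\<integral>\<^sup>+x. ennreal (2 * \<delta>) * (\<integral>\<^sup>+y. ennreal \<bar>p x y - q y\<bar> \<partial>count_space Y) + (entropy_at F n \<one> + 1) \<partial>\<mu>)"
      by (intro nn_integral_cong) (simp add: add.assoc)
    also have "\<dots> = ennreal (2 * \<delta>) * (\<integral>\<^sup>+x. \<integral>\<^sup>+y. ennreal \<bar>p x y - q y\<bar> \<partial>count_space Y \<partial>\<mu>) + (entropy_at F n \<one> + 1)"
    proof -
      have "(\<lambda>x. \<integral>\<^sup>+y. ennreal \<bar>p x y - q y\<bar> \<partial>count_space Y) \<in> borel_measurable \<mu>"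
        unfolding Y_def by (rule borel_measurable_nn_integral_count_space[OF countable_places]) (use pm in simp)
      then show ?thesis by (simp add: nn_integral_add nn_integral_cmult emeasure_carrier)
    qed
    finally show ?thesis by (simp add: step_dependence_def Y_def p_def q_def add.assoc)
  qed
  also have "\<dots> = (\<integral>\<^sup>+y. \<integral>\<^sup>+x. l x y \<partial>\<mu> \<partial>count_space Y)"
    using lm countable_places unfolding Y_def by (intro nn_integral_count_space_nn_integral)
  also have "\<dots> \<le> (\<integral>\<^sup>+y. ennreal (neg_xlogx (q y)) + ennreal (q y) + ennreal (4 * \<delta>\<^sup>2) * ennreal (q y) \<partial>count_space Y)"
    by (intro nn_integral_mono per_y)
  also have "\<dots> = entropy_at F (Suc n) \<one> + 1 + ennreal (4 * \<delta>\<^sup>2)"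
    using place_prob_total[OF one_closed, of "Suc n"]
    by (simp add: nn_integral_add nn_integral_cmult Y_def q_def entropy_at_def)
  finally show ?thesis .
qed

text \<open>
  Gibbs' inequality with the sum of the costs of the image points as code length: the sum of
  \<open>exp (- L)\<close> over all tuples of image points is a product of equal factors.
\<close>

lemma entropy_le_cost:
  assumes l0: "\<And>w. w \<in> \<Omega> \<Longrightarrow> 0 \<le> cost w"
  shows "entropy_at F n \<one> \<le> (\<Sum>w\<in>F. \<integral>\<^sup>+h. ennreal (cost (act h w)) \<partial>law n)
      + (\<integral>\<^sup>+w. ennreal (exp (- cost w)) \<partial>count_space \<Omega>) ^ card F"
proof -
  define Y where "Y = (F \<rightarrow>\<^sub>E \<Omega>)"
  define L where "L y = (\<Sum>w\<in>F. cost (y w))" for y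
  have L0: "0 \<le> L y" if "y \<in> Y" for y
    unfolding L_def using that by (intro sum_nonneg l0) (auto simp: Y_def)
  have "entropy_at F n \<one> \<le> (\<integral>\<^sup>+y. ennreal (L y) * ennreal (place_prob F n \<one> y) + ennreal (exp (- L y)) \<partial>count_space Y)"
    unfolding entropy_at_def Y_def[symmetric]
  proof (intro nn_integral_mono)
    fix y assume "y \<in> space (count_space Y)"
    then have "0 \<le> L y" using L0 by simp
    have "ennreal (neg_xlogx (place_prob F n \<one> y)) \<le> ennreal (place_prob F n \<one> y * L y + exp (- L y))"
      by (intro ennreal_leI gibbs_pointwise place_prob_bounds)
    also have "\<dots> = ennreal (L y) * ennreal (place_prob F n \<one> y) + ennreal (exp (- L y))"
      using \<open>0 \<le> L y\<close> place_prob_bounds[of n \<one> y] by (simp add: ennreal_plus ennreal_mult mult.commute)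
    finally show "ennreal (neg_xlogx (place_prob F n \<one> y))
      \<le> ennreal (L y) * ennreal (place_prob F n \<one> y) + ennreal (exp (- L y))" .
  qed
  also have "\<dots> = (\<integral>\<^sup>+y. ennreal (L y) * ennreal (place_prob F n \<one> y) \<partial>count_space Y)
      + (\<integral>\<^sup>+y. ennreal (exp (- L y)) \<partial>count_space Y)"
    by (intro nn_integral_add) auto
  also have "(\<integral>\<^sup>+y. ennreal (L y) * ennreal (place_prob F n \<one> y) \<partial>count_space Y)
      = (\<integral>\<^sup>+h. ennreal (L (place F (\<one> \<otimes> h))) \<partial>law n)"
    unfolding Y_def by (rule nn_integral_place[symmetric]) simp
  also have "\<dots> = (\<integral>\<^sup>+h. (\<Sum>w\<in>F. ennreal (cost (act h w))) \<partial>law n)"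
  proof (intro nn_integral_cong)
    fix h assume "h \<in> space (law n)"
    then show "ennreal (L (place F (\<one> \<otimes> h))) = (\<Sum>w\<in>F. ennreal (cost (act h w)))"
      using F act_closed l0 by (simp add: L_def place_def sum_ennreal subset_iff)
  qed
  also have "\<dots> = (\<Sum>w\<in>F. \<integral>\<^sup>+h. ennreal (cost (act h w)) \<partial>law n)"
  proof (intro nn_integral_sum)
    fix w assume "w \<in> F"
    then have "w \<in> \<Omega>" using F by auto
    then show "(\<lambda>h. ennreal (cost (act h w))) \<in> borel_measurable (law n)"
      unfolding measurable_law by (rule measurable_compose[OF act_measurable]) simp
  qed
  also have "(\<integral>\<^sup>+y. ennreal (exp (- L y)) \<partial>count_space Y) = (\<integral>\<^sup>+w. ennreal (exp (- cost w)) \<partial>count_space \<Omega>) ^ card F"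
  proof -
    interpret sigma_finite_measure "count_space \<Omega>"
      using countable_points by (rule sigma_finite_measure_count_space_countable)
    interpret product_sigma_finite "\<lambda>_::'w. count_space \<Omega>" ..
    have "(\<integral>\<^sup>+y. ennreal (exp (- L y)) \<partial>count_space Y)
        = (\<integral>\<^sup>+y. (\<Prod>w\<in>F. ennreal (exp (- cost (y w)))) \<partial>count_space Y)"
      using F by (intro nn_integral_cong) (simp add: L_def prod_ennreal exp_sum[symmetric] sum_negf)
    also have "\<dots> = (\<integral>\<^sup>+y. (\<Prod>w\<in>F. ennreal (exp (- cost (y w)))) \<partial>PiM F (\<lambda>_. count_space \<Omega>))"
      unfolding Y_def using F countable_points by (subst count_space_PiM_finite) auto
    also have "\<dots> = (\<Prod>w\<in>F. \<integral>\<^sup>+w. ennreal (exp (- cost w)) \<partial>count_space \<Omega>)"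
      using F by (intro product_nn_integral_prod) auto
    finally show ?thesis by simp
  qed
  finally show ?thesis .
qed

end

end

section \<open>Sublinear entropy and constant harmonic functions\<close>

context group_walk
begin

lemma measure_law_carrier: "measure (law n) (carrier G) = 1"
  by (simp add: measure_def emeasure_law_carrier)

lemma step_dependence_telescope:
  assumes "0 < \<delta>" and F: "finite F" "F \<subseteq> \<Omega>" and fin: "\<And>n. entropy_at F n \<one> < \<infinity>"
  shows "ennreal (2 * \<delta>) * (\<Sum>n<N. step_dependence F n) \<le> entropy_at F N \<one> + ennreal (4 * \<delta>\<^sup>2 * real N)"
proof (induction N)
  case (Suc N)
  have "ennreal (2 * \<delta>) * (\<Sum>n<Suc N. step_dependence F n) + (entropy_at F N \<one> + 1)
      = ennreal (2 * \<delta>) * (\<Sum>n<N. step_dependence F n)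
        + (ennreal (2 * \<delta>) * step_dependence F N + entropy_at F N \<one> + 1)"
    by (simp add: distrib_left ac_simps)
  also have "\<dots> \<le> (entropy_at F N \<one> + ennreal (4 * \<delta>\<^sup>2 * real N))
        + (entropy_at F (Suc N) \<one> + 1 + ennreal (4 * \<delta>\<^sup>2))"
    by (intro add_mono Suc entropy_step[OF F assms(1)])
  also have "\<dots> = (entropy_at F (Suc N) \<one> + (ennreal (4 * \<delta>\<^sup>2 * real N) + ennreal (4 * \<delta>\<^sup>2)))
        + (entropy_at F N \<one> + 1)"
    by (simp add: ac_simps)
  also have "ennreal (4 * \<delta>\<^sup>2 * real N) + ennreal (4 * \<delta>\<^sup>2) = ennreal (4 * \<delta>\<^sup>2 * real (Suc N))"
    by (subst ennreal_plus[symmetric]) (auto simp: algebra_simps)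
  finally have "(entropy_at F N \<one> + 1) + ennreal (2 * \<delta>) * (\<Sum>n<Suc N. step_dependence F n)
      \<le> (entropy_at F N \<one> + 1) + (entropy_at F (Suc N) \<one> + ennreal (4 * \<delta>\<^sup>2 * real (Suc N)))"
    by (simp only: ac_simps)
  moreover have "entropy_at F N \<one> + 1 \<noteq> \<infinity>" using fin[of N] by (simp add: less_top)
  ultimately show ?case unfolding ennreal_add_left_cancel_le by simp
qed simp

text \<open>
  Costs are code lengths for points, summable in the sense of Kraft, for which the mean cost of
  the position of each point grows at an arbitrarily small linear rate.
\<close>

definition sublinear_cost :: bool where
  "sublinear_cost \<longleftrightarrow> (\<forall>\<epsilon>>0. \<exists>cost::'w \<Rightarrow> real. (\<forall>w\<in>\<Omega>. 0 \<le> cost w) \<and>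
      (\<integral>\<^sup>+w. ennreal (exp (- cost w)) \<partial>count_space \<Omega>) < \<infinity> \<and>
      (\<forall>w\<in>\<Omega>. \<exists>C. \<forall>n. (\<integral>\<^sup>+h. ennreal (cost (act h w)) \<partial>law n) \<le> ennreal (\<epsilon> * real n + C)))"

lemma entropy_sublinear:
  assumes sub: sublinear_cost and F: "finite F" "F \<subseteq> \<Omega>" and \<epsilon>: "0 < \<epsilon>"
  obtains C where "0 \<le> C" "\<forall>n. entropy_at F n \<one> \<le> ennreal (\<epsilon> * real n + C)"
proof -
  define \<epsilon>' where "\<epsilon>' = \<epsilon> / (real (card F) + 1)"
  have \<epsilon>': "0 < \<epsilon>'" using \<epsilon> by (simp add: \<epsilon>'_def)
  obtain cost :: "'w \<Rightarrow> real" where cost: "\<forall>w\<in>\<Omega>. 0 \<le> cost w"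
      "(\<integral>\<^sup>+w. ennreal (exp (- cost w)) \<partial>count_space \<Omega>) < \<infinity>"
      "\<forall>w\<in>\<Omega>. \<exists>C. \<forall>n. (\<integral>\<^sup>+h. ennreal (cost (act h w)) \<partial>law n) \<le> ennreal (\<epsilon>' * real n + C)"
    using sub \<epsilon>' unfolding sublinear_cost_def by blast
  then obtain C where C: "\<And>w n. w \<in> \<Omega> \<Longrightarrow> (\<integral>\<^sup>+h. ennreal (cost (act h w)) \<partial>law n) \<le> ennreal (\<epsilon>' * real n + C w)"
    by metis
  define Z where "Z = enn2real ((\<integral>\<^sup>+w. ennreal (exp (- cost w)) \<partial>count_space \<Omega>) ^ card F)"
  have Zfin: "(\<integral>\<^sup>+w. ennreal (exp (- cost w)) \<partial>count_space \<Omega>) ^ card F < \<infinity>"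
    using cost(2) by (simp add: power_less_top_ennreal)
  have Z: "(\<integral>\<^sup>+w. ennreal (exp (- cost w)) \<partial>count_space \<Omega>) ^ card F = ennreal Z" "0 \<le> Z"
    using Zfin by (simp_all add: Z_def less_top)
  show thesis
  proof (rule that[of "(\<Sum>w\<in>F. \<bar>C w\<bar>) + Z"], goal_cases)
    case 1 then show ?case using Z(2) by (simp add: sum_nonneg)
  next
    case 2
    show ?case
    proof
      fix n
      have "entropy_at F n \<one> \<le> (\<Sum>w\<in>F. \<integral>\<^sup>+h. ennreal (cost (act h w)) \<partial>law n) + ennreal Z"
        using entropy_le_cost[OF F, of cost n] cost(1) unfolding Z(1) by simp
      also have "\<dots> \<le> (\<Sum>w\<in>F. ennreal (\<epsilon>' * real n + \<bar>C w\<bar>)) + ennreal Z"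
      proof (intro add_right_mono sum_mono)
        fix w assume "w \<in> F"
        then have "w \<in> \<Omega>" using F by auto
        then have "(\<integral>\<^sup>+h. ennreal (cost (act h w)) \<partial>law n) \<le> ennreal (\<epsilon>' * real n + C w)" by (rule C)
        also have "\<dots> \<le> ennreal (\<epsilon>' * real n + \<bar>C w\<bar>)" by (intro ennreal_leI) simp
        finally show "(\<integral>\<^sup>+h. ennreal (cost (act h w)) \<partial>law n) \<le> ennreal (\<epsilon>' * real n + \<bar>C w\<bar>)" .
      qed
      also have "\<dots> = ennreal (real (card F) * (\<epsilon>' * real n) + (\<Sum>w\<in>F. \<bar>C w\<bar>) + Z)"
        using \<epsilon>' Z(2) by (simp add: sum_ennreal sum.distrib ennreal_plus[symmetric] sum_nonneg del: ennreal_plus)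
      also have "\<dots> \<le> ennreal (\<epsilon> * real n + ((\<Sum>w\<in>F. \<bar>C w\<bar>) + Z))"
      proof (intro ennreal_leI)
        have "real (card F) * \<epsilon>' \<le> \<epsilon>" using \<epsilon> by (simp add: \<epsilon>'_def field_simps)
        then have "real (card F) * \<epsilon>' * real n \<le> \<epsilon> * real n" by (intro mult_right_mono) auto
        then show "real (card F) * (\<epsilon>' * real n) + (\<Sum>w\<in>F. \<bar>C w\<bar>) + Z \<le> \<epsilon> * real n + ((\<Sum>w\<in>F. \<bar>C w\<bar>) + Z)"
          by (simp add: mult.assoc)
      qed
      finally show "entropy_at F n \<one> \<le> ennreal (\<epsilon> * real n + ((\<Sum>w\<in>F. \<bar>C w\<bar>) + Z))" .
    qed
  qed
qed

text \<open>
  If the dependence on the first step were always above \<open>\<kappa>\<close>, then by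
  \<open>step_dependence_telescope\<close> the entropy would grow at least at the rate \<open>2 *
  \<delta> * \<kappa> - 4 * \<delta>\<^sup>2\<close>, which is positive for small
  \<open>\<delta>\<close>.
\<close>

lemma step_dependence_small:
  assumes sub: sublinear_cost and F: "finite F" "F \<subseteq> \<Omega>" and \<kappa>: "0 < \<kappa>"
  obtains n where "step_dependence F n \<le> ennreal \<kappa>"
proof (rule ccontr)
  assume "\<not> thesis"
  then have big: "ennreal \<kappa> \<le> step_dependence F n" for n using that[of n] by (meson linear)
  (* then 4 * \<delta>^2 = \<delta> * \<kappa> / 2, a quarter of the main term 2 * \<delta> *
     \<kappa> *)
  define \<delta> where "\<delta> = \<kappa> / 8"
  have \<delta>: "0 < \<delta>" using \<kappa> by (simp add: \<delta>_def)
  obtain C where C: "0 \<le> C" "\<forall>n. entropy_at F n \<one> \<le> ennreal (\<delta> * \<kappa> / 2 * real n + C)"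
    using entropy_sublinear[OF sub F, of "\<delta> * \<kappa> / 2"] \<delta> \<kappa> by auto
  have fin: "entropy_at F n \<one> < \<infinity>" for n
    using C(2) by (metis ennreal_less_top infinity_ennreal_def le_less_trans)
  have "2 * \<delta> * \<kappa> * real N \<le> \<delta> * \<kappa> / 2 * real N + C + 4 * \<delta>\<^sup>2 * real N" for N
  proof -
    have "ennreal (2 * \<delta> * \<kappa> * real N) = ennreal (2 * \<delta>) * (\<Sum>n<N. ennreal \<kappa>)"
      using \<delta> \<kappa> by (simp add: ennreal_mult[symmetric] ennreal_of_nat_eq_real_of_nat mult.commute mult.left_commute)
    also have "\<dots> \<le> ennreal (2 * \<delta>) * (\<Sum>n<N. step_dependence F n)"
      by (intro mult_left_mono sum_mono big) auto
    also have "\<dots> \<le> entropy_at F N \<one> + ennreal (4 * \<delta>\<^sup>2 * real N)"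
      by (rule step_dependence_telescope[OF \<delta> F fin])
    also have "\<dots> \<le> ennreal (\<delta> * \<kappa> / 2 * real N + C) + ennreal (4 * \<delta>\<^sup>2 * real N)"
      using C(2) by (intro add_right_mono) blast
    also have "\<dots> = ennreal (\<delta> * \<kappa> / 2 * real N + C + 4 * \<delta>\<^sup>2 * real N)"
      using \<delta> \<kappa> C(1) by (intro ennreal_plus[symmetric]) auto
    finally show ?thesis using \<delta> \<kappa> C(1) by (subst (asm) ennreal_le_iff) auto
  qed
  moreover have "4 * \<delta>\<^sup>2 = \<delta> * \<kappa> / 2" by (simp add: \<delta>_def power2_eq_square)
  ultimately have "\<delta> * \<kappa> * real N \<le> C" for N by (smt (verit) distrib_right mult_2 field_sum_of_halves)
  moreover obtain N where "C < \<delta> * \<kappa> * real N"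
    using reals_Archimedean3[of "\<delta> * \<kappa>"] \<delta> \<kappa> by (metis mult.commute mult_pos_pos)
  ultimately show False by (meson not_le)
qed

text \<open>
  Let \<open>\<phi> g = f (k \<otimes> g)\<close>. By uniform continuity \<open>\<phi>\<close> is
  nearly a function \<open>\<psi>\<close> of the position of \<open>F\<close>. By harmonicity
  \<open>\<phi> x\<close> is the mean of \<open>\<psi>\<close> after \<open>n\<close> steps from
  \<open>x\<close>, and \<open>\<phi> \<one>\<close> the mean after \<open>n + 1\<close> steps
  from \<open>\<one>\<close>, up to small errors. The two means differ by at most the bound of
  \<open>\<psi>\<close> times the distance of the laws, which is small on average over
  \<open>x\<close>.
\<close>

lemma harmonic_step_constant:
  assumes sub: sublinear_cost and so: "spread_out G X \<mu>"
    and f: "f \<in> bounded_harmonic G X \<mu>" and k: "k \<in> carrier G"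
  shows "AE x in \<mu>. f (k \<otimes> x) = f k"
proof -
  define \<phi> where "\<phi> g = f (k \<otimes> g)" for g
  have \<phi>h: "\<phi> \<in> bounded_harmonic G X \<mu>" unfolding \<phi>_def by (rule harmonic_translate[OF f k])
  obtain C where C: "0 < C" "\<And>g. g \<in> carrier G \<Longrightarrow> \<bar>\<phi> g\<bar> \<le> C" using harmonic_bound[OF \<phi>h] by metis
  have \<phi>m: "\<phi> \<in> borel_measurable (borel_of X)" using \<phi>h by (simp add: bounded_harmonic_def)
  have key: "(\<integral>\<^sup>+x. ennreal \<bar>\<phi> x - \<phi> \<one>\<bar> \<partial>\<mu>) \<le> ennreal \<epsilon>" if \<epsilon>: "0 < \<epsilon>" for \<epsilon>
  proof -
    define \<epsilon>1 where "\<epsilon>1 = \<epsilon> / 4"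
    define \<kappa> where "\<kappa> = \<epsilon> / (4 * C)"
    have \<epsilon>1: "0 < \<epsilon>1" and \<kappa>: "0 < \<kappa>" using \<epsilon> C(1) by (auto simp: \<epsilon>1_def \<kappa>_def)
    obtain F where F: "finite F" "F \<subseteq> \<Omega>"
        and uc: "\<And>g u. g \<in> carrier G \<Longrightarrow> u \<in> fixer F \<Longrightarrow> \<bar>\<phi> (g \<otimes> u) - \<phi> g\<bar> \<le> \<epsilon>1"
      using harmonic_uniformly_continuous[OF so \<phi>h \<epsilon>1] by metis
    obtain n where n: "step_dependence F n \<le> ennreal \<kappa>"
      using step_dependence_small[OF sub F \<kappa>] .
    (* a representative of all group elements that put F into position y *)
    define z where "z y = (SOME g. g \<in> carrier G \<and> place F g = y)" for y
    (* adding C makes the function nonnegative, as needed for integrals in the extended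
       nonnegative reals; the value at positions that no group element attains is irrelevant, as
       they have probability zero *)
    define \<psi> where "\<psi> y = (if \<exists>g\<in>carrier G. place F g = y then \<phi> (z y) + C else 0)" for y
    have \<psi>0: "0 \<le> \<psi> y" "\<psi> y \<le> 2 * C" for y
    proof -
      have "0 \<le> \<psi> y \<and> \<psi> y \<le> 2 * C"
      proof (cases "\<exists>g\<in>carrier G. place F g = y")
        case True
        then have "z y \<in> carrier G" unfolding z_def by (metis (mono_tags, lifting) someI_ex)
        then show ?thesis using C(2)[of "z y"] True by (auto simp: \<psi>_def abs_le_iff)
      qed (use C(1) in \<open>simp add: \<psi>_def\<close>)
      then show "0 \<le> \<psi> y" "\<psi> y \<le> 2 * C" by auto
    qed
    have \<psi>close: "\<bar>\<psi> (place F g) - (\<phi> g + C)\<bar> \<le> \<epsilon>1" if g: "g \<in> carrier G" for g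
    proof -
      have ex: "\<exists>h\<in>carrier G. place F h = place F g" using g by auto
      then have z: "z (place F g) \<in> carrier G" "place F (z (place F g)) = place F g"
        unfolding z_def by (metis (mono_tags, lifting) someI_ex)+
      define u where "u = inv g \<otimes> z (place F g)"
      have "act (z (place F g)) w = act g w" if "w \<in> F" for w
        using z(2) that by (metis place_def restrict_apply')
      then have "u \<in> fixer F"
        using F g z(1) by (auto simp: u_def fixer_def act_mult act_inv subset_iff)
      then have "\<bar>\<phi> (g \<otimes> u) - \<phi> g\<bar> \<le> \<epsilon>1" by (rule uc[OF g])
      moreover have "g \<otimes> u = z (place F g)" using g z(1) by (simp add: u_def m_assoc[symmetric])
      ultimately show ?thesis using ex by (simp add: \<psi>_def)
    qed
    (* the mean of \<psi> over the position after m steps from x *)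
    define I where "I m x = (\<integral>\<^sup>+y. ennreal (\<psi> y) * ennreal (place_prob F m x y) \<partial>count_space (F \<rightarrow>\<^sub>E \<Omega>))" for m x
    have \<phi>I: "ennreal (\<phi> x + C) \<le> ennreal \<epsilon>1 + I m x" "I m x \<le> ennreal (\<phi> x + C) + ennreal \<epsilon>1"
      if x: "x \<in> carrier G" for m x
    proof -
      interpret L: prob_space "law m" by (rule prob_space_law)
      have int: "integrable (law m) (\<lambda>h. \<phi> (x \<otimes> h))"
        using C(2) x by (intro integrable_law_bounded[where C=C] measurable_compose[OF const_mult_measurable[OF x] \<phi>m]) auto
      have "(\<integral>\<^sup>+h. ennreal (\<phi> (x \<otimes> h) + C) \<partial>law m) = ennreal (\<integral>h. \<phi> (x \<otimes> h) + C \<partial>law m)"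
      proof (rule nn_integral_eq_integral)
        show "AE h in law m. 0 \<le> \<phi> (x \<otimes> h) + C"
        proof (rule AE_I2)
          fix h assume "h \<in> space (law m)"
          then have "x \<otimes> h \<in> carrier G" using x by simp
          then show "0 \<le> \<phi> (x \<otimes> h) + C" using C(2)[of "x \<otimes> h"] by linarith
        qed
      qed (use int in simp)
      also have "(\<integral>h. \<phi> (x \<otimes> h) + C \<partial>law m) = \<phi> x + C"
        using int harmonic_law[OF \<phi>h x, of m] by (simp add: measure_law_carrier)
      finally have eq: "(\<integral>\<^sup>+h. ennreal (\<phi> (x \<otimes> h) + C) \<partial>law m) = ennreal (\<phi> x + C)" .
      have I: "I m x = (\<integral>\<^sup>+h. ennreal (\<psi> (place F (x \<otimes> h))) \<partial>law m)"
        unfolding I_def by (rule nn_integral_place[OF F x, symmetric])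
      have pm: "(\<lambda>h. ennreal (\<psi> (place F (x \<otimes> h)))) \<in> borel_measurable (law m)"
        unfolding measurable_law
        by (rule measurable_compose[OF measurable_compose[OF const_mult_measurable[OF x] place_measurable[OF F]]]) simp
      have fm: "(\<lambda>h. ennreal (\<phi> (x \<otimes> h) + C)) \<in> borel_measurable (law m)"
        unfolding measurable_law using measurable_compose[OF const_mult_measurable[OF x] \<phi>m] by simp
      have "ennreal (\<phi> x + C) \<le> (\<integral>\<^sup>+h. ennreal \<epsilon>1 + ennreal (\<psi> (place F (x \<otimes> h))) \<partial>law m)"
        unfolding eq[symmetric]
      proof (intro nn_integral_mono)
        fix h assume "h \<in> space (law m)"
        then have "x \<otimes> h \<in> carrier G" using x by simp
        have "ennreal (\<phi> (x \<otimes> h) + C) \<le> ennreal (\<epsilon>1 + \<psi> (place F (x \<otimes> h)))"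
          using \<psi>close[OF \<open>x \<otimes> h \<in> carrier G\<close>] by (intro ennreal_leI) (simp add: abs_le_iff)
        also have "\<dots> = ennreal \<epsilon>1 + ennreal (\<psi> (place F (x \<otimes> h)))"
          using \<epsilon>1 \<psi>0 by (intro ennreal_plus) auto
        finally show "ennreal (\<phi> (x \<otimes> h) + C) \<le> ennreal \<epsilon>1 + ennreal (\<psi> (place F (x \<otimes> h)))" .
      qed
      also have "\<dots> = ennreal \<epsilon>1 + I m x"
        unfolding I using pm by (simp add: nn_integral_add emeasure_law_carrier space_law del: conv_power.simps)
      finally show "ennreal (\<phi> x + C) \<le> ennreal \<epsilon>1 + I m x" .
      have "I m x \<le> (\<integral>\<^sup>+h. ennreal (\<phi> (x \<otimes> h) + C) + ennreal \<epsilon>1 \<partial>law m)"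
        unfolding I
      proof (intro nn_integral_mono)
        fix h assume "h \<in> space (law m)"
        then have xh: "x \<otimes> h \<in> carrier G" using x by simp
        have "ennreal (\<psi> (place F (x \<otimes> h))) \<le> ennreal ((\<phi> (x \<otimes> h) + C) + \<epsilon>1)"
          using \<psi>close[OF xh] by (intro ennreal_leI) (simp add: abs_le_iff)
        also have "\<dots> = ennreal (\<phi> (x \<otimes> h) + C) + ennreal \<epsilon>1"
          using \<epsilon>1 C(2)[OF xh] by (intro ennreal_plus) auto
        finally show "ennreal (\<psi> (place F (x \<otimes> h))) \<le> ennreal (\<phi> (x \<otimes> h) + C) + ennreal \<epsilon>1" .
      qed
      also have "\<dots> = ennreal (\<phi> x + C) + ennreal \<epsilon>1"
        unfolding eq[symmetric] using fm by (simp add: nn_integral_add emeasure_law_carrier space_law del: conv_power.simps)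
      finally show "I m x \<le> ennreal (\<phi> x + C) + ennreal \<epsilon>1" .
    qed
    define S where "S x = (\<integral>\<^sup>+y. ennreal \<bar>place_prob F n x y - place_prob F (Suc n) \<one> y\<bar> \<partial>count_space (F \<rightarrow>\<^sub>E \<Omega>))" for x
    have II: "I m x \<le> I m' x' + ennreal (2 * C) * (\<integral>\<^sup>+y. ennreal \<bar>place_prob F m x y - place_prob F m' x' y\<bar> \<partial>count_space (F \<rightarrow>\<^sub>E \<Omega>))"
      for m x m' x'
    proof -
      have "I m x \<le> (\<integral>\<^sup>+y. ennreal (\<psi> y) * ennreal (place_prob F m' x' y)
          + ennreal (2 * C) * ennreal \<bar>place_prob F m x y - place_prob F m' x' y\<bar> \<partial>count_space (F \<rightarrow>\<^sub>E \<Omega>))"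
        unfolding I_def
      proof (intro nn_integral_mono)
        fix y
        let ?p = "place_prob F m x y" and ?q = "place_prob F m' x' y"
        have "\<psi> y * ?p \<le> \<psi> y * (?q + \<bar>?p - ?q\<bar>)" using \<psi>0 by (intro mult_left_mono) auto
        also have "\<dots> \<le> \<psi> y * ?q + 2 * C * \<bar>?p - ?q\<bar>"
          using \<psi>0(2)[of y] by (simp add: distrib_left mult_right_mono)
        finally have "ennreal (\<psi> y * ?p) \<le> ennreal (\<psi> y * ?q + 2 * C * \<bar>?p - ?q\<bar>)" by (rule ennreal_leI)
        then show "ennreal (\<psi> y) * ennreal ?p \<le> ennreal (\<psi> y) * ennreal ?q + ennreal (2 * C) * ennreal \<bar>?p - ?q\<bar>"
          using \<psi>0(1)[of y] C(1) place_prob_bounds[OF F] by (simp add: ennreal_plus ennreal_mult)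
      qed
      also have "\<dots> = I m' x' + ennreal (2 * C) * (\<integral>\<^sup>+y. ennreal \<bar>place_prob F m x y - place_prob F m' x' y\<bar> \<partial>count_space (F \<rightarrow>\<^sub>E \<Omega>))"
        unfolding I_def by (simp add: nn_integral_add nn_integral_cmult)
      finally show ?thesis .
    qed
    have bound: "ennreal \<bar>\<phi> x - \<phi> \<one>\<bar> \<le> ennreal (2 * \<epsilon>1) + ennreal (2 * C) * S x" if x: "x \<in> carrier G" for x
    proof -
      have cmp: "ennreal (\<phi> g + C) \<le> ennreal (\<phi> g' + C) + (ennreal (2 * \<epsilon>1) + ennreal (2 * C) * S x)"
        if "ennreal (\<phi> g + C) \<le> ennreal \<epsilon>1 + I m g" "I m g \<le> I m' g' + ennreal (2 * C) * S x"
          "I m' g' \<le> ennreal (\<phi> g' + C) + ennreal \<epsilon>1" for g g' m m'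
      proof -
        have "ennreal (\<phi> g + C) \<le> ennreal \<epsilon>1 + (ennreal (\<phi> g' + C) + ennreal \<epsilon>1 + ennreal (2 * C) * S x)"
          using that by (meson add_left_mono add_right_mono order_trans)
        also have "\<dots> = ennreal (\<phi> g' + C) + ((ennreal \<epsilon>1 + ennreal \<epsilon>1) + ennreal (2 * C) * S x)"
          by (simp add: ac_simps)
        also have "ennreal \<epsilon>1 + ennreal \<epsilon>1 = ennreal (2 * \<epsilon>1)" using \<epsilon>1 by (simp add: ennreal_plus[symmetric] del: ennreal_plus)
        finally show ?thesis .
      qed
      have S': "S x = (\<integral>\<^sup>+y. ennreal \<bar>place_prob F (Suc n) \<one> y - place_prob F n x y\<bar> \<partial>count_space (F \<rightarrow>\<^sub>E \<Omega>))"
        unfolding S_def by (simp add: abs_minus_commute)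
      have 1: "ennreal (\<phi> x + C) \<le> ennreal (\<phi> \<one> + C) + (ennreal (2 * \<epsilon>1) + ennreal (2 * C) * S x)"
        by (rule cmp[OF \<phi>I(1)[OF x, of n] II[of n x "Suc n" \<one>, folded S_def] \<phi>I(2)[OF one_closed]])
      have 2: "ennreal (\<phi> \<one> + C) \<le> ennreal (\<phi> x + C) + (ennreal (2 * \<epsilon>1) + ennreal (2 * C) * S x)"
        by (rule cmp[OF \<phi>I(1)[OF one_closed, of "Suc n"] II[of "Suc n" \<one> n x, folded S'] \<phi>I(2)[OF x]])
      show ?thesis
      proof (cases "ennreal (2 * \<epsilon>1) + ennreal (2 * C) * S x = \<infinity>")
        case False
        then obtain s where s: "0 \<le> s" "ennreal (2 * \<epsilon>1) + ennreal (2 * C) * S x = ennreal s"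
          by (metis ennreal_cases infinity_ennreal_def)
        have nn: "0 \<le> \<phi> x + C" "0 \<le> \<phi> \<one> + C" using C(2)[OF x] C(2)[OF one_closed] by auto
        have "\<phi> x + C \<le> \<phi> \<one> + C + s" "\<phi> \<one> + C \<le> \<phi> x + C + s"
          using 1 2 s(1) nn unfolding s(2) by (simp_all add: ennreal_plus[symmetric] del: ennreal_plus)
        then show ?thesis unfolding s(2) by (intro ennreal_leI) auto
      qed simp
    qed
    have Sm: "S \<in> borel_measurable \<mu>"
      unfolding S_def measurable_step
      by (rule borel_measurable_nn_integral_count_space[OF countable_places[OF F]])
         (use place_prob_measurable[OF F] in simp)
    have "(\<integral>\<^sup>+x. ennreal \<bar>\<phi> x - \<phi> \<one>\<bar> \<partial>\<mu>) \<le> (\<integral>\<^sup>+x. ennreal (2 * \<epsilon>1) + ennreal (2 * C) * S x \<partial>\<mu>)"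
      by (intro nn_integral_mono bound) simp
    also have "\<dots> = ennreal (2 * \<epsilon>1) + ennreal (2 * C) * step_dependence F n"
      using Sm unfolding step_dependence_def S_def[symmetric]
      by (simp add: nn_integral_add nn_integral_cmult emeasure_carrier)
    also have "\<dots> \<le> ennreal (2 * \<epsilon>1) + ennreal (2 * C) * ennreal \<kappa>"
      using n by (intro add_left_mono mult_left_mono) auto
    also have "\<dots> = ennreal (2 * \<epsilon>1 + 2 * C * \<kappa>)"
      using \<epsilon>1 C(1) \<kappa> by (simp add: ennreal_plus ennreal_mult)
    also have "2 * \<epsilon>1 + 2 * C * \<kappa> = \<epsilon>" using C(1) by (simp add: \<epsilon>1_def \<kappa>_def)
    finally show ?thesis .
  qed
  have "(\<integral>\<^sup>+x. ennreal \<bar>\<phi> x - \<phi> \<one>\<bar> \<partial>\<mu>) \<le> 0"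
    by (rule ennreal_le_epsilon) (use key in simp)
  then have "AE x in \<mu>. ennreal \<bar>\<phi> x - \<phi> \<one>\<bar> = 0"
    using \<phi>m by (subst (asm) le_zero_eq, subst (asm) nn_integral_0_iff_AE) (simp_all add: measurable_step)
  then show ?thesis
    by (rule AE_mp, intro AE_I2 impI) (use k in \<open>simp add: \<phi>_def\<close>)
qed

text \<open>
  The elements \<open>x\<close> with \<open>f (k \<otimes> x) = f k\<close> for all
  \<open>k\<close> are closed under multiplication, they form a closed set because
  \<open>f\<close> is continuous, and they contain the support of \<open>\<mu>\<close> by
  \<open>harmonic_step_constant\<close>.
\<close>

lemma harmonic_constant_on_semigroup:
  assumes sub: sublinear_cost and so: "spread_out G X \<mu>"
    and f: "f \<in> bounded_harmonic G X \<mu>" and g: "g \<in> closed_semigroup G X \<mu>"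
  shows "f g = f \<one>"
proof -
  define S where "S = {x \<in> carrier G. \<forall>k\<in>carrier G. f (k \<otimes> x) = f k}"
  have near: "\<exists>F. finite F \<and> F \<subseteq> \<Omega> \<and> (\<forall>h\<in>carrier G. (\<forall>w\<in>F. act h w = act x w) \<longrightarrow> f (k \<otimes> h) \<noteq> f k)"
    if x: "x \<in> carrier G" and k: "k \<in> carrier G" and ne: "f (k \<otimes> x) \<noteq> f k" for x k
  proof -
    define \<epsilon> where "\<epsilon> = \<bar>f (k \<otimes> x) - f k\<bar> / 2"
    have \<epsilon>: "0 < \<epsilon>" using ne by (simp add: \<epsilon>_def)
    obtain F where F: "finite F" "F \<subseteq> \<Omega>"
        and uc: "\<And>g u. g \<in> carrier G \<Longrightarrow> u \<in> fixer F \<Longrightarrow> \<bar>f (g \<otimes> u) - f g\<bar> \<le> \<epsilon>"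
      using harmonic_uniformly_continuous[OF so f \<epsilon>] by metis
    have "f (k \<otimes> h) \<noteq> f k" if h: "h \<in> carrier G" "\<forall>w\<in>F. act h w = act x w" for h
    proof
      assume eq: "f (k \<otimes> h) = f k"
      have "inv x \<otimes> h \<in> fixer F"
        using F h x by (auto simp: fixer_def act_mult act_inv subset_iff)
      then have "\<bar>f (k \<otimes> x \<otimes> (inv x \<otimes> h)) - f (k \<otimes> x)\<bar> \<le> \<epsilon>" using k x by (intro uc) auto
      moreover have "k \<otimes> x \<otimes> (inv x \<otimes> h) = k \<otimes> h"
        using k x h(1) by (metis inv_closed m_assoc m_closed r_inv l_one)
      ultimately have "\<bar>f k - f (k \<otimes> x)\<bar> \<le> \<epsilon>" using eq by simp
      then show False using \<epsilon> by (simp add: \<epsilon>_def abs_minus_commute)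
    qed
    then show ?thesis using F by blast
  qed
  have "closedin X S"
    unfolding closedin_def
  proof
    show "S \<subseteq> topspace X" by (auto simp: S_def)
    show "openin X (topspace X - S)"
      unfolding openin_iff
    proof (intro conjI ballI)
      fix x assume "x \<in> topspace X - S"
      then obtain k where k: "x \<in> carrier G" "k \<in> carrier G" "f (k \<otimes> x) \<noteq> f k" by (auto simp: S_def)
      obtain F where F: "finite F" "F \<subseteq> \<Omega>"
        and ne: "\<forall>h\<in>carrier G. (\<forall>w\<in>F. act h w = act x w) \<longrightarrow> f (k \<otimes> h) \<noteq> f k"
        using near[OF k] by blast
      have "h \<in> topspace X - S" if "h \<in> carrier G" "\<forall>w\<in>F. act h w = act x w" for h
        using ne that k(2) by (simp add: S_def) blast
      then show "\<exists>F. finite F \<and> F \<subseteq> \<Omega> \<and> (\<forall>h\<in>carrier G. (\<forall>w\<in>F. act h w = act x w) \<longrightarrow> h \<in> topspace X - S)"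
        using F by blast
    qed auto
  qed
  moreover have "support X \<mu> \<subseteq> S"
  proof
    fix x assume x: "x \<in> support X \<mu>"
    then have xc: "x \<in> carrier G" by (simp add: support_def)
    have "f (k \<otimes> x) = f k" if k: "k \<in> carrier G" for k
    proof (rule ccontr)
      assume "f (k \<otimes> x) \<noteq> f k"
      from near[OF xc k this] obtain F where F: "finite F" "F \<subseteq> \<Omega>"
        "\<forall>h\<in>carrier G. (\<forall>w\<in>F. act h w = act x w) \<longrightarrow> f (k \<otimes> h) \<noteq> f k" by blast
      define U where "U = {h \<in> carrier G. \<forall>w\<in>F. act h w = act x w}"
      have "openin X U" unfolding U_def by (rule openin_agree[OF F(1,2) xc])
      moreover have "x \<in> U" using xc by (simp add: U_def)
      ultimately have "0 < emeasure \<mu> U" "U \<in> sets \<mu>"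
        using x borel_of_open by (auto simp: support_def sets_step)
      moreover have "AE h in \<mu>. h \<notin> U"
        using harmonic_step_constant[OF sub so f k] by (rule AE_mp, intro AE_I2 impI) (use F(3) in \<open>auto simp: U_def\<close>)
      ultimately show False
        using AE_iff_measurable[of U \<mu> "\<lambda>h. h \<notin> U"] sets.sets_into_space by (auto simp: U_def)
    qed
    then show "x \<in> S" using xc by (simp add: S_def)
  qed
  moreover have "\<forall>x\<in>S. \<forall>y\<in>S. x \<otimes> y \<in> S"
    by (auto simp: S_def m_assoc[symmetric])
  ultimately have "closed_semigroup G X \<mu> \<subseteq> S" unfolding closed_semigroup_def by blast
  then have "g \<in> S" using g by blast
  then have "g \<in> carrier G" "f (\<one> \<otimes> g) = f \<one>" unfolding S_def by blast+
  then show ?thesis by simp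
qed

end

section \<open>Trees as genealogies\<close>

text \<open>
  A homogeneous tree with a distinguished end is a genealogy: the parent of a vertex is the next
  vertex on the ray towards the end. Automorphisms that fix the end are the bijections that
  commute with the parent map.
\<close>

locale parent_tree =
  fixes V :: "'v set" and p :: "'v \<Rightarrow> 'v" and root :: 'v and q :: nat
  assumes root_in: "root \<in> V"
    and parent_closed: "v \<in> V \<Longrightarrow> p v \<in> V"
    and acyclic: "v \<in> V \<Longrightarrow> (p ^^ n) v = v \<Longrightarrow> n = 0"
    and confluence: "u \<in> V \<Longrightarrow> v \<in> V \<Longrightarrow> \<exists>m n. (p ^^ m) u = (p ^^ n) v"
    and finite_children: "v \<in> V \<Longrightarrow> finite {w \<in> V. p w = v}"
    and card_children: "v \<in> V \<Longrightarrow> card {w \<in> V. p w = v} = q"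
    and two_children: "2 \<le> q"
begin

text \<open>
  The geodesic from the root to \<open>v\<close> climbs to their first common ancestor and then
  descends; \<open>climb v\<close> and \<open>descent v\<close> are the lengths of the two parts.
  Their difference \<open>height v\<close> is the Busemann function of the end, which increases
  away from the end.
\<close>

definition climb :: "'v \<Rightarrow> nat" where
  "climb v = (LEAST m. \<exists>n. (p ^^ m) root = (p ^^ n) v)"

definition descent :: "'v \<Rightarrow> nat" where
  "descent v = (LEAST n. \<exists>m. (p ^^ m) root = (p ^^ n) v)"

definition height :: "'v \<Rightarrow> int" where
  "height v = int (descent v) - int (climb v)"

definition desc :: "'v \<Rightarrow> 'v set" where
  "desc w = {v \<in> V. \<exists>n. (p ^^ n) v = w}"

lemma ancestor_closed: "v \<in> V \<Longrightarrow> (p ^^ n) v \<in> V"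
  by (induction n) (auto intro: parent_closed)

lemma ancestor_inj:
  assumes "v \<in> V" "(p ^^ m) v = (p ^^ n) v"
  shows "m = n"
  using assms(2)
proof (induction m n rule: linorder_wlog)
  case (le m n)
  have "(p ^^ (n - m)) ((p ^^ m) v) = (p ^^ m) v"
    using le by (metis comp_apply funpow_add le_add_diff_inverse2)
  then show ?case using acyclic[OF ancestor_closed[OF assms(1)]] le(1) by fastforce
qed simp

lemma funpow_plus: "(p ^^ (m + n)) v = (p ^^ m) ((p ^^ n) v)"
  by (simp add: funpow_add)

lemma funpow_diff: "n \<le> m \<Longrightarrow> (p ^^ m) v = (p ^^ (m - n)) ((p ^^ n) v)"
  by (metis comp_apply funpow_add le_add_diff_inverse2)

lemma meet_trans:
  assumes "(p ^^ a) u = (p ^^ b) v" "(p ^^ c) v = (p ^^ d) w"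
  shows "b \<le> c \<Longrightarrow> (p ^^ (c - b + a)) u = (p ^^ d) w"
    and "c \<le> b \<Longrightarrow> (p ^^ a) u = (p ^^ (b - c + d)) w"
  using assms funpow_diff[of b c v] funpow_diff[of c b v] by (simp_all only: funpow_plus)

lemma climb_le: "(p ^^ m) root = (p ^^ n) v \<Longrightarrow> climb v \<le> m"
  unfolding climb_def by (rule Least_le) auto

lemma descent_le: "(p ^^ m) root = (p ^^ n) v \<Longrightarrow> descent v \<le> n"
  unfolding descent_def by (rule Least_le) auto

lemma join:
  assumes v: "v \<in> V"
  shows "(p ^^ climb v) root = (p ^^ descent v) v"
proof -
  obtain m0 n0 where "(p ^^ m0) root = (p ^^ n0) v" using confluence[OF root_in v] by auto
  then have "\<exists>n. (p ^^ climb v) root = (p ^^ n) v" "\<exists>m. (p ^^ m) root = (p ^^ descent v) v"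
    unfolding climb_def descent_def by (auto intro: LeastI_ex[where P="\<lambda>m. \<exists>n. (p ^^ m) root = (p ^^ n) v"]
      LeastI_ex[where P="\<lambda>n. \<exists>m. (p ^^ m) root = (p ^^ n) v"])
  then obtain m n where n: "(p ^^ climb v) root = (p ^^ n) v" and m: "(p ^^ m) root = (p ^^ descent v) v"
    by blast
  have "climb v \<le> m" "descent v \<le> n" using climb_le[OF m] descent_le[OF n] by auto
  have "(p ^^ descent v) v = (p ^^ (m - climb v)) ((p ^^ n) v)"
    using m n funpow_diff[OF \<open>climb v \<le> m\<close>, of root] by simp
  then have "descent v = m - climb v + n" using ancestor_inj[OF v] by (metis funpow_plus)
  then have "n = descent v" using \<open>descent v \<le> n\<close> by simp
  then show ?thesis using n by simp
qed

lemma common_ancestor_height: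
  assumes v: "v \<in> V" and eq: "(p ^^ m) root = (p ^^ n) v"
  shows "height v = int n - int m" "m - climb v = n - descent v" "climb v \<le> m" "descent v \<le> n"
proof -
  show le: "climb v \<le> m" "descent v \<le> n" using climb_le[OF eq] descent_le[OF eq] by auto
  have "(p ^^ n) v = (p ^^ (m - climb v + descent v)) v"
    using eq join[OF v] funpow_diff[OF le(1), of root] by (simp add: funpow_plus)
  then have "n = m - climb v + descent v" by (rule ancestor_inj[OF v])
  then show "height v = int n - int m" "m - climb v = n - descent v"
    using le by (auto simp: height_def)
qed

lemma height_parent: "v \<in> V \<Longrightarrow> height (p v) = height v - 1"
proof -
  assume v: "v \<in> V"
  have "(p ^^ climb v) root = (p ^^ descent v) v" by (rule join[OF v])
  then have "(p ^^ Suc (climb v)) root = (p ^^ descent v) (p v)"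
    by (simp add: funpow_swap1)
  from common_ancestor_height(1)[OF parent_closed[OF v] this] show ?thesis by (simp add: height_def)
qed

lemma height_ancestor: "v \<in> V \<Longrightarrow> height ((p ^^ n) v) = height v - int n"
  by (induction n) (auto simp: height_parent ancestor_closed)

definition equivariant :: "('v \<Rightarrow> 'v) \<Rightarrow> bool" where
  "equivariant g \<longleftrightarrow> (\<forall>v\<in>V. g v \<in> V \<and> g (p v) = p (g v))"

lemma equivariant_funpow: "equivariant g \<Longrightarrow> v \<in> V \<Longrightarrow> g ((p ^^ n) v) = (p ^^ n) (g v)"
  by (induction n) (auto simp: equivariant_def ancestor_closed)

lemma equivariant_closed: "equivariant g \<Longrightarrow> v \<in> V \<Longrightarrow> g v \<in> V"
  by (simp add: equivariant_def)

lemma height_equivariant: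
  assumes g: "equivariant g" and v: "v \<in> V"
  shows "height (g v) = height v + height (g root)"
proof -
  have gr: "g root \<in> V" and gv: "g v \<in> V" using equivariant_closed[OF g] root_in v by auto
  have "(p ^^ climb v) (g root) = (p ^^ descent v) (g v)"
    using join[OF v] equivariant_funpow[OF g] root_in v by metis
  then have "height (g root) - int (climb v) = height (g v) - int (descent v)"
    using height_ancestor[OF gr] height_ancestor[OF gv] by metis
  then show ?thesis by (simp add: height_def[of v])
qed

text \<open>
  One reaches \<open>g v\<close> by going from the root to \<open>g root\<close> and then along
  the image of the path to \<open>v\<close>. The climb of the second path cancels against the
  descent of the first one as far as it can. This makes the descent of a product of group elements
  behave like a walk reflected at zero.
\<close>

lemma descent_equivariant_le:
  assumes g: "equivariant g" and v: "v \<in> V"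
  shows "climb v \<le> descent (g root) \<Longrightarrow> int (descent (g v)) \<le> int (descent (g root)) + height v"
    and "descent (g root) < climb v \<Longrightarrow> descent (g v) \<le> descent v"
proof -
  have gr: "g root \<in> V" using equivariant_closed[OF g root_in] .
  have e: "(p ^^ climb v) (g root) = (p ^^ descent v) (g v)"
    using join[OF v] equivariant_funpow[OF g] root_in v by metis
  note j = join[OF gr]
  show "int (descent (g v)) \<le> int (descent (g root)) + height v" if le: "climb v \<le> descent (g root)"
  proof -
    have "(p ^^ climb (g root)) root = (p ^^ (descent (g root) - climb v + descent v)) (g v)"
      using le by (rule meet_trans(2)[OF j e])
    then have "descent (g v) \<le> descent (g root) - climb v + descent v" by (rule descent_le)
    then show ?thesis using le by (simp add: height_def)
  qed
  show "descent (g v) \<le> descent v" if lt: "descent (g root) < climb v"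
  proof -
    have "(p ^^ (climb v - descent (g root) + climb (g root))) root = (p ^^ descent v) (g v)"
      using lt by (intro meet_trans(1)[OF j e]) simp
    then show ?thesis by (rule descent_le)
  qed
qed

lemma descent_equivariant_le': "equivariant g \<Longrightarrow> v \<in> V \<Longrightarrow> descent (g v) \<le> descent (g root) + descent v"
  using descent_equivariant_le[of g v] by (cases "climb v \<le> descent (g root)") (auto simp: height_def)

lemma climb_equivariant_le:
  assumes g: "equivariant g" and v: "v \<in> V"
  shows "int (climb (g v)) \<le> max (int (climb (g root))) (int (climb v) - height (g root))"
proof -
  have gr: "g root \<in> V" using equivariant_closed[OF g root_in] .
  have e: "(p ^^ climb v) (g root) = (p ^^ descent v) (g v)"
    using join[OF v] equivariant_funpow[OF g] root_in v by metis
  note j = join[OF gr]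
  show ?thesis
  proof (cases "descent (g root) \<le> climb v")
    case True
    have "(p ^^ (climb v - descent (g root) + climb (g root))) root = (p ^^ descent v) (g v)"
      using True by (rule meet_trans(1)[OF j e])
    then have "climb (g v) \<le> climb v - descent (g root) + climb (g root)" by (rule climb_le)
    then show ?thesis using True by (simp add: height_def)
  next
    case False
    then have le: "climb v \<le> descent (g root)" by simp
    have "(p ^^ climb (g root)) root = (p ^^ (descent (g root) - climb v + descent v)) (g v)"
      using le by (rule meet_trans(2)[OF j e])
    then have "climb (g v) \<le> climb (g root)" by (rule climb_le)
    then show ?thesis by simp
  qed
qed

lemma climb_equivariant_le': "equivariant g \<Longrightarrow> v \<in> V \<Longrightarrow> climb (g v) \<le> climb (g root) + climb v"
  using climb_equivariant_le[of g v] by (auto simp: height_def)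

lemma desc_iff_climb: "v \<in> V \<Longrightarrow> v \<in> desc ((p ^^ m) root) \<longleftrightarrow> climb v \<le> m"
proof
  assume v: "v \<in> V"
  show "climb v \<le> m" if "v \<in> desc ((p ^^ m) root)"
  proof -
    obtain n where "(p ^^ n) v = (p ^^ m) root" using \<open>v \<in> desc ((p ^^ m) root)\<close> by (auto simp: desc_def)
    then show ?thesis by (metis climb_le)
  qed
  show "v \<in> desc ((p ^^ m) root)" if "climb v \<le> m"
  proof -
    have "(p ^^ m) root = (p ^^ (m - climb v + descent v)) v"
      using join[OF v] funpow_diff[OF \<open>climb v \<le> m\<close>, of root] by (simp add: funpow_plus)
    then show ?thesis using v by (auto simp: desc_def)
  qed
qed

lemma desc_disjoint:
  assumes "u \<in> V" "v \<in> V" "height u = height v" "u \<noteq> v"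
  shows "desc u \<inter> desc v = {}"
proof -
  have False if "w \<in> V" "(p ^^ m) w = u" "(p ^^ n) w = v" for w m n
    using that assms height_ancestor[of w m] height_ancestor[of w n] by auto
  then show ?thesis unfolding desc_def by blast
qed

definition level_desc :: "'v \<Rightarrow> nat \<Rightarrow> 'v set" where
  "level_desc w n = {v \<in> V. (p ^^ n) v = w}"

lemma level_desc_card:
  assumes "w \<in> V"
  shows "finite (level_desc w n) \<and> card (level_desc w n) \<le> q ^ n"
proof (induction n)
  case 0
  have "level_desc w 0 \<subseteq> {w}" by (auto simp: level_desc_def)
  then show ?case using card_mono[of "{w}"] finite_subset[of _ "{w}"] by fastforce
next
  case (Suc n)
  have eq: "level_desc w (Suc n) = (\<Union>u\<in>level_desc w n. {v \<in> V. p v = u})"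
    by (auto simp: level_desc_def funpow_swap1 parent_closed)
  have "finite (level_desc w (Suc n))"
    unfolding eq using Suc finite_children by (auto simp: level_desc_def)
  moreover have "card (level_desc w (Suc n)) \<le> (\<Sum>u\<in>level_desc w n. card {v \<in> V. p v = u})"
    unfolding eq using Suc by (intro card_UN_le) auto
  moreover have "(\<Sum>u\<in>level_desc w n. card {v \<in> V. p v = u}) = card (level_desc w n) * q"
    using card_children by (simp add: level_desc_def)
  ultimately show ?case using Suc by (auto intro: order_trans simp: mult.commute)
qed

lemma countable_vertices: "countable V"
proof -
  have "V \<subseteq> (\<Union>m. \<Union>n. level_desc ((p ^^ m) root) n)"
  proof
    fix v assume "v \<in> V"
    then have "v \<in> level_desc ((p ^^ climb v) root) (descent v)" using join[of v] by (simp add: level_desc_def)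
    then show "v \<in> (\<Union>m. \<Union>n. level_desc ((p ^^ m) root) n)" by blast
  qed
  moreover have "countable (\<Union>m. \<Union>n. level_desc ((p ^^ m) root) n)"
  proof -
    have "countable (level_desc ((p ^^ m) root) n)" for m n
      using level_desc_card[OF ancestor_closed[OF root_in]] by (simp add: countable_finite)
    then show ?thesis by (intro countable_UN) auto
  qed
  ultimately show ?thesis by (rule countable_subset)
qed

text \<open>
  At most \<open>q ^ b\<close> vertices have climb \<open>a\<close> and descent \<open>b\<close>,
  so the sum is bounded by a product of two geometric series.
\<close>

lemma vertex_weights_summable:
  fixes s t :: real
  assumes s: "0 < s" and t: "ln q < t"
  shows "(\<integral>\<^sup>+v. ennreal (exp (- (s * climb v + t * descent v))) \<partial>count_space V) < \<infinity>"
proof -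
  define e where "e a b = ennreal (exp (- (s * real a + t * real b)))" for a b :: nat
  define I where "I v a b = e a b * indicator {v \<in> V. climb v = a \<and> descent v = b} v" for v :: 'v and a b
  have "(\<integral>\<^sup>+v. ennreal (exp (- (s * climb v + t * descent v))) \<partial>count_space V)
      = (\<integral>\<^sup>+v. \<integral>\<^sup>+a. \<integral>\<^sup>+b. I v a b \<partial>count_space UNIV \<partial>count_space UNIV \<partial>count_space V)"
  proof (intro nn_integral_cong)
    fix v assume "v \<in> space (count_space V)"
    then have v: "v \<in> V" by simp
    have "(\<integral>\<^sup>+a. \<integral>\<^sup>+b. I v a b \<partial>count_space UNIV \<partial>count_space UNIV)
        = (\<integral>\<^sup>+a. \<integral>\<^sup>+b. (e (climb v) (descent v) * indicator {climb v} a) * indicator {descent v} b \<partial>count_space UNIV \<partial>count_space UNIV)"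
      using v by (intro nn_integral_cong) (auto simp: I_def indicator_def)
    also have "\<dots> = e (climb v) (descent v)"
      by (simp add: nn_integral_cmult_indicator nn_integral_multc)
    finally show "ennreal (exp (- (s * climb v + t * descent v)))
        = (\<integral>\<^sup>+a. \<integral>\<^sup>+b. I v a b \<partial>count_space UNIV \<partial>count_space UNIV)" by (simp add: e_def)
  qed
  also have "\<dots> = (\<integral>\<^sup>+a. \<integral>\<^sup>+v. \<integral>\<^sup>+b. I v a b \<partial>count_space UNIV \<partial>count_space V \<partial>count_space UNIV)"
    by (rule nn_integral_count_space_nn_integral) auto
  also have "\<dots> = (\<integral>\<^sup>+a. \<integral>\<^sup>+b. \<integral>\<^sup>+v. I v a b \<partial>count_space V \<partial>count_space UNIV \<partial>count_space UNIV)"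
    by (intro nn_integral_cong nn_integral_count_space_nn_integral) auto
  also have "\<dots> \<le> (\<integral>\<^sup>+a. \<integral>\<^sup>+b. ennreal (exp (- s) ^ a) * ennreal ((q * exp (- t)) ^ b) \<partial>count_space UNIV \<partial>count_space UNIV)"
  proof (intro nn_integral_mono)
    fix a b :: nat
    have sub: "{v \<in> V. climb v = a \<and> descent v = b} \<subseteq> level_desc ((p ^^ a) root) b"
      using join by (auto simp: level_desc_def)
    have fin: "finite (level_desc ((p ^^ a) root) b)" "card (level_desc ((p ^^ a) root) b) \<le> q ^ b"
      using level_desc_card[OF ancestor_closed[OF root_in]] by auto
    have "(\<integral>\<^sup>+v. I v a b \<partial>count_space V) = e a b * emeasure (count_space V) {v \<in> V. climb v = a \<and> descent v = b}"
      unfolding I_def by (rule nn_integral_cmult_indicator) auto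
    also have "\<dots> = e a b * of_nat (card {v \<in> V. climb v = a \<and> descent v = b})"
      using finite_subset[OF sub fin(1)] by (subst emeasure_count_space) auto
    also have "\<dots> \<le> e a b * of_nat (q ^ b)"
      using card_mono[OF fin(1) sub] fin(2) by (intro mult_left_mono) (auto simp del: of_nat_power)
    also have "\<dots> = ennreal (exp (- s) ^ a) * ennreal ((q * exp (- t)) ^ b)"
      by (simp add: e_def ennreal_of_nat_eq_real_of_nat ennreal_mult[symmetric] exp_add exp_of_nat_mult power_mult_distrib
        exp_minus exp_diff mult_ac power_inverse divide_inverse flip: exp_of_nat2_mult del: of_nat_power)
    finally show "(\<integral>\<^sup>+v. I v a b \<partial>count_space V) \<le> ennreal (exp (- s) ^ a) * ennreal ((q * exp (- t)) ^ b)" .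
  qed
  also have "\<dots> = (\<integral>\<^sup>+a. ennreal (exp (- s) ^ a) \<partial>count_space UNIV) * (\<integral>\<^sup>+b. ennreal ((q * exp (- t)) ^ b) \<partial>count_space UNIV)"
    by (simp add: nn_integral_cmult nn_integral_multc)
  also have "\<dots> < \<infinity>"
  proof -
    have geo: "(\<integral>\<^sup>+a. ennreal (r ^ a) \<partial>count_space UNIV) < \<infinity>" if "0 \<le> r" "r < 1" for r :: real
      using that by (simp add: nn_integral_count_space_nat suminf_ennreal2 summable_geometric)
    have "q * exp (- t) < 1"
    proof -
      have "real q = exp (ln q)" using two_children by simp
      also have "\<dots> < exp t" using t by simp
      finally show ?thesis by (simp add: exp_minus field_simps)
    qed
    then show ?thesis using geo[of "exp (- s)"] geo[of "q * exp (- t)"] s by (simp add: ennreal_mult_less_top)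
  qed
  finally show ?thesis .
qed

lemma desc_height: "v \<in> desc w \<Longrightarrow> height w \<le> height v"
  using height_ancestor by (auto simp: desc_def)

section \<open>Exchanging subtrees\<close>

definition child :: "'v \<Rightarrow> nat \<Rightarrow> 'v" where
  "child v = (SOME f. bij_betw f {..<q} {w \<in> V. p w = v})"

lemma child_bij: "v \<in> V \<Longrightarrow> bij_betw (child v) {..<q} {w \<in> V. p w = v}"
proof -
  assume v: "v \<in> V"
  obtain f where "bij_betw f {0..<card {w \<in> V. p w = v}} {w \<in> V. p w = v}"
    using ex_bij_betw_nat_finite[OF finite_children[OF v]] by blast
  then have "\<exists>f. bij_betw f {..<q} {w \<in> V. p w = v}"
    using card_children[OF v] by (auto simp: lessThan_atLeast0)
  then show ?thesis unfolding child_def by (rule someI_ex)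
qed

lemma child_props:
  assumes "v \<in> V" "i < q"
  shows "child v i \<in> V" "p (child v i) = v"
  using bij_betwE[OF child_bij[OF assms(1)]] assms(2) by auto

lemma child_inj: "v \<in> V \<Longrightarrow> i < q \<Longrightarrow> j < q \<Longrightarrow> child v i = child v j \<Longrightarrow> i = j"
  using bij_betw_imp_inj_on[OF child_bij] by (auto dest: inj_onD)

text \<open>
  Numbering the children of every vertex labels the descendants of \<open>u\<close> by words over
  \<open>q\<close> letters; the letter of the last generation comes first.
\<close>

primrec word :: "'v \<Rightarrow> nat list \<Rightarrow> 'v" where
  "word u [] = u"
| "word u (i # ws) = child (word u ws) i"

abbreviation words :: "nat list set" where "words \<equiv> lists {..<q}"

lemma word_closed: "u \<in> V \<Longrightarrow> ws \<in> words \<Longrightarrow> word u ws \<in> V"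
  by (induction ws) (auto intro: child_props)

lemma word_parent: "u \<in> V \<Longrightarrow> i # ws \<in> words \<Longrightarrow> p (word u (i # ws)) = word u ws"
  using word_closed[of u ws] by (auto intro: child_props)

lemma word_ancestor: "u \<in> V \<Longrightarrow> ws \<in> words \<Longrightarrow> (p ^^ length ws) (word u ws) = u"
proof (induction ws)
  case (Cons i ws)
  then have "(p ^^ length ws) (p (word u (i # ws))) = u"
    using word_parent[of u i ws] by simp
  then show ?case by (simp add: funpow_swap1)
qed simp

lemma word_inj:
  assumes u: "u \<in> V"
  shows "ws \<in> words \<Longrightarrow> ws' \<in> words \<Longrightarrow> word u ws = word u ws' \<Longrightarrow> ws = ws'"
proof (induction ws arbitrary: ws')
  case Nil
  have "(p ^^ length ws') (word u ws') = u" by (rule word_ancestor[OF u Nil(2)])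
  then have "(p ^^ length ws') u = u" using Nil(3) by simp
  then show ?case using acyclic[OF u] by fastforce
next
  case (Cons i ws)
  have len: "length (i # ws) = length ws'"
  proof (rule ancestor_inj[OF word_closed[OF u Cons(2)]])
    show "(p ^^ length (i # ws)) (word u (i # ws)) = (p ^^ length ws') (word u (i # ws))"
      using word_ancestor[OF u Cons(2)] word_ancestor[OF u Cons(3)] Cons(4) by metis
  qed
  then obtain j ws'' where ws': "ws' = j # ws''" by (cases ws') auto
  have "word u ws = word u ws''"
    using word_parent[OF u Cons(2)] word_parent[OF u Cons(3)[unfolded ws']] Cons(4) ws' by simp
  then have eq: "ws = ws''" using Cons.IH[of ws''] Cons.prems(1,2) ws' by simp
  have "word u ws \<in> V" using Cons.prems(1) by (intro word_closed[OF u]) simp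
  then have "i = j" using child_inj[of "word u ws" i j] Cons.prems ws' eq by simp
  then show ?case using eq ws' by simp
qed

lemma word_surj: "x \<in> V \<Longrightarrow> (p ^^ n) x = u \<Longrightarrow> \<exists>ws\<in>words. word u ws = x"
proof (induction n arbitrary: x)
  case 0
  then show ?case by (intro bexI[of _ "[]"]) auto
next
  case (Suc n)
  have "(p ^^ n) (p x) = u" using Suc.prems(2) by (simp add: funpow_swap1)
  then obtain ws where ws: "ws \<in> words" "word u ws = p x"
    using Suc.IH[OF parent_closed[OF Suc.prems(1)]] by auto
  have "x \<in> child (p x) ` {..<q}"
    using child_bij[OF parent_closed[OF Suc.prems(1)]] Suc.prems(1) by (auto simp: bij_betw_def)
  then obtain i where "i < q" "x = child (p x) i" by auto
  then show ?case using ws by (intro bexI[of _ "i # ws"]) auto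
qed

lemma word_desc: "u \<in> V \<Longrightarrow> ws \<in> words \<Longrightarrow> word u ws \<in> desc u"
  unfolding desc_def using word_closed[of u ws] word_ancestor[of u ws] by blast

definition label :: "'v \<Rightarrow> 'v \<Rightarrow> nat list" where
  "label u x = (THE ws. ws \<in> words \<and> word u ws = x)"

lemma label_word: "u \<in> V \<Longrightarrow> ws \<in> words \<Longrightarrow> label u (word u ws) = ws"
  unfolding label_def using word_inj by (intro the_equality) auto

lemma desc_word:
  assumes "u \<in> V" "x \<in> desc u"
  obtains ws where "ws \<in> words" "x = word u ws"
proof -
  obtain n where "x \<in> V" "(p ^^ n) x = u" using assms(2) by (auto simp: desc_def)
  from word_surj[OF this] show thesis using that by blast
qed

text \<open>Exchange the subtrees below two siblings by matching descendants with the same word.\<close>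

lemma exists_swap:
  assumes z: "z1 \<in> V" "z2 \<in> V" "p z1 = p z2" "z1 \<noteq> z2"
  shows "\<exists>\<sigma>. equivariant \<sigma> \<and> bij_betw \<sigma> V V \<and> \<sigma> z1 = z2 \<and> (\<forall>x\<in>V. height x < height z1 \<longrightarrow> \<sigma> x = x)"
proof -
  define \<sigma> where "\<sigma> x = (if x \<in> desc z1 then word z2 (label z1 x)
      else if x \<in> desc z2 then word z1 (label z2 x) else x)" for x
  have h: "height z1 = height z2" using height_parent[OF z(1)] height_parent[OF z(2)] z(3) by simp
  have disj: "desc z1 \<inter> desc z2 = {}" by (rule desc_disjoint[OF z(1,2) h z(4)])
  have s1: "\<sigma> (word z1 ws) = word z2 ws" if "ws \<in> words" for ws
    using word_desc[OF z(1) that] label_word[OF z(1) that] by (simp add: \<sigma>_def)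
  have s2: "\<sigma> (word z2 ws) = word z1 ws" if "ws \<in> words" for ws
    using word_desc[OF z(2) that] label_word[OF z(2) that] disj by (auto simp: \<sigma>_def)
  have s3: "\<sigma> x = x" if "x \<notin> desc z1" "x \<notin> desc z2" for x using that by (simp add: \<sigma>_def)
  have cases: thesis if "\<And>ws. ws \<in> words \<Longrightarrow> x = word z1 ws \<Longrightarrow> thesis"
      "\<And>ws. ws \<in> words \<Longrightarrow> x = word z2 ws \<Longrightarrow> thesis" "x \<notin> desc z1 \<Longrightarrow> x \<notin> desc z2 \<Longrightarrow> thesis" for x thesis
    using that desc_word[OF z(1)] desc_word[OF z(2)] by metis
  have top: "p z1 \<notin> desc z1" "p z1 \<notin> desc z2"
    using desc_height[of "p z1" z1] desc_height[of "p z1" z2] height_parent[OF z(1)] h by auto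
  have closed: "\<sigma> x \<in> V" if x: "x \<in> V" for x
    by (rule cases[of x]) (use x s1 s2 s3 word_closed z in auto)
  have invol: "\<sigma> (\<sigma> x) = x" if x: "x \<in> V" for x
    by (rule cases[of x]) (use x s1 s2 s3 in auto)
  have comm: "\<sigma> (p x) = p (\<sigma> x)" if x: "x \<in> V" for x
  proof (rule cases[of x])
    fix ws assume ws: "ws \<in> words" "x = word z1 ws"
    show ?thesis
    proof (cases ws)
      case Nil
      then show ?thesis using ws s1[of "[]"] s3[OF top] z(3) by simp
    next
      case (Cons i ws')
      then have "ws' \<in> words" using ws(1) by simp
      then show ?thesis
        using s1[OF ws(1)] s1[of ws'] ws word_parent[OF z(1), of i ws'] word_parent[OF z(2), of i ws'] Cons by simp
    qed
  next
    fix ws assume ws: "ws \<in> words" "x = word z2 ws"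
    show ?thesis
    proof (cases ws)
      case Nil
      then show ?thesis using ws s2[of "[]"] s3[OF top] z(3) by simp
    next
      case (Cons i ws')
      then have "ws' \<in> words" using ws(1) by simp
      then show ?thesis
        using s2[OF ws(1)] s2[of ws'] ws word_parent[OF z(1), of i ws'] word_parent[OF z(2), of i ws'] Cons by simp
    qed
  next
    assume n: "x \<notin> desc z1" "x \<notin> desc z2"
    have up: "x \<in> desc w" if pw: "p x \<in> desc w" for w
    proof -
      obtain n where "(p ^^ n) (p x) = w" using pw by (auto simp: desc_def)
      then have "(p ^^ Suc n) x = w" by (simp add: funpow_swap1)
      then show ?thesis using x unfolding desc_def by blast
    qed
    show ?thesis using n s3 up by metis
  qed
  have "equivariant \<sigma>" using closed comm by (simp add: equivariant_def)
  moreover have "bij_betw \<sigma> V V" using closed invol by (intro bij_betwI[of _ _ _ \<sigma>]) auto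
  moreover have "\<sigma> z1 = z2" using s1[of "[]"] by simp
  moreover have "\<sigma> x = x" if "height x < height z1" for x
    using that h desc_height by (intro s3) force+
  ultimately show ?thesis by blast
qed

lemma sibling:
  assumes "v \<in> V"
  obtains w where "w \<in> V" "p w = p v" "w \<noteq> v"
proof -
  have "{w \<in> V. p w = p v} \<noteq> {v}"
    using card_children[OF parent_closed[OF assms]] two_children by auto
  then show thesis using that assms by blast
qed

text \<open>
  For \<open>t < N\<close>, exchange the ancestor of \<open>y\<close> in generation
  \<open>t\<close> with one of its siblings. The image of \<open>y\<close> then meets the
  ancestral line of \<open>y\<close> in generation \<open>t + 1\<close> and not earlier, so the
  images are different.
\<close>

lemma distinct_translates:
  assumes y: "y \<in> V"
  obtains \<sigma> where
    "\<forall>t<N. equivariant (\<sigma> t) \<and> bij_betw (\<sigma> t) V V \<and> height (\<sigma> t y) = height y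
      \<and> (\<forall>x\<in>V. height x \<le> height y - int N \<longrightarrow> \<sigma> t x = x)"
    "inj_on (\<lambda>t. \<sigma> t y) {..<N}"
proof -
  have "\<exists>s. equivariant s \<and> bij_betw s V V \<and> s ((p ^^ t) y) \<noteq> (p ^^ t) y \<and> p (s ((p ^^ t) y)) = (p ^^ Suc t) y
      \<and> (\<forall>x\<in>V. height x < height ((p ^^ t) y) \<longrightarrow> s x = x)" for t
  proof -
    have v: "(p ^^ t) y \<in> V" by (rule ancestor_closed[OF y])
    obtain w where w: "w \<in> V" "p w = p ((p ^^ t) y)" "w \<noteq> (p ^^ t) y" using sibling[OF v] .
    show ?thesis using exists_swap[OF v w(1) w(2)[symmetric] w(3)[symmetric]] w(2,3) by auto
  qed
  then obtain \<sigma> where \<sigma>: "\<And>t. equivariant (\<sigma> t)" "\<And>t. bij_betw (\<sigma> t) V V"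
      "\<And>t. \<sigma> t ((p ^^ t) y) \<noteq> (p ^^ t) y" "\<And>t. p (\<sigma> t ((p ^^ t) y)) = (p ^^ Suc t) y"
      "\<And>t x. x \<in> V \<Longrightarrow> height x < height ((p ^^ t) y) \<Longrightarrow> \<sigma> t x = x"
    by metis
  have anc: "(p ^^ Suc t) (\<sigma> t y) = (p ^^ Suc t) y" for t
    using \<sigma>(4)[of t] equivariant_funpow[OF \<sigma>(1) y, of t t] by simp
  have hgt: "height (\<sigma> t y) = height y" for t
    using height_ancestor[OF equivariant_closed[OF \<sigma>(1)[of t] y], of "Suc t"] height_ancestor[OF y, of "Suc t"] anc[of t]
    by simp
  have ne: "\<sigma> t y \<noteq> \<sigma> t' y" if "t < t'" for t t'
  proof
    assume eq: "\<sigma> t y = \<sigma> t' y"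
    have "(p ^^ t') (\<sigma> t y) = (p ^^ t') y"
      using funpow_diff[of "Suc t" t'] that anc[of t] by (metis Suc_leI)
    moreover have "(p ^^ t') (\<sigma> t' y) = \<sigma> t' ((p ^^ t') y)" using equivariant_funpow[OF \<sigma>(1) y] by simp
    ultimately show False using \<sigma>(3)[of t'] eq by simp
  qed
  show thesis
  proof (rule that[of \<sigma>])
    show "inj_on (\<lambda>t. \<sigma> t y) {..<N}" using ne by (intro inj_onI) (metis linorder_neqE_nat)
    show "\<forall>t<N. equivariant (\<sigma> t) \<and> bij_betw (\<sigma> t) V V \<and> height (\<sigma> t y) = height y
      \<and> (\<forall>x\<in>V. height x \<le> height y - int N \<longrightarrow> \<sigma> t x = x)"
      using \<sigma>(1,2,5) hgt height_ancestor[OF y] by auto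
  qed
qed

end

section \<open>A smoothed distance\<close>

text \<open>
  A convex function that agrees with \<open>b\<close> beyond \<open>t\<close> and has a continuous
  derivative vanishing at \<open>b = 0\<close>. Near zero, where a reflected walk is pushed
  upwards, its slope is small.
\<close>

definition lyapunov :: "real \<Rightarrow> real \<Rightarrow> real" where
  "lyapunov t b = (if b \<le> t then b\<^sup>2 / (2 * t) + t / 2 else b)"

definition lyapunov_slope :: "real \<Rightarrow> real \<Rightarrow> real" where
  "lyapunov_slope t b = min (b / t) 1"

lemma lyapunov_ge: "0 < t \<Longrightarrow> b \<le> lyapunov t b"
proof -
  assume t: "0 < t"
  have "0 \<le> (b - t)\<^sup>2 / (2 * t)" using t by simp
  also have "\<dots> = b\<^sup>2 / (2 * t) + t / 2 - b" using t by (simp add: power2_eq_square field_simps)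
  finally show ?thesis by (simp add: lyapunov_def)
qed

lemma lyapunov_mono:
  assumes t: "0 < t" and b: "0 \<le> b" "b \<le> c"
  shows "lyapunov t b \<le> lyapunov t c"
proof (cases "c \<le> t")
  case True
  then have "b\<^sup>2 / (2 * t) \<le> c\<^sup>2 / (2 * t)" using t b by (intro divide_right_mono power_mono) auto
  then show ?thesis using True b by (simp add: lyapunov_def)
next
  case c: False
  show ?thesis
  proof (cases "b \<le> t")
    case True
    then have "b\<^sup>2 / (2 * t) \<le> t\<^sup>2 / (2 * t)" using t b by (intro divide_right_mono power_mono) auto
    also have "\<dots> = t / 2" using t by (simp add: power2_eq_square)
    finally show ?thesis using True c by (simp add: lyapunov_def)
  qed (use b c in \<open>simp add: lyapunov_def\<close>)
qed

lemma lyapunov_slope_bounds: "0 < t \<Longrightarrow> 0 \<le> b \<Longrightarrow> 0 \<le> lyapunov_slope t b \<and> lyapunov_slope t b \<le> 1"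
  by (simp add: lyapunov_slope_def)

lemma lyapunov_quadratic:
  assumes t: "0 < t"
  shows "lyapunov t c \<le> lyapunov t b + lyapunov_slope t b * (c - b) + (c - b)\<^sup>2 / (2 * t)"
proof -
  have id: "b\<^sup>2 / (2 * t) + b / t * (c - b) + (c - b)\<^sup>2 / (2 * t) = c\<^sup>2 / (2 * t)"
    using t by (simp add: power2_eq_square field_simps)
  have sq: "c \<le> c\<^sup>2 / (2 * t) + t / 2"
  proof -
    have "0 \<le> (c - t)\<^sup>2 / (2 * t)" using t by simp
    also have "\<dots> = c\<^sup>2 / (2 * t) + t / 2 - c" using t by (simp add: power2_eq_square field_simps)
    finally show ?thesis by simp
  qed
  show ?thesis
  proof (cases "b \<le> t")
    case b: True
    then have s: "lyapunov_slope t b = b / t" using t by (simp add: lyapunov_slope_def)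
    show ?thesis using id sq b unfolding s by (simp add: lyapunov_def)
  next
    case b: False
    then have s: "lyapunov_slope t b = 1" using t by (simp add: lyapunov_slope_def)
    show ?thesis
    proof (cases "c \<le> t")
      case True
      have "(t - c)\<^sup>2 \<le> (b - c)\<^sup>2" using True b by (intro power_mono) auto
      then have "(c - t)\<^sup>2 / (2 * t) \<le> (c - b)\<^sup>2 / (2 * t)" using t by (simp add: power2_commute divide_right_mono)
      moreover have "(c - t)\<^sup>2 / (2 * t) = c\<^sup>2 / (2 * t) + t / 2 - c"
        using t by (simp add: power2_eq_square field_simps)
      ultimately show ?thesis using b True unfolding s by (simp add: lyapunov_def)
    next
      case False
      then show ?thesis using b t unfolding s by (simp add: lyapunov_def)
    qed
  qed
qed

lemma lyapunov_lipschitz: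
  assumes t: "0 < t" and b: "0 \<le> b" "0 \<le> c"
  shows "lyapunov t c \<le> lyapunov t b + \<bar>c - b\<bar>"
proof (cases "c \<le> b")
  case True
  then show ?thesis using lyapunov_mono[OF t b(2) True] by simp
next
  case c: False
  show ?thesis
  proof (cases "c \<le> t")
    case True
    have "c\<^sup>2 / (2 * t) - b\<^sup>2 / (2 * t) = (c - b) * ((c + b) / (2 * t))"
      using t by (simp add: power2_eq_square field_simps)
    also have "\<dots> \<le> (c - b) * 1" using c True t b by (intro mult_left_mono) auto
    finally show ?thesis using c True by (simp add: lyapunov_def)
  next
    case False
    have "lyapunov t c + (b - c) \<le> lyapunov t b" using lyapunov_ge[OF t, of b] False by (simp add: lyapunov_def)
    then show ?thesis using c by simp
  qed
qed

text \<open>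
  A step of a reflected walk, which first reduces \<open>b\<close> by \<open>a\<close> as far as
  possible and then adds \<open>d\<close>. Apart from the linear term, the increase has two
  bounds: one quadratic in the step size and small for large \<open>t\<close>, one linear in the
  step size and hence integrable. When the walk is reflected, \<open>b < a\<close>, and the slope
  \<open>b / t\<close> is itself at most \<open>a / t\<close>.
\<close>

lemma lyapunov_step:
  assumes t: "0 < t" and b: "0 \<le> b" "0 \<le> b'" and cl: "0 \<le> a" "0 \<le> d"
    and le: "a \<le> b \<Longrightarrow> b' \<le> b + (d - a)" and gt: "b < a \<Longrightarrow> b' \<le> d"
  shows "lyapunov t b' \<le> lyapunov t b + lyapunov_slope t b * (d - a) + min (3 * (a + d)\<^sup>2 / t) (4 * (a + d))"
proof (cases "a \<le> b")
  case True
  let ?c = "b + (d - a)"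
  have c0: "0 \<le> ?c" using le[OF True] b by simp
  have sl: "0 \<le> lyapunov_slope t b" "lyapunov_slope t b \<le> 1" using lyapunov_slope_bounds[OF t b(1)] by auto
  have "(d - a)\<^sup>2 \<le> (a + d)\<^sup>2" using cl by (simp add: abs_le_square_iff[symmetric])
  then have "(d - a)\<^sup>2 / (2 * t) \<le> (a + d)\<^sup>2 / (2 * t)" using t by (intro divide_right_mono) auto
  also have "\<dots> \<le> 3 * (a + d)\<^sup>2 / t" using t by (simp add: field_simps)
  finally have 1: "(d - a)\<^sup>2 / (2 * t) \<le> 3 * (a + d)\<^sup>2 / t" .
  have "\<bar>lyapunov_slope t b * (d - a)\<bar> \<le> 1 * \<bar>d - a\<bar>"
    unfolding abs_mult using sl by (intro mult_right_mono) auto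
  moreover have "\<bar>d - a\<bar> \<le> a + d" using cl by simp
  ultimately have "- (lyapunov_slope t b * (d - a)) \<le> a + d"
    by (metis abs_ge_minus_self mult_1 order_trans)
  then have 2: "\<bar>?c - b\<bar> \<le> lyapunov_slope t b * (d - a) + 4 * (a + d)" using cl by simp
  have "lyapunov t b' \<le> lyapunov t ?c" by (rule lyapunov_mono[OF t b(2) le[OF True]])
  moreover have "lyapunov t ?c \<le> lyapunov t b + lyapunov_slope t b * (d - a) + 3 * (a + d)\<^sup>2 / t"
    using lyapunov_quadratic[OF t, of ?c b] 1 by simp
  moreover have "lyapunov t ?c \<le> lyapunov t b + lyapunov_slope t b * (d - a) + 4 * (a + d)"
    using lyapunov_lipschitz[OF t b(1) c0] 2 by simp
  ultimately show ?thesis by simp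
next
  case False
  then have b': "b' \<le> d" and ba: "b \<le> a" using gt by auto
  have sl: "0 \<le> lyapunov_slope t b" "lyapunov_slope t b \<le> 1" using lyapunov_slope_bounds[OF t b(1)] by auto
  have sl2: "lyapunov_slope t b \<le> (a + d) / t"
  proof -
    have "lyapunov_slope t b \<le> b / t" by (simp add: lyapunov_slope_def)
    also have "\<dots> \<le> (a + d) / t" using t ba cl by (intro divide_right_mono) auto
    finally show ?thesis .
  qed
  have diff: "\<bar>b' - b\<bar> \<le> a + d" using b b' ba cl by (simp add: abs_le_iff)
  have e: "b' - b - (d - a) \<le> 2 * (a + d)" using b b' cl by simp
  have s1: "lyapunov_slope t b * (b' - b - (d - a)) \<le> lyapunov_slope t b * (2 * (a + d))"
    using e sl by (intro mult_left_mono) auto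
  also have "\<dots> \<le> (a + d) / t * (2 * (a + d))" using sl2 cl by (intro mult_right_mono) auto
  finally have q1: "lyapunov_slope t b * (b' - b - (d - a)) \<le> 2 * (a + d)\<^sup>2 / t"
    by (simp add: power2_eq_square mult_ac)
  have "lyapunov_slope t b * (2 * (a + d)) \<le> 1 * (2 * (a + d))" using sl cl by (intro mult_right_mono) auto
  then have q2: "lyapunov_slope t b * (b' - b - (d - a)) \<le> 2 * (a + d)" using s1 by simp
  have "(b' - b)\<^sup>2 \<le> (a + d)\<^sup>2" using diff cl by (simp add: abs_le_square_iff[symmetric])
  then have "(b' - b)\<^sup>2 / (2 * t) \<le> (a + d)\<^sup>2 / (2 * t)" using t by (intro divide_right_mono) auto
  also have "\<dots> \<le> (a + d)\<^sup>2 / t" using t by (simp add: field_simps)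
  finally have q3: "(b' - b)\<^sup>2 / (2 * t) \<le> (a + d)\<^sup>2 / t" .
  have split: "lyapunov_slope t b * (b' - b) = lyapunov_slope t b * (d - a) + lyapunov_slope t b * (b' - b - (d - a))"
    by (simp add: algebra_simps)
  have sum: "2 * (a + d)\<^sup>2 / t + (a + d)\<^sup>2 / t = 3 * (a + d)\<^sup>2 / t" by (simp add: field_simps)
  have "lyapunov t b' \<le> lyapunov t b + lyapunov_slope t b * (d - a) + 3 * (a + d)\<^sup>2 / t"
    using lyapunov_quadratic[OF t, of b' b] q1 q3 split sum by linarith
  moreover have "lyapunov t b' \<le> lyapunov t b + lyapunov_slope t b * (d - a) + 4 * (a + d)"
  proof -
    have "\<bar>lyapunov_slope t b * (d - a)\<bar> \<le> 1 * \<bar>d - a\<bar>"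
      unfolding abs_mult using sl by (intro mult_right_mono) auto
    moreover have "\<bar>d - a\<bar> \<le> a + d" using cl by simp
    ultimately have "- (lyapunov_slope t b * (d - a)) \<le> a + d"
      by (metis abs_ge_minus_self mult_1 order_trans)
    moreover have "lyapunov t b' \<le> lyapunov t b + (a + d)"
      using lyapunov_lipschitz[OF t b] diff by (rule order_trans[OF _ add_left_mono])
    ultimately show ?thesis using cl by simp
  qed
  ultimately show ?thesis by simp
qed

section \<open>Walks on a tree without downward drift\<close>

text \<open>
  The walk acts on a tree \<open>V\<close> by automorphisms that fix the end. The tree is embedded
  into \<open>\<Omega>\<close> because in a product of groups \<open>\<Omega>\<close> consists of
  several trees.
\<close>

locale tree_walk = group_walk G X \<Omega> act \<mu> + parent_tree V p root q
  for G :: "('g, 'm) monoid_scheme" (structure) and X :: "'g topology" and \<Omega> :: "'w set" and act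
    and \<mu> :: "'g measure" and V :: "'v set" and p root q +
  fixes emb :: "'v \<Rightarrow> 'w" and \<tau> :: "'g \<Rightarrow> 'v \<Rightarrow> 'v"
  assumes emb_in: "v \<in> V \<Longrightarrow> emb v \<in> \<Omega>" and emb_inj: "inj_on emb V"
    and act_emb: "g \<in> carrier G \<Longrightarrow> v \<in> V \<Longrightarrow> act g (emb v) = emb (\<tau> g v)"
    and equivariant_\<tau>: "g \<in> carrier G \<Longrightarrow> equivariant (\<tau> g)"
    and moment: "integrable \<mu> (\<lambda>g. real (climb (\<tau> g root) + descent (\<tau> g root)))"
begin

lemma \<tau>_closed: "g \<in> carrier G \<Longrightarrow> v \<in> V \<Longrightarrow> \<tau> g v \<in> V"
  using equivariant_closed[OF equivariant_\<tau>] .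

lemma \<tau>_mult: "g \<in> carrier G \<Longrightarrow> h \<in> carrier G \<Longrightarrow> v \<in> V \<Longrightarrow> \<tau> (g \<otimes> h) v = \<tau> g (\<tau> h v)"
  using act_mult[of g h "emb v"] act_emb emb_in \<tau>_closed by (intro inj_onD[OF emb_inj]) auto

lemma \<tau>_one: "v \<in> V \<Longrightarrow> \<tau> \<one> v = v"
  using act_one[of "emb v"] act_emb[of \<one> v] emb_in \<tau>_closed by (intro inj_onD[OF emb_inj]) auto

lemma \<tau>_inv: "g \<in> carrier G \<Longrightarrow> v \<in> V \<Longrightarrow> \<tau> (inv g) (\<tau> g v) = v"
  using \<tau>_mult[of "inv g" g v] \<tau>_one[of v] by simp

lemma \<tau>_inv': "g \<in> carrier G \<Longrightarrow> v \<in> V \<Longrightarrow> \<tau> g (\<tau> (inv g) v) = v"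
  using \<tau>_mult[of g "inv g" v] \<tau>_one[of v] by simp

lemma \<tau>_measurable:
  assumes v: "v \<in> V"
  shows "(\<lambda>g. \<tau> g v) \<in> measurable (borel_of X) (count_space UNIV)"
proof -
  have "(\<lambda>g. inv_into V emb (act g (emb v))) \<in> measurable (borel_of X) (count_space UNIV)"
    by (rule measurable_compose[OF act_measurable[OF emb_in[OF v]]]) simp
  then show ?thesis
    by (rule measurable_cong[THEN iffD1, rotated])
       (use v in \<open>simp add: act_emb inv_into_f_f[OF emb_inj] \<tau>_closed\<close>)
qed

lemma \<tau>_borel: "v \<in> V \<Longrightarrow> (\<lambda>g. f (\<tau> g v)) \<in> borel_measurable (borel_of X)"
  by (rule measurable_compose[OF \<tau>_measurable]) simp_all

lemma \<tau>_borel_mult: "x \<in> carrier G \<Longrightarrow> v \<in> V \<Longrightarrow> (\<lambda>g. f (\<tau> (x \<otimes> g) v)) \<in> borel_measurable (borel_of X)"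
  by (rule measurable_compose[OF const_mult_measurable \<tau>_borel])

definition up :: "'g \<Rightarrow> real" where "up g = real (climb (\<tau> g root))"
definition down :: "'g \<Rightarrow> real" where "down g = real (descent (\<tau> g root))"

lemma up_nonneg: "0 \<le> up g" and down_nonneg: "0 \<le> down g" by (auto simp: up_def down_def)

lemma up_measurable: "up \<in> borel_measurable (borel_of X)"
  and down_measurable: "down \<in> borel_measurable (borel_of X)"
  unfolding up_def down_def using root_in by (auto intro: \<tau>_borel)

lemma height_eq: "real_of_int (height (\<tau> g root)) = down g - up g"
  by (simp add: height_def up_def down_def)

lemma up_down_integrable: "integrable \<mu> up" "integrable \<mu> down"
proof -
  have m: "integrable \<mu> (\<lambda>g. up g + down g)" using moment by (simp add: up_def down_def)
  show "integrable \<mu> up"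
    by (rule Bochner_Integration.integrable_bound[OF m])
       (auto simp: measurable_step up_measurable up_nonneg down_nonneg)
  show "integrable \<mu> down"
    by (rule Bochner_Integration.integrable_bound[OF m])
       (auto simp: measurable_step down_measurable up_nonneg down_nonneg)
qed

lemma up_mult:
  assumes "g \<in> carrier G" "x \<in> carrier G"
  shows "up (g \<otimes> x) \<le> max (up g) (up x - (down g - up g))" "up (g \<otimes> x) \<le> up g + up x"
proof -
  have e: "\<tau> (g \<otimes> x) root = \<tau> g (\<tau> x root)" using assms root_in by (rule \<tau>_mult)
  have v: "\<tau> x root \<in> V" using assms root_in by (intro \<tau>_closed)
  have "int (climb (\<tau> g (\<tau> x root))) \<le> max (int (climb (\<tau> g root))) (int (climb (\<tau> x root)) - height (\<tau> g root))"
    using climb_equivariant_le[OF equivariant_\<tau>[OF assms(1)] v] .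
  then have "real_of_int (int (climb (\<tau> g (\<tau> x root))))
      \<le> real_of_int (max (int (climb (\<tau> g root))) (int (climb (\<tau> x root)) - height (\<tau> g root)))"
    by (simp only: of_int_le_iff)
  then show "up (g \<otimes> x) \<le> max (up g) (up x - (down g - up g))"
    by (simp add: up_def down_def e height_def of_int_max)
  then show "up (g \<otimes> x) \<le> up g + up x" using up_nonneg down_nonneg by (smt (verit))
qed

lemma down_mult:
  assumes "g \<in> carrier G" "x \<in> carrier G"
  shows "up x \<le> down g \<Longrightarrow> down (g \<otimes> x) \<le> down g + (down x - up x)"
    and "down g < up x \<Longrightarrow> down (g \<otimes> x) \<le> down x"
proof -
  have e: "\<tau> (g \<otimes> x) root = \<tau> g (\<tau> x root)" using assms root_in by (rule \<tau>_mult)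
  have v: "\<tau> x root \<in> V" using assms root_in by (intro \<tau>_closed)
  note d = descent_equivariant_le[OF equivariant_\<tau>[OF assms(1)] v]
  show "down (g \<otimes> x) \<le> down g + (down x - up x)" if "up x \<le> down g"
  proof -
    have "int (descent (\<tau> g (\<tau> x root))) \<le> int (descent (\<tau> g root)) + height (\<tau> x root)"
      using that by (intro d(1)) (simp add: up_def down_def)
    then have "real_of_int (int (descent (\<tau> g (\<tau> x root)))) \<le> real_of_int (int (descent (\<tau> g root)) + height (\<tau> x root))"
      by (simp only: of_int_le_iff)
    then show ?thesis by (simp add: down_def e height_eq[symmetric, unfolded down_def])
  qed
  show "down (g \<otimes> x) \<le> down x" if "down g < up x"
    using d(2) that by (simp add: up_def down_def e)
qed

text \<open>The height increases away from the end, so a positive drift leads away from the end.\<close>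

definition drift :: real where
  "drift = (\<integral>g. real_of_int (height (\<tau> g root)) \<partial>\<mu>)"

lemma drift_eq: "drift = (\<integral>g. down g - up g \<partial>\<mu>)"
  by (simp add: drift_def height_eq)

text \<open>
  The linear term of \<open>lyapunov_step\<close> has mean slope times drift, which is not
  positive. The error term tends to zero with \<open>1 / t\<close> and is dominated by an
  integrable function, so its mean is below \<open>\<epsilon>\<close> for large \<open>t\<close>.
\<close>

lemma lyapunov_drift:
  assumes drift: "drift \<le> 0" and \<epsilon>: "0 < \<epsilon>"
  obtains t where "0 < t"
    "\<forall>g\<in>carrier G. (\<integral>\<^sup>+x. ennreal (lyapunov t (down (g \<otimes> x))) \<partial>\<mu>) \<le> ennreal (lyapunov t (down g) + \<epsilon>)"
proof -
  define L where "L x = up x + down x" for x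
  define \<psi> where "\<psi> t x = min (3 * (L x)\<^sup>2 / t) (4 * L x)" for t x
  have L0: "0 \<le> L x" for x using up_nonneg down_nonneg by (simp add: L_def)
  have Lint: "integrable \<mu> L" unfolding L_def using up_down_integrable by simp
  have Lm: "L \<in> borel_measurable \<mu>" using Lint by simp
  have "(\<lambda>n. \<integral>x. \<psi> (real (Suc n)) x \<partial>\<mu>) \<longlonglongrightarrow> (\<integral>x. 0 \<partial>\<mu>)"
  proof (rule integral_dominated_convergence)
    show "integrable \<mu> (\<lambda>x. 4 * L x)" using Lint by simp
    show "(\<lambda>x. \<psi> (real (Suc n)) x) \<in> borel_measurable \<mu>" for n
      unfolding \<psi>_def using Lm by measurable
    show "AE x in \<mu>. norm (\<psi> (real (Suc n)) x) \<le> 4 * L x" for n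
      using L0 by (intro AE_I2) (auto simp: \<psi>_def)
    show "AE x in \<mu>. (\<lambda>n. \<psi> (real (Suc n)) x) \<longlonglongrightarrow> 0"
    proof (intro AE_I2)
      fix x
      have "(\<lambda>n. 3 * (L x)\<^sup>2 / real (Suc n)) \<longlonglongrightarrow> 0"
        by (rule LIMSEQ_Suc) (rule lim_const_over_n)
      then have "(\<lambda>n. min (3 * (L x)\<^sup>2 / real (Suc n)) (4 * L x)) \<longlonglongrightarrow> min 0 (4 * L x)"
        by (intro tendsto_min tendsto_const)
      then show "(\<lambda>n. \<psi> (real (Suc n)) x) \<longlonglongrightarrow> 0" using L0[of x] by (simp add: \<psi>_def min_def)
    qed
  qed simp
  then have "eventually (\<lambda>n. (\<integral>x. \<psi> (real (Suc n)) x \<partial>\<mu>) < \<epsilon>) sequentially"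
    using \<epsilon> by (intro order_tendstoD(2)) auto
  then obtain n where n: "(\<integral>x. \<psi> (real (Suc n)) x \<partial>\<mu>) < \<epsilon>" by (auto simp: eventually_sequentially)
  define t where "t = real (Suc n)"
  have t: "0 < t" by (simp add: t_def)
  have \<psi>m: "(\<lambda>x. \<psi> t x) \<in> borel_measurable \<mu>" unfolding \<psi>_def using Lm by measurable
  have \<psi>int: "integrable \<mu> (\<lambda>x. \<psi> t x)"
  proof (rule Bochner_Integration.integrable_bound)
    show "integrable \<mu> (\<lambda>x. 4 * L x)" using Lint by simp
    show "AE x in \<mu>. norm (\<psi> t x) \<le> norm (4 * L x)"
      using L0 t by (intro AE_I2) (auto simp: \<psi>_def)
  qed (rule \<psi>m)
  show thesis
  proof (rule that[OF t], intro ballI)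
    fix g assume g: "g \<in> carrier G"
    define b where "b = down g"
    define s where "s = lyapunov_slope t b"
    have s0: "0 \<le> s" unfolding s_def b_def using lyapunov_slope_bounds[OF t down_nonneg] by simp
    define R where "R x = lyapunov t b + s * (down x - up x) + \<psi> t x" for x
    have le: "lyapunov t (down (g \<otimes> x)) \<le> R x" if x: "x \<in> carrier G" for x
      unfolding R_def s_def b_def \<psi>_def L_def
      by (rule lyapunov_step[OF t down_nonneg down_nonneg up_nonneg down_nonneg down_mult[OF g x]])
    have R0: "0 \<le> R x" if x: "x \<in> carrier G" for x
      using le[OF x] lyapunov_ge[OF t, of "down (g \<otimes> x)"] down_nonneg[of "g \<otimes> x"] by linarith
    have Rint: "integrable \<mu> R" unfolding R_def using up_down_integrable \<psi>int by simp
    have "(\<integral>\<^sup>+x. ennreal (lyapunov t (down (g \<otimes> x))) \<partial>\<mu>) \<le> (\<integral>\<^sup>+x. ennreal (R x) \<partial>\<mu>)"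
      using le by (intro nn_integral_mono ennreal_leI) simp
    also have "\<dots> = ennreal (\<integral>x. R x \<partial>\<mu>)"
      using Rint R0 by (intro nn_integral_eq_integral AE_I2) auto
    also have "(\<integral>x. R x \<partial>\<mu>) = lyapunov t b + s * drift + (\<integral>x. \<psi> t x \<partial>\<mu>)"
      unfolding R_def drift_eq using up_down_integrable \<psi>int by (simp add: prob_space[unfolded space_step])
    also have "\<dots> \<le> lyapunov t b + \<epsilon>"
      using n mult_nonneg_nonpos[OF s0 drift] by (simp add: t_def)
    finally show "(\<integral>\<^sup>+x. ennreal (lyapunov t (down (g \<otimes> x))) \<partial>\<mu>) \<le> ennreal (lyapunov t (down g) + \<epsilon>)"
      using ennreal_leI unfolding b_def by (meson order_trans)
  qed
qed

lemma down_sublinear: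
  assumes drift: "drift \<le> 0" and \<epsilon>: "0 < \<epsilon>"
  obtains C where "0 \<le> C" "\<forall>n. (\<integral>\<^sup>+r. ennreal (down r) \<partial>law n) \<le> ennreal (\<epsilon> * real n + C)"
proof -
  obtain t where t: "0 < t" and
    step: "\<forall>g\<in>carrier G. (\<integral>\<^sup>+x. ennreal (lyapunov t (down (g \<otimes> x))) \<partial>\<mu>) \<le> ennreal (lyapunov t (down g) + \<epsilon>)"
    using lyapunov_drift[OF drift \<epsilon>] .
  have ly0: "0 \<le> lyapunov t (down g)" for g using lyapunov_ge[OF t, of "down g"] down_nonneg[of g] by linarith
  have lym: "(\<lambda>r. ennreal (lyapunov t (down (g \<otimes> r)))) \<in> borel_measurable (borel_of X)" if "g \<in> carrier G" for g
    unfolding down_def using that root_in by (intro \<tau>_borel_mult)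
  have main: "(\<integral>\<^sup>+r. ennreal (lyapunov t (down (g \<otimes> r))) \<partial>law n) \<le> ennreal (lyapunov t (down g) + \<epsilon> * real n)"
    if g: "g \<in> carrier G" for g n
    using g
  proof (induction n arbitrary: g)
    case 0
    have "(\<integral>\<^sup>+r. ennreal (lyapunov t (down (g \<otimes> r))) \<partial>law 0) = ennreal (lyapunov t (down (g \<otimes> \<one>)))"
      using lym[OF 0] by (simp add: nn_integral_return)
    then show ?case using 0 by simp
  next
    case (Suc n)
    have "(\<integral>\<^sup>+r. ennreal (lyapunov t (down (g \<otimes> r))) \<partial>law (Suc n))
        = (\<integral>\<^sup>+x. \<integral>\<^sup>+r. ennreal (lyapunov t (down (g \<otimes> (x \<otimes> r)))) \<partial>law n \<partial>\<mu>)"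
      by (rule nn_integral_law_Suc[OF lym[OF Suc.prems]])
    also have "\<dots> \<le> (\<integral>\<^sup>+x. ennreal (lyapunov t (down (g \<otimes> x))) + ennreal (\<epsilon> * real n) \<partial>\<mu>)"
    proof (intro nn_integral_mono)
      fix x assume "x \<in> space \<mu>"
      then have x: "x \<in> carrier G" by simp
      have "(\<integral>\<^sup>+r. ennreal (lyapunov t (down (g \<otimes> (x \<otimes> r)))) \<partial>law n)
          = (\<integral>\<^sup>+r. ennreal (lyapunov t (down (g \<otimes> x \<otimes> r))) \<partial>law n)"
        using Suc.prems x by (intro nn_integral_cong) (simp add: m_assoc)
      also have "\<dots> \<le> ennreal (lyapunov t (down (g \<otimes> x)) + \<epsilon> * real n)"
        using Suc.prems x by (intro Suc.IH) simp
      also have "\<dots> = ennreal (lyapunov t (down (g \<otimes> x))) + ennreal (\<epsilon> * real n)"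
        using ly0 \<epsilon> by (intro ennreal_plus) auto
      finally show "(\<integral>\<^sup>+r. ennreal (lyapunov t (down (g \<otimes> (x \<otimes> r)))) \<partial>law n)
          \<le> ennreal (lyapunov t (down (g \<otimes> x))) + ennreal (\<epsilon> * real n)" .
    qed
    also have "\<dots> = (\<integral>\<^sup>+x. ennreal (lyapunov t (down (g \<otimes> x))) \<partial>\<mu>) + ennreal (\<epsilon> * real n)"
      using lym[OF Suc.prems] by (subst nn_integral_add) (simp_all add: measurable_step emeasure_carrier)
    also have "\<dots> \<le> ennreal (lyapunov t (down g) + \<epsilon>) + ennreal (\<epsilon> * real n)"
      using step Suc.prems by (intro add_right_mono) blast
    also have "\<dots> = ennreal (lyapunov t (down g) + \<epsilon> + \<epsilon> * real n)"
      using ly0[of g] \<epsilon> by (intro ennreal_plus[symmetric]) auto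
    finally show ?case by (simp add: algebra_simps)
  qed
  show thesis
  proof (rule that[of "lyapunov t (down \<one>)"])
    show "\<forall>n. (\<integral>\<^sup>+r. ennreal (down r) \<partial>law n) \<le> ennreal (\<epsilon> * real n + lyapunov t (down \<one>))"
    proof
      fix n
      have "(\<integral>\<^sup>+r. ennreal (down r) \<partial>law n) \<le> (\<integral>\<^sup>+r. ennreal (lyapunov t (down (\<one> \<otimes> r))) \<partial>law n)"
      proof (intro nn_integral_mono ennreal_leI)
        fix r assume "r \<in> space (law n)"
        then have "r \<in> carrier G" unfolding space_law .
        then show "down r \<le> lyapunov t (down (\<one> \<otimes> r))" using lyapunov_ge[OF t, of "down r"] by simp
      qed
      also have "\<dots> \<le> ennreal (lyapunov t (down \<one>) + \<epsilon> * real n)" by (rule main) simp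
      finally show "(\<integral>\<^sup>+r. ennreal (down r) \<partial>law n) \<le> ennreal (\<epsilon> * real n + lyapunov t (down \<one>))"
        by (simp add: add.commute)
    qed
  qed (rule ly0)
qed

lemma up_linear: "(\<integral>\<^sup>+r. ennreal (up r) \<partial>law n) \<le> ennreal ((\<integral>x. up x \<partial>\<mu>) * real n)"
proof (induction n)
  case 0
  have "up \<one> = 0" using climb_le[of 0 0 root] root_in by (simp add: up_def \<tau>_one)
  then show ?case using up_measurable by (simp add: nn_integral_return)
next
  case (Suc n)
  have E0: "0 \<le> (\<integral>x. up x \<partial>\<mu>)" using up_nonneg by (intro Bochner_Integration.integral_nonneg)
  have "(\<integral>\<^sup>+r. ennreal (up r) \<partial>law (Suc n)) = (\<integral>\<^sup>+x. \<integral>\<^sup>+r. ennreal (up (x \<otimes> r)) \<partial>law n \<partial>\<mu>)"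
    using up_measurable by (intro nn_integral_law_Suc) simp
  also have "\<dots> \<le> (\<integral>\<^sup>+x. \<integral>\<^sup>+r. ennreal (up x) + ennreal (up r) \<partial>law n \<partial>\<mu>)"
  proof (intro nn_integral_mono)
    fix x r assume "x \<in> space \<mu>" "r \<in> space (law n)"
    then have "x \<in> carrier G" "r \<in> carrier G" by simp_all
    from up_mult(2)[OF this] have "ennreal (up (x \<otimes> r)) \<le> ennreal (up x + up r)" by (rule ennreal_leI)
    then show "ennreal (up (x \<otimes> r)) \<le> ennreal (up x) + ennreal (up r)" using up_nonneg by simp
  qed
  also have "\<dots> = (\<integral>\<^sup>+x. ennreal (up x) \<partial>\<mu>) + (\<integral>\<^sup>+r. ennreal (up r) \<partial>law n)"
    using up_measurable by (simp add: nn_integral_add measurable_step measurable_law emeasure_carrier emeasure_law_carrier)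
  also have "\<dots> \<le> ennreal (\<integral>x. up x \<partial>\<mu>) + ennreal ((\<integral>x. up x \<partial>\<mu>) * real n)"
    using up_down_integrable(1) up_nonneg Suc by (intro add_mono) (simp_all add: nn_integral_eq_integral)
  also have "\<dots> = ennreal ((\<integral>x. up x \<partial>\<mu>) * real (Suc n))"
    using E0 by (subst ennreal_plus[symmetric]) (auto simp: algebra_simps)
  finally show ?case .
qed

text \<open>
  Charge \<open>s\<close> per step climbed and \<open>t > ln q\<close> per step descended. The
  mean climb grows at most linearly, which a small \<open>s\<close> compensates, and the mean
  descent sublinearly.
\<close>

lemma tree_cost:
  assumes drift: "drift \<le> 0" and \<epsilon>: "0 < \<epsilon>"
  obtains cost :: "'v \<Rightarrow> real" where "\<forall>v\<in>V. 0 \<le> cost v"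
    "(\<integral>\<^sup>+v. ennreal (exp (- cost v)) \<partial>count_space V) < \<infinity>"
    "\<forall>v\<in>V. \<exists>C. \<forall>n. (\<integral>\<^sup>+r. ennreal (cost (\<tau> r v)) \<partial>law n) \<le> ennreal (\<epsilon> * real n + C)"
proof -
  define E where "E = (\<integral>x. up x \<partial>\<mu>)"
  have E0: "0 \<le> E" unfolding E_def using up_nonneg by (intro Bochner_Integration.integral_nonneg)
  define s where "s = \<epsilon> / (2 * (E + 1))"
  define t where "t = ln q + 1"
  have s: "0 < s" using \<epsilon> E0 by (simp add: s_def)
  have "0 \<le> ln (real q)" using two_children by simp
  then have t: "ln q < t" "0 < t" by (simp_all add: t_def)
  have sE: "s * E \<le> \<epsilon> / 2" using \<epsilon> E0 by (simp add: s_def field_simps)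
  obtain C where C: "0 \<le> C" "\<forall>n. (\<integral>\<^sup>+r. ennreal (down r) \<partial>law n) \<le> ennreal (\<epsilon> / (2 * t) * real n + C)"
    using down_sublinear[OF drift, of "\<epsilon> / (2 * t)"] \<epsilon> t by auto
  define cost where "cost v = s * climb v + t * descent v" for v
  show thesis
  proof (rule that[of cost])
    show "\<forall>v\<in>V. 0 \<le> cost v" using s t by (simp add: cost_def)
    show "(\<integral>\<^sup>+v. ennreal (exp (- cost v)) \<partial>count_space V) < \<infinity>"
      unfolding cost_def by (rule vertex_weights_summable[OF s t(1)])
    show "\<forall>v\<in>V. \<exists>C. \<forall>n. (\<integral>\<^sup>+r. ennreal (cost (\<tau> r v)) \<partial>law n) \<le> ennreal (\<epsilon> * real n + C)"
    proof (intro ballI exI allI)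
      fix v n assume v: "v \<in> V"
      define c where "c = cost v"
      have c0: "0 \<le> c" using s t by (simp add: c_def cost_def)
      have "(\<integral>\<^sup>+r. ennreal (cost (\<tau> r v)) \<partial>law n) \<le> (\<integral>\<^sup>+r. ennreal s * ennreal (up r) + ennreal t * ennreal (down r) + ennreal c \<partial>law n)"
      proof (intro nn_integral_mono)
        fix r assume "r \<in> space (law n)"
        then have r: "r \<in> carrier G" unfolding space_law .
        have "climb (\<tau> r v) \<le> climb (\<tau> r root) + climb v" "descent (\<tau> r v) \<le> descent (\<tau> r root) + descent v"
          using climb_equivariant_le'[OF equivariant_\<tau>[OF r] v] descent_equivariant_le'[OF equivariant_\<tau>[OF r] v] by auto
        then have "real (climb (\<tau> r v)) \<le> up r + climb v" "real (descent (\<tau> r v)) \<le> down r + descent v"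
          by (simp_all add: up_def down_def flip: of_nat_add)
        then have "s * real (climb (\<tau> r v)) \<le> s * (up r + climb v)" "t * real (descent (\<tau> r v)) \<le> t * (down r + descent v)"
          using s t by (auto intro!: mult_left_mono)
        then have "cost (\<tau> r v) \<le> s * up r + t * down r + c"
          by (simp add: cost_def c_def algebra_simps)
        then have "ennreal (cost (\<tau> r v)) \<le> ennreal (s * up r + t * down r + c)" by (rule ennreal_leI)
        also have "\<dots> = ennreal s * ennreal (up r) + ennreal t * ennreal (down r) + ennreal c"
          using s t c0 up_nonneg[of r] down_nonneg[of r] by (simp add: ennreal_mult)
        finally show "ennreal (cost (\<tau> r v)) \<le> ennreal s * ennreal (up r) + ennreal t * ennreal (down r) + ennreal c" .
      qed
      also have "\<dots> = ennreal s * (\<integral>\<^sup>+r. ennreal (up r) \<partial>law n) + ennreal t * (\<integral>\<^sup>+r. ennreal (down r) \<partial>law n) + ennreal c"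
        using up_measurable down_measurable
        by (simp add: nn_integral_add nn_integral_cmult measurable_law emeasure_law_carrier)
      also have "\<dots> \<le> ennreal s * ennreal (E * real n) + ennreal t * ennreal (\<epsilon> / (2 * t) * real n + C) + ennreal c"
        using up_linear[of n] C(2) unfolding E_def by (intro add_mono mult_left_mono) auto
      also have "\<dots> = ennreal (s * (E * real n) + t * (\<epsilon> / (2 * t) * real n + C) + c)"
        using s t E0 \<epsilon> C(1) c0 by (simp add: ennreal_mult[symmetric] ennreal_plus[symmetric] del: ennreal_plus)
      also have "\<dots> \<le> ennreal (\<epsilon> * real n + (t * C + c))"
      proof (intro ennreal_leI)
        have "s * (E * real n) \<le> \<epsilon> / 2 * real n" using mult_right_mono[OF sE, of "real n"] by simp
        moreover have "t * (\<epsilon> / (2 * t) * real n + C) = \<epsilon> / 2 * real n + t * C" using t(2) by (simp add: field_simps)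
        ultimately show "s * (E * real n) + t * (\<epsilon> / (2 * t) * real n + C) + c \<le> \<epsilon> * real n + (t * C + c)" by simp
      qed
      finally show "(\<integral>\<^sup>+r. ennreal (cost (\<tau> r v)) \<partial>law n) \<le> ennreal (\<epsilon> * real n + (t * C + cost v))"
        unfolding c_def .
    qed
  qed
qed

end

section \<open>Walks on a tree with downward drift\<close>

context tree_walk
begin

lemma desc_\<tau>_iff:
  assumes g: "g \<in> carrier G" and v: "v \<in> V" "w \<in> V"
  shows "\<tau> g v \<in> desc (\<tau> g w) \<longleftrightarrow> v \<in> desc w"
proof
  assume "v \<in> desc w"
  then obtain n where "(p ^^ n) v = w" by (auto simp: desc_def)
  then have "(p ^^ n) (\<tau> g v) = \<tau> g w" using equivariant_funpow[OF equivariant_\<tau>[OF g] v(1)] by metis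
  then show "\<tau> g v \<in> desc (\<tau> g w)" using \<tau>_closed[OF g v(1)] by (auto simp: desc_def)
next
  assume "\<tau> g v \<in> desc (\<tau> g w)"
  then obtain n where "(p ^^ n) (\<tau> g v) = \<tau> g w" by (auto simp: desc_def)
  then have "\<tau> g ((p ^^ n) v) = \<tau> g w" using equivariant_funpow[OF equivariant_\<tau>[OF g] v(1)] by metis
  then have "(p ^^ n) v = w" using \<tau>_inv[OF g] ancestor_closed[OF v(1)] v(2) by metis
  then show "v \<in> desc w" using v(1) by (auto simp: desc_def)
qed

definition hit :: "nat \<Rightarrow> 'v \<Rightarrow> real" where
  "hit n w = measure (law n) {r \<in> carrier G. \<tau> r root \<in> desc w}"

lemma hit_event: "{r \<in> carrier G. \<tau> r root \<in> D} \<in> sets (borel_of X)"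
proof -
  have "(\<lambda>r. \<tau> r root) -` D \<inter> space (borel_of X) \<in> sets (borel_of X)"
    by (rule measurable_sets[OF \<tau>_measurable[OF root_in]]) simp
  moreover have "(\<lambda>r. \<tau> r root) -` D \<inter> space (borel_of X) = {r \<in> carrier G. \<tau> r root \<in> D}" by auto
  ultimately show ?thesis by simp
qed

lemma hit_bounds: "0 \<le> hit n w" "hit n w \<le> 1"
proof -
  interpret L: prob_space "law n" by (rule prob_space_law)
  show "0 \<le> hit n w" "hit n w \<le> 1" by (simp_all add: hit_def)
qed

lemma hit_integral: "hit n w = (\<integral>r. indicator {r \<in> carrier G. \<tau> r root \<in> desc w} r \<partial>law n)"
proof -
  have "{r \<in> carrier G. \<tau> r root \<in> desc w} \<inter> space (law n) = {r \<in> carrier G. \<tau> r root \<in> desc w}"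
    unfolding space_law by auto
  then show ?thesis unfolding hit_def Bochner_Integration.integral_indicator by simp
qed

text \<open>
  After a first step \<open>x\<close>, the remaining steps have to bring the root below \<open>inv
  x\<close> applied to \<open>w\<close>.
\<close>

lemma hit_Suc:
  assumes w: "w \<in> V"
  shows "hit (Suc n) w = (\<integral>x. hit n (\<tau> (inv x) w) \<partial>\<mu>)"
proof -
  have "hit (Suc n) w = (\<integral>x. (\<integral>r. indicator {r \<in> carrier G. \<tau> r root \<in> desc w} (x \<otimes> r) \<partial>law n) \<partial>\<mu>)"
    unfolding hit_integral
    by (rule integral_law_Suc[where C=1, OF borel_measurable_indicator[OF hit_event]]) (simp add: indicator_def)
  also have "\<dots> = (\<integral>x. hit n (\<tau> (inv x) w) \<partial>\<mu>)"
  proof (intro Bochner_Integration.integral_cong refl)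
    fix x assume "x \<in> space \<mu>"
    then have x: "x \<in> carrier G" by simp
    show "(\<integral>r. indicator {r \<in> carrier G. \<tau> r root \<in> desc w} (x \<otimes> r) \<partial>law n) = hit n (\<tau> (inv x) w)"
      unfolding hit_integral
    proof (intro Bochner_Integration.integral_cong refl)
      fix r assume "r \<in> space (law n)"
      then have r: "r \<in> carrier G" unfolding space_law .
      have "\<tau> (x \<otimes> r) root \<in> desc w \<longleftrightarrow> \<tau> x (\<tau> r root) \<in> desc (\<tau> x (\<tau> (inv x) w))"
        using x r root_in w by (simp add: \<tau>_mult \<tau>_inv')
      also have "\<dots> \<longleftrightarrow> \<tau> r root \<in> desc (\<tau> (inv x) w)"
        using x r root_in w by (intro desc_\<tau>_iff \<tau>_closed) auto
      finally show "indicat_real {r \<in> carrier G. \<tau> r root \<in> desc w} (x \<otimes> r)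
          = indicator {r \<in> carrier G. \<tau> r root \<in> desc (\<tau> (inv x) w)} r"
        using x r by (simp add: indicator_def)
    qed
  qed
  finally show ?thesis .
qed

lemma hit_disjoint:
  assumes I: "finite I" and inj: "inj_on y I" and y: "\<And>t. t \<in> I \<Longrightarrow> y t \<in> V"
    and h: "\<And>t. t \<in> I \<Longrightarrow> height (y t) = k"
  shows "(\<Sum>t\<in>I. hit n (y t)) \<le> 1"
proof -
  interpret L: prob_space "law n" by (rule prob_space_law)
  have "(\<Sum>t\<in>I. hit n (y t)) = measure (law n) (\<Union>t\<in>I. {r \<in> carrier G. \<tau> r root \<in> desc (y t)})"
    unfolding hit_def
  proof (rule L.finite_measure_finite_Union[symmetric, OF I])
    show "(\<lambda>t. {r \<in> carrier G. \<tau> r root \<in> desc (y t)}) ` I \<subseteq> L.events" using hit_event by (auto simp: sets_law)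
    show "disjoint_family_on (\<lambda>t. {r \<in> carrier G. \<tau> r root \<in> desc (y t)}) I"
      unfolding disjoint_family_on_def
    proof (intro ballI impI)
      fix s t assume st: "s \<in> I" "t \<in> I" "s \<noteq> t"
      then have "desc (y s) \<inter> desc (y t) = {}"
        using y h inj by (intro desc_disjoint) (auto dest: inj_onD)
      then show "{r \<in> carrier G. \<tau> r root \<in> desc (y s)} \<inter> {r \<in> carrier G. \<tau> r root \<in> desc (y t)} = {}" by blast
    qed
  qed
  also have "\<dots> \<le> 1" by simp
  finally show ?thesis .
qed

lemma hit_ancestor_root: "hit n ((p ^^ m) root) = measure (law n) {r \<in> carrier G. up r \<le> real m}"
  unfolding hit_def
  by (rule arg_cong[where f="measure (law n)"]) (auto simp: up_def desc_iff_climb \<tau>_closed root_in)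

lemma measure_step_carrier: "measure \<mu> (carrier G) = 1"
  by (simp add: measure_def emeasure_carrier)

text \<open>
  Prefixing a step \<open>x\<close> to a walk whose climb is \<open>z\<close> changes the climb by
  at most \<open>D z x = max (up x - z) (up x - down x)\<close>. As \<open>z\<close> grows, the
  mean of \<open>D z\<close> tends to \<open>- drift\<close>, so the mean climb decreases at a
  definite rate while the climb exceeds some \<open>K\<close>. Since the climb is nonnegative, it
  must be at most \<open>K\<close> for a positive proportion of the time.
\<close>

lemma occupation_lower_bound:
  assumes drift: "0 < drift"
  obtains K \<delta> where "0 < \<delta>" "\<forall>N. \<delta> * real N \<le> (\<Sum>n<N. hit n ((p ^^ K) root))"
proof -
  define L where "L x = up x + down x" for x
  have L0: "0 \<le> L x" for x using up_nonneg down_nonneg by (simp add: L_def)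
  have Lint: "integrable \<mu> L" unfolding L_def using up_down_integrable by simp
  define D where "D z x = max (up x - z) (up x - down x)" for z x
  have upm: "up \<in> borel_measurable \<mu>" and downm: "down \<in> borel_measurable \<mu>"
    using up_measurable down_measurable by (simp_all add: measurable_step)
  have Dm: "(\<lambda>x. D z x) \<in> borel_measurable \<mu>" for z unfolding D_def using upm downm by measurable
  have Dabs: "\<bar>D z x\<bar> \<le> L x" if "0 \<le> z" for z x
    using that up_nonneg[of x] down_nonneg[of x] by (auto simp: D_def L_def)
  have Dint: "integrable \<mu> (D z)" if "0 \<le> z" for z
    by (rule Bochner_Integration.integrable_bound[OF Lint Dm]) (use Dabs[OF that] L0 in auto)
  have "(\<lambda>n. \<integral>x. D (real n) x \<partial>\<mu>) \<longlonglongrightarrow> (\<integral>x. up x - down x \<partial>\<mu>)"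
  proof (rule integral_dominated_convergence)
    show "integrable \<mu> L" by (rule Lint)
    show "(\<lambda>x. D (real n) x) \<in> borel_measurable \<mu>" for n by (rule Dm)
    show "(\<lambda>x. up x - down x) \<in> borel_measurable \<mu>" using upm downm by measurable
    show "AE x in \<mu>. norm (D (real n) x) \<le> L x" for n using Dabs by (intro AE_I2) simp
    show "AE x in \<mu>. (\<lambda>n. D (real n) x) \<longlonglongrightarrow> up x - down x"
    proof (intro AE_I2)
      fix x
      have "eventually (\<lambda>n. down x \<le> real n) sequentially"
        using eventually_ge_at_top[of "descent (\<tau> x root)"] by eventually_elim (simp add: down_def)
      then have "eventually (\<lambda>n. D (real n) x = up x - down x) sequentially"
        by eventually_elim (simp add: D_def)
      then show "(\<lambda>n. D (real n) x) \<longlonglongrightarrow> up x - down x" by (rule tendsto_eventually)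
    qed
  qed
  moreover have "(\<integral>x. up x - down x \<partial>\<mu>) = - drift"
    unfolding drift_eq using up_down_integrable by simp
  ultimately have "eventually (\<lambda>n. (\<integral>x. D (real n) x \<partial>\<mu>) < - (drift / 2)) sequentially"
    using drift by (intro order_tendstoD(2)) auto
  then obtain K where K: "(\<integral>x. D (real K) x \<partial>\<mu>) < - (drift / 2)" by (auto simp: eventually_sequentially)
  define C where "C = (\<integral>x. L x \<partial>\<mu>)"
  have C0: "0 \<le> C" unfolding C_def using L0 by (intro Bochner_Integration.integral_nonneg)
  have DC: "(\<integral>x. D z x \<partial>\<mu>) \<le> (C + drift / 2) * indicator {z. z \<le> real K} z - drift / 2" if z: "0 \<le> z" for z
  proof (cases "z \<le> real K")
    case True
    have "(\<integral>x. D z x \<partial>\<mu>) \<le> C"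
      unfolding C_def using Dint[OF z] Lint Dabs[OF z] by (intro integral_mono) (auto simp: abs_le_iff)
    then show ?thesis using True by simp
  next
    case False
    have "(\<integral>x. D z x \<partial>\<mu>) \<le> (\<integral>x. D (real K) x \<partial>\<mu>)"
      by (rule integral_mono[OF Dint[OF z] Dint]) (use False in \<open>auto simp: D_def\<close>)
    then show ?thesis using K False by simp
  qed
  (* the mean climb, whose telescoping sum gives the estimate *)
  define e where "e n = (\<integral>r. up r \<partial>law n)" for n
  have upfin: "integrable (law n) up" for n
  proof (rule integrableI_bounded)
    show "up \<in> borel_measurable (law n)" using up_measurable by (simp add: measurable_law)
    have "(\<integral>\<^sup>+r. ennreal (up r) \<partial>law n) < \<infinity>" using up_linear[of n] by (simp add: le_less_trans)
    then show "(\<integral>\<^sup>+r. ennreal (norm (up r)) \<partial>law n) < \<infinity>" using up_nonneg by simp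
  qed
  have e0: "0 \<le> e n" for n unfolding e_def using up_nonneg by (intro Bochner_Integration.integral_nonneg)
  have eup: "(\<integral>\<^sup>+r. ennreal (up r) \<partial>law n) = ennreal (e n)" for n
    unfolding e_def using upfin up_nonneg by (intro nn_integral_eq_integral) auto
  have hK: "hit n ((p ^^ K) root) = (\<integral>r. indicator {z. z \<le> real K} (up r) \<partial>law n)" for n
  proof -
    have "{r \<in> carrier G. up r \<le> real K} \<in> sets (borel_of X)"
      using hit_event[of "{v. real (climb v) \<le> real K}"] by (simp add: up_def)
    then have "measure (law n) {r \<in> carrier G. up r \<le> real K} = (\<integral>r. indicator {r \<in> carrier G. up r \<le> real K} r \<partial>law n)"
    proof -
      have "{r \<in> carrier G. up r \<le> real K} \<inter> space (law n) = {r \<in> carrier G. up r \<le> real K}"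
        unfolding space_law by auto
      then show ?thesis unfolding Bochner_Integration.integral_indicator by simp
    qed
    also have "\<dots> = (\<integral>r. indicator {z. z \<le> real K} (up r) \<partial>law n)"
    proof (intro Bochner_Integration.integral_cong refl)
      fix r assume "r \<in> space (law n)"
      then have "r \<in> carrier G" unfolding space_law .
      then show "indicat_real {r \<in> carrier G. up r \<le> real K} r = indicator {z. z \<le> real K} (up r)"
        by (simp add: indicator_def)
    qed
    finally show ?thesis unfolding hit_ancestor_root .
  qed
  have step: "e (Suc n) \<le> e n + (C + drift / 2) * hit n ((p ^^ K) root) - drift / 2" for n
  proof -
    interpret L: prob_space "law n" by (rule prob_space_law)
    interpret pair_prob_space \<mu> "law n" ..
    define R where "R r = up r + ((C + drift / 2) * indicator {z. z \<le> real K} (up r) - drift / 2)" for r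
    have Rint: "integrable (law n) R"
    proof -
      have "(\<lambda>r. indicator {z. z \<le> real K} (up r) :: real) \<in> borel_measurable (borel_of X)"
        by (rule measurable_compose[OF up_measurable]) simp
      then have "integrable (law n) (\<lambda>r. indicator {z. z \<le> real K} (up r) :: real)"
        by (rule integrable_law_bounded[where C=1]) (simp add: indicator_def)
      then show ?thesis unfolding R_def using upfin by simp
    qed
    have Rge: "up r + (\<integral>x. D (up r) x \<partial>\<mu>) \<le> R r" for r using DC[OF up_nonneg] by (simp add: R_def)
    have nn: "0 \<le> up r + D (up r) x" for r x using up_nonneg[of x] up_nonneg[of r] by (simp add: D_def)
    have R0: "0 \<le> R r" for r
    proof -
      have "0 \<le> (\<integral>x. up r + D (up r) x \<partial>\<mu>)" using nn by (intro Bochner_Integration.integral_nonneg)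
      also have "\<dots> = up r + (\<integral>x. D (up r) x \<partial>\<mu>)" using Dint[OF up_nonneg] by (simp add: measure_step_carrier)
      finally show ?thesis using Rge[of r] by simp
    qed
    have "ennreal (e (Suc n)) = (\<integral>\<^sup>+x. \<integral>\<^sup>+r. ennreal (up (x \<otimes> r)) \<partial>law n \<partial>\<mu>)"
      unfolding eup[symmetric] using up_measurable by (intro nn_integral_law_Suc) simp
    also have "\<dots> \<le> (\<integral>\<^sup>+x. \<integral>\<^sup>+r. ennreal (up r + D (up r) x) \<partial>law n \<partial>\<mu>)"
    proof (intro nn_integral_mono ennreal_leI)
      fix x r assume "x \<in> space \<mu>" "r \<in> space (law n)"
      then have "x \<in> carrier G" "r \<in> carrier G" by simp_all
      from up_mult(1)[OF this] show "up (x \<otimes> r) \<le> up r + D (up r) x" by (simp add: D_def max_def split: if_splits)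
    qed
    also have "\<dots> = (\<integral>\<^sup>+r. \<integral>\<^sup>+x. ennreal (up r + D (up r) x) \<partial>\<mu> \<partial>law n)"
    proof (rule Fubini'[symmetric])
      have [measurable]: "up \<in> borel_measurable (law n)" using up_measurable by (simp add: measurable_law)
      note [measurable] = upm downm
      show "(\<lambda>(x, r). ennreal (up r + D (up r) x)) \<in> borel_measurable (\<mu> \<Otimes>\<^sub>M law n)"
        unfolding D_def by measurable
    qed
    also have "\<dots> \<le> (\<integral>\<^sup>+r. ennreal (R r) \<partial>law n)"
    proof (intro nn_integral_mono)
      fix r
      have "(\<integral>\<^sup>+x. ennreal (up r + D (up r) x) \<partial>\<mu>) = ennreal (\<integral>x. up r + D (up r) x \<partial>\<mu>)"
        using Dint[OF up_nonneg] nn by (intro nn_integral_eq_integral) auto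
      also have "(\<integral>x. up r + D (up r) x \<partial>\<mu>) = up r + (\<integral>x. D (up r) x \<partial>\<mu>)"
        using Dint[OF up_nonneg] by (simp add: measure_step_carrier)
      also have "ennreal \<dots> \<le> ennreal (R r)" by (rule ennreal_leI[OF Rge])
      finally show "(\<integral>\<^sup>+x. ennreal (up r + D (up r) x) \<partial>\<mu>) \<le> ennreal (R r)" .
    qed
    also have "\<dots> = ennreal (\<integral>r. R r \<partial>law n)"
      using Rint R0 by (intro nn_integral_eq_integral) auto
    also have "(\<integral>r. R r \<partial>law n) = e n + ((C + drift / 2) * hit n ((p ^^ K) root) - drift / 2)"
    proof -
      have "(\<lambda>r. indicator {z. z \<le> real K} (up r) :: real) \<in> borel_measurable (borel_of X)"
        by (rule measurable_compose[OF up_measurable]) simp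
      then have "integrable (law n) (\<lambda>r. indicator {z. z \<le> real K} (up r) :: real)"
        by (rule integrable_law_bounded[where C=1]) (simp add: indicator_def)
      then show ?thesis unfolding R_def hK e_def using upfin[of n] by (simp add: measure_law_carrier)
    qed
    finally have "ennreal (e (Suc n)) \<le> ennreal (e n + ((C + drift / 2) * hit n ((p ^^ K) root) - drift / 2))" .
    moreover have "0 \<le> e n + ((C + drift / 2) * hit n ((p ^^ K) root) - drift / 2)"
      using \<open>(\<integral>r. R r \<partial>law n) = _\<close> R0 Bochner_Integration.integral_nonneg[of "law n" R] by simp
    ultimately show ?thesis by (simp add: ennreal_le_iff)
  qed
  have tele: "e N \<le> (C + drift / 2) * (\<Sum>n<N. hit n ((p ^^ K) root)) - drift / 2 * real N" for N
  proof (induction N)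
    case 0
    have "up \<one> = 0" using climb_le[of 0 0 root] root_in by (simp add: up_def \<tau>_one)
    then have "e 0 = 0" unfolding e_def using up_measurable by (simp add: integral_return)
    then show ?case by simp
  next
    case (Suc N)
    have "(C + drift / 2) * (\<Sum>n<Suc N. hit n ((p ^^ K) root))
        = (C + drift / 2) * (\<Sum>n<N. hit n ((p ^^ K) root)) + (C + drift / 2) * hit N ((p ^^ K) root)"
      by (simp add: distrib_left)
    moreover have "drift / 2 * real (Suc N) = drift / 2 * real N + drift / 2"
      by (simp add: distrib_left add.commute)
    ultimately show ?case using step[of N] Suc by linarith
  qed
  have Cd: "0 < C + drift / 2" using C0 drift by simp
  show thesis
  proof (rule that[of "(drift / 2) / (C + drift / 2)" K])
    show "0 < (drift / 2) / (C + drift / 2)" using Cd drift by simp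
    show "\<forall>N. (drift / 2) / (C + drift / 2) * real N \<le> (\<Sum>n<N. hit n ((p ^^ K) root))"
    proof
      fix N
      have "drift / 2 * real N \<le> (C + drift / 2) * (\<Sum>n<N. hit n ((p ^^ K) root))"
        using tele[of N] e0[of N] by simp
      then show "(drift / 2) / (C + drift / 2) * real N \<le> (\<Sum>n<N. hit n ((p ^^ K) root))"
        using Cd by (simp add: field_simps)
    qed
  qed
qed

definition average_hit :: "nat \<Rightarrow> 'v \<Rightarrow> real" where
  "average_hit N w = (\<Sum>n<N. hit n w) / real N"

lemma average_hit_bounds: "0 \<le> average_hit N w" "average_hit N w \<le> 1"
proof -
  show "0 \<le> average_hit N w" using hit_bounds by (simp add: average_hit_def sum_nonneg)
  have "(\<Sum>n<N. hit n w) \<le> (\<Sum>n<N. 1)" using hit_bounds by (intro sum_mono) auto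
  then show "average_hit N w \<le> 1" by (cases "N = 0") (simp_all add: average_hit_def)
qed

text \<open>
  A diagonal subsequence makes the averages converge at all vertices simultaneously. Splitting off
  the first step changes the average over \<open>N\<close> times by at most \<open>1 / N\<close>,
  so the limit is stationary.
\<close>

lemma limit_hit:
  obtains A k where "strict_mono (k :: nat \<Rightarrow> nat)" "\<forall>w\<in>V. (\<lambda>i. average_hit (k i) w) \<longlonglongrightarrow> A w"
    "\<forall>w\<in>V. 0 \<le> A w \<and> A w \<le> 1" "\<forall>w\<in>V. A w = (\<integral>x. A (\<tau> (inv x) w) \<partial>\<mu>)"
proof -
  obtain k :: "nat \<Rightarrow> nat" where k: "strict_mono k" "\<And>w. w \<in> V \<Longrightarrow> \<exists>l. (\<lambda>i. average_hit (k i) w) \<longlonglongrightarrow> l"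
  proof (rule function_convergent_subsequence[OF countable_vertices, of average_hit 1])
    show "norm (average_hit n x) \<le> 1" for n x using average_hit_bounds by simp
  qed blast
  then obtain A where A: "\<And>w. w \<in> V \<Longrightarrow> (\<lambda>i. average_hit (k i) w) \<longlonglongrightarrow> A w" by metis
  have A01: "0 \<le> A w \<and> A w \<le> 1" if w: "w \<in> V" for w
    using LIMSEQ_le_const[OF A[OF w], of 0] LIMSEQ_le_const2[OF A[OF w], of 1] average_hit_bounds by blast
  have meas: "(\<lambda>x. F (\<tau> (inv x) w)) \<in> borel_measurable \<mu>" if "w \<in> V" for w and F :: "'v \<Rightarrow> real"
    unfolding measurable_step by (rule measurable_compose[OF inv_measurable \<tau>_borel[OF that]])
  have "A w = (\<integral>x. A (\<tau> (inv x) w) \<partial>\<mu>)" if w: "w \<in> V" for w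
  proof (rule LIMSEQ_unique)
    have hint: "integrable \<mu> (\<lambda>x. hit n (\<tau> (inv x) w))" for n
      by (rule integrable_const_bound[where B=1]) (use hit_bounds meas[OF w] in auto)
    have eq: "(\<integral>x. average_hit N (\<tau> (inv x) w) \<partial>\<mu>) = average_hit N w + (hit N w - hit 0 w) / real N" for N
    proof -
      have "(\<integral>x. average_hit N (\<tau> (inv x) w) \<partial>\<mu>) = (\<Sum>n<N. \<integral>x. hit n (\<tau> (inv x) w) \<partial>\<mu>) / real N"
        unfolding average_hit_def using hint by (simp add: Bochner_Integration.integral_sum)
      also have "(\<Sum>n<N. \<integral>x. hit n (\<tau> (inv x) w) \<partial>\<mu>) = (\<Sum>n<N. hit (Suc n) w)"
        using hit_Suc[OF w] by simp
      also have "\<dots> = (\<Sum>n<N. hit n w) + (hit N w - hit 0 w)"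
        by (induction N) auto
      finally show ?thesis by (simp add: average_hit_def add_divide_distrib)
    qed
    have "(\<lambda>i. (\<integral>x. average_hit (k i) (\<tau> (inv x) w) \<partial>\<mu>)) \<longlonglongrightarrow> (\<integral>x. A (\<tau> (inv x) w) \<partial>\<mu>)"
    proof (rule integral_dominated_convergence[where w="\<lambda>_. 1"])
      show "AE x in \<mu>. (\<lambda>i. average_hit (k i) (\<tau> (inv x) w)) \<longlonglongrightarrow> A (\<tau> (inv x) w)"
        using w by (intro AE_I2 A \<tau>_closed) auto
      show "AE x in \<mu>. norm (average_hit (k i) (\<tau> (inv x) w)) \<le> 1" for i
        using average_hit_bounds by simp
    qed (use meas[OF w] in auto)
    then show "(\<lambda>i. average_hit (k i) w + (hit (k i) w - hit 0 w) / real (k i)) \<longlonglongrightarrow> (\<integral>x. A (\<tau> (inv x) w) \<partial>\<mu>)"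
      unfolding eq .
    have "(\<lambda>i. (hit (k i) w - hit 0 w) / real (k i)) \<longlonglongrightarrow> 0"
    proof (rule Lim_null_comparison)
      show "eventually (\<lambda>i. norm ((hit (k i) w - hit 0 w) / real (k i)) \<le> 1 / real (k i)) sequentially"
      proof (intro always_eventually allI)
        fix i
        have "\<bar>hit (k i) w - hit 0 w\<bar> \<le> 1"
          using hit_bounds[of "k i" w] hit_bounds[of 0 w] by (simp add: abs_le_iff)
        then show "norm ((hit (k i) w - hit 0 w) / real (k i)) \<le> 1 / real (k i)"
          by (simp add: divide_right_mono)
      qed
      show "(\<lambda>i. 1 / real (k i)) \<longlonglongrightarrow> 0"
        using LIMSEQ_subseq_LIMSEQ[OF lim_const_over_n[of 1] k(1)] by (simp add: o_def)
    qed
    from tendsto_add[OF A[OF w] this]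
    show "(\<lambda>i. average_hit (k i) w + (hit (k i) w - hit 0 w) / real (k i)) \<longlonglongrightarrow> A w" by simp
  qed
  then show thesis using that[of k A] k(1) A A01 by blast
qed

lemma limit_hit_harmonic:
  assumes A: "\<forall>w\<in>V. 0 \<le> A w \<and> A w \<le> 1" "\<forall>w\<in>V. A w = (\<integral>x. A (\<tau> (inv x) w) \<partial>\<mu>)" and w: "w \<in> V"
  shows "(\<lambda>g. A (\<tau> (inv g) w)) \<in> bounded_harmonic G X \<mu>"
proof -
  have "A (\<tau> (inv g) w) = (\<integral>x. A (\<tau> (inv (g \<otimes> x)) w) \<partial>\<mu>)" if g: "g \<in> carrier G" for g
  proof -
    have "A (\<tau> (inv g) w) = (\<integral>x. A (\<tau> (inv x) (\<tau> (inv g) w)) \<partial>\<mu>)"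
      using A(2) \<tau>_closed[of "inv g" w] g w by simp
    also have "\<dots> = (\<integral>x. A (\<tau> (inv (g \<otimes> x)) w) \<partial>\<mu>)"
      using g w by (intro Bochner_Integration.integral_cong refl) (simp add: inv_mult_group \<tau>_mult)
    finally show ?thesis .
  qed
  moreover have "(\<lambda>g. A (\<tau> (inv g) w)) \<in> borel_measurable (borel_of X)"
    by (rule measurable_compose[OF inv_measurable \<tau>_borel[OF w]])
  moreover have "bounded ((\<lambda>g. A (\<tau> (inv g) w)) ` carrier G)"
    unfolding bounded_iff using A(1) \<tau>_closed w by (intro exI[of _ 1]) auto
  ultimately show ?thesis by (simp add: bounded_harmonic_def)
qed

text \<open>
  If all bounded harmonic functions were constant on \<open>\<Gamma>\<close>, then the limit
  \<open>A\<close> of \<open>limit_hit\<close> would be invariant under \<open>\<Gamma>\<close>.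
  It would be at least \<open>\<delta>\<close> at high ancestors of the root, hence at the images
  of such an ancestor under the powers of \<open>\<gamma>\<close>, which lie arbitrarily far down.
  Below the vertices that \<open>F\<close> refers to, exchanging subtrees is realised by elements
  of \<open>\<Gamma>\<close>, and so \<open>A\<close> would be at least \<open>\<delta>\<close> at
  arbitrarily many vertices of equal height. The descendants of these vertices are disjoint sets,
  whose averaged hitting probabilities add up to at most one, a contradiction.
\<close>

lemma nonconstant_harmonic:
  assumes drift: "0 < drift" and \<Gamma>: "subgroup \<Gamma> G" and F: "finite F" "fixer F \<subseteq> \<Gamma>"
    and \<gamma>: "\<gamma> \<in> \<Gamma>" "0 < height (\<tau> \<gamma> root)"
    and rich: "\<And>\<sigma>. equivariant \<sigma> \<Longrightarrow> bij_betw \<sigma> V V \<Longrightarrow>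
      \<exists>u\<in>carrier G. (\<forall>v\<in>V. \<tau> u v = \<sigma> v) \<and> (\<forall>w\<in>\<Omega> - emb ` V. act u w = w)"
    and F\<Omega>: "F \<subseteq> \<Omega>"
  shows "\<exists>f\<in>bounded_harmonic G X \<mu>. \<exists>g\<in>\<Gamma>. f g \<noteq> f \<one>"
proof (rule ccontr)
  assume "\<not> ?thesis"
  then have const: "\<And>f g. f \<in> bounded_harmonic G X \<mu> \<Longrightarrow> g \<in> \<Gamma> \<Longrightarrow> f g = f \<one>" by blast
  have \<Gamma>c: "g \<in> carrier G" if "g \<in> \<Gamma>" for g using subgroup.mem_carrier[OF \<Gamma> that] .
  obtain K \<delta> where \<delta>: "0 < \<delta>" "\<forall>N. \<delta> * real N \<le> (\<Sum>n<N. hit n ((p ^^ K) root))"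
    using occupation_lower_bound[OF drift] .
  obtain A k where k: "strict_mono (k :: nat \<Rightarrow> nat)" and A: "\<forall>w\<in>V. (\<lambda>i. average_hit (k i) w) \<longlonglongrightarrow> A w"
    and A01: "\<forall>w\<in>V. 0 \<le> A w \<and> A w \<le> 1" and Ah: "\<forall>w\<in>V. A w = (\<integral>x. A (\<tau> (inv x) w) \<partial>\<mu>)"
    using limit_hit .
  have inv: "A (\<tau> g w) = A w" if g: "g \<in> \<Gamma>" and w: "w \<in> V" for g w
    using const[OF limit_hit_harmonic[OF A01 Ah w] subgroup.m_inv_closed[OF \<Gamma> g]] \<Gamma>c[OF g] w
    by (simp add: \<tau>_one)
  have Abig: "\<delta> \<le> A ((p ^^ m) root)" if m: "K \<le> m" for m
  proof (rule LIMSEQ_le_const)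
    show "(\<lambda>i. average_hit (k i) ((p ^^ m) root)) \<longlonglongrightarrow> A ((p ^^ m) root)"
      using A ancestor_closed[OF root_in] by blast
    have "\<delta> \<le> average_hit (k i) ((p ^^ m) root)" if i: "1 \<le> i" for i
    proof -
      have pos: "0 < k i" using seq_suble[OF k, of i] i by simp
      have "hit n ((p ^^ K) root) \<le> hit n ((p ^^ m) root)" for n
      proof -
        interpret L: prob_space "law n" by (rule prob_space_law)
        have "{r \<in> carrier G. up r \<le> real m} \<in> sets (borel_of X)"
          using hit_event[of "{v. real (climb v) \<le> real m}"] by (simp add: up_def)
        then show ?thesis
          unfolding hit_ancestor_root using m by (intro L.finite_measure_mono) (auto simp: sets_law)
      qed
      then have "\<delta> * real (k i) \<le> (\<Sum>n<k i. hit n ((p ^^ m) root))"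
        using \<delta>(2) by (meson order_trans sum_mono)
      then show ?thesis using pos by (simp add: average_hit_def field_simps)
    qed
    then show "\<exists>N. \<forall>i\<ge>N. \<delta> \<le> average_hit (k i) ((p ^^ m) root)" by blast
  qed
  define s where "s = nat (height (\<tau> \<gamma> root))"
  have s: "0 < s" "int s = height (\<tau> \<gamma> root)" using \<gamma>(2) by (auto simp: s_def)
  have \<gamma>c: "\<gamma> \<in> carrier G" by (rule \<Gamma>c[OF \<gamma>(1)])
  define d where "d = descent (\<tau> \<gamma> root)"
  define v where "v = (p ^^ d) root"
  have v: "v \<in> V" unfolding v_def by (rule ancestor_closed[OF root_in])
  (* v lies on the axis of \<gamma>, which the ray of the root enters at \<tau> \<gamma> v, s
     generations below v *)
  have axis: "(p ^^ s) (\<tau> \<gamma> v) = v"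
  proof -
    have "\<tau> \<gamma> v = (p ^^ d) (\<tau> \<gamma> root)"
      unfolding v_def by (rule equivariant_funpow[OF equivariant_\<tau>[OF \<gamma>c] root_in])
    also have "\<dots> = (p ^^ climb (\<tau> \<gamma> root)) root"
      unfolding d_def using join[OF \<tau>_closed[OF \<gamma>c root_in]] by simp
    finally have "(p ^^ s) (\<tau> \<gamma> v) = (p ^^ (s + climb (\<tau> \<gamma> root))) root" by (simp add: funpow_plus)
    moreover have "s + climb (\<tau> \<gamma> root) = d" using s(2) by (simp add: d_def height_def)
    ultimately show ?thesis by (simp add: v_def)
  qed
  have \<gamma>funpow: "\<tau> \<gamma> ((p ^^ n) u) = (p ^^ n) (\<tau> \<gamma> u)" if "u \<in> V" for n u
    by (rule equivariant_funpow[OF equivariant_\<tau>[OF \<gamma>c] that])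
  have A_up: "A ((p ^^ (s * J)) v) = A v" for J
  proof (induction J)
    case (Suc J)
    have "\<tau> \<gamma> ((p ^^ (s * Suc J)) v) = (p ^^ (s * J)) ((p ^^ s) (\<tau> \<gamma> v))"
      using \<gamma>funpow[OF v] by (simp add: funpow_plus[symmetric] add.commute)
    also have "\<dots> = (p ^^ (s * J)) v" by (simp add: axis)
    finally show ?case using inv[OF \<gamma>(1) ancestor_closed[OF v, of "s * Suc J"]] Suc by simp
  qed simp
  have Av: "\<delta> \<le> A v"
  proof -
    have "(p ^^ (s * K)) v = (p ^^ (s * K + d)) root" by (simp add: v_def funpow_plus)
    moreover have "K \<le> s * K + d" using s(1) by (simp add: trans_le_add1)
    ultimately show ?thesis using Abig A_up[of K] by metis
  qed
  (* the vertices of the axis below v *)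
  define y where "y J = (\<tau> \<gamma> ^^ J) v" for J
  have yV: "y J \<in> V" and Ay: "A (y J) = A v" and hy: "height (y J) = height v + int (s * J)" for J
  proof -
    have "y J \<in> V \<and> A (y J) = A v \<and> height (y J) = height v + int (s * J)"
    proof (induction J)
      case (Suc J)
      then have "height (\<tau> \<gamma> (y J)) = height (y J) + int s"
        using height_equivariant[OF equivariant_\<tau>[OF \<gamma>c]] s(2) by simp
      then show ?case using Suc inv[OF \<gamma>(1)] \<tau>_closed[OF \<gamma>c] by (simp add: y_def algebra_simps)
    qed (simp add: y_def v)
    then show "y J \<in> V" "A (y J) = A v" "height (y J) = height v + int (s * J)" by auto
  qed
  obtain N where N: "1 < real N * \<delta>" using reals_Archimedean3[OF \<delta>(1)] by blast
  obtain h where h: "\<And>x. x \<in> V \<Longrightarrow> emb x \<in> F \<Longrightarrow> height x \<le> h"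
  proof -
    have "finite (height ` (V \<inter> emb -` F))"
      using F(1) emb_inj by (intro finite_imageI finite_vimage_IntI[of F emb V, unfolded Int_commute[of _ V]]) auto
    then obtain h where "\<And>i. i \<in> height ` (V \<inter> emb -` F) \<Longrightarrow> i \<le> h"
      using Max_ge by blast
    then show thesis using that by blast
  qed
  (* so far down that exchanging subtrees at y J and its first N - 1 ancestors does not move F *)
  define J where "J = nat (\<bar>h\<bar> + \<bar>height v\<bar> + int N)"
  have hJ: "h \<le> height (y J) - int N"
  proof -
    have "J \<le> s * J" using s(1) by simp
    then have "int J \<le> int (s * J)" by (simp only: of_nat_le_iff)
    then show ?thesis unfolding hy by (simp add: J_def)
  qed
  obtain \<sigma> where \<sigma>: "\<forall>t<N. equivariant (\<sigma> t) \<and> bij_betw (\<sigma> t) V V \<and> height (\<sigma> t (y J)) = height (y J)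
      \<and> (\<forall>x\<in>V. height x \<le> height (y J) - int N \<longrightarrow> \<sigma> t x = x)" "inj_on (\<lambda>t. \<sigma> t (y J)) {..<N}"
    using distinct_translates[OF yV] .
  have A\<sigma>: "A (\<sigma> t (y J)) = A v" if t: "t < N" for t
  proof -
    obtain u where u: "u \<in> carrier G" "\<forall>v\<in>V. \<tau> u v = \<sigma> t v" "\<forall>w\<in>\<Omega> - emb ` V. act u w = w"
      using rich \<sigma>(1) t by metis
    have "act u w = w" if w: "w \<in> F" for w
    proof (cases "w \<in> emb ` V")
      case True
      then obtain x where x: "x \<in> V" "w = emb x" by auto
      then have "\<sigma> t x = x" using \<sigma>(1) t h[OF x(1)] w hJ by (meson order_trans)
      then show ?thesis using act_emb[OF u(1) x(1)] u(2) x by simp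
    qed (use u(3) F\<Omega> w in blast)
    then have "u \<in> \<Gamma>" using F(2) u(1) by (auto simp: fixer_def)
    then show ?thesis using inv[OF _ yV] Ay u(2) yV by metis
  qed
  have "(\<Sum>t<N. A (\<sigma> t (y J))) \<le> 1"
  proof (rule LIMSEQ_le_const2)
    show "(\<lambda>i. \<Sum>t<N. average_hit (k i) (\<sigma> t (y J))) \<longlonglongrightarrow> (\<Sum>t<N. A (\<sigma> t (y J)))"
      using A \<sigma>(1) yV by (intro tendsto_sum) (simp add: equivariant_closed)
    have "(\<Sum>t<N. average_hit M (\<sigma> t (y J))) \<le> 1" for M
    proof -
      have "(\<Sum>t<N. average_hit M (\<sigma> t (y J))) = (\<Sum>n<M. \<Sum>t<N. hit n (\<sigma> t (y J))) / real M"
        unfolding average_hit_def sum_divide_distrib[symmetric] by (subst sum.swap) simp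
      also have "\<dots> \<le> (\<Sum>n<M. 1) / real M"
        using \<sigma> yV by (intro divide_right_mono sum_mono hit_disjoint[where k="height (y J)"]) (auto intro: equivariant_closed)
      also have "\<dots> \<le> 1" by simp
      finally show ?thesis .
    qed
    then show "\<exists>N0. \<forall>i\<ge>N0. (\<Sum>t<N. average_hit (k i) (\<sigma> t (y J))) \<le> 1" by blast
  qed
  moreover have "(\<Sum>t<N. A (\<sigma> t (y J))) = real N * A v" using A\<sigma> by simp
  moreover have "real N * \<delta> \<le> real N * A v" using Av by (intro mult_left_mono) auto
  ultimately show False using N by linarith
qed

end

section \<open>Homogeneous trees with a distinguished end\<close>

text \<open>
  The parent map is obtained from the Busemann function of the end, constructed as a limit of
  distances along a ray. That the tree has no cycles enters through \<open>level_path\<close>.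
\<close>

locale rooted_tree =
  fixes T :: "'v pointed_tree" and d :: nat
  assumes homogeneous: "homogeneous_tree d T" and d3: "3 \<le> d"
begin

abbreviation V where "V \<equiv> verts T"
abbreviation adjacent where "adjacent \<equiv> adj T"
abbreviation dist where "dist \<equiv> tree_dist T"

lemma is_tree: "is_tree T" using homogeneous by (simp add: homogeneous_tree_def)

lemma adj_in: "adjacent u v \<Longrightarrow> u \<in> V" "adjacent u v \<Longrightarrow> v \<in> V"
  and adj_neq: "adjacent u v \<Longrightarrow> u \<noteq> v" and adj_sym: "adjacent u v \<Longrightarrow> adjacent v u"
  using is_tree unfolding is_tree_def by blast+

lemma no_cycle: "3 \<le> length c \<Longrightarrow> distinct c \<Longrightarrow> successively adjacent c \<Longrightarrow> adjacent (last c) (hd c) \<Longrightarrow> False"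
proof -
  assume c: "3 \<le> length c" "distinct c" "successively adjacent c" "adjacent (last c) (hd c)"
  have "adjacent (c ! i) (c ! (Suc i mod length c))" if i: "i < length c" for i
  proof (cases "Suc i < length c")
    case True
    then show ?thesis using c(3) by (simp add: successively_conv_nth)
  next
    case False
    then have "Suc i = length c" using i by simp
    then have "i = length c - 1" "Suc i mod length c = 0" "c \<noteq> []" using c(1) by auto
    then have "c ! i = last c" "c ! (Suc i mod length c) = hd c" by (simp_all add: last_conv_nth hd_conv_nth)
    then show ?thesis using c(4) by simp
  qed
  then show False using is_tree c(1,2) unfolding is_tree_def by blast
qed

lemma relpow_sym: "(adjacent ^^ n) u v \<Longrightarrow> (adjacent ^^ n) v u"
proof (induction n arbitrary: v)
  case (Suc n)
  then obtain w where "(adjacent ^^ n) u w" "adjacent w v" by auto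
  then show ?case using Suc.IH adj_sym by (intro relpowp_Suc_I2)
qed simp

lemma dist_le: "(adjacent ^^ n) u v \<Longrightarrow> dist u v \<le> n"
  unfolding tree_dist_def by (rule Least_le)

lemma dist_relpow: "u \<in> V \<Longrightarrow> v \<in> V \<Longrightarrow> (adjacent ^^ dist u v) u v"
proof -
  assume "u \<in> V" "v \<in> V"
  then have "adjacent\<^sup>*\<^sup>* u v" using is_tree by (simp add: is_tree_def)
  then obtain n where "(adjacent ^^ n) u v" using rtranclp_imp_relpowp by metis
  then show ?thesis unfolding tree_dist_def by (rule LeastI)
qed

lemma dist_eq_0: "u \<in> V \<Longrightarrow> v \<in> V \<Longrightarrow> dist u v = 0 \<Longrightarrow> u = v"
  using dist_relpow[of u v] by simp

lemma dist_commute: "u \<in> V \<Longrightarrow> v \<in> V \<Longrightarrow> dist u v = dist v u"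
  using dist_le[OF relpow_sym[OF dist_relpow[of u v]]] dist_le[OF relpow_sym[OF dist_relpow[of v u]]] by simp

lemma dist_triangle: "u \<in> V \<Longrightarrow> v \<in> V \<Longrightarrow> w \<in> V \<Longrightarrow> dist u w \<le> dist u v + dist v w"
proof (rule dist_le)
  assume "u \<in> V" "v \<in> V" "w \<in> V"
  then show "(adjacent ^^ (dist u v + dist v w)) u w"
    using dist_relpow[of u v] dist_relpow[of v w] by (auto simp: relpowp_add)
qed

lemma dist_adj: "adjacent u v \<Longrightarrow> dist u v \<le> 1"
  by (rule dist_le) (auto simp: eq_OO)

lemma adj_if_dist_1: "u \<in> V \<Longrightarrow> v \<in> V \<Longrightarrow> dist u v = 1 \<Longrightarrow> adjacent u v"
  using dist_relpow[of u v] by (simp add: eq_OO)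

lemma closer_neighbour:
  assumes "v \<in> V" "x \<in> V" "dist v x = Suc n"
  obtains u where "adjacent v u" "dist u x = n"
proof -
  have "(adjacent ^^ Suc n) v x" using dist_relpow[OF assms(1,2)] assms(3) by simp
  then obtain u where u: "adjacent v u" "(adjacent ^^ n) u x" by (rule relpowp_Suc_E2)
  have "Suc n \<le> dist v u + dist u x" using dist_triangle[of v u x] adj_in[OF u(1)] assms by simp
  then have "dist u x = n" using dist_adj[OF u(1)] dist_le[OF u(2)] by simp
  then show thesis using that u(1) by blast
qed

text \<open>
  Following geodesics to \<open>x\<close> from two vertices at the same distance until they meet
  gives a simple path that stays closer to \<open>x\<close>. An edge between the two vertices, or
  a common neighbour farther from \<open>x\<close>, would close it to a cycle.
\<close>

lemma level_path:
  assumes x: "x \<in> V"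
  shows "u \<in> V \<Longrightarrow> v \<in> V \<Longrightarrow> u \<noteq> v \<Longrightarrow> dist u x = n \<Longrightarrow> dist v x = n \<Longrightarrow>
    \<exists>c. 3 \<le> length c \<and> distinct c \<and> successively adjacent c \<and> hd c = u \<and> last c = v
      \<and> (\<forall>z\<in>set c. z = u \<or> z = v \<or> dist z x < n)"
proof (induction n arbitrary: u v)
  case 0
  then show ?case using dist_eq_0 x by metis
next
  case (Suc n)
  obtain u' where u': "adjacent u u'" "dist u' x = n" using closer_neighbour[OF Suc.prems(1) x Suc.prems(4)] .
  obtain v' where v': "adjacent v v'" "dist v' x = n" using closer_neighbour[OF Suc.prems(2) x Suc.prems(5)] .
  show ?case
  proof (cases "u' = v'")
    case True
    then have "distinct [u, u', v]" using Suc.prems(3) adj_neq u'(1) v'(1) by auto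
    then show ?thesis using u' v' True adj_sym by (intro exI[of _ "[u, u', v]"]) auto
  next
    case False
    obtain c where c: "3 \<le> length c" "distinct c" "successively adjacent c" "hd c = u'" "last c = v'"
        "\<forall>z\<in>set c. z = u' \<or> z = v' \<or> dist z x < n"
      using Suc.IH[OF adj_in(2)[OF u'(1)] adj_in(2)[OF v'(1)] False u'(2) v'(2)] by blast
    have small: "dist z x \<le> n" if "z \<in> set c" for z using c(6) that u'(2) v'(2) by force
    then have "u \<notin> set c" "v \<notin> set c" using Suc.prems(4,5) by force+
    moreover have "c \<noteq> []" using c(1) by auto
    ultimately have "distinct (u # c @ [v])" "successively adjacent (u # c @ [v])"
      using c(2,3,4,5) Suc.prems(3) u'(1) adj_sym[OF v'(1)]
      by (auto simp: successively_append_iff successively_Cons)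
    then show ?thesis using small c(1) by (intro exI[of _ "u # c @ [v]"]) fastforce
  qed
qed

lemma adj_dist_neq:
  assumes "adjacent u v" "x \<in> V"
  shows "dist u x \<noteq> dist v x"
proof
  assume eq: "dist u x = dist v x"
  obtain c where c: "3 \<le> length c" "distinct c" "successively adjacent c" "hd c = u" "last c = v"
    using level_path[OF assms(2) adj_in[OF assms(1)] adj_neq[OF assms(1)] refl eq[symmetric]] by blast
  then show False using no_cycle[OF c(1-3)] adj_sym[OF assms(1)] by simp
qed

lemma closer_neighbour_unique:
  assumes "adjacent w u" "adjacent w v" "x \<in> V" "dist w x = Suc n" "dist u x = n" "dist v x = n"
  shows "u = v"
proof (rule ccontr)
  assume ne: "u \<noteq> v"
  obtain c where c: "3 \<le> length c" "distinct c" "successively adjacent c" "hd c = u" "last c = v"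
      "\<forall>z\<in>set c. z = u \<or> z = v \<or> dist z x < n"
    using level_path[OF assms(3) adj_in(2)[OF assms(1)] adj_in(2)[OF assms(2)] ne assms(5,6)] by blast
  have "w \<notin> set c" using c(6) assms(4-6) by force
  moreover have "c \<noteq> []" using c(1) by auto
  ultimately have "distinct (w # c)" "successively adjacent (w # c)" "adjacent (last (w # c)) (hd (w # c))"
    using c assms(1) adj_sym[OF assms(2)] by (auto simp: successively_Cons)
  then show False using no_cycle[of "w # c"] c(1) by simp
qed

lemma adj_dist_cases:
  assumes "adjacent u v" "x \<in> V"
  shows "dist u x = Suc (dist v x) \<or> dist v x = Suc (dist u x)"
proof -
  have "dist u x \<le> 1 + dist v x" "dist v x \<le> 1 + dist u x"
    using dist_triangle[of u v x] dist_triangle[of v u x] adj_in[OF assms(1)] assms(2)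
      dist_adj[OF assms(1)] dist_adj[OF adj_sym[OF assms(1)]] by auto
  then show ?thesis using adj_dist_neq[OF assms] by linarith
qed

definition base_ray :: "nat \<Rightarrow> 'v" where
  "base_ray = (SOME r. r \<in> rays T \<and> top_end T = ray_equiv T `` {r})"

lemma base_ray: "base_ray \<in> rays T" "top_end T = ray_equiv T `` {base_ray}"
proof -
  have "top_end T \<in> rays T // ray_equiv T" using homogeneous by (simp add: homogeneous_tree_def ends_def)
  then have "\<exists>r. r \<in> rays T \<and> top_end T = ray_equiv T `` {r}" by (auto simp: quotient_def)
  then have "base_ray \<in> rays T \<and> top_end T = ray_equiv T `` {base_ray}"
    unfolding base_ray_def by (rule someI_ex)
  then show "base_ray \<in> rays T" "top_end T = ray_equiv T `` {base_ray}" by auto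
qed

lemma base_in: "base_ray n \<in> V" and base_dist: "m \<le> n \<Longrightarrow> dist (base_ray m) (base_ray n) = n - m"
  using base_ray(1) by (auto simp: rays_def)

text \<open>
  These integers decrease with \<open>n\<close> and are bounded below, so they become constant.
  The eventual value \<open>horo v\<close> is the Busemann function normalised at the start of the
  ray.
\<close>

definition approx :: "nat \<Rightarrow> 'v \<Rightarrow> int" where
  "approx n v = int (dist v (base_ray n)) - int n"

lemma approx_antimono:
  assumes "v \<in> V" "m \<le> n"
  shows "approx n v \<le> approx m v"
  using dist_triangle[OF assms(1) base_in[of m] base_in[of n]] base_dist[OF assms(2)] assms(2)
  by (simp add: approx_def)

lemma approx_lower: "v \<in> V \<Longrightarrow> - int (dist v (base_ray 0)) \<le> approx n v"
  using dist_triangle[of "base_ray 0" v "base_ray n"] base_in base_dist[of 0 n] dist_commute[of v "base_ray 0"]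
  by (simp add: approx_def)

definition horo :: "'v \<Rightarrow> int" where
  "horo v = (SOME b. \<exists>N. \<forall>n\<ge>N. approx n v = b)"

lemma horo_eventually:
  assumes v: "v \<in> V"
  obtains N where "\<forall>n\<ge>N. approx n v = horo v"
proof -
  define k where "k n = nat (approx n v + int (dist v (base_ray 0)))" for n
  have "\<exists>m. m \<in> range k" by blast
  then have "(LEAST m. m \<in> range k) \<in> range k" by (rule LeastI_ex)
  then obtain N where N: "k N = (LEAST m. m \<in> range k)" by auto
  have "approx n v = approx N v" if "N \<le> n" for n
  proof -
    have "k N \<le> k n" unfolding N by (rule Least_le) simp
    then show ?thesis using approx_antimono[OF v that] approx_lower[OF v, of n] approx_lower[OF v, of N]
      by (simp add: k_def)
  qed
  then have "\<exists>b. \<exists>N. \<forall>n\<ge>N. approx n v = b" by blast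
  then have "\<exists>N. \<forall>n\<ge>N. approx n v = horo v" unfolding horo_def by (rule someI_ex)
  then show thesis using that by blast
qed

lemma horo_le_approx: "v \<in> V \<Longrightarrow> horo v \<le> approx n v"
  by (metis approx_antimono horo_eventually linear)

lemma horo_lipschitz:
  assumes "u \<in> V" "v \<in> V"
  shows "horo u \<le> horo v + int (dist u v)"
proof -
  obtain M where M: "\<forall>n\<ge>M. approx n u = horo u" using horo_eventually[OF assms(1)] .
  obtain N where N: "\<forall>n\<ge>N. approx n v = horo v" using horo_eventually[OF assms(2)] .
  have "approx (max M N) u \<le> approx (max M N) v + int (dist u v)"
    using dist_triangle[OF assms base_in[of "max M N"]] by (simp add: approx_def)
  then show ?thesis using M[rule_format, of "max M N"] N[rule_format, of "max M N"] by simp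
qed

lemma horo_adj_cases:
  assumes "adjacent u v"
  shows "horo u = horo v + 1 \<or> horo v = horo u + 1"
proof -
  obtain M where M: "\<forall>n\<ge>M. approx n u = horo u" using horo_eventually[OF adj_in(1)[OF assms]] .
  obtain N where N: "\<forall>n\<ge>N. approx n v = horo v" using horo_eventually[OF adj_in(2)[OF assms]] .
  show ?thesis
    using adj_dist_cases[OF assms base_in[of "max M N"]] M[rule_format, of "max M N"] N[rule_format, of "max M N"]
    by (auto simp: approx_def)
qed

lemma approx_step:
  assumes v: "v \<in> V" and st: "approx n v = horo v" and pos: "dist v (base_ray n) = Suc k"
  obtains u where "adjacent v u" "horo u = horo v - 1" "approx n u = horo u" "dist u (base_ray n) = k"
proof -
  obtain u where u: "adjacent v u" "dist u (base_ray n) = k"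
    using closer_neighbour[OF v base_in pos] .
  have "approx n u = horo v - 1" using st pos u(2) by (simp add: approx_def)
  moreover have "horo u \<le> approx n u" using horo_le_approx[OF adj_in(2)[OF u(1)]] .
  moreover have "horo u = horo v + 1 \<or> horo v = horo u + 1" using horo_adj_cases[OF u(1)] by auto
  ultimately show thesis using that u by auto
qed

definition parent :: "'v \<Rightarrow> 'v" where
  "parent v = (THE u. adjacent v u \<and> horo u = horo v - 1)"

text \<open>
  The first step of a geodesic from \<open>v\<close> to a late point of the base ray lowers the
  Busemann function, and only one neighbour is closer to that point.
\<close>

lemma parent_ex1: 
  assumes v: "v \<in> V"
  shows "\<exists>!u. adjacent v u \<and> horo u = horo v - 1"
proof (rule ex_ex1I)
  obtain N where N: "\<forall>n\<ge>N. approx n v = horo v" using horo_eventually[OF v] .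
  define n where "n = max N (Suc (dist v (base_ray 0)))"
  have "dist (base_ray 0) (base_ray n) \<le> dist (base_ray 0) v + dist v (base_ray n)"
    using dist_triangle v base_in by blast
  then have "dist v (base_ray n) \<noteq> 0"
    using base_dist[of 0 n] dist_commute[OF v base_in[of 0]] by (simp add: n_def)
  then obtain k where "dist v (base_ray n) = Suc k" using not0_implies_Suc by blast
  then show "\<exists>u. adjacent v u \<and> horo u = horo v - 1"
    using approx_step[OF v N[rule_format, of n]] by (metis max.cobounded1 n_def)
next
  fix u u' assume u: "adjacent v u \<and> horo u = horo v - 1" and u': "adjacent v u' \<and> horo u' = horo v - 1"
  obtain N where N: "\<forall>n\<ge>N. approx n v = horo v" using horo_eventually[OF v] .
  obtain M where M: "\<forall>n\<ge>M. approx n u = horo u" using horo_eventually[of u] adj_in u by blast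
  obtain M' where M': "\<forall>n\<ge>M'. approx n u' = horo u'" using horo_eventually[of u'] adj_in u' by blast
  define n where "n = max N (max M M')"
  have "approx n v = horo v" "approx n u = horo u" "approx n u' = horo u'"
    using N M M' by (auto simp: n_def)
  then have "int (dist v (base_ray n)) = int (dist u (base_ray n)) + 1" "dist u' (base_ray n) = dist u (base_ray n)"
    using u u' by (auto simp: approx_def)
  then have e: "dist v (base_ray n) = Suc (dist u (base_ray n))" "dist u' (base_ray n) = dist u (base_ray n)" by simp_all
  have "adjacent v u" "adjacent v u'" using u u' by simp_all
  then show "u = u'" by (rule closer_neighbour_unique[OF _ _ base_in e(1) refl e(2)])
qed

lemma parent_adj: "v \<in> V \<Longrightarrow> adjacent v (parent v)" and horo_parent: "v \<in> V \<Longrightarrow> horo (parent v) = horo v - 1"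
  using theI'[OF parent_ex1] unfolding parent_def by blast+

lemma parent_eqI: "adjacent v u \<Longrightarrow> horo u = horo v - 1 \<Longrightarrow> parent v = u"
  using parent_ex1[OF adj_in(1)] parent_adj[OF adj_in(1)] horo_parent[OF adj_in(1)] by metis

lemma adj_iff: "adjacent u v \<longleftrightarrow> u \<in> V \<and> v \<in> V \<and> (parent u = v \<or> parent v = u)"
  using horo_adj_cases[of u v] parent_eqI[of u v] parent_eqI[of v u] adj_sym adj_in parent_adj
  by (metis add_diff_cancel_right')

lemma parent_in: "v \<in> V \<Longrightarrow> parent v \<in> V" using adj_in(2)[OF parent_adj] .

lemma ancestor_in: "v \<in> V \<Longrightarrow> (parent ^^ n) v \<in> V" by (induction n) (auto intro: parent_in)

lemma horo_ancestor: "v \<in> V \<Longrightarrow> horo ((parent ^^ n) v) = horo v - int n"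
  by (induction n) (auto simp: horo_parent ancestor_in)

lemma ancestor_base: "v \<in> V \<Longrightarrow> approx n v = horo v \<Longrightarrow> dist v (base_ray n) = k \<Longrightarrow> (parent ^^ k) v = base_ray n"
proof (induction k arbitrary: v)
  case 0
  then show ?case using dist_eq_0[OF _ base_in] by simp
next
  case (Suc k)
  obtain u where u: "adjacent v u" "horo u = horo v - 1" "approx n u = horo u" "dist u (base_ray n) = k"
    using approx_step[OF Suc.prems] .
  then have "(parent ^^ k) u = base_ray n" using Suc.IH adj_in by blast
  then show ?case using parent_eqI[OF u(1,2)] by (simp add: funpow_swap1)
qed

lemma ancestor_base_eventually:
  assumes v: "v \<in> V"
  obtains N where "\<forall>n\<ge>N. \<exists>m. (parent ^^ m) v = base_ray n"
  using horo_eventually[OF v] ancestor_base[OF v] by metis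

sublocale parent_tree V parent "origin T" "d - 1"
proof
  show "origin T \<in> V" using homogeneous by (simp add: homogeneous_tree_def)
  show "parent v \<in> V" if "v \<in> V" for v by (rule parent_in[OF that])
  show "n = 0" if "v \<in> V" "(parent ^^ n) v = v" for v n using horo_ancestor[OF that(1), of n] that(2) by simp
  show "\<exists>m n. (parent ^^ m) u = (parent ^^ n) v" if uv: "u \<in> V" "v \<in> V" for u v
  proof -
    obtain M where M: "\<forall>n\<ge>M. \<exists>m. (parent ^^ m) u = base_ray n" using ancestor_base_eventually[OF uv(1)] .
    obtain N where N: "\<forall>n\<ge>N. \<exists>m. (parent ^^ m) v = base_ray n" using ancestor_base_eventually[OF uv(2)] .
    show ?thesis using M[rule_format, of "max M N"] N[rule_format, of "max M N"] by (metis max.cobounded1 max.cobounded2)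
  qed
  have ch: "{w \<in> V. parent w = v} = {w. adjacent v w} - {parent v}" if v: "v \<in> V" for v
  proof -
    have "parent (parent v) \<noteq> v" using horo_ancestor[OF v, of 2] by (auto simp: numeral_2_eq_2)
    then show ?thesis using adj_iff v parent_in by auto
  qed
  have deg: "finite {w. adjacent v w}" "card {w. adjacent v w} = d" if "v \<in> V" for v
    using homogeneous that by (auto simp: homogeneous_tree_def)
  show "finite {w \<in> V. parent w = v}" if "v \<in> V" for v using ch[OF that] deg[OF that] by simp
  show "card {w \<in> V. parent w = v} = d - 1" if "v \<in> V" for v
    using ch[OF that] deg[OF that] parent_adj[OF that] by simp
  show "2 \<le> d - 1" using d3 by simp
qed

lemma ancestor_dist:
  assumes v: "v \<in> V" and "m \<le> n"
  shows "dist ((parent ^^ m) v) ((parent ^^ n) v) = n - m"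
proof (rule antisym)
  have "(adjacent ^^ k) u ((parent ^^ k) u)" if "u \<in> V" for k u
    using that by (induction k) (auto intro!: parent_adj ancestor_in)
  from this[OF ancestor_in[OF v, of m], of "n - m"]
  show "dist ((parent ^^ m) v) ((parent ^^ n) v) \<le> n - m"
    using funpow_diff[OF assms(2), of v] by (intro dist_le) simp
  show "n - m \<le> dist ((parent ^^ m) v) ((parent ^^ n) v)"
    using horo_lipschitz[OF ancestor_in[OF v, of m] ancestor_in[OF v, of n]] horo_ancestor[OF v] by simp
qed

lemma horo_base: "horo (base_ray n) = - int n"
proof -
  obtain N where N: "\<forall>k\<ge>N. approx k (base_ray n) = horo (base_ray n)"
    using horo_eventually[OF base_in] .
  show ?thesis using N[rule_format, of "max N n"] base_dist[of n "max N n"] by (simp add: approx_def)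
qed

text \<open>
  Between its start and a late common point with the base ray, the ray lowers the Busemann
  function by its full length, hence by one in each step.
\<close>

lemma ray_horo_step:
  assumes r: "r \<in> rays T" and inf: "infinite (range base_ray \<inter> range r)"
  shows "r (Suc n) = parent (r n)"
proof -
  have rin: "r i \<in> V" and rdist: "i \<le> j \<Longrightarrow> dist (r i) (r j) = j - i" for i j
    using r by (auto simp: rays_def)
  obtain N where N: "\<forall>k\<ge>N. approx k (r 0) = horo (r 0)" using horo_eventually[OF rin] .
  have "infinite (range base_ray \<inter> range r - (r ` {..n} \<union> base_ray ` {..N}))"
    using inf by (rule Diff_infinite_finite[rotated]) simp
  then obtain z where "z \<in> range base_ray \<inter> range r - (r ` {..n} \<union> base_ray ` {..N})"
    by (metis ex_in_conv finite.emptyI)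
  then obtain i j where ij: "z = r i" "z = base_ray j" "n < i" "N < j"
    by (auto simp: image_iff) (metis atMost_iff not_le)
  have "approx j (r 0) = int i - int j" using rdist[of 0 i] ij by (simp add: approx_def)
  then have h0: "horo (r 0) = int i - int j" using N[rule_format, of j] ij(4) by simp
  have hi: "horo (r i) = - int j" using horo_base[of j] ij by simp
  have "horo (r k) = horo (r 0) - int k" if "k \<le> i" for k
  proof -
    have "horo (r 0) \<le> horo (r k) + int k" using horo_lipschitz[OF rin rin, of 0 k] rdist[of 0 k] by simp
    moreover have "horo (r k) \<le> horo (r i) + int (i - k)" using horo_lipschitz[OF rin rin, of k i] rdist[OF that] by simp
    ultimately show ?thesis using h0 hi that by simp
  qed
  from this[of n] this[of "Suc n"] have "horo (r (Suc n)) = horo (r n) - 1" using ij(3) by simp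
  moreover have "adjacent (r n) (r (Suc n))" using rdist[of n "Suc n"] by (intro adj_if_dist_1 rin) simp
  ultimately show ?thesis by (rule parent_eqI[symmetric, rotated])
qed

text \<open>
  A ray in the distinguished end meets the base ray infinitely often and follows parents by
  \<open>ray_horo_step\<close>; conversely, every ancestral line eventually runs along the base
  ray.
\<close>

lemma top_end_eq: "top_end T = (\<lambda>v n. (parent ^^ n) v) ` V"
proof (intro equalityI subsetI)
  fix r assume "r \<in> top_end T"
  then have r: "r \<in> rays T" "infinite (range base_ray \<inter> range r)"
    using base_ray(2) by (auto simp: ray_equiv_def)
  have "r n = (parent ^^ n) (r 0)" for n by (induction n) (auto simp: ray_horo_step[OF r])
  moreover have "r 0 \<in> V" using r(1) by (auto simp: rays_def)
  ultimately show "r \<in> (\<lambda>v n. (parent ^^ n) v) ` V" by blast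
next
  fix r assume "r \<in> (\<lambda>v n. (parent ^^ n) v) ` V"
  then obtain v where v: "v \<in> V" "r = (\<lambda>n. (parent ^^ n) v)" by auto
  have "r \<in> rays T" using v ancestor_in ancestor_dist by (auto simp: rays_def)
  moreover have "infinite (range base_ray \<inter> range r)"
  proof -
    obtain N where N: "\<forall>n\<ge>N. \<exists>m. (parent ^^ m) v = base_ray n" using ancestor_base_eventually[OF v(1)] .
    have "inj base_ray" using horo_base by (metis injI neg_equal_iff_equal of_nat_eq_iff)
    then have "infinite (base_ray ` {N..})" using finite_imageD inj_on_subset infinite_Ici by blast
    moreover have "base_ray ` {N..} \<subseteq> range base_ray \<inter> range r"
    proof
      fix x assume "x \<in> base_ray ` {N..}"
      then obtain n where n: "N \<le> n" "x = base_ray n" by auto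
      obtain m where "(parent ^^ m) v = base_ray n" using N n(1) by blast
      then have "x = r m" using n(2) v(2) by simp
      then show "x \<in> range base_ray \<inter> range r" using n(2) by blast
    qed
    ultimately show ?thesis using finite_subset by blast
  qed
  ultimately show "r \<in> top_end T" using base_ray by (auto simp: ray_equiv_def)
qed

lemma ray_to_top_eq:
  assumes "v \<in> V"
  shows "ray_to_top T v = (\<lambda>n. (parent ^^ n) v)"
  unfolding ray_to_top_def top_end_eq using assms by (intro the_equality) auto

lemma busemann_eq:
  assumes v: "v \<in> V"
  shows "busemann T v = height v"
proof -
  have "(LEAST n. ray_to_top T v n \<in> range (ray_to_top T (origin T))) = descent v"
  proof -
    have "(parent ^^ n) v \<in> range (\<lambda>m. (parent ^^ m) (origin T)) \<longleftrightarrow> (\<exists>m. (parent ^^ m) (origin T) = (parent ^^ n) v)" for n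
      by (simp add: image_iff eq_commute)
    then show ?thesis unfolding ray_to_top_eq[OF v] ray_to_top_eq[OF root_in] descent_def by simp
  qed
  then have c: "confluent T v = (parent ^^ descent v) v" by (simp add: confluent_def ray_to_top_eq[OF v])
  have "dist v (confluent T v) = descent v" using ancestor_dist[OF v, of 0 "descent v"] c by simp
  moreover have "dist (origin T) (confluent T v) = climb v"
    using ancestor_dist[OF root_in, of 0 "climb v"] join[OF v] c by simp
  ultimately show ?thesis by (simp add: busemann_def height_def)
qed

lemma climb_descent_le_dist:
  assumes v: "v \<in> V"
  shows "climb v + descent v \<le> dist (origin T) v"
proof -
  have "\<exists>m l. m + l \<le> n \<and> (parent ^^ m) (origin T) = (parent ^^ l) v" if "(adjacent ^^ n) (origin T) v" for n v
    using that
  proof (induction n arbitrary: v)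
    case (Suc n)
    then obtain w where w: "(adjacent ^^ n) (origin T) w" "adjacent w v" by auto
    obtain m l where ml: "m + l \<le> n" "(parent ^^ m) (origin T) = (parent ^^ l) w" using Suc.IH[OF w(1)] by blast
    consider "parent v = w" | "parent w = v" using adj_iff w(2) by auto
    then show ?case
    proof cases
      case 1
      then have "(parent ^^ m) (origin T) = (parent ^^ Suc l) v" using ml(2) by (simp add: funpow_swap1)
      then show ?thesis using ml(1) by (intro exI[of _ m] exI[of _ "Suc l"]) simp
    next
      case 2
      show ?thesis
      proof (cases l)
        case 0
        then have "(parent ^^ Suc m) (origin T) = (parent ^^ 0) v" using ml(2) 2 by simp
        then show ?thesis using ml(1) by (intro exI[of _ "Suc m"] exI[of _ 0]) simp
      next
        case (Suc l')
        then have "(parent ^^ m) (origin T) = (parent ^^ l') v" using ml(2) 2 by (simp add: funpow_swap1)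
        then show ?thesis using ml(1) Suc by (intro exI[of _ m] exI[of _ l']) simp
      qed
    qed
  qed auto
  from this[OF dist_relpow[OF root_in v]] show ?thesis
    using climb_le descent_le by (meson add_mono order_trans)
qed

text \<open>
  Adjacency and the distinguished end are both expressed by the parent map, through
  \<open>adj_iff\<close> and \<open>top_end_eq\<close>.
\<close>

lemma Aff_eq: "Aff T = {g \<in> Bij V. equivariant g}"
proof (intro equalityI subsetI)
  fix g assume g: "g \<in> Aff T"
  then have gB: "g \<in> Bij V" by (simp add: Aff_def automorphisms_def)
  then have bij: "bij_betw g V V" by (simp add: Bij_def)
  have "g (parent v) = parent (g v)" if v: "v \<in> V" for v
  proof -
    have "(\<lambda>n. (parent ^^ n) v) \<in> top_end T" using v by (auto simp: top_end_eq)
    then have "g \<circ> (\<lambda>n. (parent ^^ n) v) \<in> top_end T" using g by (auto simp: Aff_def fixes_end_def)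
    then obtain w where "g \<circ> (\<lambda>n. (parent ^^ n) v) = (\<lambda>n. (parent ^^ n) w)" by (auto simp: top_end_eq)
    from fun_cong[OF this, of 0] fun_cong[OF this, of 1] show ?thesis by simp
  qed
  then show "g \<in> {g \<in> Bij V. equivariant g}" using gB bij_betwE[OF bij] by (simp add: equivariant_def)
next
  fix g assume "g \<in> {g \<in> Bij V. equivariant g}"
  then have gB: "g \<in> Bij V" and eq: "equivariant g" by auto
  have bij: "bij_betw g V V" using gB by (simp add: Bij_def)
  have inj: "g u = g v \<longleftrightarrow> u = v" if "u \<in> V" "v \<in> V" for u v
    using bij_betw_imp_inj_on[OF bij] that by (auto dest: inj_onD)
  have "adjacent (g u) (g v) \<longleftrightarrow> adjacent u v" if "u \<in> V" "v \<in> V" for u v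
    using eq that inj parent_in unfolding adj_iff equivariant_def by metis
  moreover have "fixes_end g (top_end T)"
    unfolding fixes_end_def
  proof (intro equalityI subsetI)
    fix r assume "r \<in> (\<lambda>r. g \<circ> r) ` top_end T"
    then obtain v where "v \<in> V" "r = g \<circ> (\<lambda>n. (parent ^^ n) v)" by (auto simp: top_end_eq)
    then show "r \<in> top_end T" using equivariant_funpow[OF eq] equivariant_closed[OF eq]
      by (auto simp: top_end_eq fun_eq_iff intro!: image_eqI[of _ _ "g v"])
  next
    fix r assume "r \<in> top_end T"
    then obtain w where w: "w \<in> V" "r = (\<lambda>n. (parent ^^ n) w)" by (auto simp: top_end_eq)
    then obtain v where v: "v \<in> V" "w = g v" using bij by (auto simp: bij_betw_def)
    then have "r = g \<circ> (\<lambda>n. (parent ^^ n) v)" using w equivariant_funpow[OF eq] by (auto simp: fun_eq_iff)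
    then show "r \<in> (\<lambda>r. g \<circ> r) ` top_end T" using v(1) by (auto simp: top_end_eq)
  qed
  ultimately show "g \<in> Aff T" using gB by (simp add: Aff_def automorphisms_def)
qed

lemma horocyclic_eq: "g \<in> Aff T \<Longrightarrow> horocyclic T g = height (g (origin T))"
  using busemann_eq equivariant_closed root_in by (auto simp: horocyclic_def Aff_eq)

lemma restrict_in_Aff:
  assumes "equivariant \<sigma>" "bij_betw \<sigma> V V"
  shows "restrict \<sigma> V \<in> Aff T"
  using assms by (auto simp: Aff_eq Bij_def equivariant_def parent_in cong: bij_betw_cong)

lemma subgroup_Aff: "subgroup (Aff T) (BijGroup V)"
proof (rule group.subgroupI[OF group_BijGroup])
  show "Aff T \<subseteq> carrier (BijGroup V)" by (auto simp: Aff_eq BijGroup_def)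
  have "restrict (\<lambda>v. v) V \<in> Aff T" by (rule restrict_in_Aff) (auto simp: equivariant_def parent_in bij_betw_def inj_on_def)
  then show "Aff T \<noteq> {}" by auto
next
  fix g assume "g \<in> Aff T"
  then have gB: "g \<in> Bij V" and eq: "equivariant g" by (auto simp: Aff_eq)
  have bij: "bij_betw g V V" using gB by (simp add: Bij_def)
  have inv: "inv_into V g v \<in> V" "g (inv_into V g v) = v" if "v \<in> V" for v
    using bij_betw_apply[OF bij_betw_inv_into[OF bij] that] bij_betw_inv_into_right[OF bij that] by auto
  have "inv_into V g (parent v) = parent (inv_into V g v)" if v: "v \<in> V" for v
  proof -
    have "g (parent (inv_into V g v)) = parent v" using eq inv[OF v] by (simp add: equivariant_def)
    then show ?thesis using bij_betw_inv_into_left[OF bij parent_in[OF inv(1)[OF v]]] by simp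
  qed
  then have "restrict (inv_into V g) V \<in> Aff T"
    using inv bij_betw_inv_into[OF bij] by (intro restrict_in_Aff) (auto simp: equivariant_def)
  then show "inv\<^bsub>BijGroup V\<^esub> g \<in> Aff T" by (simp add: inv_BijGroup[OF gB])
next
  fix g h assume g: "g \<in> Aff T" and h: "h \<in> Aff T"
  have "restrict (\<lambda>x. g (h x)) V \<in> Aff T"
  proof (rule restrict_in_Aff)
    show "equivariant (\<lambda>x. g (h x))" using g h by (simp add: Aff_eq equivariant_def)
    have "bij_betw (g \<circ> h) V V" using g h by (intro bij_betw_trans) (auto simp: Aff_eq Bij_def)
    then show "bij_betw (\<lambda>x. g (h x)) V V" by (simp add: o_def)
  qed
  then show "g \<otimes>\<^bsub>BijGroup V\<^esub> h \<in> Aff T"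
    using g h by (simp add: BijGroup_def Aff_eq compose_def)
qed

lemma group_Aff: "group (Aff_group T)"
  unfolding Aff_group_def by (rule subgroup.subgroup_is_group[OF subgroup_Aff group_BijGroup])

lemma carrier_Aff [simp]: "carrier (Aff_group T) = Aff T"
  by (simp add: Aff_group_def)

lemma Aff_mult: "g \<in> Aff T \<Longrightarrow> h \<in> Aff T \<Longrightarrow> v \<in> V \<Longrightarrow> (g \<otimes>\<^bsub>Aff_group T\<^esub> h) v = g (h v)"
  by (simp add: Aff_group_def BijGroup_def Aff_eq compose_def)

lemma Aff_one: "v \<in> V \<Longrightarrow> \<one>\<^bsub>Aff_group T\<^esub> v = v"
  by (simp add: Aff_group_def BijGroup_def)

lemma Aff_closed: "g \<in> Aff T \<Longrightarrow> v \<in> V \<Longrightarrow> g v \<in> V"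
  by (simp add: Aff_eq equivariant_def)

lemma openin_Aff_agree:
  assumes "finite F" "F \<subseteq> V"
  shows "openin (Aff_topology T) {h \<in> Aff T. \<forall>w\<in>F. h w = g w}"
proof -
  have "openin (product_topology (\<lambda>_. discrete_topology V) V)
      (Pi\<^sub>E V (\<lambda>w. if w \<in> F then {g w} \<inter> V else V))"
    unfolding openin_PiE_gen using assms by (auto intro: finite_subset[OF _ assms(1)])
  moreover have "{h \<in> Aff T. \<forall>w\<in>F. h w = g w} = Pi\<^sub>E V (\<lambda>w. if w \<in> F then {g w} \<inter> V else V) \<inter> Aff T"
  proof -
    have "h \<in> Pi\<^sub>E V (\<lambda>w. if w \<in> F then {g w} \<inter> V else V) \<longleftrightarrow> (\<forall>w\<in>F. h w = g w)" if h: "h \<in> Aff T" for h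
    proof -
      have "h \<in> extensional V" using h by (simp add: Aff_eq Bij_def)
      then show ?thesis using Aff_closed[OF h] assms(2) by (auto simp: PiE_iff split: if_splits)
    qed
    then show ?thesis by blast
  qed
  ultimately show ?thesis unfolding Aff_topology_def openin_subtopology by blast
qed

lemma topspace_Aff [simp]: "topspace (Aff_topology T) = Aff T"
proof -
  have "g \<in> Pi\<^sub>E V (\<lambda>_. V)" if g: "g \<in> Aff T" for g
  proof -
    have "g \<in> extensional V" using g by (simp add: Aff_eq Bij_def)
    then show ?thesis using Aff_closed[OF g] by (simp add: PiE_iff)
  qed
  then have "Aff T \<subseteq> Pi\<^sub>E V (\<lambda>_. V)" by blast
  then show ?thesis by (auto simp: Aff_topology_def)
qed

lemma openin_Aff_basic:
  assumes "openin (Aff_topology T) U" "g \<in> U"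
  obtains F where "finite F" "F \<subseteq> V" "\<forall>h\<in>Aff T. (\<forall>w\<in>F. h w = g w) \<longrightarrow> h \<in> U"
proof -
  obtain S where S: "openin (product_topology (\<lambda>_. discrete_topology V) V) S" "U = S \<inter> Aff T"
    using assms(1) unfolding Aff_topology_def openin_subtopology by blast
  have "g \<in> S" using S(2) assms(2) by simp
  then obtain W where W: "finite {i \<in> V. W i \<noteq> V}" "\<forall>i\<in>V. W i \<subseteq> V" "g \<in> Pi\<^sub>E V W" "Pi\<^sub>E V W \<subseteq> S"
    using S(1) unfolding openin_product_topology_alt by auto
  show thesis
  proof (rule that[OF W(1)])
    show "\<forall>h\<in>Aff T. (\<forall>w\<in>{i \<in> V. W i \<noteq> V}. h w = g w) \<longrightarrow> h \<in> U"
    proof (intro ballI impI)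
      fix h assume h: "h \<in> Aff T" "\<forall>w\<in>{i \<in> V. W i \<noteq> V}. h w = g w"
      have "h w \<in> W w" if w: "w \<in> V" for w
        by (cases "W w = V") (use h w W(3) Aff_closed[OF h(1) w] in \<open>auto simp: PiE_iff\<close>)
      moreover have "h \<in> extensional V" using h(1) by (simp add: Aff_eq Bij_def)
      ultimately have "h \<in> Pi\<^sub>E V W" by (simp add: PiE_iff)
      then show "h \<in> U" using W(4) S(2) h(1) by blast
    qed
  qed auto
qed

end

section \<open>Point masses and constant harmonic functions\<close>

lemma poisson_boundary_continuous_act:
  assumes "poisson_boundary G X \<mu> B act \<nu>" "topspace X = carrier G" "g \<in> carrier G"
  shows "continuous_map B B (act g)"
proof -
  have "continuous_map (prod_topology X B) B (\<lambda>(g, b). act g b)"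
    using assms(1) by (simp add: poisson_boundary_def mu_boundary_def stationary_space_def)
  moreover have "continuous_map B (prod_topology X B) (\<lambda>b. (g, b))"
    using assms(2,3) by (intro continuous_map_pairedI continuous_map_id[unfolded id_def]) auto
  ultimately have "continuous_map B B ((\<lambda>(g, b). act g b) \<circ> (\<lambda>b. (g, b)))"
    by (rule continuous_map_compose[rotated])
  then show ?thesis by (simp add: o_def)
qed

lemma poisson_boundary_act_one:
  assumes "poisson_boundary G X \<mu> B act \<nu>" "b \<in> topspace B"
  shows "act \<one>\<^bsub>G\<^esub> b = b"
proof -
  have "group_action G (topspace B) act"
    using assms(1) by (simp add: poisson_boundary_def mu_boundary_def stationary_space_def)
  then show ?thesis using group_action.id_eq_one assms(2) by (metis restrict_apply')
qed

lemma ess_norm_return: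
  assumes "b \<in> topspace B" "\<phi> \<in> borel_measurable (borel_of B)"
  shows "ess_norm (return (borel_of B) b) \<phi> = ereal \<bar>\<phi> b\<bar>"
proof -
  have m: "(\<lambda>x. ereal \<bar>\<phi> x\<bar>) \<in> borel_measurable (borel_of B)" using assms(2) by simp
  have "esssup (return (borel_of B) b) (\<lambda>x. ereal \<bar>\<phi> x\<bar>) = esssup (return (borel_of B) b) (\<lambda>x. ereal \<bar>\<phi> b\<bar>)"
  proof (rule esssup_AE_cong)
    show "AE x in return (borel_of B) b. ereal \<bar>\<phi> x\<bar> = ereal \<bar>\<phi> b\<bar>"
      using assms by (subst AE_return) auto
  qed (use m in simp_all)
  also have "\<dots> = ereal \<bar>\<phi> b\<bar>"
    using assms(1) by (intro esssup_const) (simp add: emeasure_return borel_of_open)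
  finally show ?thesis by (simp add: ess_norm_def)
qed

text \<open>
  If \<open>\<nu>\<close> is concentrated at \<open>b\<close>, then \<open>f g = \<phi> (act g
  b)\<close>, and the isometry applied to \<open>\<phi> + c\<close> says that \<open>\<bar>f g +
  c\<bar> \<le> \<bar>f \<one> + c\<bar>\<close>. For \<open>c\<close> equal to plus or minus a
  bound of \<open>\<bar>f\<bar>\<close> the absolute values can be dropped, and the two
  inequalities give equality.
\<close>

lemma constant_if_point_mass:
  assumes pb: "poisson_boundary G X \<mu> B act \<nu>" and top: "topspace X = carrier G" and "group G"
    and pm: "point_mass B \<nu>" and f: "f \<in> bounded_harmonic G X \<mu>" and g: "g \<in> carrier G"
  shows "f g = f \<one>\<^bsub>G\<^esub>"
proof -
  interpret group G by fact
  obtain b where b: "b \<in> topspace B" and \<nu>: "\<nu> = return (borel_of B) b" using pm by (auto simp: point_mass_def)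
  obtain \<phi> where \<phi>: "\<phi> \<in> ess_bounded \<nu>" and rep: "\<And>g. g \<in> carrier G \<Longrightarrow> f g = poisson_transform act \<nu> \<phi> g"
    using pb f unfolding poisson_boundary_def by blast
  have \<phi>m: "\<phi> \<in> borel_measurable (borel_of B)" using \<phi> by (simp add: ess_bounded_def \<nu>)
  have transform_at: "poisson_transform act \<nu> \<psi> g = \<psi> (act g b)"
    if "\<psi> \<in> borel_measurable (borel_of B)" "g \<in> carrier G" for \<psi> g
    unfolding poisson_transform_def \<nu>
    using that b measurable_compose[OF continuous_map_borel_of[OF poisson_boundary_continuous_act[OF pb top]]]
    by (intro integral_return) auto
  have one: "act \<one>\<^bsub>G\<^esub> b = b" by (rule poisson_boundary_act_one[OF pb b])
  have fval: "f g = \<phi> (act g b)" if "g \<in> carrier G" for g using rep transform_at \<phi>m that by simp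
  have shift: "\<bar>f g + c\<bar> \<le> \<bar>f \<one>\<^bsub>G\<^esub> + c\<bar>" if "g \<in> carrier G" for g c
  proof -
    define \<psi> where "\<psi> x = \<phi> x + c" for x
    have \<psi>m: "\<psi> \<in> borel_measurable (borel_of B)" unfolding \<psi>_def using \<phi>m by simp
    have en: "ess_norm \<nu> \<psi> = ereal \<bar>\<psi> b\<bar>" unfolding \<nu> by (rule ess_norm_return[OF b \<psi>m])
    then have "\<psi> \<in> ess_bounded \<nu>" using \<psi>m by (simp add: ess_bounded_def \<nu>)
    then have "(SUP g\<in>carrier G. ereal \<bar>poisson_transform act \<nu> \<psi> g\<bar>) = ereal \<bar>\<psi> b\<bar>"
      using pb en unfolding poisson_boundary_def by auto
    then have "ereal \<bar>poisson_transform act \<nu> \<psi> g\<bar> \<le> ereal \<bar>\<psi> b\<bar>" using that by (metis SUP_upper)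
    then show ?thesis using transform_at[OF \<psi>m that] fval[OF that] fval[OF one_closed] one by (simp add: \<psi>_def)
  qed
  obtain M where M: "\<And>g. g \<in> carrier G \<Longrightarrow> \<bar>f g\<bar> \<le> M"
  proof -
    have "bounded (f ` carrier G)" using f unfolding bounded_harmonic_def by blast
    then show thesis using that by (auto simp: bounded_iff)
  qed
  show ?thesis
    using shift[OF g, of M] shift[OF g, of "- M"] M[OF g] M[OF one_closed] by (simp add: abs_le_iff abs_if split: if_splits)
qed

text \<open>
  From each set of a countable base and its complement, pick the one of measure one. Their
  intersection has measure one, and it is a single point because the base separates points.
\<close>

lemma zero_one_measure_point_mass:
  assumes haus: "Hausdorff_space B" and sc: "second_countable B"
    and "prob_space \<nu>" and sets: "sets \<nu> = sets (borel_of B)"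
    and zo: "\<And>A. A \<in> sets \<nu> \<Longrightarrow> measure \<nu> A = 0 \<or> measure \<nu> A = 1"
  shows "point_mass B \<nu>"
proof -
  interpret prob_space \<nu> by fact
  have sp: "space \<nu> = topspace B" using sets_eq_imp_space_eq[OF sets] by simp
  obtain \<B> where \<B>': "countable \<B> \<and> (\<forall>V\<in>\<B>. openin B V)
      \<and> (\<forall>U x. openin B U \<and> x \<in> U \<longrightarrow> (\<exists>V\<in>\<B>. x \<in> V \<and> V \<subseteq> U))"
    using sc unfolding second_countable_def by (elim exE)
  have \<B>: "countable \<B>" "V \<in> \<B> \<Longrightarrow> openin B V"
      "openin B U \<Longrightarrow> x \<in> U \<Longrightarrow> \<exists>V\<in>\<B>. x \<in> V \<and> V \<subseteq> U" for U V x
    using \<B>' by simp_all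
  have Bm: "V \<in> events" if "V \<in> \<B>" for V using borel_of_open[OF \<B>(2)[OF that]] sets by simp
  define pick where "pick V = (if prob V = 1 then V else space \<nu> - V)" for V
  have pick: "pick V \<in> events" "prob (pick V) = 1" if "V \<in> \<B>" for V
    using Bm[OF that] zo[OF Bm[OF that]] by (auto simp: pick_def prob_compl)
  define C where "C = space \<nu> \<inter> (\<Inter>V\<in>\<B>. pick V)"
  have AEp: "AE x in \<nu>. x \<in> pick V" if "V \<in> \<B>" for V
    using pick[OF that] by (simp add: prob_eq_1)
  have "AE x in \<nu>. \<forall>V\<in>\<B>. x \<in> pick V"
    by (rule AE_ball_countable'[OF AEp \<B>(1)])
  then have AEC: "AE x in \<nu>. x \<in> C" unfolding C_def by (rule AE_mp, intro AE_I2) auto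
  have "C \<noteq> {}"
  proof
    assume "C = {}"
    then have "AE x in \<nu>. False" using AEC by simp
    then show False by simp
  qed
  then obtain b where b: "b \<in> C" by auto
  have uniq: "x = b" if x: "x \<in> C" for x
  proof (rule ccontr)
    assume "x \<noteq> b"
    have "x \<in> topspace B" "b \<in> topspace B" using x b sp by (auto simp: C_def)
    then obtain U U' where U: "openin B U" "openin B U'" "x \<in> U" "b \<in> U'" "disjnt U U'"
      using haus \<open>x \<noteq> b\<close> unfolding Hausdorff_space_def by blast
    obtain W where W: "W \<in> \<B>" "b \<in> W" "W \<subseteq> U'" using \<B>(3)[OF U(2,4)] by blast
    have "b \<in> pick W" "x \<in> pick W" using x b W(1) by (auto simp: C_def)
    then show False using W(2,3) U(3,5) by (auto simp: pick_def disjnt_def split: if_splits)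
  qed
  have AEb: "AE x in \<nu>. x = b" using AEC by (rule AE_mp, intro AE_I2) (use uniq in auto)
  have bt: "b \<in> topspace B" using b sp by (auto simp: C_def)
  have "\<nu> = return (borel_of B) b"
  proof (rule measure_eqI)
    fix A assume A: "A \<in> events"
    have "emeasure \<nu> A = emeasure \<nu> (if b \<in> A then space \<nu> else {})"
      using AEb A by (intro emeasure_eq_AE) (auto elim: AE_mp)
    then show "emeasure \<nu> A = emeasure (return (borel_of B) b) A"
      using A sets by (simp add: emeasure_space_1 indicator_def)
  qed (simp add: sets)
  then show ?thesis using bt by (auto simp: point_mass_def)
qed

text \<open>
  The Poisson transform of the indicator function of \<open>A\<close> is some constant
  \<open>c\<close>, so the transform of the indicator function minus \<open>c\<close> vanishes. By
  the isometry the indicator function is almost everywhere equal to \<open>c\<close>, hence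
  \<open>A\<close> has measure zero or one.
\<close>

lemma point_mass_if_constant:
  assumes pb: "poisson_boundary G X \<mu> B act \<nu>" and top: "topspace X = carrier G" and "group G"
    and const: "\<And>f g. f \<in> bounded_harmonic G X \<mu> \<Longrightarrow> g \<in> carrier G \<Longrightarrow> f g = f \<one>\<^bsub>G\<^esub>"
  shows "point_mass B \<nu>"
proof (rule zero_one_measure_point_mass)
  have st: "stationary_space G X \<mu> B act \<nu>" using pb by (simp add: poisson_boundary_def mu_boundary_def)
  then show "Hausdorff_space B" "second_countable B" "prob_space \<nu>" and sets: "sets \<nu> = sets (borel_of B)"
    by (simp_all add: stationary_space_def)
  interpret group G by fact
  interpret prob_space \<nu> using st by (simp add: stationary_space_def)
  fix A assume A: "A \<in> events"
  note mc = measurable_cong_sets[OF sets refl]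
  have bdd: "\<phi> \<in> ess_bounded \<nu>" if "\<phi> \<in> borel_measurable \<nu>" "\<And>x. \<bar>\<phi> x\<bar> \<le> C" for \<phi> C
  proof -
    have "ess_norm \<nu> \<phi> \<le> ereal C" unfolding ess_norm_def using that by (intro esssup_I) auto
    then have "ess_norm \<nu> \<phi> < \<infinity>" by (rule le_less_trans) simp
    then show ?thesis using that(1) by (simp add: ess_bounded_def)
  qed
  define \<phi> :: "_ \<Rightarrow> real" where "\<phi> = indicator A"
  have \<phi>m: "\<phi> \<in> borel_measurable \<nu>" using A by (simp add: \<phi>_def)
  have \<phi>b: "\<bar>\<phi> x\<bar> \<le> 1" for x by (simp add: \<phi>_def)
  define c where "c = poisson_transform act \<nu> \<phi> \<one>\<^bsub>G\<^esub>"
  have "poisson_transform act \<nu> \<phi> \<in> bounded_harmonic G X \<mu>"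
    using pb bdd[OF \<phi>m \<phi>b] unfolding poisson_boundary_def by blast
  then have pc: "poisson_transform act \<nu> \<phi> g = c" if "g \<in> carrier G" for g
    unfolding c_def using const that by blast
  define \<psi> where "\<psi> x = \<phi> x - c" for x
  have \<psi>m: "\<psi> \<in> borel_measurable \<nu>" unfolding \<psi>_def using \<phi>m by simp
  have "\<bar>\<psi> x\<bar> \<le> 1 + \<bar>c\<bar>" for x using \<phi>b[of x] by (simp add: \<psi>_def abs_le_iff abs_if split: if_splits)
  note \<psi>b = bdd[OF \<psi>m this]
  have "poisson_transform act \<nu> \<psi> g = 0" if g: "g \<in> carrier G" for g
  proof -
    have "act g \<in> measurable \<nu> \<nu>"
      using continuous_map_borel_of[OF poisson_boundary_continuous_act[OF pb top g]]
        measurable_cong_sets[OF sets sets] by blast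
    then have "(\<lambda>b. \<phi> (act g b)) \<in> borel_measurable \<nu>" using \<phi>m by (rule measurable_compose)
    then have "integrable \<nu> (\<lambda>b. \<phi> (act g b))"
      using \<phi>b by (intro integrable_const_bound[where B=1]) auto
    then have "poisson_transform act \<nu> \<psi> g = poisson_transform act \<nu> \<phi> g - c"
      by (simp add: poisson_transform_def \<psi>_def prob_space)
    then show ?thesis using pc[OF g] by simp
  qed
  moreover have "(SUP g\<in>carrier G. ereal \<bar>poisson_transform act \<nu> \<psi> g\<bar>) = ess_norm \<nu> \<psi>"
    using pb \<psi>b unfolding poisson_boundary_def by blast
  moreover have "carrier G \<noteq> {}" using one_closed by auto
  ultimately have "ess_norm \<nu> \<psi> = 0" by (simp flip: zero_ereal_def)
  then have "AE x in \<nu>. ereal \<bar>\<psi> x\<bar> \<le> 0" using esssup_AE[of "\<lambda>x. ereal \<bar>\<psi> x\<bar>" \<nu>] by (simp add: ess_norm_def)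
  then have AEc: "AE x in \<nu>. indicator A x = c"
    by (rule AE_mp, intro AE_I2) (simp add: \<psi>_def \<phi>_def)
  show "prob A = 0 \<or> prob A = 1"
  proof (cases "c = 1")
    case True
    then have "AE x in \<nu>. x \<in> A" using AEc by (elim AE_mp) (auto simp: indicator_def split: if_splits)
    then show ?thesis using A by (simp add: prob_eq_1)
  next
    case False
    then have "AE x in \<nu>. x \<notin> A" using AEc by (elim AE_mp) (auto simp: indicator_def split: if_splits)
    then show ?thesis using A by (simp add: prob_eq_0)
  qed
qed

text \<open>On a one-point space the Poisson transform identifies functions with constants.\<close>

lemma trivial_poisson_boundary:
  fixes G :: "('g, 'm) monoid_scheme" and X :: "'g topology"
  assumes top: "topspace X = carrier G" and "group G" and "prob_space \<mu>" and sets\<mu>: "sets \<mu> = sets (borel_of X)"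
    and const: "\<And>f g. f \<in> bounded_harmonic G X \<mu> \<Longrightarrow> g \<in> carrier G \<Longrightarrow> f g = f \<one>\<^bsub>G\<^esub>"
  shows "\<exists>(B :: 'b topology) act \<nu>. poisson_boundary G X \<mu> B act \<nu> \<and> point_mass B \<nu>"
proof -
  interpret group G by fact
  interpret M: prob_space \<mu> by fact
  (* any point of the type serves *)
  define b :: 'b where "b = undefined"
  define B where "B = discrete_topology {b}"
  define act :: "'g \<Rightarrow> 'b \<Rightarrow> 'b" where "act g = restrict (\<lambda>x. x) {b}" for g
  define \<nu> where "\<nu> = return (borel_of B) b"
  have tB: "topspace B = {b}" by (simp add: B_def)
  have sp\<mu>: "space \<mu> = carrier G" using sets_eq_imp_space_eq[OF sets\<mu>] top by simp
  interpret N: prob_space \<nu> unfolding \<nu>_def by (rule prob_space_return) (simp add: tB)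
  have sp\<nu>: "space \<nu> = {b}" by (simp add: \<nu>_def tB)
  have act: "act g b = b" for g by (simp add: act_def)
  interpret S: group "BijGroup {b}" by (rule group_BijGroup)
  have "act g = \<one>\<^bsub>BijGroup {b}\<^esub>" for g by (simp add: BijGroup_def act_def)
  then have hom: "act \<in> hom G (BijGroup {b})" by (intro homI) auto
  have ga: "group_action G (topspace B) act"
    unfolding group_action_def group_hom_def group_hom_axioms_def tB
    using hom group_BijGroup is_group by blast
  have cont: "continuous_map (prod_topology X B) B (\<lambda>(g, b). act g b)"
    by (rule continuous_map_eq[of _ _ "\<lambda>_. b"]) (auto simp: tB act)
  interpret MN: pair_prob_space \<mu> \<nu> ..
  have conv: "convolve B act \<mu> \<nu> = \<nu>"
  proof -
    have "convolve B act \<mu> \<nu> = distr (\<mu> \<Otimes>\<^sub>M \<nu>) (borel_of B) (\<lambda>_. b)"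
      unfolding convolve_def by (rule distr_cong) (auto simp: space_pair_measure sp\<nu> act)
    also have "\<dots> = \<nu>" unfolding \<nu>_def[symmetric] using MN.P.distr_const[of b "borel_of B"] by (simp add: tB \<nu>_def)
    finally show ?thesis .
  qed
  have stat: "stationary_space G X \<mu> B act \<nu>"
    unfolding stationary_space_def
    using ga cont conv N.prob_space_axioms
    by (auto simp: B_def \<nu>_def locally_compact_space_discrete_topology second_countable_discrete_topology)
  have push: "distr \<nu> (borel_of B) (act g) = \<nu>" for g
  proof -
    have "distr \<nu> (borel_of B) (act g) = distr \<nu> (borel_of B) (\<lambda>_. b)"
      by (rule distr_cong) (auto simp: sp\<nu> act)
    also have "\<dots> = \<nu>" using N.distr_const[of b "borel_of B"] by (simp add: tB \<nu>_def)
    finally show ?thesis .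
  qed
  have mb: "mu_boundary G X \<mu> B act \<nu>"
    unfolding mu_boundary_def push
    using stat by (intro conjI AE_I2 bexI[of _ b]) (auto simp: weak_star_converges_def \<nu>_def tB)
  have tr: "poisson_transform act \<nu> \<phi> = (\<lambda>g. \<phi> b)" for \<phi>
  proof
    fix g
    have "poisson_transform act \<nu> \<phi> g = (\<integral>x. \<phi> b \<partial>\<nu>)"
      unfolding poisson_transform_def by (intro Bochner_Integration.integral_cong) (auto simp: sp\<nu> act)
    then show "poisson_transform act \<nu> \<phi> g = \<phi> b" by (simp add: N.prob_space)
  qed
  have cst: "(\<lambda>g. r) \<in> bounded_harmonic G X \<mu>" for r
    by (auto simp: bounded_harmonic_def M.prob_space bounded_iff)
  have en: "ess_norm \<nu> \<phi> = ereal \<bar>\<phi> b\<bar>" for \<phi>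
  proof -
    have m: "\<psi> \<in> borel_measurable \<nu>" for \<psi> :: "'b \<Rightarrow> ereal"
      by (rule measurable_cong[THEN iffD1, of _ "\<lambda>_. \<psi> b"]) (auto simp: sp\<nu>)
    have "ess_norm \<nu> \<phi> = esssup \<nu> (\<lambda>x. ereal \<bar>\<phi> b\<bar>)"
      unfolding ess_norm_def by (rule esssup_AE_cong[OF m m], rule AE_I2) (simp add: sp\<nu>)
    also have "\<dots> = ereal \<bar>\<phi> b\<bar>" by (rule esssup_const) (simp add: N.emeasure_space_1)
    finally show ?thesis .
  qed
  have ne: "carrier G \<noteq> {}" using one_closed by auto
  have "poisson_boundary G X \<mu> B act \<nu>"
    unfolding poisson_boundary_def
  proof (intro conjI ballI)
    show "mu_boundary G X \<mu> B act \<nu>" by (rule mb)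
    show "poisson_transform act \<nu> \<phi> \<in> bounded_harmonic G X \<mu>" for \<phi> unfolding tr by (rule cst)
    show "(SUP g\<in>carrier G. ereal \<bar>poisson_transform act \<nu> \<phi> g\<bar>) = ess_norm \<nu> \<phi>" for \<phi>
      unfolding tr en using ne by (rule cSUP_const)
    fix f assume f: "f \<in> bounded_harmonic G X \<mu>"
    have "(\<lambda>_. f \<one>\<^bsub>G\<^esub>) \<in> ess_bounded \<nu>" unfolding ess_bounded_def mem_Collect_eq en by simp
    moreover have "\<forall>g\<in>carrier G. f g = poisson_transform act \<nu> (\<lambda>_. f \<one>\<^bsub>G\<^esub>) g"
      unfolding tr using const[OF f] by blast
    ultimately show "\<exists>\<phi>\<in>ess_bounded \<nu>. \<forall>g\<in>carrier G. f g = poisson_transform act \<nu> \<phi> g" by blast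
  qed
  moreover have "point_mass B \<nu>" unfolding point_mass_def \<nu>_def tB by blast
  ultimately show ?thesis by blast
qed

section \<open>Harmonic functions on a subgroup of full measure\<close>

lemma sets_borel_of_subtopology:
  assumes "\<Gamma> \<in> sets (borel_of X)"
  shows "sets (borel_of (subtopology X \<Gamma>)) = sets (restrict_space (borel_of X) \<Gamma>)"
proof -
  have sub: "\<Gamma> \<subseteq> topspace X" using sets.sets_into_space[OF assms] by simp
  have "{U. openin (subtopology X \<Gamma>) U} = (\<inter>) \<Gamma> ` {U. openin X U}"
    unfolding openin_subtopology by (auto simp: Int_commute)
  moreover have "topspace X \<inter> \<Gamma> = \<Gamma>" using sub by auto
  ultimately have "sets (borel_of (subtopology X \<Gamma>)) = sigma_sets \<Gamma> ((\<inter>) \<Gamma> ` {U. openin X U})"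
    by (simp add: sets_borel_of)
  also have "\<dots> = (\<inter>) \<Gamma> ` sigma_sets (topspace X) {U. openin X U}"
    using assms sub by (intro sigma_sets_Int[symmetric]) (simp_all add: sets_borel_of)
  finally show ?thesis by (simp add: sets_restrict_space sets_borel_of)
qed

context group_walk
begin

context
  fixes \<Gamma> assumes \<Gamma>: "subgroup \<Gamma> G" and \<Gamma>m: "\<Gamma> \<in> sets (borel_of X)" and full: "emeasure \<mu> \<Gamma> = 1"
begin

lemma AE_subgroup: "AE x in \<mu>. x \<in> \<Gamma>"
  using full \<Gamma>m by (intro AE_in_set_eq_1[THEN iffD2]) (simp_all add: sets_step emeasure_eq_measure)

lemma integral_restrict:
  fixes f :: "'g \<Rightarrow> real"
  shows "(\<integral>x. f x \<partial>restrict_space \<mu> \<Gamma>) = (\<integral>x. indicator \<Gamma> x * f x \<partial>\<mu>)"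
proof -
  have "\<Gamma> \<inter> space \<mu> = \<Gamma>" using subgroup.subset[OF \<Gamma>] by auto
  then show ?thesis using \<Gamma>m by (subst integral_restrict_space) (simp_all add: sets_step)
qed

lemma measurable_restrict_iff:
  fixes f :: "'g \<Rightarrow> real"
  shows "f \<in> borel_measurable (borel_of (subtopology X \<Gamma>)) \<longleftrightarrow> (\<lambda>x. indicator \<Gamma> x * f x) \<in> borel_measurable (borel_of X)"
proof -
  have "\<Gamma> \<inter> space (borel_of X) = \<Gamma>" using subgroup.subset[OF \<Gamma>] by auto
  then have "f \<in> borel_measurable (restrict_space (borel_of X) \<Gamma>) \<longleftrightarrow> (\<lambda>x. indicator \<Gamma> x *\<^sub>R f x) \<in> borel_measurable (borel_of X)"
    using \<Gamma>m by (intro borel_measurable_restrict_space_iff) simp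
  then show ?thesis
    unfolding measurable_cong_sets[OF sets_borel_of_subtopology[OF \<Gamma>m] refl] by (simp only: real_scaleR_def)
qed

lemma subgroup_mult_iff: "g \<in> \<Gamma> \<Longrightarrow> x \<in> carrier G \<Longrightarrow> g \<otimes> x \<in> \<Gamma> \<longleftrightarrow> x \<in> \<Gamma>"
proof
  assume g: "g \<in> \<Gamma>" and x: "x \<in> carrier G" and gx: "g \<otimes> x \<in> \<Gamma>"
  have gc: "g \<in> carrier G" using subgroup.mem_carrier[OF \<Gamma> g] .
  have "inv g \<otimes> (g \<otimes> x) \<in> \<Gamma>" by (rule subgroup.m_closed[OF \<Gamma> subgroup.m_inv_closed[OF \<Gamma> g] gx])
  moreover have "inv g \<otimes> (g \<otimes> x) = x" using gc x by (simp add: m_assoc[symmetric])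
  ultimately show "x \<in> \<Gamma>" by simp
qed (auto intro: subgroup.m_closed[OF \<Gamma>])

text \<open>
  Almost all steps lie in \<open>\<Gamma>\<close>, so the walk never enters or leaves
  \<open>\<Gamma>\<close>, and extension by zero preserves harmonicity.
\<close>

lemma extend_harmonic:
  assumes f: "f \<in> bounded_harmonic (G\<lparr>carrier := \<Gamma>\<rparr>) (subtopology X \<Gamma>) (restrict_space \<mu> \<Gamma>)"
  shows "(\<lambda>x. indicator \<Gamma> x * f x) \<in> bounded_harmonic G X \<mu>"
proof -
  have fm: "f \<in> borel_measurable (borel_of (subtopology X \<Gamma>))" and fb: "bounded (f ` \<Gamma>)"
    and fh: "\<And>g. g \<in> \<Gamma> \<Longrightarrow> f g = (\<integral>x. f (g \<otimes> x) \<partial>restrict_space \<mu> \<Gamma>)"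
    using f unfolding bounded_harmonic_def by auto
  obtain C where C: "\<forall>x\<in>\<Gamma>. \<bar>f x\<bar> \<le> C" using fb by (auto simp: bounded_iff)
  have "indicator \<Gamma> g * f g = (\<integral>x. indicator \<Gamma> (g \<otimes> x) * f (g \<otimes> x) \<partial>\<mu>)" if g: "g \<in> carrier G" for g
  proof (cases "g \<in> \<Gamma>")
    case True
    have "(\<integral>x. indicator \<Gamma> (g \<otimes> x) * f (g \<otimes> x) \<partial>\<mu>) = (\<integral>x. indicator \<Gamma> x * f (g \<otimes> x) \<partial>\<mu>)"
      using subgroup_mult_iff[OF True] by (intro Bochner_Integration.integral_cong) (auto simp: indicator_def)
    then show ?thesis using True fh[OF True] by (simp add: integral_restrict)
  next
    case False
    have out: "g \<otimes> x \<notin> \<Gamma>" if x: "x \<in> \<Gamma>" for x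
    proof
      assume gx: "g \<otimes> x \<in> \<Gamma>"
      have xc: "x \<in> carrier G" using subgroup.mem_carrier[OF \<Gamma> x] .
      have "g \<otimes> x \<otimes> inv x \<in> \<Gamma>" by (rule subgroup.m_closed[OF \<Gamma> gx subgroup.m_inv_closed[OF \<Gamma> x]])
      then show False using False g xc by (simp add: m_assoc)
    qed
    have "AE x in \<mu>. indicator \<Gamma> (g \<otimes> x) * f (g \<otimes> x) = 0"
      using AE_subgroup by (rule AE_mp, intro AE_I2) (simp add: out)
    then have "(\<integral>x. indicator \<Gamma> (g \<otimes> x) * f (g \<otimes> x) \<partial>\<mu>) = 0" by (rule integral_eq_zero_AE)
    then show ?thesis using False by simp
  qed
  moreover have "bounded ((\<lambda>x. indicator \<Gamma> x * f x) ` carrier G)"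
    unfolding bounded_iff using C by (intro exI[of _ "\<bar>C\<bar>"]) (force simp: indicator_def)
  ultimately show ?thesis using fm measurable_restrict_iff by (simp add: bounded_harmonic_def)
qed

lemma restrict_harmonic:
  assumes f: "f \<in> bounded_harmonic G X \<mu>"
  shows "f \<in> bounded_harmonic (G\<lparr>carrier := \<Gamma>\<rparr>) (subtopology X \<Gamma>) (restrict_space \<mu> \<Gamma>)"
proof -
  have fm: "f \<in> borel_measurable (borel_of X)" and fb: "bounded (f ` carrier G)"
    and fh: "\<And>g. g \<in> carrier G \<Longrightarrow> f g = (\<integral>x. f (g \<otimes> x) \<partial>\<mu>)"
    using f unfolding bounded_harmonic_def by auto
  have "f g = (\<integral>x. f (g \<otimes> x) \<partial>restrict_space \<mu> \<Gamma>)" if g: "g \<in> \<Gamma>" for g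
  proof -
    have gc: "g \<in> carrier G" using subgroup.mem_carrier[OF \<Gamma> g] .
    have m: "(\<lambda>x. f (g \<otimes> x)) \<in> borel_measurable \<mu>"
      unfolding measurable_step by (rule measurable_compose[OF const_mult_measurable[OF gc] fm])
    have "(\<integral>x. f (g \<otimes> x) \<partial>\<mu>) = (\<integral>x. indicator \<Gamma> x * f (g \<otimes> x) \<partial>\<mu>)"
    proof (rule integral_cong_AE)
      show "(\<lambda>x. indicator \<Gamma> x * f (g \<otimes> x)) \<in> borel_measurable \<mu>"
        using m \<Gamma>m by (intro borel_measurable_times borel_measurable_indicator) (simp_all add: sets_step)
      show "AE x in \<mu>. f (g \<otimes> x) = indicator \<Gamma> x * f (g \<otimes> x)"
        using AE_subgroup by (rule AE_mp, intro AE_I2) simp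
    qed (rule m)
    then show ?thesis using fh[OF gc] by (simp add: integral_restrict)
  qed
  moreover have "bounded (f ` \<Gamma>)" by (rule bounded_subset[OF fb]) (use subgroup.subset[OF \<Gamma>] in blast)
  moreover have "f \<in> borel_measurable (borel_of (subtopology X \<Gamma>))"
    unfolding measurable_restrict_iff using fm \<Gamma>m by simp
  ultimately show ?thesis by (simp add: bounded_harmonic_def)
qed

text \<open>
  The indicator function of \<open>\<Gamma>\<close> is the extension of a constant, hence harmonic
  and uniformly continuous. As it only takes the values zero and one, it is locally constant.
\<close>

lemma fixer_in_subgroup:
  assumes so: "spread_out G X \<mu>"
  obtains F where "finite F" "F \<subseteq> \<Omega>" "fixer F \<subseteq> \<Gamma>"
proof -
  have "space (restrict_space \<mu> \<Gamma>) = \<Gamma>"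
    using subgroup.subset[OF \<Gamma>] by (auto simp: space_restrict_space)
  then have "emeasure (restrict_space \<mu> \<Gamma>) (space (restrict_space \<mu> \<Gamma>)) = 1"
    using full \<Gamma>m subgroup.subset[OF \<Gamma>] by (simp add: emeasure_restrict_space sets_step Int_absorb2)
  then interpret R: prob_space "restrict_space \<mu> \<Gamma>" by (rule prob_spaceI)
  have "(\<lambda>x. 1) \<in> bounded_harmonic (G\<lparr>carrier := \<Gamma>\<rparr>) (subtopology X \<Gamma>) (restrict_space \<mu> \<Gamma>)"
    by (auto simp: bounded_harmonic_def R.prob_space bounded_iff)
  from extend_harmonic[OF this] have h: "(\<lambda>x. indicator \<Gamma> x) \<in> bounded_harmonic G X \<mu>" by simp
  obtain F where F: "finite F" "F \<subseteq> \<Omega>" and uc: "\<And>g u. g \<in> carrier G \<Longrightarrow> u \<in> fixer F \<Longrightarrow>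
      \<bar>indicator \<Gamma> (g \<otimes> u) - (indicator \<Gamma> g :: real)\<bar> \<le> 1 / 2"
    using harmonic_uniformly_continuous[OF so h, of "1/2"] by (metis zero_less_divide_1_iff zero_less_numeral)
  have "u \<in> \<Gamma>" if u: "u \<in> fixer F" for u
  proof (rule ccontr)
    assume "u \<notin> \<Gamma>"
    moreover have "u \<in> carrier G" using u by (simp add: fixer_def)
    moreover have "\<one> \<in> \<Gamma>" by (rule subgroup.one_closed[OF \<Gamma>])
    ultimately show False using uc[OF one_closed u] by simp
  qed
  then show thesis using that F by blast
qed

end

end

section \<open>Products of affine groups\<close>

locale affine_product =
  fixes k :: nat and d :: "nat \<Rightarrow> nat" and T :: "nat \<Rightarrow> 'v pointed_tree"
  assumes trees: "i \<in> {1..k} \<Longrightarrow> 3 \<le> d i \<and> homogeneous_tree (d i) (T i)"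
begin

abbreviation P where "P \<equiv> prod_group k T"
abbreviation X where "X \<equiv> prod_top k T"

definition points :: "(nat \<times> 'v) set" where
  "points = Sigma {1..k} (\<lambda>i. verts (T i))"

definition move :: "(nat \<Rightarrow> 'v \<Rightarrow> 'v) \<Rightarrow> nat \<times> 'v \<Rightarrow> nat \<times> 'v" where
  "move g w = (fst w, g (fst w) (snd w))"

lemma rooted_tree: "i \<in> {1..k} \<Longrightarrow> rooted_tree (T i) (d i)"
  using trees by (simp add: rooted_tree_def)

lemma carrier_P: "carrier P = (\<Pi>\<^sub>E i\<in>{1..k}. Aff (T i))"
  unfolding prod_group_def carrier_product_group
  by (rule PiE_cong) (rule rooted_tree.carrier_Aff[OF rooted_tree])

lemma group_P: "group P"
  unfolding prod_group_def by (rule product_group) (rule rooted_tree.group_Aff[OF rooted_tree])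

lemma component: "g \<in> carrier P \<Longrightarrow> i \<in> {1..k} \<Longrightarrow> g i \<in> Aff (T i)"
  unfolding carrier_P by (rule PiE_mem)

lemma openin_P:
  "openin X S \<longleftrightarrow> S \<subseteq> carrier P \<and>
    (\<forall>g\<in>S. \<exists>F. finite F \<and> F \<subseteq> points \<and> (\<forall>h\<in>carrier P. (\<forall>w\<in>F. move h w = move g w) \<longrightarrow> h \<in> S))"
  (is "_ \<longleftrightarrow> ?R")
proof
  assume S: "openin X S"
  have top: "topspace X = carrier P"
    unfolding prod_top_def topspace_product_topology carrier_P
    by (rule PiE_cong) (rule rooted_tree.topspace_Aff[OF rooted_tree])
  show ?R
  proof (intro conjI ballI)
    show "S \<subseteq> carrier P" using openin_subset[OF S] top by simp
    fix g assume "g \<in> S"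
    then have "\<exists>U. finite {i \<in> {1..k}. U i \<noteq> topspace (Aff_topology (T i))}
        \<and> (\<forall>i\<in>{1..k}. openin (Aff_topology (T i)) (U i)) \<and> g \<in> Pi\<^sub>E {1..k} U \<and> Pi\<^sub>E {1..k} U \<subseteq> S"
      by (rule S[unfolded prod_top_def openin_product_topology_alt, THEN bspec])
    then obtain U where *: "finite {i \<in> {1..k}. U i \<noteq> topspace (Aff_topology (T i))}
        \<and> (\<forall>i\<in>{1..k}. openin (Aff_topology (T i)) (U i)) \<and> g \<in> Pi\<^sub>E {1..k} U \<and> Pi\<^sub>E {1..k} U \<subseteq> S"
      by (elim exE)
    note U = *[THEN conjunct2, THEN conjunct1] *[THEN conjunct2, THEN conjunct2, THEN conjunct1]
      *[THEN conjunct2, THEN conjunct2, THEN conjunct2]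
    have "\<exists>F. finite F \<and> F \<subseteq> verts (T i) \<and> (\<forall>h\<in>Aff (T i). (\<forall>w\<in>F. h w = g i w) \<longrightarrow> h \<in> U i)" if i: "i \<in> {1..k}" for i
      using rooted_tree.openin_Aff_basic[OF rooted_tree[OF i] U(1)[rule_format, OF i] PiE_mem[OF U(2) i]] by metis
    then obtain F where F: "\<And>i. i \<in> {1..k} \<Longrightarrow> finite (F i) \<and> F i \<subseteq> verts (T i)
        \<and> (\<forall>h\<in>Aff (T i). (\<forall>w\<in>F i. h w = g i w) \<longrightarrow> h \<in> U i)" by metis
    show "\<exists>F. finite F \<and> F \<subseteq> points \<and> (\<forall>h\<in>carrier P. (\<forall>w\<in>F. move h w = move g w) \<longrightarrow> h \<in> S)"
    proof (intro exI[of _ "Sigma {1..k} F"] conjI ballI impI)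
      show "finite (Sigma {1..k} F)" using F by (intro finite_SigmaI) auto
      show "Sigma {1..k} F \<subseteq> points" unfolding points_def using F by (intro Sigma_mono) auto
      fix h assume h: "h \<in> carrier P" and eq: "\<forall>w\<in>Sigma {1..k} F. move h w = move g w"
      have "h i \<in> U i" if i: "i \<in> {1..k}" for i
      proof -
        have "h i w = g i w" if "w \<in> F i" for w
          using eq[rule_format, of "(i, w)"] i that by (simp add: move_def)
        then show ?thesis using F[OF i] component[OF h i] by blast
      qed
      moreover have "h \<in> extensional {1..k}" using h by (simp add: carrier_P PiE_iff)
      ultimately have "h \<in> Pi\<^sub>E {1..k} U" unfolding PiE_iff by blast
      then show "h \<in> S" using U(3) by blast
    qed
  qed
next
  assume R: ?R
  show "openin X S"
    unfolding prod_top_def openin_product_topology_alt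
  proof (intro ballI)
    fix g assume g: "g \<in> S"
    then obtain F where F: "finite F" "F \<subseteq> points" "\<forall>h\<in>carrier P. (\<forall>w\<in>F. move h w = move g w) \<longrightarrow> h \<in> S"
      using R by blast
    have gc: "g \<in> carrier P" using R g by blast
    define U where "U i = {h \<in> Aff (T i). \<forall>w\<in>snd ` {p\<in>F. fst p = i}. h w = g i w}" for i
    have "openin (Aff_topology (T i)) (U i)" if i: "i \<in> {1..k}" for i
      unfolding U_def using F(1,2)
      by (intro rooted_tree.openin_Aff_agree[OF rooted_tree[OF i]]) (auto simp: points_def)
    moreover have "g \<in> Pi\<^sub>E {1..k} U" using gc by (auto simp: U_def carrier_P PiE_iff)
    moreover have "Pi\<^sub>E {1..k} U \<subseteq> S"
    proof
      fix h assume h: "h \<in> Pi\<^sub>E {1..k} U"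
      then have hc: "h \<in> carrier P" by (auto simp: U_def carrier_P PiE_iff)
      have "move h w = move g w" if w: "w \<in> F" for w
      proof -
        have i: "fst w \<in> {1..k}" using w F(2) by (auto simp: points_def)
        have "h (fst w) \<in> U (fst w)" using h i by (rule PiE_mem)
        then show ?thesis using w by (auto simp: U_def move_def)
      qed
      then show "h \<in> S" using F(3) hc by blast
    qed
    ultimately show "\<exists>U. finite {i \<in> {1..k}. U i \<noteq> topspace (Aff_topology (T i))}
        \<and> (\<forall>i\<in>{1..k}. openin (Aff_topology (T i)) (U i)) \<and> g \<in> Pi\<^sub>E {1..k} U \<and> Pi\<^sub>E {1..k} U \<subseteq> S"
      by (intro exI[of _ U]) auto
  qed
qed

sublocale permutation_group P X points move
proof -
  interpret group P by (rule group_P)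
  show "permutation_group P X points move"
  proof unfold_locales
    show "countable points"
      unfolding points_def
    proof (intro countable_SIGMA)
      fix i assume i: "i \<in> {1..k}"
      interpret rooted_tree "T i" "d i" by (rule rooted_tree[OF i])
      show "countable (verts (T i))" by (rule countable_vertices)
    qed simp
  next
    fix g w assume "g \<in> carrier P" "w \<in> points"
    then show "move g w \<in> points"
      using rooted_tree.Aff_closed[OF rooted_tree component] by (auto simp: points_def move_def)
  next
    fix g h w assume g: "g \<in> carrier P" and h: "h \<in> carrier P" and w: "w \<in> points"
    then have i: "fst w \<in> {1..k}" "snd w \<in> verts (T (fst w))" by (auto simp: points_def)
    have "(g \<otimes>\<^bsub>P\<^esub> h) (fst w) = g (fst w) \<otimes>\<^bsub>Aff_group (T (fst w))\<^esub> h (fst w)"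
      using i(1) by (simp add: prod_group_def)
    then show "move (g \<otimes>\<^bsub>P\<^esub> h) w = move g (move h w)"
      using rooted_tree.Aff_mult[OF rooted_tree[OF i(1)] component[OF g i(1)] component[OF h i(1)] i(2)]
      by (simp add: move_def)
  next
    fix w assume "w \<in> points"
    then have i: "fst w \<in> {1..k}" "snd w \<in> verts (T (fst w))" by (auto simp: points_def)
    then show "move \<one>\<^bsub>P\<^esub> w = w"
      using rooted_tree.Aff_one[OF rooted_tree[OF i(1)] i(2)] by (simp add: move_def prod_group_def)
  next
    show "openin X S \<longleftrightarrow> S \<subseteq> carrier P \<and>
      (\<forall>g\<in>S. \<exists>F. finite F \<and> F \<subseteq> points \<and> (\<forall>h\<in>carrier P. (\<forall>w\<in>F. move h w = move g w) \<longrightarrow> h \<in> S))" for S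
      by (rule openin_P)
  qed
qed

end

locale affine_product_walk = affine_product k d T + prob_space \<mu>
  for k d and T :: "nat \<Rightarrow> 'v pointed_tree" and \<mu> :: "(nat \<Rightarrow> 'v \<Rightarrow> 'v) measure" +
  assumes sets_\<mu>: "sets \<mu> = sets (borel_of X)"
    and first_moment: "(\<integral>\<^sup>+ \<gamma>. ennreal (real (prod_length k T \<gamma>)) \<partial>\<mu>) < \<infinity>"
begin

sublocale group_walk P X points move \<mu>
  by unfold_locales (rule sets_\<mu>)

lemma tree_walk:
  assumes j: "j \<in> {1..k}"
  shows "tree_walk P X points move \<mu> (verts (T j)) (rooted_tree.parent (T j)) (origin (T j)) (d j - 1)
    (Pair j) (\<lambda>g. g j)"
proof -
  interpret R: rooted_tree "T j" "d j" by (rule rooted_tree[OF j])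
  show ?thesis
  proof unfold_locales
    show "(j, v) \<in> points" if "v \<in> verts (T j)" for v using that j by (simp add: points_def)
    show "inj_on (Pair j) (verts (T j))" by (simp add: inj_on_def)
    show "move g (j, v) = (j, g j v)" for g v by (simp add: move_def)
    show "R.equivariant (g j)" if "g \<in> carrier P" for g using component[OF that j] R.Aff_eq by blast
    define \<phi> where "\<phi> w = real (R.climb (snd w) + R.descent (snd w))" for w :: "nat \<times> 'v"
    have m: "(\<lambda>g. \<phi> (move g (j, origin (T j)))) \<in> borel_measurable (borel_of X)"
      using R.root_in j by (intro measurable_compose[OF act_measurable]) (auto simp: points_def)
    show "integrable \<mu> (\<lambda>g. real (R.climb (g j (origin (T j))) + R.descent (g j (origin (T j)))))"
    proof (rule integrableI_bounded)
      show "(\<lambda>g. real (R.climb (g j (origin (T j))) + R.descent (g j (origin (T j))))) \<in> borel_measurable \<mu>"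
        using m by (simp add: measurable_step \<phi>_def move_def)
      have "(\<integral>\<^sup>+ g. ennreal (norm (real (R.climb (g j (origin (T j))) + R.descent (g j (origin (T j)))))) \<partial>\<mu>)
          \<le> (\<integral>\<^sup>+ \<gamma>. ennreal (real (prod_length k T \<gamma>)) \<partial>\<mu>)"
      proof (intro nn_integral_mono ennreal_leI)
        fix g assume "g \<in> space \<mu>"
        then have "g j (origin (T j)) \<in> verts (T j)"
          using R.Aff_closed[OF component[OF _ j] R.root_in] by simp
        from R.climb_descent_le_dist[OF this]
        have "R.climb (g j (origin (T j))) + R.descent (g j (origin (T j))) \<le> tree_dist (T j) (origin (T j)) (g j (origin (T j)))" .
        also have "\<dots> \<le> prod_length k T g"
          unfolding prod_length_def using j by (intro member_le_sum) auto
        finally show "norm (real (R.climb (g j (origin (T j))) + R.descent (g j (origin (T j))))) \<le> real (prod_length k T g)"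
          by simp
      qed
      then show "(\<integral>\<^sup>+ g. ennreal (norm (real (R.climb (g j (origin (T j))) + R.descent (g j (origin (T j)))))) \<partial>\<mu>) < \<infinity>"
        using first_moment by (rule le_less_trans)
    qed
  qed
qed

definition vertical_drift :: "nat \<Rightarrow> real" where
  "vertical_drift j = m1 (vertical_image T j \<mu>)"

lemma drift_eq_vertical_drift:
  assumes j: "j \<in> {1..k}"
  shows "tree_walk.drift \<mu> (rooted_tree.parent (T j)) (origin (T j)) (\<lambda>g. g j) = vertical_drift j"
proof -
  interpret W: tree_walk P X points move \<mu> "verts (T j)" "rooted_tree.parent (T j)" "origin (T j)" "d j - 1" "Pair j" "\<lambda>g. g j"
    by (rule tree_walk[OF j])
  interpret R: rooted_tree "T j" "d j" by (rule rooted_tree[OF j])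
  have eq: "horocyclic (T j) (g j) = W.height (g j (origin (T j)))" if "g \<in> carrier P" for g
    by (rule R.horocyclic_eq[OF component[OF that j]])
  have "(\<lambda>g. W.height (g j (origin (T j)))) \<in> measurable (borel_of X) (count_space UNIV)"
    by (rule measurable_compose[OF W.\<tau>_measurable[OF W.root_in]]) simp
  then have m: "(\<lambda>g. horocyclic (T j) (g j)) \<in> measurable \<mu> (count_space UNIV)"
    unfolding measurable_step by (rule measurable_cong[THEN iffD1, rotated]) (simp add: eq)
  have "vertical_drift j = (\<integral>g. real_of_int (horocyclic (T j) (g j)) \<partial>\<mu>)"
    unfolding vertical_drift_def m1_def vertical_image_def by (rule integral_distr[OF m]) simp
  also have "\<dots> = W.drift"
    unfolding W.drift_def by (rule Bochner_Integration.integral_cong) (simp_all add: eq)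
  finally show ?thesis by simp
qed

lemma nn_integral_points:
  "(\<integral>\<^sup>+w. f w \<partial>count_space points) = (\<Sum>i\<in>{1..k}. \<integral>\<^sup>+v. f (i, v) \<partial>count_space (verts (T i)))"
proof -
  have "(\<integral>\<^sup>+w. f w \<partial>count_space points)
      = (\<integral>\<^sup>+w. (\<Sum>i\<in>{1..k}. f w * indicator (Pair i ` verts (T i)) w) \<partial>count_space points)"
  proof (intro nn_integral_cong)
    fix w assume "w \<in> space (count_space points)"
    then obtain i v where w: "w = (i, v)" "i \<in> {1..k}" "v \<in> verts (T i)" by (auto simp: points_def)
    have "(\<Sum>j\<in>{1..k}. f w * indicator (Pair j ` verts (T j)) w) = (\<Sum>j\<in>{1..k}. if j = i then f w else 0)"
      using w by (intro sum.cong) (auto simp: indicator_def)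
    then show "f w = (\<Sum>j\<in>{1..k}. f w * indicator (Pair j ` verts (T j)) w)" using w(2) by simp
  qed
  also have "\<dots> = (\<Sum>i\<in>{1..k}. \<integral>\<^sup>+w. f w * indicator (Pair i ` verts (T i)) w \<partial>count_space points)"
    by (rule nn_integral_sum) simp
  also have "\<dots> = (\<Sum>i\<in>{1..k}. \<integral>\<^sup>+v. f (i, v) \<partial>count_space (verts (T i)))"
  proof (rule sum.cong[OF refl])
    fix i assume i: "i \<in> {1..k}"
    have sub: "Pair i ` verts (T i) \<subseteq> points" using i by (auto simp: points_def)
    have "(\<integral>\<^sup>+w. f w * indicator (Pair i ` verts (T i)) w \<partial>count_space points)
        = (\<integral>\<^sup>+w. f w \<partial>count_space (Pair i ` verts (T i)))"
      using sub by (simp add: nn_integral_count_space_indicator indicator_inter_arith[symmetric] Int_absorb2[OF sub] mult.assoc)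
    also have "\<dots> = (\<integral>\<^sup>+v. f (i, v) \<partial>count_space (verts (T i)))"
      by (rule nn_integral_bij_count_space[symmetric]) (auto simp: bij_betw_def inj_on_def)
    finally show "(\<integral>\<^sup>+w. f w * indicator (Pair i ` verts (T i)) w \<partial>count_space points)
        = (\<integral>\<^sup>+v. f (i, v) \<partial>count_space (verts (T i)))" .
  qed
  finally show ?thesis .
qed

text \<open>The costs of the single trees together form a cost on their disjoint union.\<close>

lemma sublinear_cost_if_nonpositive_drift:
  assumes drift: "\<forall>j\<in>{1..k}. vertical_drift j \<le> 0"
  shows sublinear_cost
  unfolding sublinear_cost_def
proof (intro allI impI)
  fix \<epsilon> :: real assume \<epsilon>: "0 < \<epsilon>"
  have "\<exists>cost :: 'v \<Rightarrow> real. (\<forall>v\<in>verts (T j). 0 \<le> cost v)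
      \<and> (\<integral>\<^sup>+v. ennreal (exp (- cost v)) \<partial>count_space (verts (T j))) < \<infinity>
      \<and> (\<forall>v\<in>verts (T j). \<exists>C. \<forall>n. (\<integral>\<^sup>+r. ennreal (cost (r j v)) \<partial>law n) \<le> ennreal (\<epsilon> * real n + C))"
    if j: "j \<in> {1..k}" for j
  proof -
    interpret W: tree_walk P X points move \<mu> "verts (T j)" "rooted_tree.parent (T j)" "origin (T j)" "d j - 1" "Pair j" "\<lambda>g. g j"
      by (rule tree_walk[OF j])
    have "W.drift \<le> 0" using drift_eq_vertical_drift[OF j] drift j by simp
    from W.tree_cost[OF this \<epsilon>] show ?thesis by metis
  qed
  then obtain cost :: "nat \<Rightarrow> 'v \<Rightarrow> real" where cost: "\<And>j. j \<in> {1..k} \<Longrightarrow> (\<forall>v\<in>verts (T j). 0 \<le> cost j v)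
      \<and> (\<integral>\<^sup>+v. ennreal (exp (- cost j v)) \<partial>count_space (verts (T j))) < \<infinity>
      \<and> (\<forall>v\<in>verts (T j). \<exists>C. \<forall>n. (\<integral>\<^sup>+r. ennreal (cost j (r j v)) \<partial>law n) \<le> ennreal (\<epsilon> * real n + C))"
    by metis
  show "\<exists>c::nat \<times> 'v \<Rightarrow> real. (\<forall>w\<in>points. 0 \<le> c w) \<and>
      (\<integral>\<^sup>+w. ennreal (exp (- c w)) \<partial>count_space points) < \<infinity> \<and>
      (\<forall>w\<in>points. \<exists>C. \<forall>n. (\<integral>\<^sup>+h. ennreal (c (move h w)) \<partial>law n) \<le> ennreal (\<epsilon> * real n + C))"
  proof (intro exI[of _ "\<lambda>w. cost (fst w) (snd w)"] conjI ballI)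
    show "0 \<le> cost (fst w) (snd w)" if "w \<in> points" for w
      using cost[of "fst w"] that by (auto simp: points_def)
    show "(\<integral>\<^sup>+w. ennreal (exp (- cost (fst w) (snd w))) \<partial>count_space points) < \<infinity>"
      unfolding nn_integral_points using cost by (simp add: less_top)
    show "\<exists>C. \<forall>n. (\<integral>\<^sup>+h. ennreal (cost (fst (move h w)) (snd (move h w))) \<partial>law n) \<le> ennreal (\<epsilon> * real n + C)"
      if "w \<in> points" for w
      using cost[of "fst w"] that by (auto simp: points_def move_def)
  qed
qed

text \<open>
  Since the group is the full product, an automorphism of one factor can be extended by the
  identity on all the others.
\<close>

lemma realize_equivariant:
  assumes j: "j \<in> {1..k}" and \<sigma>: "parent_tree.equivariant (verts (T j)) (rooted_tree.parent (T j)) \<sigma>"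
    "bij_betw \<sigma> (verts (T j)) (verts (T j))"
  shows "\<exists>u\<in>carrier P. (\<forall>v\<in>verts (T j). u j v = \<sigma> v) \<and> (\<forall>w\<in>points - Pair j ` verts (T j). move u w = w)"
proof -
  interpret R: rooted_tree "T j" "d j" by (rule rooted_tree[OF j])
  define u where "u = (\<lambda>i\<in>{1..k}. if i = j then restrict \<sigma> (verts (T j)) else \<one>\<^bsub>P\<^esub> i)"
  have "u \<in> carrier P"
    unfolding carrier_P u_def
    using R.restrict_in_Aff[OF \<sigma>] component[OF one_closed] by (simp add: PiE_iff)
  moreover have "u j v = \<sigma> v" if "v \<in> verts (T j)" for v using that j by (simp add: u_def)
  moreover have "move u w = w" if w: "w \<in> points - Pair j ` verts (T j)" for w
  proof -
    have "w \<in> points" "fst w \<in> {1..k}" "fst w \<noteq> j" using w by (auto simp: points_def)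
    then have "move u w = move \<one>\<^bsub>P\<^esub> w" by (simp add: move_def u_def)
    then show ?thesis using act_one[OF \<open>w \<in> points\<close>] by simp
  qed
  ultimately show ?thesis by blast
qed

text \<open>
  Without positive drift, a harmonic function on \<open>\<Gamma>\<close> is extended by zero and
  \<open>harmonic_constant_on_semigroup\<close> applies. With a positive drift,
  \<open>nonconstant_harmonic\<close> gives a function on the whole group that is not constant on
  \<open>\<Gamma>\<close>.
\<close>

lemma constant_harmonic_iff:
  assumes \<Gamma>: "\<Gamma> = closed_semigroup P X \<mu>" and sub: "subgroup \<Gamma> P" and cl: "closedin X \<Gamma>"
    and so: "spread_out P X \<mu>"
  shows "(\<forall>f\<in>bounded_harmonic (P\<lparr>carrier := \<Gamma>\<rparr>) (subtopology X \<Gamma>) (restrict_space \<mu> \<Gamma>). \<forall>g\<in>\<Gamma>. f g = f \<one>\<^bsub>P\<^esub>)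
    \<longleftrightarrow> (\<forall>j\<in>{1..k}. vertical_drift j \<le> 0)"
proof -
  have supp: "support X \<mu> \<subseteq> \<Gamma>" unfolding \<Gamma> closed_semigroup_def by blast
  have full: "emeasure \<mu> \<Gamma> = 1" by (rule emeasure_support[OF cl supp])
  have \<Gamma>m: "\<Gamma> \<in> sets (borel_of X)" by (rule borel_of_closed[OF cl])
  have one: "\<one>\<^bsub>P\<^esub> \<in> \<Gamma>" by (rule subgroup.one_closed[OF sub])
  show ?thesis
  proof
    assume drift: "\<forall>j\<in>{1..k}. vertical_drift j \<le> 0"
    show "\<forall>f\<in>bounded_harmonic (P\<lparr>carrier := \<Gamma>\<rparr>) (subtopology X \<Gamma>) (restrict_space \<mu> \<Gamma>). \<forall>g\<in>\<Gamma>. f g = f \<one>\<^bsub>P\<^esub>"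
    proof (intro ballI)
      fix f g assume f: "f \<in> bounded_harmonic (P\<lparr>carrier := \<Gamma>\<rparr>) (subtopology X \<Gamma>) (restrict_space \<mu> \<Gamma>)" and g: "g \<in> \<Gamma>"
      have "indicator \<Gamma> g * f g = indicator \<Gamma> \<one>\<^bsub>P\<^esub> * f \<one>\<^bsub>P\<^esub>"
        using harmonic_constant_on_semigroup[OF sublinear_cost_if_nonpositive_drift[OF drift] so
            extend_harmonic[OF sub \<Gamma>m full f]] g \<Gamma> by blast
      then show "f g = f \<one>\<^bsub>P\<^esub>" using g one by simp
    qed
  next
    assume const: "\<forall>f\<in>bounded_harmonic (P\<lparr>carrier := \<Gamma>\<rparr>) (subtopology X \<Gamma>) (restrict_space \<mu> \<Gamma>). \<forall>g\<in>\<Gamma>. f g = f \<one>\<^bsub>P\<^esub>"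
    show "\<forall>j\<in>{1..k}. vertical_drift j \<le> 0"
    proof (rule ccontr)
      assume "\<not> (\<forall>j\<in>{1..k}. vertical_drift j \<le> 0)"
      then obtain j where j: "j \<in> {1..k}" and pos: "0 < vertical_drift j" by (auto simp: not_le)
      interpret W: tree_walk P X points move \<mu> "verts (T j)" "rooted_tree.parent (T j)" "origin (T j)" "d j - 1" "Pair j" "\<lambda>g. g j"
        by (rule tree_walk[OF j])
      have drift: "0 < W.drift" using drift_eq_vertical_drift[OF j] pos by simp
      obtain F where F: "finite F" "F \<subseteq> points" "fixer F \<subseteq> \<Gamma>"
        using fixer_in_subgroup[OF sub \<Gamma>m full so] .
      (* the height of a step has positive mean and almost every step lies in \<Gamma> *)
      have "\<exists>\<gamma>\<in>\<Gamma>. 0 < W.height (\<gamma> j (origin (T j)))"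
      proof (rule ccontr)
        assume "\<not> ?thesis"
        then have "AE g in \<mu>. real_of_int (W.height (g j (origin (T j)))) \<le> 0"
          using AE_subgroup[OF sub \<Gamma>m full] by (elim AE_mp) (auto simp: not_less)
        then have "W.drift \<le> (\<integral>g. 0 \<partial>\<mu>)"
          unfolding W.drift_def W.height_eq
          using W.up_down_integrable by (intro integral_mono_AE) auto
        then show False using drift by simp
      qed
      then obtain \<gamma> where \<gamma>: "\<gamma> \<in> \<Gamma>" "0 < W.height (\<gamma> j (origin (T j)))" by blast
      obtain f g where f: "f \<in> bounded_harmonic P X \<mu>" and g: "g \<in> \<Gamma>" "f g \<noteq> f \<one>\<^bsub>P\<^esub>"
        using W.nonconstant_harmonic[OF drift sub F(1,3) \<gamma> realize_equivariant[OF j] F(2)] by blast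
      show False using const restrict_harmonic[OF sub \<Gamma>m full f] g by blast
    qed
  qed
qed

end

section \<open>The Poisson boundary\<close>

theorem corollary3p2p6:
  fixes k :: nat
    and d :: "nat \<Rightarrow> nat"
    and T :: "nat \<Rightarrow> 'v pointed_tree"
    and P :: "(nat \<Rightarrow> 'v \<Rightarrow> 'v) monoid"
    and X :: "(nat \<Rightarrow> 'v \<Rightarrow> 'v) topology"
    and \<mu> :: "(nat \<Rightarrow> 'v \<Rightarrow> 'v) measure"
    and \<Gamma> :: "(nat \<Rightarrow> 'v \<Rightarrow> 'v) set"
  assumes "\<And>i. i \<in> {1..k} \<Longrightarrow> 3 \<le> d i \<and> homogeneous_tree (d i) (T i)"
    and "P = prod_group k T" and "X = prod_top k T"
    and "prob_space \<mu>" and "sets \<mu> = sets (borel_of X)"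
    and "\<Gamma> = closed_semigroup P X \<mu>"
    and "subgroup \<Gamma> P" and "closedin X \<Gamma>"
    and "aperiodic (P\<lparr>carrier := \<Gamma>\<rparr>) (subtopology X \<Gamma>) (restrict_space \<mu> \<Gamma>)"
    and "spread_out P X \<mu>"
    and "(\<integral>\<^sup>+ \<gamma>. ennreal (real (prod_length k T \<gamma>)) \<partial>\<mu>) < \<infinity>"
    and "\<not> fully_exceptional k T \<Gamma>"
  shows
    "((\<exists>(B :: 'b topology) act \<nu>.
         poisson_boundary (P\<lparr>carrier := \<Gamma>\<rparr>) (subtopology X \<Gamma>) (restrict_space \<mu> \<Gamma>) B act \<nu> \<and>
         point_mass B \<nu>)
      \<longleftrightarrow> (\<forall>j\<in>{1..k}. m1 (vertical_image T j \<mu>) \<le> 0)) \<and>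
     (\<forall>(B :: 'b topology) act \<nu>.
         poisson_boundary (P\<lparr>carrier := \<Gamma>\<rparr>) (subtopology X \<Gamma>) (restrict_space \<mu> \<Gamma>) B act \<nu> \<longrightarrow>
         (point_mass B \<nu> \<longleftrightarrow> (\<forall>j\<in>{1..k}. m1 (vertical_image T j \<mu>) \<le> 0)))"
proof -
  interpret W: affine_product_walk k d T \<mu>
    using assms(1,4,5,11) unfolding assms(2,3)
    by (simp add: affine_product_walk_def affine_product_def affine_product_walk_axioms_def)
  let ?G = "P\<lparr>carrier := \<Gamma>\<rparr>" and ?X = "subtopology X \<Gamma>" and ?\<mu> = "restrict_space \<mu> \<Gamma>"
  have supp: "support X \<mu> \<subseteq> \<Gamma>" unfolding assms(6) closed_semigroup_def by blast
  have full: "emeasure \<mu> \<Gamma> = 1"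
    using W.emeasure_support assms(8) supp unfolding assms(2,3) by blast
  have \<Gamma>m: "\<Gamma> \<in> sets (borel_of X)" by (rule borel_of_closed[OF assms(8)])
  have \<Gamma>c: "\<Gamma> \<subseteq> carrier P" by (rule subgroup.subset[OF assms(7)])
  have grp: "group ?G"
    using subgroup.subgroup_is_group[OF assms(7)] W.group_P unfolding assms(2) by blast
  have top: "topspace ?X = carrier ?G"
    using \<Gamma>c W.topspace_eq unfolding assms(2,3) by auto
  have prob: "prob_space ?\<mu>"
  proof (rule prob_spaceI)
    have "space ?\<mu> = \<Gamma>" using \<Gamma>c W.space_step unfolding assms(2) by (auto simp: space_restrict_space)
    then show "emeasure ?\<mu> (space ?\<mu>) = 1"
      using full \<Gamma>m \<Gamma>c W.space_step assms(5) unfolding assms(2)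
      by (simp add: emeasure_restrict_space Int_absorb2)
  qed
  have sets: "sets ?\<mu> = sets (borel_of ?X)"
    unfolding sets_borel_of_subtopology[OF \<Gamma>m] by (simp add: sets_restrict_space assms(5))
  have const_iff: "(\<forall>f\<in>bounded_harmonic ?G ?X ?\<mu>. \<forall>g\<in>carrier ?G. f g = f \<one>\<^bsub>?G\<^esub>)
      \<longleftrightarrow> (\<forall>j\<in>{1..k}. m1 (vertical_image T j \<mu>) \<le> 0)"
    using W.constant_harmonic_iff[of \<Gamma>] assms(6,7,8,10) unfolding assms(2,3) W.vertical_drift_def by simp
  have equiv: "point_mass B \<nu> \<longleftrightarrow> (\<forall>j\<in>{1..k}. m1 (vertical_image T j \<mu>) \<le> 0)"
    if pb: "poisson_boundary ?G ?X ?\<mu> B act \<nu>" for B :: "'b topology" and act \<nu>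
    unfolding const_iff[symmetric]
    using constant_if_point_mass[OF pb top grp] point_mass_if_constant[OF pb top grp] by blast
  moreover have "\<exists>(B :: 'b topology) act \<nu>. poisson_boundary ?G ?X ?\<mu> B act \<nu> \<and> point_mass B \<nu>"
    if "\<forall>j\<in>{1..k}. m1 (vertical_image T j \<mu>) \<le> 0"
    using trivial_poisson_boundary[OF top grp prob sets] that unfolding const_iff[symmetric] by blast
  ultimately show ?thesis by blast
qed

end
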